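(* Suppose $\rho_1$ is such that for some finite $c_1>0$ it is non-decreasing on $[0,c_1]$ and constant on $[c_1,\infty)$, $\rho_1$ is continuously differentiable, and $u_1(s)=\rho_1'(s)/s$ is continuous and of bounded variation. Suppose $\theta\mapsto\mathbf V(\theta)$ is continuous and $\mathbb E\|\mathbf s\|^2<\infty$. Let $\sigma_n$ and $\sigma(P)$ be solutions of the scale equations at $\mathbb P_n$ and at $P$, respectively, and let $\xi_n=(\beta_{1,n},\gamma_n)\in\mathfrak D$ and $\xi(P)=(\beta_1(P),\gamma(P))\in\mathfrak D$ be local minima of $R_n(\beta,\mathbf V(\gamma))$ and $R_P(\beta,\mathbf V(\gamma))$, respectively. Suppose $(\xi_n,\sigma_n)\to(\xi(P),\sigma(P))$ in probability, and that $\beta_1(P)$ is a point of symmetry of $P$. Let $$\Lambda_\beta(\xi,\sigma)=\int\Psi_\beta(\mathbf s,\xi,\sigma)\,dP(\mathbf s),\qquad \Psi_\beta(\mathbf s,\xi,\sigma)=u_1\left(\frac d\sigma\right)\mathbf X^T\mathbf V(\gamma)^{-1}(\mathbf y-\mathbf X\beta),$$ where $\xi=(\beta,\gamma)$ and $d^2=(\mathbf y-\mathbf X\beta)^T\mathbf V(\gamma)^{-1}(\mathbf y-\mathbf X\beta)$, and suppose that $\Lambda_\beta$ is continuously differentiable with a non-singular derivative $\mathbf D_\beta=\partial\Lambda_\beta/\partial\beta$ at $(\xi(P),\sigma(P))$. Then $\sqrt n(\beta_{1,n}-\beta_1(P))$ is asymptotically normal with mean zero and variance $$\mathbf D_\beta^{-1}\,\mathbb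 E\left[\Psi_\beta(\mathbf s,\xi(P),\sigma(P))\Psi_\beta(\mathbf s,\xi(P),\sigma(P))^T\right]\mathbf D_\beta^{-1}.$$
   Context: Fix positive integers $k,q,l$. A point $\mathbf s=(\mathbf y,\mathbf X)$, with $\mathbf y\in\mathbb R^k$ and $\mathbf X\in\mathbb R^{k\times q}$, is identified with a point of $\mathbb R^k\times\mathbb R^{kq}$; $P$ is a probability measure on this space, $\mathbb E$ is expectation under $P$. The observations $\mathbf s_1,\mathbf s_2,\dots$, $\mathbf s_i=(\mathbf y_i,\mathbf X_i)$, are independent with distribution $P$, and $\mathbb P_n$ is the empirical measure of $\mathbf s_1,\dots,\mathbf s_n$. $\mathrm{PDS}(k)$ is the set of positive definite symmetric $k\times k$ matrices; $|\mathbf A|$ is the determinant. $\Theta\subset\mathbb R^l$ and $\mathbf V:\Theta\to\mathrm{PDS}(k)$ is a known injective (identifiable) map. Put $\Gamma(\theta)=\mathbf V(\theta)/|\mathbf V(\theta)|^{1/k}$ and $\mathfrak D=\{(\beta,\gamma)\in\mathbb R^q\times\Theta:\mathbf V(\gamma)\in\mathrm{PDS}(k),\ |\mathbf V(\gamma)|=1\}$. $\rho_0,\rho_1:\mathbb R\to[0,\infty)$ are the loss functions and $0<b_0<\sup\rho_0$. Initial functionals $Q\mapsto(\beta_0(Q),\theta_0(Q))\in\mathbb R^q\times\Theta$ are given, with initial estimators $(\beta_{0,n},\theta_{0,n})=(\beta_0(\mathbb P_n),\theta_0(\mathbb P_n))$. The scale equation at a probability measure $Q$, to be solved for $\sigma>0$,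 is $$\int\rho_0\left(\frac{\sqrt{(\mathbf y-\mathbf X\beta_0(Q))^T\Gamma(\theta_0(Q))^{-1}(\mathbf y-\mathbf X\beta_0(Q))}}{\sigma}\right)dQ(\mathbf s)=b_0;$$ $\sigma(P)$ is a solution for $Q=P$ and $\sigma_n=\sigma(\mathbb P_n)$ for $Q=\mathbb P_n$. Further $R_Q(\beta,\mathbf C)=\int\rho_1\big(\sqrt{(\mathbf y-\mathbf X\beta)^T\mathbf C^{-1}(\mathbf y-\mathbf X\beta)}/\sigma(Q)\big)\,dQ(\mathbf s)$ and $R_n=R_{\mathbb P_n}$. Local minima are over $(\beta,\gamma)\in\mathfrak D$. A vector $\mathbf b\in\mathbb R^q$ is a point of symmetry of $P$ if for almost all $\mathbf X$, $P(\mathbf X\mathbf b+A\mid\mathbf X)=P(\mathbf X\mathbf b-A\mid\mathbf X)$ for all measurable $A\subset\mathbb R^k$, where $\mathbf X\mathbf b\pm A=\{\mathbf X\mathbf b\pm\mathbf y:\mathbf y\in A\}$. *)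

theory Defs
  imports "HOL-Probability.Probability"
begin

section \<open>Probabilistic notions\<close>

text \<open>The first \<open>n\<close> observations are \<open>S 0, \<dots>, S (n - 1)\<close>.\<close>

definition empirical_measure :: "(nat \<Rightarrow> 'w \<Rightarrow> 'a::topological_space) \<Rightarrow> nat \<Rightarrow> 'w \<Rightarrow> 'a measure"
  where "empirical_measure S n \<omega> = distr (uniform_count_measure {..<n}) borel (\<lambda>i. S i \<omega>)"

definition iid_sample :: "'w measure \<Rightarrow> 'a::topological_space measure \<Rightarrow> (nat \<Rightarrow> 'w \<Rightarrow> 'a) \<Rightarrow> bool"
  where "iid_sample M P S \<longleftrightarrow>
    prob_space.indep_vars M (\<lambda>_. borel) S UNIV \<and> (\<forall>i. distr M borel (S i) = P)"

definition converges_in_prob :: "'w measure \<Rightarrow> (nat \<Rightarrow> 'w \<Rightarrow> 'a::metric_space) \<Rightarrow> 'a \<Rightarrow> bool"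
  where "converges_in_prob M Z z \<longleftrightarrow>
    (\<forall>e>0. (\<lambda>n. measure M {\<omega> \<in> space M. dist (Z n \<omega>) z > e}) \<longlonglongrightarrow> 0)"

text \<open>The events \<open>A n\<close> are used because the set on which \<open>E n\<close> holds need not be measurable.\<close>

definition with_prob_tending_to_one :: "'w measure \<Rightarrow> (nat \<Rightarrow> 'w \<Rightarrow> bool) \<Rightarrow> bool"
  where "with_prob_tending_to_one M E \<longleftrightarrow>
    (\<exists>A. (\<forall>n. A n \<in> sets M \<and> (\<forall>\<omega> \<in> A n. E n \<omega>)) \<and> (\<lambda>n. measure M (A n)) \<longlonglongrightarrow> 1)"

definition weakly_converges :: "(nat \<Rightarrow> 'a::topological_space measure) \<Rightarrow> 'a measure \<Rightarrow> bool"
  where "weakly_converges \<mu> \<nu> \<longleftrightarrow>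
    (\<forall>f :: 'a \<Rightarrow> real. continuous_on UNIV f \<and> bounded (range f) \<longrightarrow>
      (\<lambda>n. \<integral>x. f x \<partial>\<mu> n) \<longlonglongrightarrow> (\<integral>x. f x \<partial>\<nu>))"

definition std_normal_vec :: "(real^'n) measure"
  where "std_normal_vec = density lborel (\<lambda>x. \<Prod>i\<in>UNIV. ennreal (std_normal_density (x $ i)))"

text \<open>The law of \<open>m + A Z\<close> with \<open>Z\<close> standard normal and \<open>A A\<^sup>T = \<Sigma>\<close>; the covariance
  matrix \<open>\<Sigma>\<close> may be singular.\<close>

definition multivariate_normal :: "(real^'n) measure \<Rightarrow> real^'n \<Rightarrow> real^'n^'n \<Rightarrow> bool"
  where "multivariate_normal \<nu> m \<Sigma> \<longleftrightarrow>
    (\<exists>A :: real^'n^'n. A ** transpose A = \<Sigma> \<and> \<nu> = distr std_normal_vec borel (\<lambda>z. m + A *v z))"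

definition asymptotically_normal ::
    "'w measure \<Rightarrow> (nat \<Rightarrow> 'w \<Rightarrow> real^'n) \<Rightarrow> real^'n \<Rightarrow> real^'n^'n \<Rightarrow> bool"
  where "asymptotically_normal M Z m \<Sigma> \<longleftrightarrow>
    (\<exists>\<nu>. multivariate_normal \<nu> m \<Sigma> \<and> weakly_converges (\<lambda>n. distr M borel (Z n)) \<nu>)"

text \<open>\<open>K\<close> is a regular conditional distribution of the first coordinate given the second.\<close>

definition regular_cond_distr ::
    "('a::topological_space \<times> 'b::topological_space) measure \<Rightarrow> ('b \<Rightarrow> 'a measure) \<Rightarrow> bool"
  where "regular_cond_distr P K \<longleftrightarrow>
    K \<in> borel \<rightarrow>\<^sub>M prob_algebra borel \<and>
    (\<forall>A \<in> sets borel. \<forall>B \<in> sets borel.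
      emeasure P (A \<times> B) = (\<integral>\<^sup>+X. emeasure (K X) A * indicator B X \<partial>distr P borel snd))"

definition point_of_symmetry :: "((real^'k) \<times> (real^'q^'k)) measure \<Rightarrow> real^'q \<Rightarrow> bool"
  where "point_of_symmetry P b \<longleftrightarrow>
    (\<exists>K. regular_cond_distr P K \<and>
      (AE X in distr P borel snd. \<forall>A \<in> sets borel.
        measure (K X) ((\<lambda>y. X *v b + y) ` A) = measure (K X) ((\<lambda>y. X *v b - y) ` A)))"

section \<open>Analytical notions\<close>

definition bounded_variation :: "(real \<Rightarrow> real) \<Rightarrow> bool"
  where "bounded_variation f \<longleftrightarrow>
    (\<exists>B. \<forall>t :: nat \<Rightarrow> real. mono t \<longrightarrow> (\<forall>n. (\<Sum>i<n. \<bar>f (t (Suc i)) - f (t i)\<bar>) \<le> B))"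

definition local_min_on :: "('a::topological_space \<Rightarrow> real) \<Rightarrow> 'a set \<Rightarrow> 'a \<Rightarrow> bool"
  where "local_min_on f S x \<longleftrightarrow> x \<in> S \<and> (\<forall>\<^sub>F z in at x within S. f x \<le> f z)"

text \<open>\<open>\<rho>'(s) / s\<close>, extended to \<open>s = 0\<close> by its limit. If there is no limit, the function
  is not continuous at \<open>0\<close>, whatever value is taken there.\<close>

definition weight_fun :: "(real \<Rightarrow> real) \<Rightarrow> real \<Rightarrow> real"
  where "weight_fun \<rho> s =
    (if s = 0 then Lim (at 0) (\<lambda>t. deriv \<rho> t / t) else deriv \<rho> s / s)"

section \<open>The linear model with structured covariance\<close>

definition PDS :: "(real^'k^'k) set"
  where "PDS = {A. transpose A = A \<and> (\<forall>x. x \<noteq> 0 \<longrightarrow> 0 < x \<bullet> (A *v x))}"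

definition shape :: "(real^'l \<Rightarrow> real^'k^'k) \<Rightarrow> real^'l \<Rightarrow> real^'k^'k"
  where "shape V \<theta> = V \<theta> /\<^sub>R (det (V \<theta>) powr (1 / CARD('k)))"

definition param_set :: "(real^'l) set \<Rightarrow> (real^'l \<Rightarrow> real^'k^'k) \<Rightarrow> ((real^'q) \<times> (real^'l)) set"
  where "param_set \<Theta> V = {(\<beta>, \<gamma>). \<gamma> \<in> \<Theta> \<and> V \<gamma> \<in> PDS \<and> det (V \<gamma>) = 1}"

definition residual :: "(real^'k) \<times> (real^'q^'k) \<Rightarrow> real^'q \<Rightarrow> real^'k"
  where "residual s \<beta> = fst s - snd s *v \<beta>"

definition mahal :: "(real^'k) \<times> (real^'q^'k) \<Rightarrow> real^'q \<Rightarrow> real^'k^'k \<Rightarrow> real"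
  where "mahal s \<beta> C = sqrt (residual s \<beta> \<bullet> (matrix_inv C *v residual s \<beta>))"

definition scale_solution ::
    "(real \<Rightarrow> real) \<Rightarrow> real \<Rightarrow> (real^'l \<Rightarrow> real^'k^'k) \<Rightarrow>
     (((real^'k) \<times> (real^'q^'k)) measure \<Rightarrow> real^'q) \<Rightarrow>
     (((real^'k) \<times> (real^'q^'k)) measure \<Rightarrow> real^'l) \<Rightarrow>
     ((real^'k) \<times> (real^'q^'k)) measure \<Rightarrow> real \<Rightarrow> bool"
  where "scale_solution \<rho>0 b0 V \<beta>0 \<theta>0 Q \<sigma> \<longleftrightarrow>
    0 < \<sigma> \<and> (\<integral>s. \<rho>0 (mahal s (\<beta>0 Q) (shape V (\<theta>0 Q)) / \<sigma>) \<partial>Q) = b0"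

definition risk ::
    "(real \<Rightarrow> real) \<Rightarrow> ((real^'k) \<times> (real^'q^'k)) measure \<Rightarrow> real \<Rightarrow> real^'q \<Rightarrow> real^'k^'k \<Rightarrow> real"
  where "risk \<rho>1 Q \<sigma> \<beta> C = (\<integral>s. \<rho>1 (mahal s \<beta> C / \<sigma>) \<partial>Q)"

definition Psi_beta ::
    "(real \<Rightarrow> real) \<Rightarrow> (real^'l \<Rightarrow> real^'k^'k) \<Rightarrow> (real^'k) \<times> (real^'q^'k) \<Rightarrow>
     (real^'q) \<times> (real^'l) \<Rightarrow> real \<Rightarrow> real^'q"
  where "Psi_beta \<rho>1 V s \<xi> \<sigma> =
    (case \<xi> of (\<beta>, \<gamma>) \<Rightarrow>
      weight_fun \<rho>1 (mahal s \<beta> (V \<gamma>) / \<sigma>) *\<^sub>R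
        (transpose (snd s) *v (matrix_inv (V \<gamma>) *v residual s \<beta>)))"

definition Lambda_beta ::
    "(real \<Rightarrow> real) \<Rightarrow> (real^'l \<Rightarrow> real^'k^'k) \<Rightarrow> ((real^'k) \<times> (real^'q^'k)) measure \<Rightarrow>
     (real^'q) \<times> (real^'l) \<Rightarrow> real \<Rightarrow> real^'q"
  where "Lambda_beta \<rho>1 V P \<xi> \<sigma> = (\<integral>s. Psi_beta \<rho>1 V s \<xi> \<sigma> \<partial>P)"

text \<open>The matrix of the partial derivative with respect to \<open>\<beta>\<close> of a function of
  \<open>((\<beta>, \<gamma>), \<sigma>)\<close>.\<close>

definition partial_beta ::
    "((real^'q) \<times> 'c \<Rightarrow> real \<Rightarrow> real^'q) \<Rightarrow> (real^'q) \<times> 'c \<Rightarrow> real \<Rightarrow> real^'q^'q"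
  where "partial_beta L \<xi> \<sigma> = matrix (frechet_derivative (\<lambda>\<beta>. L (\<beta>, snd \<xi>) \<sigma>) (at (fst \<xi>)))"

text \<open>Continuous differentiability near \<open>(\<xi>, \<sigma>)\<close>, relative to \<open>D \<times> (0, \<infinity>)\<close>. Only the
  derivative in \<open>\<beta>\<close> is involved: the admissible \<open>\<gamma>\<close> form a set without interior in general.
  The derivative has to be continuous in all variables jointly.\<close>

definition cont_diff_beta_at ::
    "((real^'q) \<times> 'c::topological_space) set \<Rightarrow> ((real^'q) \<times> 'c \<Rightarrow> real \<Rightarrow> real^'q) \<Rightarrow>
     (real^'q) \<times> 'c \<Rightarrow> real \<Rightarrow> bool"
  where "cont_diff_beta_at D L \<xi> \<sigma> \<longleftrightarrow>
    (\<exists>N. open N \<and> (\<xi>, \<sigma>) \<in> N \<and>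
      (\<forall>(\<eta>, \<tau>) \<in> N \<inter> (D \<times> {0<..}). (\<lambda>\<beta>. L (\<beta>, snd \<eta>) \<tau>) differentiable (at (fst \<eta>))) \<and>
      continuous_on (N \<inter> (D \<times> {0<..})) (\<lambda>(\<eta>, \<tau>). partial_beta L \<eta> \<tau>))"

text \<open>\<open>E[\<Psi> \<Psi>\<^sup>T]\<close>, entry by entry.\<close>

definition second_moment :: "'a measure \<Rightarrow> ('a \<Rightarrow> real^'q) \<Rightarrow> real^'q^'q"
  where "second_moment P \<psi> = (\<chi> i j. \<integral>s. \<psi> s $ i * \<psi> s $ j \<partial>P)"

end

theory Submission
  imports Defs
begin

text \<open>The estimates solve an estimating equation with nuisance parameters. Write \<open>\<eta> = (\<beta>, \<gamma>, \<sigma>)\<close>, let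
  \<open>\<Psi>\<close> be the score, \<open>\<Lambda>\<close> its mean under \<open>P\<close>, \<open>b\<close> the point of symmetry and \<open>\<eta>\<^sub>0\<close> the limit of the
  estimates \<open>\<eta>\<^sub>n = (\<beta>\<^sub>n, \<gamma>\<^sub>n, \<sigma>\<^sub>n)\<close>. The derivative of the loss in \<open>\<beta>\<close> is \<open>- \<Psi> / \<sigma>\<^sup>2\<close>, and the admissible
  \<open>\<beta>\<close> for a given \<open>\<gamma>\<close> fill the whole space; hence at a local minimum the scores of the sample sum to
  zero (\<open>estimating_equation\<close>). Comparing with the scores at \<open>\<eta>\<^sub>0\<close> gives

  \<open>\<surd>n \<Lambda>(\<eta>\<^sub>n) + n\<^sup>-\<^sup>1\<^sup>/\<^sup>2 \<Sum> \<Psi>(s\<^sub>i, \<eta>\<^sub>0) = - (Z\<^sub>n(\<eta>\<^sub>n) - Z\<^sub>n(\<eta>\<^sub>0))\<close>,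

  where \<open>Z\<^sub>n(\<eta>)\<close> is the centred sum of the scores \<open>\<Psi>(s\<^sub>i, \<eta>)\<close> divided by \<open>\<surd>n\<close>.

  The right-hand side tends to zero in probability (\<open>score_equicontinuity\<close>). A component of the score
  is a function of bounded variation of a quadratic form in \<open>s\<close>, times another quadratic form in
  \<open>s\<close> that is of the order of \<open>norm s\<close> where the weight does not vanish. Quadratic forms are a
  vector space of finite dimension, so the sets on which they exceed thresholds cut out only
  polynomially many subsets of a finite set (\<open>card_threshold_patterns_le\<close>). Therefore the scores have
  polynomial packing numbers (\<open>packing_bound_polynomial\<close>), and chaining over random signs
  (\<open>chaining_bound\<close>) together with \<open>symmetrization\<close> bounds the oscillation of \<open>Z\<^sub>n\<close> near \<open>\<eta>\<^sub>0\<close>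
  uniformly in \<open>n\<close> (\<open>equicontinuity_of_empirical_process\<close>).

  The left-hand side is linearized in \<open>\<beta>\<close> alone. The reflection \<open>(y, X) \<mapsto> (2 X b - y, X)\<close> preserves
  \<open>P\<close> (\<open>reflection_invariance\<close>) and changes the sign of the score at \<open>\<beta> = b\<close>, so that
  \<open>\<Lambda>(b, \<gamma>, \<sigma>) = 0\<close> for all \<open>\<gamma>\<close> and \<open>\<sigma>\<close> (\<open>mean_psi_zero\<close>). The mean value inequality on the segment
  from \<open>b\<close> to \<open>\<beta>\<^sub>n\<close>, with \<open>\<gamma>\<^sub>n\<close> and \<open>\<sigma>\<^sub>n\<close> kept fixed, and the joint continuity of
  \<open>\<partial>\<Lambda>/\<partial>\<beta>\<close> give \<open>\<Lambda>(\<eta>\<^sub>n) = D\<^sub>\<beta> (\<beta>\<^sub>n - b) + o(norm (\<beta>\<^sub>n - b))\<close> (\<open>uniform_linearization\<close>). The errors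
  of \<open>\<gamma>\<^sub>n\<close> and \<open>\<sigma>\<^sub>n\<close> thus have no effect of first order.

  Solving for \<open>\<beta>\<^sub>n\<close> gives \<open>\<surd>n (\<beta>\<^sub>n - b) = - D\<^sub>\<beta>\<^sup>-\<^sup>1 n\<^sup>-\<^sup>1\<^sup>/\<^sup>2 \<Sum> \<Psi>(s\<^sub>i, \<eta>\<^sub>0)\<close> up to a term that tends to zero in
  probability (\<open>solve_linearized_equation\<close>), and a multivariate central limit theorem
  (\<open>asymptotically_normal_of_linear_expansion\<close>) yields the normal limit. Its covariance is the second
  moment of \<open>D\<^sub>\<beta>\<^sup>-\<^sup>1 \<Psi>\<close>; it contains \<open>D\<^sub>\<beta>\<^sup>-\<^sup>1\<close> twice without a transpose, since \<open>\<Lambda>\<close> is, up to the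
  factor \<open>- \<sigma>\<^sup>2\<close>, the gradient of the risk in \<open>\<beta>\<close>, so that its derivative is symmetric
  (\<open>Lambda_beta_derivative_symmetric\<close>).\<close>

section \<open>Shattering and thresholded linear families\<close>

definition shatters :: "'a set set \<Rightarrow> 'a set \<Rightarrow> bool"
  where "shatters \<A> B \<longleftrightarrow> (\<forall>C\<subseteq>B. \<exists>A\<in>\<A>. A \<inter> B = C)"

text \<open>Induction on the ground set. For a new point \<open>x\<close> the family is split into the members \<open>A0\<close> without
  \<open>x\<close> and the traces \<open>A1\<close> of the members with \<open>x\<close>. A set shattered by \<open>A0\<close> or by \<open>A1\<close> is shattered
  by the family, and a set shattered by both remains shattered after \<open>x\<close> is added; this accounts
  for the sum of the two cardinalities.\<close>

lemma card_le_card_shattered: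
  assumes "finite X" "\<A> \<subseteq> Pow X"
  shows "card \<A> \<le> card {B. B \<subseteq> X \<and> shatters \<A> B}"
  using assms
proof (induction X arbitrary: \<A> rule: finite_induct)
  case empty
  then have "\<A> = {} \<or> \<A> = {{}}" by auto
  then show ?case
  proof
    assume "\<A> = {{}}"
    then have "{B. B \<subseteq> {} \<and> shatters \<A> B} = {{}}" by (auto simp: shatters_def)
    with \<open>\<A> = {{}}\<close> show ?thesis by simp
  qed simp
next
  case (insert x X)
  define A0 where "A0 = {A\<in>\<A>. x \<notin> A}"
  define A1 where "A1 = (\<lambda>A. A - {x}) ` {A\<in>\<A>. x \<in> A}"
  define sh where "sh = (\<lambda>\<B>. {B. B \<subseteq> X \<and> shatters \<B> B})"
  have fin: "finite \<A>" using insert.prems insert.hyps(1) by (meson finite_Pow_iff finite.insertI finite_subset)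
  have fsh: "finite (sh \<B>)" for \<B>
    unfolding sh_def by (rule finite_subset[of _ "Pow X"]) (use insert.hyps(1) in auto)
  have "card {A\<in>\<A>. x \<in> A} = card A1"
    unfolding A1_def by (subst card_image) (auto simp: inj_on_def)
  moreover have "card \<A> = card A0 + card {A\<in>\<A>. x \<in> A}"
    unfolding A0_def using fin by (subst card_Un_disjoint[symmetric]) (auto intro!: arg_cong[where f=card])
  ultimately have "card \<A> = card A0 + card A1" by simp
  also have "\<dots> \<le> card (sh A0) + card (sh A1)"
    unfolding sh_def
    by (intro add_mono insert.IH) (use insert.prems in \<open>auto simp: A0_def A1_def\<close>)
  also have "\<dots> = card (sh A0 \<union> sh A1) + card (sh A0 \<inter> sh A1)"
    by (rule card_Un_Int[OF fsh fsh])
  also have "card (sh A0 \<inter> sh A1) = card (insert x ` (sh A0 \<inter> sh A1))"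
    using insert.hyps(2) by (subst card_image) (auto simp: inj_on_def sh_def)
  also have "card (sh A0 \<union> sh A1) + \<dots> = card ((sh A0 \<union> sh A1) \<union> insert x ` (sh A0 \<inter> sh A1))"
    using insert.hyps(2) fsh by (subst card_Un_disjoint) (auto simp: sh_def)
  also have "\<dots> \<le> card {B. B \<subseteq> insert x X \<and> shatters \<A> B}"
  proof (rule card_mono)
    show "finite {B. B \<subseteq> insert x X \<and> shatters \<A> B}"
      by (rule finite_subset[of _ "Pow (insert x X)"]) (use insert.hyps(1) in auto)
    have 1: "shatters \<A> B" if "B \<in> sh A0" for B
      using that unfolding sh_def shatters_def A0_def by blast
    have 2: "shatters \<A> B" if B: "B \<in> sh A1" for B
      unfolding shatters_def
    proof safe
      fix C assume "C \<subseteq> B"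
      then have "\<exists>A'\<in>A1. A' \<inter> B = C" using B unfolding sh_def shatters_def by simp
      then obtain A where A: "A \<in> \<A>" "x \<in> A" "(A - {x}) \<inter> B = C"
        unfolding A1_def by auto
      moreover have "x \<notin> B" using B insert.hyps(2) by (auto simp: sh_def)
      ultimately have "A \<inter> B = C" by auto
      with A show "\<exists>A\<in>\<A>. A \<inter> B = C" by blast
    qed
    have 3: "shatters \<A> (insert x B)" if B: "B \<in> sh A0 \<inter> sh A1" for B
      unfolding shatters_def
    proof safe
      fix C assume C: "C \<subseteq> insert x B"
      have xB: "x \<notin> B" using B insert.hyps(2) by (auto simp: sh_def)
      show "\<exists>A\<in>\<A>. A \<inter> insert x B = C"
      proof (cases "x \<in> C")
        case True
        have "C - {x} \<subseteq> B" using C by auto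
        then have "\<exists>A'\<in>A1. A' \<inter> B = C - {x}" using B unfolding sh_def shatters_def by simp
        then obtain A where A: "A \<in> \<A>" "x \<in> A" "(A - {x}) \<inter> B = C - {x}"
          unfolding A1_def by auto
        then have "A \<inter> insert x B = C" using True xB by auto
        then show ?thesis using A by blast
      next
        case False
        then have "C \<subseteq> B" using C by auto
        then have "\<exists>A\<in>A0. A \<inter> B = C" using B unfolding sh_def shatters_def by simp
        then obtain A where A: "A \<in> \<A>" "x \<notin> A" "A \<inter> B = C"
          unfolding A0_def by auto
        then have "A \<inter> insert x B = C" using False xB by auto
        then show ?thesis using A by blast
      qed
    qed
    show "sh A0 \<union> sh A1 \<union> insert x ` (sh A0 \<inter> sh A1) \<subseteq> {B. B \<subseteq> insert x X \<and> shatters \<A> B}"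
      using 1 2 3 by (auto simp: sh_def)
  qed
  finally show ?case .
qed

lemma card_small_subsets_le:
  assumes "finite X"
  shows "card {B. B \<subseteq> X \<and> card B \<le> d} \<le> (card X + 1) ^ d"
proof (induction d)
  case 0
  have "{B. B \<subseteq> X \<and> card B \<le> 0} = {{}}"
    using assms by (auto dest: finite_subset)
  then show ?case by simp
next
  case (Suc d)
  let ?S = "\<lambda>d. {B. B \<subseteq> X \<and> card B \<le> d}"
  have finS: "finite (?S d)" for d by (rule finite_subset[of _ "Pow X"]) (use assms in auto)
  have "?S (Suc d) \<subseteq> ?S d \<union> (\<lambda>(x, B). insert x B) ` (X \<times> ?S d)"
  proof
    fix B assume B: "B \<in> ?S (Suc d)"
    show "B \<in> ?S d \<union> (\<lambda>(x, B). insert x B) ` (X \<times> ?S d)"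
    proof (cases "B = {}")
      case False
      then obtain x where x: "x \<in> B" by auto
      have "finite B" using B assms by (auto dest: finite_subset)
      then have "card (B - {x}) \<le> d" using B x by auto
      then have "(x, B - {x}) \<in> X \<times> ?S d" using B x by auto
      moreover have "B = (\<lambda>(x, B). insert x B) (x, B - {x})" using x by auto
      ultimately show ?thesis by blast
    qed auto
  qed
  then have "card (?S (Suc d)) \<le> card (?S d \<union> (\<lambda>(x, B). insert x B) ` (X \<times> ?S d))"
    using assms finS by (intro card_mono) auto
  also have "\<dots> \<le> card (?S d) + card ((\<lambda>(x, B). insert x B) ` (X \<times> ?S d))"
    by (rule card_Un_le)
  also have "card ((\<lambda>(x, B). insert x B) ` (X \<times> ?S d)) \<le> card (X \<times> ?S d)"
    using assms finS by (intro card_image_le) auto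
  finally have "card (?S (Suc d)) \<le> card (?S d) + card X * card (?S d)"
    by (simp add: card_cartesian_product)
  also have "\<dots> = (card X + 1) * card (?S d)" by simp
  also have "\<dots> \<le> (card X + 1) * (card X + 1) ^ d" using Suc by (intro mult_left_mono) auto
  finally show ?case by simp
qed

lemma sauer_shelah:
  assumes "finite X" "\<A> \<subseteq> Pow X" and "\<And>B. B \<subseteq> X \<Longrightarrow> shatters \<A> B \<Longrightarrow> card B \<le> d"
  shows "card \<A> \<le> (card X + 1) ^ d"
proof -
  have "card \<A> \<le> card {B. B \<subseteq> X \<and> shatters \<A> B}"
    by (rule card_le_card_shattered[OF assms(1,2)])
  also have "\<dots> \<le> card {B. B \<subseteq> X \<and> card B \<le> d}"
    by (rule card_mono) (use assms in auto)
  also have "\<dots> \<le> (card X + 1) ^ d" by (rule card_small_subsets_le[OF assms(1)])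
  finally show ?thesis .
qed

text \<open>Gaussian elimination: a homogeneous system with fewer equations than unknowns has a nonzero
  solution. The equations are indexed by \<open>A\<close>, the unknowns by \<open>Z\<close>.\<close>

lemma nontrivial_linear_relation:
  fixes \<phi> :: "'a \<Rightarrow> 'z \<Rightarrow> real"
  assumes "finite A" "finite Z" "card A < card Z"
  shows "\<exists>w. (\<exists>z\<in>Z. w z \<noteq> 0) \<and> (\<forall>a\<in>A. (\<Sum>z\<in>Z. w z * \<phi> a z) = 0)"
  using assms
proof (induction A arbitrary: Z \<phi> rule: finite_induct)
  case empty
  then have "Z \<noteq> {}" by auto
  then show ?case by (intro exI[of _ "\<lambda>_. 1"]) auto
next
  case (insert b A)
  show ?case
  proof (cases "\<forall>z\<in>Z. \<phi> b z = 0")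
    case True
    obtain w where "\<exists>z\<in>Z. w z \<noteq> 0" "\<forall>a\<in>A. (\<Sum>z\<in>Z. w z * \<phi> a z) = 0"
      using insert.IH[of Z \<phi>] insert.prems insert.hyps by auto
    then show ?thesis using True by (intro exI[of _ w]) auto
  next
    case False
    then obtain y where y: "y \<in> Z" "\<phi> b y \<noteq> 0" by auto
    define \<phi>' where "\<phi>' = (\<lambda>a z. \<phi> a z - \<phi> a y * \<phi> b z / \<phi> b y)"
    have "card A < card (Z - {y})" using insert y by auto
    then obtain w where l: "\<exists>z\<in>Z - {y}. w z \<noteq> 0" "\<forall>a\<in>A. (\<Sum>z\<in>Z - {y}. w z * \<phi>' a z) = 0"
      using insert.IH[of "Z - {y}" \<phi>'] insert.prems by auto
    define S where "S = (\<Sum>z\<in>Z - {y}. w z * \<phi> b z)"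
    define \<mu> where "\<mu> = w(y := - S / \<phi> b y)"
    have split: "(\<Sum>z\<in>Z. \<mu> z * \<phi> a z) = - S / \<phi> b y * \<phi> a y + (\<Sum>z\<in>Z - {y}. w z * \<phi> a z)" for a
      using y(1) insert.prems(1) by (subst sum.remove[of _ y]) (auto simp: \<mu>_def intro!: sum.cong)
    have "(\<Sum>z\<in>Z. \<mu> z * \<phi> a z) = 0" if "a \<in> A" for a
    proof -
      have "0 = (\<Sum>z\<in>Z - {y}. w z * \<phi>' a z)" using l that by simp
      also have "\<dots> = (\<Sum>z\<in>Z - {y}. w z * \<phi> a z) - \<phi> a y / \<phi> b y * S"
        by (simp add: \<phi>'_def S_def right_diff_distrib sum_subtractf sum_distrib_left mult.commute mult.left_commute)
      finally show ?thesis by (simp add: split)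
    qed
    moreover have "(\<Sum>z\<in>Z. \<mu> z * \<phi> b z) = 0" using y by (simp add: split S_def)
    moreover have "\<exists>z\<in>Z. \<mu> z \<noteq> 0" using l(1) by (auto simp: \<mu>_def)
    ultimately show ?thesis by (intro exI[of _ \<mu>]) auto
  qed
qed

text \<open>Allows arbitrary monotone functions to be treated like the identity: exceeding a value after a
  monotone function is an upward closed condition on the argument.\<close>

lemma up_set_on_finite_eq_threshold:
  fixes V :: "real set"
  assumes "finite V" and up: "\<And>x y. Q x \<Longrightarrow> x \<le> y \<Longrightarrow> Q y"
  obtains c where "\<And>x. x \<in> V \<Longrightarrow> Q x \<longleftrightarrow> c < x"
proof (cases "{x\<in>V. \<not> Q x} = {}")
  case True
  define c where "c = (if V = {} then 0 else Min V - 1)"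
  have "c < x" if "x \<in> V" for x
    using Min_le[OF assms(1) that] that by (auto simp: c_def)
  then show ?thesis using True by (intro that[of c]) auto
next
  case False
  define c where "c = Max {x\<in>V. \<not> Q x}"
  have fin: "finite {x\<in>V. \<not> Q x}" using assms(1) by auto
  have c: "c \<in> V" "\<not> Q c" using Max_in[OF fin False] by (auto simp: c_def)
  have "x \<le> c" if "x \<in> V" "\<not> Q x" for x using Max_ge[OF fin, of x] that by (auto simp: c_def)
  then show ?thesis using c up by (intro that[of c]) (metis not_le)
qed

text \<open>If more than \<open>card A + 1\<close> points were shattered, a nontrivial relation with coefficients \<open>w\<close> would
  hold between the values of the \<open>\<phi> a\<close> and the thresholds at these points, and hence
  \<open>\<Sum> w z * (l t z - k z) = 0\<close> for all parameters. A parameter that exceeds the threshold exactly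
  where \<open>w\<close> is positive makes this sum positive. The bound then follows from \<open>sauer_shelah\<close>.\<close>

lemma card_threshold_patterns_le:
  fixes \<phi> :: "'a \<Rightarrow> 'z \<Rightarrow> real" and c :: "'t \<Rightarrow> 'a \<Rightarrow> real" and Q :: "'z \<Rightarrow> real \<Rightarrow> bool"
  assumes A: "finite A" and Z: "finite Z" and T: "finite T"
    and up: "\<And>z x y. Q z x \<Longrightarrow> x \<le> y \<Longrightarrow> Q z y"
  shows "card ((\<lambda>t. {z\<in>Z. Q z (\<Sum>a\<in>A. c t a * \<phi> a z)}) ` T) \<le> (card Z + 1) ^ (card A + 1)"
proof -
  define l where "l = (\<lambda>t z. \<Sum>a\<in>A. c t a * \<phi> a z)"
  have "\<exists>k. \<forall>t\<in>T. Q z (l t z) \<longleftrightarrow> k < l t z" for z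
  proof -
    obtain k where "\<And>x. x \<in> (\<lambda>t. l t z) ` T \<Longrightarrow> Q z x \<longleftrightarrow> k < x"
      by (rule up_set_on_finite_eq_threshold[of "(\<lambda>t. l t z) ` T" "Q z"]) (use T up in auto)
    then show ?thesis by auto
  qed
  then obtain k where k: "\<And>t z. t \<in> T \<Longrightarrow> Q z (l t z) \<longleftrightarrow> k z < l t z" by metis
  have "card ((\<lambda>t. {z\<in>Z. Q z (l t z)}) ` T) \<le> (card Z + 1) ^ (card A + 1)"
  proof (rule sauer_shelah[OF Z])
    fix B assume B: "B \<subseteq> Z" and sh: "shatters ((\<lambda>t. {z\<in>Z. Q z (l t z)}) ` T) B"
    show "card B \<le> card A + 1"
    proof (rule ccontr)
      assume "\<not> card B \<le> card A + 1"
      moreover have finB: "finite B" using B Z finite_subset by auto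
      moreover have "card (insert None (Some ` A)) = card A + 1"
        using A by (subst card_insert_disjoint) (auto simp: card_image)
      \<comment> \<open>The index \<open>None\<close> stands for the additional equation that involves the thresholds \<open>k\<close>.\<close>
      ultimately obtain w where l0: "\<exists>z\<in>B. w z \<noteq> 0"
        and l: "\<forall>a\<in>insert None (Some ` A). (\<Sum>z\<in>B. w z * (case a of None \<Rightarrow> k z | Some a \<Rightarrow> \<phi> a z)) = 0"
        using nontrivial_linear_relation[of "insert None (Some ` A)" B
            "\<lambda>a z. case a of None \<Rightarrow> k z | Some a \<Rightarrow> \<phi> a z"] A by auto
      have lk: "(\<Sum>z\<in>B. w z * k z) = 0" using l by auto
      have l\<phi>: "(\<Sum>z\<in>B. w z * \<phi> a z) = 0" if "a \<in> A" for a using l that by force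
      have rel: "(\<Sum>z\<in>B. w z * (l t z - k z)) = 0" for t
      proof -
        have "(\<Sum>z\<in>B. w z * l t z) = (\<Sum>z\<in>B. \<Sum>a\<in>A. c t a * (w z * \<phi> a z))"
          by (simp add: l_def sum_distrib_left mult_ac)
        also have "\<dots> = (\<Sum>a\<in>A. c t a * (\<Sum>z\<in>B. w z * \<phi> a z))"
          by (subst sum.swap) (simp add: sum_distrib_left)
        also have "\<dots> = 0" using l\<phi> by simp
        finally show ?thesis by (simp add: right_diff_distrib sum_subtractf lk)
      qed
      have contr: False if pos: "\<exists>z\<in>B. \<mu> z > 0" and \<mu>: "\<And>t. (\<Sum>z\<in>B. \<mu> z * (l t z - k z)) = 0" for \<mu> :: "'z \<Rightarrow> real"
      proof -
        have "{z\<in>B. \<mu> z > 0} \<subseteq> B" by auto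
        then obtain t where t: "t \<in> T" "{z\<in>Z. Q z (l t z)} \<inter> B = {z\<in>B. \<mu> z > 0}"
          using sh unfolding shatters_def by blast
        have sgn: "k z < l t z \<longleftrightarrow> \<mu> z > 0" if "z \<in> B" for z
          using t(2) that B k[OF t(1)] by blast
        have "0 < (\<Sum>z\<in>B. \<mu> z * (l t z - k z))"
        proof -
          obtain z0 where z0: "z0 \<in> B" "\<mu> z0 > 0" using pos by auto
          have "0 < \<mu> z0 * (l t z0 - k z0)" using sgn[OF z0(1)] z0 by simp
          moreover have "0 \<le> \<mu> z * (l t z - k z)" if "z \<in> B" for z
            using sgn[OF that] by (cases "\<mu> z > 0") (auto intro: mult_nonpos_nonpos)
          ultimately show ?thesis by (intro sum_pos2[OF finB z0(1)]) auto
        qed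
        then show False using \<mu>[of t] by simp
      qed
      from l0 obtain z where "z \<in> B" "w z > 0 \<or> - w z > 0" by force
      then show False
        using contr[of w] contr[of "\<lambda>z. - w z"] rel by (auto simp: sum_negf)
    qed
  qed auto
  then show ?thesis by (simp add: l_def)
qed

section \<open>Packing numbers of monotone images of linear families\<close>

text \<open>A uniformly distributed threshold lies between \<open>a\<close> and \<open>b\<close> with probability \<open>\<bar>a - b\<bar>\<close>. This
  turns distances between functions into probabilities of being separated by a level set.\<close>

lemma threshold_measure_eq_diff:
  fixes a b :: real
  assumes "0 \<le> a" "a \<le> 1" "0 \<le> b" "b \<le> 1"
  shows "(LINT c|lborel. indicator {0..1} c * (if (c < a) \<noteq> (c < b) then 1 else 0)) = \<bar>a - b\<bar>"
proof -
  have "(LINT c|lborel. indicator {0..1} c * (if (c < a) \<noteq> (c < b) then 1 else 0 :: real))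
      = (LINT c|lborel. indicator {min a b..<max a b} c)"
    by (rule Bochner_Integration.integral_cong) (use assms in \<open>auto simp: indicator_def\<close>)
  also have "\<dots> = \<bar>a - b\<bar>" by (auto simp: min_def max_def)
  finally show ?thesis .
qed

text \<open>If a point is drawn with weights \<open>q\<close> and a threshold uniformly from the unit interval, each pair in
  \<open>U\<close> is separated with probability at least \<open>e\<close>. Hence some point and threshold separate at
  least the fraction \<open>e\<close> of the pairs.\<close>

lemma exists_threshold_separating_fraction:
  fixes p :: "'t \<Rightarrow> 'z \<Rightarrow> real" and q :: "'z \<Rightarrow> real" and e :: real
  assumes Z: "finite Z" and q: "\<And>z. z \<in> Z \<Longrightarrow> 0 \<le> q z" "sum q Z \<le> 1"
    and p: "\<And>t z. 0 \<le> p t z" "\<And>t z. p t z \<le> 1"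
    and U: "finite U" "U \<noteq> {}" and e: "e > 0"
    and sep: "\<And>t t'. (t, t') \<in> U \<Longrightarrow> e \<le> (\<Sum>z\<in>Z. q z * \<bar>p t z - p t' z\<bar>)"
  shows "\<exists>z\<in>Z. \<exists>c. e * card U \<le> card {(t, t')\<in>U. (c < p t z) \<noteq> (c < p t' z)}"
proof -
  define S where "S = (\<lambda>z. \<Sum>(t, t')\<in>U. \<bar>p t z - p t' z\<bar>)"
  have pos: "0 < e * card U" using U e by (simp add: card_gt_0_iff)
  have "e * card U = (\<Sum>(t, t')\<in>U. e)" by simp
  also have "\<dots> \<le> (\<Sum>(t, t')\<in>U. \<Sum>z\<in>Z. q z * \<bar>p t z - p t' z\<bar>)"
    using sep by (intro sum_mono) auto
  also have "\<dots> = (\<Sum>z\<in>Z. q z * S z)"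
    unfolding S_def case_prod_beta sum_distrib_left by (rule sum.swap)
  finally have total: "e * card U \<le> (\<Sum>z\<in>Z. q z * S z)" .
  have "\<exists>z\<in>Z. e * card U \<le> S z"
  proof (rule ccontr)
    assume "\<not> ?thesis"
    then have less: "S z < e * card U" if "z \<in> Z" for z using that by force
    have "(\<Sum>z\<in>Z. q z * S z) < e * card U"
    proof (cases "\<forall>z\<in>Z. q z = 0")
      case True
      then show ?thesis using pos by simp
    next
      case False
      then obtain y where y: "y \<in> Z" "q y > 0" using q(1) by force
      have "(\<Sum>z\<in>Z. q z * S z) < (\<Sum>z\<in>Z. q z * (e * card U))"
      proof (rule sum_strict_mono_ex1[OF Z])
        show "\<forall>z\<in>Z. q z * S z \<le> q z * (e * card U)"
          using less q(1) by (intro ballI mult_left_mono less_imp_le[OF less]) auto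
        show "\<exists>z\<in>Z. q z * S z < q z * (e * card U)"
          using less[OF y(1)] y by (intro bexI[of _ y]) auto
      qed
      also have "\<dots> = sum q Z * (e * card U)" by (simp add: sum_distrib_right)
      also have "\<dots> \<le> 1 * (e * card U)" using q pos by (intro mult_right_mono) auto
      finally show ?thesis by simp
    qed
    then show False using total by simp
  qed
  then obtain z where z: "z \<in> Z" "e * card U \<le> S z" by blast
  define D where "D = (\<lambda>c. {(t, t')\<in>U. (c < p t z) \<noteq> (c < p t' z)})"
  have Dle: "card (D c) \<le> card U" for c
    unfolding D_def by (rule card_mono[OF U(1)]) auto
  have fR: "finite (range (\<lambda>c. card (D c)))" by (rule finite_subset[of _ "{..card U}"]) (use Dle in auto)
  have "Max (range (\<lambda>c. card (D c))) \<in> range (\<lambda>c. card (D c))" by (rule Max_in[OF fR]) simp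
  then obtain c0 where c0': "card (D c0) = Max (range (\<lambda>c. card (D c)))" by (auto simp only: image_iff)
  have c0: "card (D c) \<le> card (D c0)" for c unfolding c0' by (rule Max_ge[OF fR]) simp
  have m: "(\<lambda>c. indicator {0..1} c * (if (c < a) \<noteq> (c < b) then 1 else 0 :: real)) \<in> borel_measurable borel" for a b :: real
    by measurable
  have int: "integrable lborel (\<lambda>c. indicator {0..1} c * (if (c < a) \<noteq> (c < b) then 1 else 0 :: real))" for a b :: real
    by (rule Bochner_Integration.integrable_bound[of lborel "indicator {0..1::real} :: real \<Rightarrow> real"])
      (use m in \<open>auto simp: indicator_def\<close>)
  have "S z = (\<Sum>(t, t')\<in>U. LINT c|lborel. indicator {0..1} c * (if (c < p t z) \<noteq> (c < p t' z) then 1 else 0))"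
    unfolding S_def by (simp only: threshold_measure_eq_diff[OF p p])
  also have "\<dots> = (LINT c|lborel. (\<Sum>(t, t')\<in>U. indicator {0..1} c * (if (c < p t z) \<noteq> (c < p t' z) then 1 else 0)))"
    unfolding case_prod_beta using int by (intro Bochner_Integration.integral_sum[symmetric])
  also have "\<dots> = (LINT c|lborel. indicator {0..1} c * real (card (D c)))"
  proof (intro Bochner_Integration.integral_cong refl)
    fix c
    have "real (card (D c)) = (\<Sum>(t, t')\<in>U. if (c < p t z) \<noteq> (c < p t' z) then 1 else 0)"
      unfolding D_def case_prod_beta using U(1) by (simp add: sum.If_cases Int_def)
    then show "(\<Sum>(t, t')\<in>U. indicator {0..1} c * (if (c < p t z) \<noteq> (c < p t' z) then 1 else 0)) = indicator {0..1} c * real (card (D c))"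
      by (simp add: sum_distrib_left case_prod_beta)
  qed
  also have "\<dots> \<le> (LINT c|lborel. indicator {0..1::real} c * real (card (D c0)))"
  proof (rule integral_mono')
    show "integrable lborel (\<lambda>c::real. indicator {0..1::real} c * real (card (D c0)))" by simp
  qed (use c0 in \<open>auto simp: indicator_def\<close>)
  also have "\<dots> = card (D c0)" by simp
  finally show ?thesis using z unfolding D_def by (intro bexI[of _ z] exI[of _ c0]) auto
qed

text \<open>Greedy choice: each further threshold removes at least the fraction \<open>e\<close> of the pairs that are not
  separated yet.\<close>

lemma few_thresholds_separate_most_pairs:
  fixes p :: "'t \<Rightarrow> 'z \<Rightarrow> real" and q :: "'z \<Rightarrow> real" and e :: real
  assumes Z: "finite Z" and q: "\<And>z. z \<in> Z \<Longrightarrow> 0 \<le> q z" "sum q Z \<le> 1"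
    and p: "\<And>t z. 0 \<le> p t z" "\<And>t z. p t z \<le> 1"
    and U: "finite U" and e: "0 < e" "e \<le> 1"
    and sep: "\<And>t t'. (t, t') \<in> U \<Longrightarrow> e \<le> (\<Sum>z\<in>Z. q z * \<bar>p t z - p t' z\<bar>)"
  shows "\<exists>Y. finite Y \<and> card Y \<le> M \<and>
    card {(t, t')\<in>U. \<forall>(z, c)\<in>Y. (c < p t z) = (c < p t' z)} \<le> (1 - e) ^ M * card U"
proof (induction M)
  case 0
  then show ?case by (intro exI[of _ "{}"]) simp
next
  case (Suc M)
  then obtain Y where Y: "finite Y" "card Y \<le> M"
    "card {(t, t')\<in>U. \<forall>(z, c)\<in>Y. (c < p t z) = (c < p t' z)} \<le> (1 - e) ^ M * card U" by blast
  define U' where "U' = {(t, t')\<in>U. \<forall>(z, c)\<in>Y. (c < p t z) = (c < p t' z)}"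
  have U': "finite U'" unfolding U'_def by (rule finite_subset[OF _ U]) auto
  show ?case
  proof (cases "U' = {}")
    case True
    have "card U' \<le> (1 - e) ^ Suc M * card U" using True e by simp
    then show ?thesis using Y unfolding U'_def by (intro exI[of _ Y]) auto
  next
    case False
    have sep': "(t, t') \<in> U' \<Longrightarrow> e \<le> (\<Sum>z\<in>Z. q z * \<bar>p t z - p t' z\<bar>)" for t t'
      using sep by (auto simp: U'_def)
    obtain z c where zc: "e * card U' \<le> card {(t, t')\<in>U'. (c < p t z) \<noteq> (c < p t' z)}"
      using exists_threshold_separating_fraction[where Z=Z and q=q and p=p and U=U' and e=e]
        Z q p U' False e(1) sep' by blast
    define Y' where "Y' = insert (z, c) Y"
    have eq: "{(t, t')\<in>U. \<forall>(z, c)\<in>Y'. (c < p t z) = (c < p t' z)} = U' - {(t, t')\<in>U'. (c < p t z) \<noteq> (c < p t' z)}"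
      unfolding U'_def Y'_def by auto
    have "real (card {(t, t')\<in>U. \<forall>(z, c)\<in>Y'. (c < p t z) = (c < p t' z)})
        = card U' - real (card {(t, t')\<in>U'. (c < p t z) \<noteq> (c < p t' z)})"
      unfolding eq using U' by (subst card_Diff_subset) (auto intro!: of_nat_diff card_mono elim: finite_subset[rotated])
    also have "\<dots> \<le> (1 - e) * card U'" using zc by (simp add: algebra_simps)
    also have "\<dots> \<le> (1 - e) * ((1 - e) ^ M * card U)"
      using Y(3) e unfolding U'_def by (intro mult_left_mono) auto
    finally show ?thesis
      using Y by (intro exI[of _ Y']) (auto simp: Y'_def card_insert_if)
  qed
qed

text \<open>Once the greedily chosen thresholds separate all pairs, distinct parameters have distinct patterns
  on them, and \<open>card_threshold_patterns_le\<close> bounds the number of patterns.\<close>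

lemma packing_bound_implicit:
  fixes A :: "'a set" and \<phi> :: "'a \<Rightarrow> 'z \<Rightarrow> real" and c :: "'t \<Rightarrow> 'a \<Rightarrow> real" and m :: "'z \<Rightarrow> real \<Rightarrow> real"
    and q :: "'z \<Rightarrow> real" and e :: real
  defines "p \<equiv> (\<lambda>t z. m z (\<Sum>a\<in>A. c t a * \<phi> a z))"
  assumes A: "finite A" and T: "finite T"
    and m: "\<And>z. mono (m z)" "\<And>z x. 0 \<le> m z x" "\<And>z x. m z x \<le> 1"
    and Z: "finite Z" and q: "\<And>z. z \<in> Z \<Longrightarrow> 0 \<le> q z" "sum q Z \<le> 1"
    and e: "0 < e" "e \<le> 1"
    and sep: "\<And>t t'. t \<in> T \<Longrightarrow> t' \<in> T \<Longrightarrow> t \<noteq> t' \<Longrightarrow> e \<le> (\<Sum>z\<in>Z. q z * \<bar>p t z - p t' z\<bar>)"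
    and M: "(1 - e) ^ M * (card T)\<^sup>2 < 1"
  shows "card T \<le> (M + 1) ^ (card A + 1)"
proof -
  define U where "U = {(t, t')\<in>T \<times> T. t \<noteq> t'}"
  have fU: "finite U" unfolding U_def by (rule finite_subset[of _ "T \<times> T"]) (use T in auto)
  obtain Y where Y: "finite Y" "card Y \<le> M"
    "card {(t, t')\<in>U. \<forall>(z, c)\<in>Y. (c < p t z) = (c < p t' z)} \<le> (1 - e) ^ M * card U"
    using few_thresholds_separate_most_pairs[OF Z q, of p U e M] m e sep fU
    by (auto simp: p_def U_def)
  have "card U \<le> card (T \<times> T)" unfolding U_def using T by (intro card_mono) auto
  then have "real (card U) \<le> real ((card T)\<^sup>2)" by (simp only: of_nat_le_iff card_cartesian_product power2_eq_square)
  then have "(1 - e) ^ M * card U \<le> (1 - e) ^ M * (card T)\<^sup>2"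
    using e by (intro mult_left_mono) auto
  then have "card {(t, t')\<in>U. \<forall>(z, c)\<in>Y. (c < p t z) = (c < p t' z)} = 0" using Y M by linarith
  moreover have "finite {(t, t')\<in>U. \<forall>(z, c)\<in>Y. (c < p t z) = (c < p t' z)}"
    by (rule finite_subset[OF _ fU]) auto
  ultimately have emp: "{(t, t')\<in>U. \<forall>(z, c)\<in>Y. (c < p t z) = (c < p t' z)} = {}" by simp
  define pat where "pat = (\<lambda>t. {y\<in>Y. snd y < m (fst y) (\<Sum>a\<in>A. c t a * \<phi> a (fst y))})"
  have "inj_on pat T"
  proof (rule inj_onI, rule ccontr)
    fix t t' assume t: "t \<in> T" "t' \<in> T" "pat t = pat t'" "t \<noteq> t'"
    have "(snd y < p t (fst y)) = (snd y < p t' (fst y))" if "y \<in> Y" for y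
      using t(3) that unfolding pat_def p_def by blast
    then have "(t, t') \<in> {(t, t')\<in>U. \<forall>(z, c)\<in>Y. (c < p t z) = (c < p t' z)}"
      using t by (auto simp: U_def)
    then show False using emp by simp
  qed
  then have "card T = card (pat ` T)" by (simp add: card_image)
  also have "\<dots> \<le> (card Y + 1) ^ (card A + 1)"
    unfolding pat_def
    by (rule card_threshold_patterns_le[OF A Y(1) T, where Q="\<lambda>y x. snd y < m (fst y) x" and \<phi>="\<lambda>a y. \<phi> a (fst y)"])
      (meson m(1) monoD order_less_le_trans)
  also have "\<dots> \<le> (M + 1) ^ (card A + 1)" using Y(2) by (intro power_mono) auto
  finally show ?thesis .
qed

text \<open>With \<open>M\<close> about \<open>2 ln N / r\<close> the implicit bound reads \<open>N \<le> (2 ln N / r + 2)^d\<close>, where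
  \<open>N = card T\<close> and \<open>r = e / W\<close>. The logarithm is absorbed by \<open>ln N \<le> 2 d x\<close> for the root
  \<open>x = N\<^sup>1\<^sup>/\<^sup>(\<^sup>2\<^sup>d\<^sup>)\<close>, at the price of doubling the exponent.\<close>

lemma packing_bound_polynomial:
  fixes A :: "'a set" and \<phi> :: "'a \<Rightarrow> 'z \<Rightarrow> real" and c :: "'t \<Rightarrow> 'a \<Rightarrow> real" and m :: "'z \<Rightarrow> real \<Rightarrow> real"
    and q :: "'z \<Rightarrow> real" and e :: real
  defines "p \<equiv> (\<lambda>t z. m z (\<Sum>a\<in>A. c t a * \<phi> a z))"
  assumes A: "finite A" and T: "finite T"
    and m: "\<And>z. mono (m z)" "\<And>z x. 0 \<le> m z x" "\<And>z x. m z x \<le> 1"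
    and Z: "finite Z" and q: "\<And>z. z \<in> Z \<Longrightarrow> 0 \<le> q z" "sum q Z \<le> W"
    and e: "0 < e" "e \<le> W"
    and sep: "\<And>t t'. t \<in> T \<Longrightarrow> t' \<in> T \<Longrightarrow> t \<noteq> t' \<Longrightarrow> e \<le> (\<Sum>z\<in>Z. q z * \<bar>p t z - p t' z\<bar>)"
  defines "d \<equiv> card A + 1"
  shows "card T \<le> ((4 * d + 2) * (W / e)) ^ (2 * d)"
proof (cases "T = {}")
  case False
  define N where "N = real (card T)"
  have N: "N \<ge> 1" using False T unfolding N_def by (simp add: Suc_le_eq card_gt_0_iff)
  have W: "W > 0" using e by linarith
  define r where "r = e / W"
  have r: "0 < r" "r \<le> 1" using e W by (auto simp: r_def)
  \<comment> \<open>Large enough for \<open>(1 - r) ^ M * N\<^sup>2 < 1\<close>.\<close>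
  define M where "M = nat \<lfloor>2 * ln N / r\<rfloor> + 1"
  have lnN: "ln N \<ge> 0" using N by simp
  have M1: "real M > 2 * ln N / r" and M2: "real M \<le> 2 * ln N / r + 1"
  proof -
    have "real M = \<lfloor>2 * ln N / r\<rfloor> + 1" using r lnN unfolding M_def by (simp add: of_nat_nat)
    then show "real M > 2 * ln N / r" "real M \<le> 2 * ln N / r + 1" by linarith+
  qed
  have "(1 - r) ^ M \<le> exp (- r) ^ M" using r exp_ge_add_one_self[of "-r"] by (intro power_mono) auto
  also have "\<dots> = exp (- (r * M))" by (simp add: exp_of_nat_mult[symmetric] mult.commute)
  also have "\<dots> < exp (- (2 * ln N))" using M1 r by (simp add: field_simps)
  also have "\<dots> = 1 / N\<^sup>2"
    using N by (simp add: exp_minus exp_of_nat_mult[of 2, simplified] inverse_eq_divide)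
  finally have "(1 - r) ^ M * N\<^sup>2 < 1" using N by (simp add: field_simps)
  then have "card T \<le> (M + 1) ^ (card A + 1)"
    by (intro packing_bound_implicit[where m=m and Z=Z and q="\<lambda>z. q z / W" and e=r and c=c and \<phi>=\<phi>])
      (use A T m Z q W r sep in \<open>auto simp: p_def sum_divide_distrib[symmetric] r_def N_def divide_right_mono\<close>)
  then have "N \<le> real ((M + 1) ^ d)" unfolding N_def d_def by (simp only: of_nat_le_iff)
  then have NM: "N \<le> (real M + 1) ^ d" by (simp add: add.commute)
  define x where "x = root (2 * d) N"
  have d: "d > 0" by (simp add: d_def)
  have x: "x \<ge> 1" "x ^ (2 * d) = N" using N d by (auto simp: x_def real_root_pow_pos2 real_root_ge_1_iff)
  have "ln N = 2 * d * ln x" using x by (simp add: x(2)[symmetric] ln_realpow)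
  also have "\<dots> \<le> 2 * d * x" using x ln_le_minus_one[of x] by (intro mult_left_mono) auto
  finally have lnx: "ln N \<le> 2 * d * x" .
  have "real M + 1 \<le> 2 * ln N / r + 2" using M2 by simp
  also have "\<dots> \<le> 2 * (2 * d * x) / r + 2 * (x / r)"
    using lnx r x by (intro add_mono divide_right_mono mult_left_mono) (auto simp: field_simps intro: order_trans[of r 1 x])
  also have "\<dots> = (4 * d + 2) / r * x" using r by (simp add: field_simps)
  finally have "N \<le> ((4 * d + 2) / r * x) ^ d" using NM by (meson of_nat_0_le_iff add_nonneg_nonneg order_trans power_mono zero_le_one)
  then have "x ^ d * x ^ d \<le> ((4 * d + 2) / r) ^ d * x ^ d"
    unfolding power_mult_distrib using x(2) by (simp add: power_add[symmetric] mult_2)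
  then have "x ^ d \<le> ((4 * d + 2) / r) ^ d" using x by simp
  then have "(x ^ d)\<^sup>2 \<le> (((4 * d + 2) / r) ^ d)\<^sup>2" by (rule power_mono) (use x in simp)
  then have "N \<le> ((4 * d + 2) / r) ^ (2 * d)"
    by (simp only: x(2)[symmetric] power_mult mult.commute[of 2 d])
  moreover have "(4 * d + 2) / r = (4 * d + 2) * (W / e)" by (simp add: r_def)
  ultimately show ?thesis by (simp only: N_def of_nat_add of_nat_mult of_nat_numeral)
qed simp

section \<open>Random signs and chaining\<close>

text \<open>The sign vectors are taken extensional outside \<open>{..<n}\<close>, so that there are finitely many and averages
  over independent random signs are finite sums.\<close>

definition signs :: "nat \<Rightarrow> (nat \<Rightarrow> real) set"
  where "signs n = PiE {..<n} (\<lambda>_. {-1, 1})"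

definition sign_avg :: "nat \<Rightarrow> ((nat \<Rightarrow> real) \<Rightarrow> real) \<Rightarrow> real"
  where "sign_avg n F = (\<Sum>e\<in>signs n. F e) / 2 ^ n"

lemma finite_signs [simp]: "finite (signs n)" by (simp add: signs_def finite_PiE)

lemma card_signs: "card (signs n) = 2 ^ n" by (simp add: signs_def card_PiE numeral_2_eq_2)

lemma abs_sign: "e \<in> signs n \<Longrightarrow> i < n \<Longrightarrow> \<bar>e i\<bar> = 1" by (auto simp: signs_def PiE_def Pi_def)

lemma sign_avg_mono: "(\<And>e. e \<in> signs n \<Longrightarrow> F e \<le> G e) \<Longrightarrow> sign_avg n F \<le> sign_avg n G"
  unfolding sign_avg_def by (intro divide_right_mono sum_mono) auto

lemma sign_avg_add: "sign_avg n (\<lambda>e. F e + G e) = sign_avg n F + sign_avg n G"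
  by (simp add: sign_avg_def sum.distrib add_divide_distrib)

lemma sign_avg_const [simp]: "sign_avg n (\<lambda>_. c) = c"
  by (simp add: sign_avg_def card_signs)

lemma sign_avg_cmult: "sign_avg n (\<lambda>e. c * F e) = c * sign_avg n F"
  by (simp add: sign_avg_def sum_distrib_left)

lemma sign_avg_sum: "sign_avg n (\<lambda>e. \<Sum>k\<in>I. F k e) = (\<Sum>k\<in>I. sign_avg n (F k))"
  unfolding sign_avg_def by (subst sum.swap) (simp add: sum_divide_distrib)

lemma sign_avg_Suc: "sign_avg (Suc n) F = sign_avg n (\<lambda>e. (F (e(n := 1)) + F (e(n := -1))) / 2)"
proof -
  have "signs (Suc n) = (\<lambda>(y, e). e(n := y)) ` ({-1, 1} \<times> signs n)"
    unfolding signs_def lessThan_Suc by (rule PiE_insert_eq)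
  moreover have "inj_on (\<lambda>(y, e). e(n := y)) ({-1, 1} \<times> signs n)"
    unfolding signs_def by (rule inj_combinator) auto
  ultimately have "sum F (signs (Suc n)) = (\<Sum>(y, e)\<in>{-1, 1} \<times> signs n. F (e(n := y)))"
    by (simp add: sum.reindex case_prod_unfold comp_def)
  also have "\<dots> = (\<Sum>e\<in>signs n. F (e(n := 1)) + F (e(n := -1)))"
    by (subst sum.cartesian_product[symmetric]) (simp add: sum.distrib add.commute)
  finally show ?thesis by (simp add: sign_avg_def sum_divide_distrib)
qed

text \<open>Hoeffding's lemma for the uniform distribution on the two signs.\<close>

lemma cosh_le_exp_half_square:
  fixes x :: real shows "(exp x + exp (- x)) / 2 \<le> exp (x\<^sup>2 / 2)"
proof -
  have pos: "(exp x + exp (- x)) / 2 \<le> exp (x\<^sup>2 / 2)" if "x \<ge> 0" for x :: real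
  proof -
    have "- (2 * x) * (1 / 2) + ln (1 + 1 / 2 * (exp (2 * x) - 1)) \<le> (2 * x)\<^sup>2 / 8"
      using that by (intro Hoeffdings_lemma_aux) auto
    then have "ln ((1 + exp (2 * x)) / 2) \<le> x + x\<^sup>2 / 2" by (simp add: field_simps)
    then have "exp (ln ((1 + exp (2 * x)) / 2)) \<le> exp (x + x\<^sup>2 / 2)" by simp
    then have "(1 + exp (2 * x)) / 2 \<le> exp x * exp (x\<^sup>2 / 2)"
      by (simp add: exp_add exp_gt_zero add_pos_pos)
    then have "exp (- x) * ((1 + exp (2 * x)) / 2) \<le> exp (- x) * (exp x * exp (x\<^sup>2 / 2))" by simp
    also have "\<dots> = exp (x\<^sup>2 / 2)" by (simp add: mult.assoc[symmetric] exp_add[symmetric])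
    finally show ?thesis by (simp add: distrib_left exp_add[symmetric] add.commute)
  qed
  show ?thesis using pos[of x] pos[of "- x"] by (cases "x \<ge> 0") (auto simp: add.commute)
qed

lemma sign_avg_exp_le: "sign_avg n (\<lambda>e. exp (\<Sum>i<n. e i * a i)) \<le> exp ((\<Sum>i<n. (a i)\<^sup>2) / 2)"
proof -
  have "(\<Sum>e\<in>signs n. exp (\<Sum>i<n. e i * a i)) = (\<Sum>e\<in>signs n. \<Prod>i<n. exp (e i * a i))"
    by (simp add: exp_sum)
  also have "\<dots> = (\<Prod>i<n. \<Sum>s\<in>{-1, 1}. exp (s * a i))"
    unfolding signs_def by (rule prod_sum_PiE[symmetric]) auto
  also have "\<dots> = (\<Prod>i<n. 2 * ((exp (a i) + exp (- a i)) / 2))"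
    by (intro prod.cong refl) (simp add: field_simps)
  also have "\<dots> = 2 ^ n * (\<Prod>i<n. (exp (a i) + exp (- a i)) / 2)" by (subst prod.distrib) simp
  also have "\<dots> \<le> 2 ^ n * (\<Prod>i<n. exp ((a i)\<^sup>2 / 2))"
    by (intro mult_left_mono prod_mono conjI cosh_le_exp_half_square) (auto intro: add_nonneg_nonneg)
  also have "(\<Prod>i<n. exp ((a i)\<^sup>2 / 2)) = exp ((\<Sum>i<n. (a i)\<^sup>2) / 2)"
    by (simp add: exp_sum sum_divide_distrib)
  finally show ?thesis by (simp add: sign_avg_def field_simps)
qed

text \<open>The maximal inequality for finitely many subgaussian variables. Jensen's inequality for the
  exponential function is replaced by \<open>ln x \<le> x - 1\<close>, applied for each sign vector to
  \<open>x = exp (l * Z e) / c\<close>; the constant \<open>c\<close> is an upper bound for the average of the sum of all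
  exponentials, so that this sum divided by \<open>c\<close> contributes at most \<open>1\<close>.\<close>

lemma sign_avg_Max_le:
  assumes I: "finite I" "I \<noteq> {}" and v: "v > 0" "\<And>k. k \<in> I \<Longrightarrow> L2_set (a k) {..<n} \<le> v"
    and N: "card I \<le> N"
  shows "sign_avg n (\<lambda>e. Max ((\<lambda>k. \<bar>\<Sum>i<n. e i * a k i\<bar>) ` I)) \<le> v * sqrt (2 * ln (2 * N))"
proof -
  define L where "L = sqrt (2 * ln (2 * N))"
  have "card I > 0" using I by (simp add: card_gt_0_iff)
  then have N1: "N \<ge> 1" using N by linarith
  have L: "L > 0" "L\<^sup>2 = 2 * ln (2 * N)" using N1 by (auto simp: L_def)
  \<comment> \<open>The exponent for which the two terms of the bound, \<open>ln (2 N) / l\<close> and \<open>l v\<^sup>2 / 2\<close>, are equal.\<close>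
  define l where "l = L / v"
  have l: "l > 0" using L v by (simp add: l_def)
  define c where "c = 2 * N * exp (l\<^sup>2 * v\<^sup>2 / 2)"
  have c: "c > 0" using N1 by (simp add: c_def)
  define X where "X = (\<lambda>e k. \<Sum>i<n. e i * a k i)"
  define Z where "Z = (\<lambda>e. Max ((\<lambda>k. \<bar>X e k\<bar>) ` I))"
  have point: "l * Z e \<le> (\<Sum>k\<in>I. exp (l * X e k) + exp (- l * X e k)) / c + (ln c - 1)" for e
  proof -
    have "Z e \<in> (\<lambda>k. \<bar>X e k\<bar>) ` I" unfolding Z_def using I by (intro Max_in) auto
    then obtain k where k: "k \<in> I" "Z e = \<bar>X e k\<bar>" by auto
    have "exp (l * Z e) \<le> exp (l * X e k) + exp (- l * X e k)"
      unfolding k(2) by (cases "X e k \<ge> 0") auto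
    also have "\<dots> \<le> (\<Sum>k\<in>I. exp (l * X e k) + exp (- l * X e k))"
      using I k by (intro member_le_sum) auto
    finally have le: "exp (l * Z e) / c \<le> (\<Sum>k\<in>I. exp (l * X e k) + exp (- l * X e k)) / c"
      using c by (intro divide_right_mono) auto
    have "l * Z e = ln (exp (l * Z e) / c) + ln c" using c by (simp add: ln_div)
    also have "\<dots> \<le> exp (l * Z e) / c - 1 + ln c" using c by (intro add_right_mono ln_le_minus_one) auto
    finally show ?thesis using le by linarith
  qed
  have mgf: "sign_avg n (\<lambda>e. exp (s * X e k)) \<le> exp (l\<^sup>2 * v\<^sup>2 / 2)" if k: "k \<in> I" and s: "s\<^sup>2 = l\<^sup>2" for k s
  proof -
    have "sign_avg n (\<lambda>e. exp (s * X e k)) = sign_avg n (\<lambda>e. exp (\<Sum>i<n. e i * (s * a k i)))"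
      by (simp add: X_def sum_distrib_left mult_ac)
    also have "\<dots> \<le> exp ((\<Sum>i<n. (s * a k i)\<^sup>2) / 2)" by (rule sign_avg_exp_le)
    also have "(\<Sum>i<n. (s * a k i)\<^sup>2) = l\<^sup>2 * (L2_set (a k) {..<n})\<^sup>2"
      by (simp add: power_mult_distrib s sum_distrib_left[symmetric] L2_set_def sum_nonneg)
    also have "exp (l\<^sup>2 * (L2_set (a k) {..<n})\<^sup>2 / 2) \<le> exp (l\<^sup>2 * v\<^sup>2 / 2)"
      using v(2)[OF k] by (auto intro!: mult_left_mono power_mono)
    finally show ?thesis .
  qed
  have "l * sign_avg n Z \<le> sign_avg n (\<lambda>e. (1 / c) * (\<Sum>k\<in>I. exp (l * X e k) + exp (- l * X e k)) + (ln c - 1))"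
    unfolding sign_avg_cmult[symmetric] using point by (intro sign_avg_mono) auto
  also have "\<dots> = (1 / c) * (\<Sum>k\<in>I. sign_avg n (\<lambda>e. exp (l * X e k)) + sign_avg n (\<lambda>e. exp (- l * X e k))) + (ln c - 1)"
    unfolding sign_avg_add sign_avg_cmult sign_avg_sum sign_avg_const ..
  also have "\<dots> \<le> (1 / c) * (\<Sum>k\<in>I. exp (l\<^sup>2 * v\<^sup>2 / 2) + exp (l\<^sup>2 * v\<^sup>2 / 2)) + (ln c - 1)"
    using c by (intro add_right_mono mult_left_mono sum_mono add_mono mgf) auto
  also have "\<dots> \<le> 1 + (ln c - 1)"
  proof -
    have "(\<Sum>k\<in>I. exp (l\<^sup>2 * v\<^sup>2 / 2) + exp (l\<^sup>2 * v\<^sup>2 / 2)) = card I * (2 * exp (l\<^sup>2 * v\<^sup>2 / 2))" by simp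
    also have "\<dots> \<le> N * (2 * exp (l\<^sup>2 * v\<^sup>2 / 2))" using N by (intro mult_right_mono) auto
    also have "\<dots> = c" by (simp add: c_def)
    finally have "(\<Sum>k\<in>I. exp (l\<^sup>2 * v\<^sup>2 / 2) + exp (l\<^sup>2 * v\<^sup>2 / 2)) \<le> c" .
    then have "(1 / c) * (\<Sum>k\<in>I. exp (l\<^sup>2 * v\<^sup>2 / 2) + exp (l\<^sup>2 * v\<^sup>2 / 2)) \<le> (1 / c) * c"
      using c by (intro mult_left_mono) auto
    then show ?thesis using c by simp
  qed
  also have "\<dots> = ln (2 * N) + (l * v)\<^sup>2 / 2" using N1 by (simp add: c_def ln_mult power_mult_distrib)
  also have "l * v = L" using v by (simp add: l_def)
  also have "ln (2 * N) + L\<^sup>2 / 2 = L * L" using L(2) by (simp add: power2_eq_square)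
  also have "\<dots> = l * (v * L)" using v by (simp add: l_def)
  finally have "sign_avg n Z \<le> v * L" using l by simp
  then show ?thesis by (simp add: Z_def X_def L_def)
qed

text \<open>A maximal separated subset is a net.\<close>

lemma exists_separated_net:
  fixes D :: "'t \<Rightarrow> 't \<Rightarrow> real"
  assumes "finite T" and sym: "\<And>s t. D s t = D t s" and refl: "\<And>t. D t t \<le> r"
  obtains T' \<pi> where "T' \<subseteq> T" "\<And>s t. s \<in> T' \<Longrightarrow> t \<in> T' \<Longrightarrow> s \<noteq> t \<Longrightarrow> r < D s t"
    "\<And>t. t \<in> T \<Longrightarrow> \<pi> t \<in> T' \<and> D t (\<pi> t) \<le> r"
proof -
  define sep where "sep = {T'. T' \<subseteq> T \<and> (\<forall>s\<in>T'. \<forall>t\<in>T'. s \<noteq> t \<longrightarrow> r < D s t)}"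
  have fin: "finite sep" unfolding sep_def by (rule finite_subset[of _ "Pow T"]) (use assms(1) in auto)
  have "{} \<in> sep" by (simp add: sep_def)
  then obtain T' where T': "T' \<in> sep" "\<And>S. S \<in> sep \<Longrightarrow> T' \<subseteq> S \<Longrightarrow> S = T'"
    using finite_has_maximal[OF fin] by blast
  have "\<exists>s\<in>T'. D t s \<le> r" if "t \<in> T" for t
  proof (rule ccontr)
    assume "\<not> ?thesis"
    then have far: "\<And>s. s \<in> T' \<Longrightarrow> r < D t s" by force
    then have "insert t T' \<in> sep"
      using T'(1) that sym by (auto simp: sep_def)
    then have "t \<in> T'" using T'(2)[of "insert t T'"] by auto
    then show False using far[of t] refl[of t] by simp
  qed
  then obtain \<pi> where "\<And>t. t \<in> T \<Longrightarrow> \<pi> t \<in> T' \<and> D t (\<pi> t) \<le> r" by metis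
  then show ?thesis using T'(1) by (intro that[of T' \<pi>]) (auto simp: sep_def)
qed

text \<open>Chaining along nets \<open>N j\<close> at the scales \<open>r j = R / 2 ^ j\<close>. A link from level \<open>j + 1\<close> to level \<open>j\<close>
  has length at most \<open>3 r (j + 1)\<close>, and the logarithm of the number of links is at most of the
  order of \<open>K / r j\<close>; so the links of one level contribute at most a multiple of
  \<open>sqrt (r j * K)\<close>. These contributions form a geometric series with sum of the order of
  \<open>sqrt (R * K)\<close>. What matters later is that the bound vanishes with the radius \<open>R\<close> while \<open>K\<close> stays
  bounded. The estimate \<open>ln y \<le> y\<close> is wasteful but sufficient for polynomial packing numbers.\<close>

lemma chaining_bound:
  fixes a :: "'t \<Rightarrow> nat \<Rightarrow> real" and n :: nat
  defines "D \<equiv> (\<lambda>s t. L2_set (\<lambda>i. a s i - a t i) {..<n})"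
  assumes T: "finite T" "t0 \<in> T" and R: "0 < R" "R \<le> K" "\<And>t. t \<in> T \<Longrightarrow> D t t0 \<le> R"
    and B: "B \<ge> 1"
    and pack: "\<And>\<epsilon> T'. 0 < \<epsilon> \<Longrightarrow> \<epsilon> \<le> R \<Longrightarrow> T' \<subseteq> T \<Longrightarrow> (\<And>s t. s \<in> T' \<Longrightarrow> t \<in> T' \<Longrightarrow> s \<noteq> t \<Longrightarrow> \<epsilon> < D s t)
        \<Longrightarrow> card T' \<le> (B * (K / \<epsilon>)) ^ W"
  shows "sign_avg n (\<lambda>e. Max ((\<lambda>t. \<bar>\<Sum>i<n. e i * (a t i - a t0 i)\<bar>) ` T))
    \<le> 12 * sqrt (2 * (1 + 2 * W) * (2 * B)) * sqrt (R * K)"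
proof -
  define r where "r = (\<lambda>j::nat. R / 2 ^ j)"
  have r: "0 < r j" "r j \<le> R" for j using R by (auto simp: r_def field_simps)
  have Dsym: "D s t = D t s" for s t unfolding D_def L2_set_def by (simp add: power2_commute)
  have D0: "D t t = 0" for t by (simp add: D_def L2_set_0')
  have Dtri: "D s u \<le> D s t + D t u" for s t u
    unfolding D_def using L2_set_triangle_ineq[of "\<lambda>i. a s i - a t i" "\<lambda>i. a t i - a u i" "{..<n}"] by simp
  \<comment> \<open>At level zero the point \<open>t0\<close> alone is a net, because the radius of \<open>T\<close> is at most \<open>R = r 0\<close>.\<close>
  have "\<exists>T' \<pi>. T' \<subseteq> T \<and> (\<forall>s\<in>T'. \<forall>t\<in>T'. s \<noteq> t \<longrightarrow> r j < D s t) \<and> (\<forall>t\<in>T. \<pi> t \<in> T' \<and> D t (\<pi> t) \<le> r j) \<and> (j = 0 \<longrightarrow> (\<forall>t. \<pi> t = t0))" for j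
  proof (cases "j = 0")
    case True
    then show ?thesis using T R by (intro exI[of _ "{t0}"] exI[of _ "\<lambda>_. t0"]) (auto simp: r_def)
  next
    case False
    have "D t t \<le> r j" for t using r(1)[of j] by (simp add: D0)
    then show ?thesis using exists_separated_net[OF T(1), of D "r j"] Dsym False by (metis (lifting))
  qed
  then obtain N \<pi> where N: "\<And>j. N j \<subseteq> T" "\<And>j s t. s \<in> N j \<Longrightarrow> t \<in> N j \<Longrightarrow> s \<noteq> t \<Longrightarrow> r j < D s t"
    and \<pi>: "\<And>j t. t \<in> T \<Longrightarrow> \<pi> j t \<in> N j" "\<And>j t. t \<in> T \<Longrightarrow> D t (\<pi> j t) \<le> r j" and \<pi>0: "\<And>t. \<pi> 0 t = t0"
    by metis
  have cardN: "card (N j) \<le> (B * (K / r j)) ^ W" for j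
    by (rule pack[OF r N(1)]) (use N(2) in auto)
  define P where "P = (\<lambda>j. (\<lambda>t. (\<pi> (Suc j) t, \<pi> j t)) ` T)"
  have P: "finite (P j)" "P j \<noteq> {}" for j using T by (auto simp: P_def)
  define x where "x = (\<lambda>e (s, t). \<Sum>i<n. e i * (a s i - a t i))"
  define lk where "lk = (\<lambda>j. sign_avg n (\<lambda>e. Max ((\<lambda>p. \<bar>x e p\<bar>) ` P j)))"
  define C where "C = 3 * sqrt (2 * (1 + 2 * W) * (2 * B)) * sqrt (R * K)"
  have C: "C \<ge> 0" using R B by (simp add: C_def)
  have link: "lk j \<le> C * (1 / sqrt 2) ^ j" for j
  proof -
    \<comment> \<open>An upper bound for the bases of the packing bounds at both ends of the link.\<close>
    define y where "y = B * (K / r (Suc j))"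
    have "K / r (Suc j) \<ge> 1" using r[of "Suc j"] R by (simp add: le_divide_eq)
    then have "B * (K / r (Suc j)) \<ge> 1 * 1" using B by (intro mult_mono) auto
    then have y: "y \<ge> 1" by (simp add: y_def)
    have yj: "B * (K / r j) \<le> y" unfolding y_def using B R by (intro mult_left_mono divide_left_mono) (auto simp: r_def field_simps)
    have B0: "0 \<le> B * (K / r j)" using B R r[of j] by simp
    have fN: "finite (N j)" for j by (rule finite_subset[OF N(1) T(1)])
    have "card (P j) \<le> card (N (Suc j) \<times> N j)"
      unfolding P_def using \<pi> fN by (intro card_mono) auto
    then have cP: "card (P j) \<le> card (N (Suc j)) * card (N j)" by (simp add: card_cartesian_product)
    have "real (card (N (Suc j)) * card (N j)) \<le> y ^ W * y ^ W"
      unfolding of_nat_mult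
    proof (intro mult_mono)
      show "card (N (Suc j)) \<le> y ^ W" using cardN[of "Suc j"] by (simp add: y_def)
      show "card (N j) \<le> y ^ W" using cardN[of j] power_mono[OF yj B0, of W] by linarith
    qed (use y in auto)
    then have cN: "real (card (N (Suc j)) * card (N j)) \<le> y ^ (2 * W)" by (simp add: power_add[symmetric] mult_2)
    have "card (P j) > 0" using P by (simp add: card_gt_0_iff)
    then have pos: "card (N (Suc j)) * card (N j) > 0" using cP by linarith
    have "lk j \<le> (3 * r (Suc j)) * sqrt (2 * ln (2 * real (card (N (Suc j)) * card (N j))))"
      unfolding lk_def x_def case_prod_beta
    proof (rule sign_avg_Max_le[OF P _ _ cP])
      show "0 < 3 * r (Suc j)" using r by simp
      fix p assume "p \<in> P j"
      then obtain t where t: "t \<in> T" "p = (\<pi> (Suc j) t, \<pi> j t)" by (auto simp: P_def)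
      have "D (\<pi> (Suc j) t) (\<pi> j t) \<le> D (\<pi> (Suc j) t) t + D t (\<pi> j t)" by (rule Dtri)
      also have "\<dots> \<le> r (Suc j) + r j" using \<pi>(2)[OF t(1)] Dsym by (intro add_mono) metis+
      also have "\<dots> = 3 * r (Suc j)" by (simp add: r_def field_simps)
      finally show "L2_set (\<lambda>i. a (fst p) i - a (snd p) i) {..<n} \<le> 3 * r (Suc j)"
        by (simp add: t D_def)
    qed
    also have "\<dots> \<le> (3 * r (Suc j)) * sqrt (2 * ((1 + 2 * W) * y))"
    proof -
      have "ln (2 * real (card (N (Suc j)) * card (N j))) \<le> ln (2 * y ^ (2 * W))"
        using cN pos by (subst ln_le_cancel_iff) (auto intro: less_le_trans[OF _ cN])
      also have "\<dots> = ln 2 + 2 * W * ln y" using y by (simp add: ln_mult ln_realpow)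
      also have "\<dots> \<le> 1 + 2 * W * y"
        using y ln_le_minus_one[of y] ln_le_minus_one[of 2] by (intro add_mono mult_left_mono) auto
      also have "\<dots> \<le> (1 + 2 * W) * y" using y by (simp add: algebra_simps)
      finally show ?thesis using r[of "Suc j"] by (intro mult_left_mono) auto
    qed
    also have "\<dots> = 3 * sqrt ((r (Suc j))\<^sup>2 * (2 * ((1 + 2 * W) * y)))" using r[of "Suc j"] by (simp add: real_sqrt_mult)
    also have "(r (Suc j))\<^sup>2 * (2 * ((1 + 2 * W) * y)) = (2 * (1 + 2 * W) * B) * (r (Suc j) * K)"
      using r(1)[of "Suc j"] by (simp add: y_def power2_eq_square field_simps)
    also have "\<dots> \<le> (2 * (1 + 2 * W) * (2 * B)) * (r j * K)"
      using B R by (intro mult_mono) (auto simp: r_def field_simps)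
    also have "\<dots> = (2 * (1 + 2 * W) * (2 * B)) * (R * K) * (1 / 2) ^ j" by (simp add: r_def power_divide)
    also have "3 * sqrt \<dots> = C * (1 / sqrt 2) ^ j"
      by (simp add: C_def real_sqrt_mult real_sqrt_power real_sqrt_divide)
    finally show ?thesis by simp
  qed
  have geo: "(\<Sum>j<J. (1 / sqrt 2 :: real) ^ j) \<le> 4" for J
  proof -
    have s2: "sqrt 2 \<ge> (4/3 :: real)" by (rule real_le_rsqrt) (simp add: power2_eq_square)
    define q :: real where "q = 1 / sqrt 2"
    have q: "0 < q" "q \<le> 3/4" using s2 by (auto simp: q_def field_simps)
    have "(\<Sum>j<J. q ^ j) = (1 - q ^ J) / (1 - q)" using q by (subst sum_gp_strict) auto
    also have "\<dots> \<le> 1 / (1 - q)" using q by (intro divide_right_mono) auto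
    also have "\<dots> \<le> 4" using q by (simp add: field_simps)
    finally show ?thesis by (simp add: q_def)
  qed
  define Z where "Z = (\<lambda>e. Max ((\<lambda>t. \<bar>\<Sum>i<n. e i * (a t i - a t0 i)\<bar>) ` T))"
  \<comment> \<open>After \<open>J\<close> levels the chain stops; the rest is bounded trivially and vanishes as \<open>J\<close> grows.\<close>
  have bound: "sign_avg n Z \<le> 4 * C + n * r J" for J
  proof -
    have "Z e \<le> (\<Sum>j<J. Max ((\<lambda>p. \<bar>x e p\<bar>) ` P j)) + n * r J" if e: "e \<in> signs n" for e
    proof -
      have "Z e \<in> (\<lambda>t. \<bar>\<Sum>i<n. e i * (a t i - a t0 i)\<bar>) ` T" unfolding Z_def using T by (intro Max_in) auto
      then obtain t where t: "t \<in> T" "Z e = \<bar>x e (t, t0)\<bar>" by (auto simp: x_def)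
      have tel: "x e (\<pi> J t, t0) = (\<Sum>j<J. x e (\<pi> (Suc j) t, \<pi> j t))"
      proof (induction J)
        case (Suc J)
        have "x e (\<pi> (Suc J) t, t0) = x e (\<pi> (Suc J) t, \<pi> J t) + x e (\<pi> J t, t0)"
          by (simp add: x_def sum.distrib[symmetric] algebra_simps)
        then show ?case using Suc by simp
      qed (simp add: \<pi>0 x_def)
      have "\<bar>x e (t, \<pi> J t)\<bar> \<le> (\<Sum>i<n. \<bar>e i * (a t i - a (\<pi> J t) i)\<bar>)" unfolding x_def by simp
      also have "\<dots> \<le> (\<Sum>i<n. D t (\<pi> J t))"
      proof (rule sum_mono)
        fix i assume i: "i \<in> {..<n}"
        have "\<bar>a t i - a (\<pi> J t) i\<bar> \<le> L2_set (\<lambda>i. \<bar>a t i - a (\<pi> J t) i\<bar>) {..<n}"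
          by (rule member_le_L2_set) (use i in auto)
        then show "\<bar>e i * (a t i - a (\<pi> J t) i)\<bar> \<le> D t (\<pi> J t)"
          using abs_sign[OF e, of i] i by (simp add: abs_mult D_def L2_set_def)
      qed
      also have "\<dots> \<le> n * r J" using \<pi>(2)[OF t(1)] by (simp add: mult_left_mono)
      finally have rest: "\<bar>x e (t, \<pi> J t)\<bar> \<le> n * r J" .
      have "x e (t, t0) = x e (t, \<pi> J t) + x e (\<pi> J t, t0)"
        by (simp add: x_def sum.distrib[symmetric] algebra_simps)
      then have "Z e \<le> \<bar>x e (t, \<pi> J t)\<bar> + (\<Sum>j<J. \<bar>x e (\<pi> (Suc j) t, \<pi> j t)\<bar>)"
        unfolding t(2) tel using sum_abs[of "\<lambda>j. x e (\<pi> (Suc j) t, \<pi> j t)" "{..<J}"] by linarith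
      also have "(\<Sum>j<J. \<bar>x e (\<pi> (Suc j) t, \<pi> j t)\<bar>) \<le> (\<Sum>j<J. Max ((\<lambda>p. \<bar>x e p\<bar>) ` P j))"
        using P t by (intro sum_mono Max_ge) (auto simp: P_def)
      finally show ?thesis using rest by linarith
    qed
    then have "sign_avg n Z \<le> sign_avg n (\<lambda>e. (\<Sum>j<J. Max ((\<lambda>p. \<bar>x e p\<bar>) ` P j)) + n * r J)"
      by (rule sign_avg_mono)
    also have "\<dots> = (\<Sum>j<J. lk j) + n * r J" unfolding sign_avg_add sign_avg_sum lk_def by simp
    also have "(\<Sum>j<J. lk j) \<le> (\<Sum>j<J. C * (1 / sqrt 2) ^ j)" by (intro sum_mono link)
    also have "\<dots> = C * (\<Sum>j<J. (1 / sqrt 2) ^ j)" by (simp add: sum_distrib_left)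
    also have "\<dots> \<le> C * 4" using geo C by (intro mult_left_mono) auto
    finally show ?thesis by simp
  qed
  have "(\<lambda>J. 4 * C + n * R / 2 ^ J) \<longlonglongrightarrow> 4 * C + 0"
    by (intro tendsto_intros LIMSEQ_divide_realpow_zero) auto
  then have "(\<lambda>J. 4 * C + n * r J) \<longlonglongrightarrow> 4 * C" by (simp add: r_def)
  then have "sign_avg n Z \<le> 4 * C" using bound by (intro LIMSEQ_le_const[of _ "4 * C"]) auto
  then show ?thesis by (simp add: Z_def C_def)
qed

section \<open>Symmetrization\<close>

definition max_abs :: "'t set \<Rightarrow> ('t \<Rightarrow> real) \<Rightarrow> real"
  where "max_abs T x = Max ((\<lambda>t. \<bar>x t\<bar>) ` T)"

lemma max_abs_ge: "finite T \<Longrightarrow> t \<in> T \<Longrightarrow> \<bar>x t\<bar> \<le> max_abs T x"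
  unfolding max_abs_def by (intro Max_ge) auto

lemma max_abs_le: "finite T \<Longrightarrow> T \<noteq> {} \<Longrightarrow> (\<And>t. t \<in> T \<Longrightarrow> \<bar>x t\<bar> \<le> c) \<Longrightarrow> max_abs T x \<le> c"
  unfolding max_abs_def by (subst Max_le_iff) auto

lemma max_abs_nonneg: "finite T \<Longrightarrow> T \<noteq> {} \<Longrightarrow> 0 \<le> max_abs T x"
  using max_abs_ge[of T _ x] by (meson abs_ge_zero ex_in_conv order_trans)

lemma max_abs_measurable [measurable]:
  assumes "finite T" "\<And>t. t \<in> T \<Longrightarrow> (\<lambda>s. f s t) \<in> borel_measurable M"
  shows "(\<lambda>s. max_abs T (f s)) \<in> borel_measurable M"
  unfolding max_abs_def using assms by (intro borel_measurable_Max) auto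

lemma nn_integral_sign_avg:
  assumes F: "\<And>e s. e \<in> signs n \<Longrightarrow> 0 \<le> F e s"
    and m: "\<And>e. e \<in> signs n \<Longrightarrow> (\<lambda>s. F e s) \<in> borel_measurable P"
  shows "(\<integral>\<^sup>+s. ennreal (sign_avg n (\<lambda>e. F e s)) \<partial>P) = (\<Sum>e\<in>signs n. \<integral>\<^sup>+s. ennreal (F e s) \<partial>P) * ennreal (1 / 2 ^ n)"
proof -
  have "ennreal (sign_avg n (\<lambda>e. F e s)) = (\<Sum>e\<in>signs n. ennreal (F e s)) * ennreal (1 / 2 ^ n)" for s
  proof -
    have "ennreal (sign_avg n (\<lambda>e. F e s)) = ennreal ((\<Sum>e\<in>signs n. F e s) * (1 / 2 ^ n))"
      by (simp add: sign_avg_def)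
    also have "\<dots> = ennreal (\<Sum>e\<in>signs n. F e s) * ennreal (1 / 2 ^ n)"
      using F by (intro ennreal_mult sum_nonneg) auto
    finally show ?thesis using F by simp
  qed
  then show ?thesis
    using m by (simp add: nn_integral_multc nn_integral_sum cong: nn_integral_cong)
qed

text \<open>Write \<open>x + (g s - m)\<close>, with \<open>m\<close> the mean of \<open>g\<close>, as the average of \<open>x + 2 g s\<close> and \<open>x - 2 m\<close>. By
  Jensen's inequality the maximum of \<open>\<bar>x - 2 m\<bar>\<close> is at most the expected maximum of
  \<open>\<bar>x - 2 g s\<bar>\<close>. So replacing a centred observation by a doubled observation with a random sign does
  not decrease the expectation, whatever the fixed part \<open>x\<close> is.\<close>

lemma symmetrization_one_observation:
  assumes P: "prob_space P" and T: "finite T" "T \<noteq> {}"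
    and g: "\<And>t. t \<in> T \<Longrightarrow> integrable P (g t)"
  shows "(\<integral>\<^sup>+s. ennreal (max_abs T (\<lambda>t. x t + (g t s - integral\<^sup>L P (g t)))) \<partial>P)
    \<le> (\<integral>\<^sup>+s. ennreal ((max_abs T (\<lambda>t. x t + 2 * g t s) + max_abs T (\<lambda>t. x t - 2 * g t s)) / 2) \<partial>P)"
proof -
  interpret prob_space P by fact
  have [measurable]: "\<And>t. t \<in> T \<Longrightarrow> g t \<in> borel_measurable P" using g by auto
  define up where "up = (\<lambda>s. max_abs T (\<lambda>t. x t + 2 * g t s))"
  define dn where "dn = (\<lambda>s. max_abs T (\<lambda>t. x t - 2 * g t s))"
  have [measurable]: "up \<in> borel_measurable P" "dn \<in> borel_measurable P"
    unfolding up_def dn_def using T by measurable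
  have nn: "0 \<le> up s" "0 \<le> dn s" for s unfolding up_def dn_def using T by (auto intro: max_abs_nonneg)
  have dn_le: "dn s \<le> (\<Sum>t\<in>T. \<bar>x t\<bar> + 2 * \<bar>g t s\<bar>)" for s
    unfolding dn_def
  proof (rule max_abs_le[OF T])
    fix t assume t: "t \<in> T"
    have "\<bar>x t - 2 * g t s\<bar> \<le> \<bar>x t\<bar> + 2 * \<bar>g t s\<bar>" by linarith
    also have "\<dots> \<le> (\<Sum>t\<in>T. \<bar>x t\<bar> + 2 * \<bar>g t s\<bar>)"
      using T(1) t by (intro member_le_sum[of t T "\<lambda>t. \<bar>x t\<bar> + 2 * \<bar>g t s\<bar>"]) auto
    finally show "\<bar>x t - 2 * g t s\<bar> \<le> (\<Sum>t\<in>T. \<bar>x t\<bar> + 2 * \<bar>g t s\<bar>)" .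
  qed
  have int_dn: "integrable P dn"
  proof (rule Bochner_Integration.integrable_bound[of P "\<lambda>s. \<Sum>t\<in>T. \<bar>x t\<bar> + 2 * \<bar>g t s\<bar>"])
    show "integrable P (\<lambda>s. \<Sum>t\<in>T. \<bar>x t\<bar> + 2 * \<bar>g t s\<bar>)" using g by auto
    show "AE s in P. norm (dn s) \<le> norm (\<Sum>t\<in>T. \<bar>x t\<bar> + 2 * \<bar>g t s\<bar>)"
      using dn_le nn by (auto intro: order_trans[OF _ abs_ge_self])
  qed simp
  define J where "J = integral\<^sup>L P dn"
  have J: "max_abs T (\<lambda>t. x t - 2 * integral\<^sup>L P (g t)) \<le> J"
  proof (rule max_abs_le[OF T])
    fix t assume t: "t \<in> T"
    have "x t - 2 * integral\<^sup>L P (g t) = (\<integral>s. x t - 2 * g t s \<partial>P)" using g[OF t] by (simp add: prob_space)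
    also have "\<bar>\<dots>\<bar> \<le> (\<integral>s. \<bar>x t - 2 * g t s\<bar> \<partial>P)" using integral_norm_bound[of P "\<lambda>s. x t - 2 * g t s"] by simp
    also have "\<dots> \<le> J" unfolding J_def dn_def
      using g[OF t] int_dn T t by (intro integral_mono max_abs_ge[of T t "\<lambda>t. x t - 2 * g t _"]) (auto simp: dn_def)
    finally show "\<bar>x t - 2 * integral\<^sup>L P (g t)\<bar> \<le> J" .
  qed
  have J0: "J \<ge> 0" using nn unfolding J_def by (intro integral_nonneg_AE) auto
  have "(\<integral>\<^sup>+s. ennreal (max_abs T (\<lambda>t. x t + (g t s - integral\<^sup>L P (g t)))) \<partial>P) \<le> (\<integral>\<^sup>+s. ennreal (up s / 2) + ennreal (J / 2) \<partial>P)"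
  proof (rule nn_integral_mono)
    fix s
    have "max_abs T (\<lambda>t. x t + (g t s - integral\<^sup>L P (g t))) \<le> up s / 2 + J / 2"
    proof (rule max_abs_le[OF T])
      fix t assume t: "t \<in> T"
      have "\<bar>x t + 2 * g t s\<bar> \<le> up s" unfolding up_def
        using max_abs_ge[OF T(1) t, of "\<lambda>t. x t + 2 * g t s"] by simp
      moreover have "\<bar>x t - 2 * integral\<^sup>L P (g t)\<bar> \<le> J"
        using max_abs_ge[OF T(1) t, of "\<lambda>t. x t - 2 * integral\<^sup>L P (g t)"] J by simp
      ultimately show "\<bar>x t + (g t s - integral\<^sup>L P (g t))\<bar> \<le> up s / 2 + J / 2" by linarith
    qed
    then have "ennreal (max_abs T (\<lambda>t. x t + (g t s - integral\<^sup>L P (g t)))) \<le> ennreal (up s / 2 + J / 2)"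
      by (rule ennreal_leI)
    also have "\<dots> = ennreal (up s / 2) + ennreal (J / 2)" using nn J0 by (intro ennreal_plus) auto
    finally show "ennreal (max_abs T (\<lambda>t. x t + (g t s - integral\<^sup>L P (g t)))) \<le> ennreal (up s / 2) + ennreal (J / 2)" .
  qed
  also have "\<dots> = (\<integral>\<^sup>+s. ennreal (up s / 2) \<partial>P) + ennreal (J / 2)"
    by (subst nn_integral_add) (auto simp: emeasure_space_1)
  also have "ennreal (J / 2) = (\<integral>\<^sup>+s. ennreal (dn s / 2) \<partial>P)"
    unfolding J_def using int_dn nn by (subst nn_integral_eq_integral) auto
  also have "(\<integral>\<^sup>+s. ennreal (up s / 2) \<partial>P) + (\<integral>\<^sup>+s. ennreal (dn s / 2) \<partial>P) = (\<integral>\<^sup>+s. ennreal (up s / 2) + ennreal (dn s / 2) \<partial>P)"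
    by (subst nn_integral_add) auto
  also have "\<dots> = (\<integral>\<^sup>+s. ennreal ((up s + dn s) / 2) \<partial>P)"
    using nn by (intro nn_integral_cong) (simp add: ennreal_plus[symmetric] add_divide_distrib del: ennreal_plus)
  finally show ?thesis by (simp add: up_def dn_def)
qed

text \<open>The observations are replaced one after the other; the part \<open>x\<close> takes up those that are held fixed.\<close>

lemma symmetrization:
  assumes P: "prob_space P" and T: "finite T" "T \<noteq> {}"
    and g: "\<And>t. t \<in> T \<Longrightarrow> integrable P (g t)"
  shows "(\<integral>\<^sup>+w. ennreal (max_abs T (\<lambda>t. x t + (\<Sum>i<n. g t (w i) - integral\<^sup>L P (g t)))) \<partial>PiM {..<n} (\<lambda>_. P))
    \<le> (\<integral>\<^sup>+w. ennreal (sign_avg n (\<lambda>e. max_abs T (\<lambda>t. x t + 2 * (\<Sum>i<n. e i * g t (w i))))) \<partial>PiM {..<n} (\<lambda>_. P))"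
proof (induction n arbitrary: x)
  case 0
  show ?case by (simp add: sign_avg_def signs_def)
next
  case (Suc n)
  interpret prob_space P by fact
  interpret product_prob_space "\<lambda>_. P" "{..<n}" by unfold_locales
  interpret product_sigma_finite "\<lambda>_::nat. P" by unfold_locales
  have [measurable]: "\<And>t. t \<in> T \<Longrightarrow> g t \<in> borel_measurable P" using g by auto
  let ?m = "\<lambda>t. integral\<^sup>L P (g t)"
  have S: "{..<Suc n} = insert n {..<n}" by auto
  have n: "n \<notin> {..<n}" by simp
  define G where "G = (\<lambda>w. ennreal (sign_avg n (\<lambda>e. max_abs T (\<lambda>t. x t + (g t (w n) - ?m t) + 2 * (\<Sum>i<n. e i * g t (w i))))))"
  have G_meas [measurable]: "G \<in> borel_measurable (PiM (insert n {..<n}) (\<lambda>_. P))"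
    unfolding G_def sign_avg_def using T by measurable
  have L_meas: "(\<lambda>w. ennreal (max_abs T (\<lambda>t. x t + (\<Sum>i<Suc n. g t (w i) - ?m t)))) \<in> borel_measurable (PiM (insert n {..<n}) (\<lambda>_. P))"
    using T by measurable auto
  define H where "H = (\<lambda>w. ennreal (sign_avg (Suc n) (\<lambda>e. max_abs T (\<lambda>t. x t + 2 * (\<Sum>i<Suc n. e i * g t (w i))))))"
  have H_meas: "H \<in> borel_measurable (PiM (insert n {..<n}) (\<lambda>_. P))"
    unfolding H_def sign_avg_def using T by measurable auto
  have "(\<integral>\<^sup>+w. ennreal (max_abs T (\<lambda>t. x t + (\<Sum>i<Suc n. g t (w i) - ?m t))) \<partial>PiM {..<Suc n} (\<lambda>_. P))
     = (\<integral>\<^sup>+y. \<integral>\<^sup>+w. ennreal (max_abs T (\<lambda>t. x t + (\<Sum>i<Suc n. g t ((w(n := y)) i) - ?m t))) \<partial>PiM {..<n} (\<lambda>_. P) \<partial>P)"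
    unfolding S using L_meas by (subst product_nn_integral_insert_rev) (auto simp: S)
  also have "\<dots> = (\<integral>\<^sup>+y. \<integral>\<^sup>+w. ennreal (max_abs T (\<lambda>t. (x t + (g t y - ?m t)) + (\<Sum>i<n. g t (w i) - ?m t))) \<partial>PiM {..<n} (\<lambda>_. P) \<partial>P)"
    by (intro nn_integral_cong arg_cong[where f=ennreal] arg_cong2[where f=max_abs] refl) (auto simp: algebra_simps)
  also have "\<dots> \<le> (\<integral>\<^sup>+y. \<integral>\<^sup>+w. G (w(n := y)) \<partial>PiM {..<n} (\<lambda>_. P) \<partial>P)"
  proof (rule nn_integral_mono)
    fix y
    have "(\<integral>\<^sup>+w. G (w(n := y)) \<partial>PiM {..<n} (\<lambda>_. P)) =
        (\<integral>\<^sup>+w. ennreal (sign_avg n (\<lambda>e. max_abs T (\<lambda>t. (x t + (g t y - ?m t)) + 2 * (\<Sum>i<n. e i * g t (w i))))) \<partial>PiM {..<n} (\<lambda>_. P))"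
      unfolding G_def by (intro nn_integral_cong) simp
    then show "(\<integral>\<^sup>+w. ennreal (max_abs T (\<lambda>t. (x t + (g t y - ?m t)) + (\<Sum>i<n. g t (w i) - ?m t))) \<partial>PiM {..<n} (\<lambda>_. P))
        \<le> (\<integral>\<^sup>+w. G (w(n := y)) \<partial>PiM {..<n} (\<lambda>_. P))"
      using Suc.IH[of "\<lambda>t. x t + (g t y - ?m t)"] by simp
  qed
  also have "\<dots> = (\<integral>\<^sup>+w. \<integral>\<^sup>+y. G (w(n := y)) \<partial>P \<partial>PiM {..<n} (\<lambda>_. P))"
    by (subst product_nn_integral_insert_rev[symmetric], simp, simp, simp add: G_meas,
        subst product_nn_integral_insert, simp, simp, simp_all add: G_meas)
  also have "\<dots> \<le> (\<integral>\<^sup>+w. \<integral>\<^sup>+y. H (w(n := y)) \<partial>P \<partial>PiM {..<n} (\<lambda>_. P))"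
  proof (rule nn_integral_mono)
    fix w
    define X where "X = (\<lambda>e t. x t + 2 * (\<Sum>i<n. e i * g t (w i)))"
    have "(\<integral>\<^sup>+y. G (w(n := y)) \<partial>P) = (\<integral>\<^sup>+y. ennreal (sign_avg n (\<lambda>e. max_abs T (\<lambda>t. X e t + (g t y - ?m t)))) \<partial>P)"
      unfolding G_def X_def by (intro nn_integral_cong) (simp add: algebra_simps)
    also have "\<dots> = (\<Sum>e\<in>signs n. \<integral>\<^sup>+y. ennreal (max_abs T (\<lambda>t. X e t + (g t y - ?m t))) \<partial>P) * ennreal (1 / 2 ^ n)"
      using T by (intro nn_integral_sign_avg max_abs_nonneg) measurable
    also have "\<dots> \<le> (\<Sum>e\<in>signs n. \<integral>\<^sup>+y. ennreal ((max_abs T (\<lambda>t. X e t + 2 * g t y) + max_abs T (\<lambda>t. X e t - 2 * g t y)) / 2) \<partial>P) * ennreal (1 / 2 ^ n)"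
      by (intro mult_right_mono sum_mono symmetrization_one_observation[OF assms(1) T g]) auto
    also have "\<dots> = (\<integral>\<^sup>+y. ennreal (sign_avg n (\<lambda>e. (max_abs T (\<lambda>t. X e t + 2 * g t y) + max_abs T (\<lambda>t. X e t - 2 * g t y)) / 2)) \<partial>P)"
      using T by (intro nn_integral_sign_avg[symmetric] divide_nonneg_pos add_nonneg_nonneg max_abs_nonneg) (auto simp: S)
    also have "\<dots> = (\<integral>\<^sup>+y. H (w(n := y)) \<partial>P)"
    proof (intro nn_integral_cong)
      fix y
      show "ennreal (sign_avg n (\<lambda>e. (max_abs T (\<lambda>t. X e t + 2 * g t y) + max_abs T (\<lambda>t. X e t - 2 * g t y)) / 2)) = H (w(n := y))"
        unfolding H_def sign_avg_Suc by (simp add: X_def algebra_simps)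
    qed
    finally show "(\<integral>\<^sup>+y. G (w(n := y)) \<partial>P) \<le> (\<integral>\<^sup>+y. H (w(n := y)) \<partial>P)" .
  qed
  also have "\<dots> = (\<integral>\<^sup>+w. H w \<partial>PiM {..<Suc n} (\<lambda>_. P))"
    unfolding S using H_meas by (subst product_nn_integral_insert) auto
  finally show ?case by (simp add: H_def)
qed

section \<open>A maximal inequality\<close>

text \<open>Applied to the empirical averages \<open>h\<close> and \<open>k\<close>, this makes the chaining bound linear in them, so that
  expectations can be taken. The parameter \<open>\<tau>\<close> is chosen small first, and then the mean of \<open>h\<close> small
  compared with \<open>\<tau> ^ 3\<close>.\<close>

lemma sqrt_sqrt_mult_le:
  fixes h k \<tau> :: real
  assumes "h \<ge> 0" "k \<ge> 0" "\<tau> > 0"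
  shows "sqrt (sqrt h * sqrt k) \<le> \<tau> * (2 + k) + h / \<tau> ^ 3"
proof -
  have amgm: "sqrt (x * y) \<le> (\<tau> * x + y / \<tau>) / 2" if "x \<ge> 0" "y \<ge> 0" for x y
    using arith_geo_mean_sqrt[of "\<tau> * x" "y / \<tau>"] that assms(3) by simp
  have k: "sqrt k \<le> 1 + k" using arith_geo_mean_sqrt[of 1 k] assms by simp
  have t2: "\<tau>\<^sup>2 * (1 / \<tau>\<^sup>2) = 1" using assms by simp
  have "sqrt h = sqrt (\<tau>\<^sup>2 * (h / \<tau>\<^sup>2))" using assms by simp
  also have "\<dots> \<le> (\<tau>\<^sup>2 + h / \<tau>\<^sup>2) / 2" using assms by (intro arith_geo_mean_sqrt) auto
  finally have h: "sqrt h / \<tau> \<le> (\<tau>\<^sup>2 + h / \<tau>\<^sup>2) / 2 / \<tau>" using assms by (intro divide_right_mono) auto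
  have "sqrt (sqrt h * sqrt k) \<le> (\<tau> * sqrt k + sqrt h / \<tau>) / 2"
    using amgm[of "sqrt k" "sqrt h"] assms by (simp add: mult.commute)
  also have "\<dots> \<le> (\<tau> * (1 + k) + (\<tau>\<^sup>2 + h / \<tau>\<^sup>2) / 2 / \<tau>) / 2"
  proof -
    have "\<tau> * sqrt k \<le> \<tau> * (1 + k)" using k assms by (intro mult_left_mono) auto
    then show ?thesis by (rule divide_right_mono[OF add_mono[OF _ h]]) simp
  qed
  also have "\<dots> = \<tau> * (1 + k) / 2 + \<tau> / 4 + h / \<tau> ^ 3 / 4"
    using assms by (simp add: field_simps power2_eq_square power3_eq_cube)
  also have "\<dots> \<le> \<tau> * (2 + k) + h / \<tau> ^ 3"
  proof -
    have "h / \<tau> ^ 3 \<ge> 0" "\<tau> * k \<ge> 0" using assms by auto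
    moreover have "\<tau> * (1 + k) / 2 + \<tau> / 4 = \<tau> * 3 / 4 + \<tau> * k / 2" by (simp add: field_simps)
    ultimately show ?thesis using assms(3) by (simp add: distrib_left)
  qed
  finally show ?thesis .
qed

text \<open>The constant of \<open>chaining_bound\<close> for packing numbers \<open>((4 d + 2) * (K / \<epsilon>)) ^ (4 d)\<close>.\<close>

definition chain_const :: "nat \<Rightarrow> real"
  where "chain_const d = 12 * sqrt (2 * (1 + 2 * (4 * real d)) * (2 * (4 * real d + 2)))"

text \<open>The observations \<open>w\<close> are fixed. Squared distances between the functions are bounded by weighted
  \<open>L\<^sup>1\<close> distances between the \<open>p t\<close>, to which \<open>packing_bound_polynomial\<close> applies at the scale
  \<open>\<epsilon>\<^sup>2\<close>; the radius for the chaining comes from the envelope \<open>H\<close> of the squared increments.\<close>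

lemma sign_avg_max_abs_class_le:
  fixes f :: "'t \<Rightarrow> 's \<Rightarrow> real" and A :: "'a set" and I :: "'i set"
    and c :: "'t \<Rightarrow> 'a \<Rightarrow> real" and \<phi> :: "'a \<Rightarrow> 's \<times> 'i \<Rightarrow> real" and m :: "'s \<times> 'i \<Rightarrow> real \<Rightarrow> real"
    and w :: "nat \<Rightarrow> 's" and H F :: "'s \<Rightarrow> real" and n :: nat
  defines "p \<equiv> (\<lambda>t z. m z (\<Sum>a\<in>A. c t a * \<phi> a z))"
  assumes T: "finite T" "t0 \<in> T" and A: "finite A" and I: "finite I"
    and m: "\<And>z. mono (m z)" "\<And>z x. 0 \<le> m z x" "\<And>z x. m z x \<le> 1"
    and F: "\<And>s. 0 \<le> F s"
    and inc: "\<And>s t t'. t \<in> T \<Longrightarrow> t' \<in> T \<Longrightarrow> (f t s - f t' s)\<^sup>2 \<le> F s * (\<Sum>i\<in>I. \<bar>p t (s, i) - p t' (s, i)\<bar>)"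
    and H: "\<And>s t. t \<in> T \<Longrightarrow> (f t s - f t0 s)\<^sup>2 \<le> H s"
  shows "sign_avg n (\<lambda>e. max_abs T (\<lambda>t. \<Sum>i<n. e i * (f t (w i) - f t0 (w i))))
    \<le> chain_const (card A + 1) * sqrt (sqrt (\<Sum>i<n. H (w i)) * sqrt (\<Sum>i<n. card I * F (w i) + H (w i)))"
proof -
  define d where "d = card A + 1"
  define R where "R = sqrt (\<Sum>i<n. H (w i))"
  define K where "K = sqrt (\<Sum>i<n. card I * F (w i) + H (w i))"
  define D where "D = (\<lambda>s t. L2_set (\<lambda>i. f s (w i) - f t (w i)) {..<n})"
  have H0: "0 \<le> H s" for s using H[OF T(2), of s] by simp
  have Rle: "D t t0 \<le> R" if "t \<in> T" for t
    unfolding D_def R_def L2_set_def using H[OF that] by (intro real_sqrt_le_mono sum_mono) auto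
  have RK: "R \<le> K" unfolding R_def K_def using F by (intro real_sqrt_le_mono sum_mono) auto
  have R0: "0 \<le> R" unfolding R_def using H0 by (intro real_sqrt_ge_zero sum_nonneg) auto
  show ?thesis
  \<comment> \<open>If \<open>R = 0\<close> all increments vanish on the sample; the chaining needs a positive radius.\<close>
  proof (cases "R = 0")
    case True
    have "\<bar>\<Sum>i<n. e i * (f t (w i) - f t0 (w i))\<bar> \<le> 0" if t: "t \<in> T" for e t
    proof -
      have "D t t0 = 0" using Rle[OF t] True by (simp add: D_def antisym)
      then have "\<And>i. i < n \<Longrightarrow> f t (w i) - f t0 (w i) = 0" unfolding D_def by (subst (asm) L2_set_eq_0_iff) auto
      then show ?thesis by simp
    qed
    then have "max_abs T (\<lambda>t. \<Sum>i<n. e i * (f t (w i) - f t0 (w i))) \<le> 0" for e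
      using T by (intro max_abs_le) auto
    then have "sign_avg n (\<lambda>e. max_abs T (\<lambda>t. \<Sum>i<n. e i * (f t (w i) - f t0 (w i)))) \<le> sign_avg n (\<lambda>_. 0)"
      by (intro sign_avg_mono)
    then show ?thesis using True by (simp add: R_def)
  next
    case False
    then have R: "R > 0" using R0 by simp
    have "sign_avg n (\<lambda>e. Max ((\<lambda>t. \<bar>\<Sum>i<n. e i * (f t (w i) - f t0 (w i))\<bar>) ` T))
      \<le> 12 * sqrt (2 * (1 + 2 * (4 * real d)) * (2 * (4 * real d + 2))) * sqrt (R * K)"
    proof (rule chaining_bound[where a="\<lambda>t i. f t (w i)" and B="real (4 * d + 2)" and W="4 * d", simplified of_nat_mult of_nat_add of_nat_numeral of_nat_1])
      show "L2_set (\<lambda>i. f t (w i) - f t0 (w i)) {..<n} \<le> R" if "t \<in> T" for t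
        using Rle[OF that] by (simp add: D_def)
      fix \<epsilon> T' assume e: "0 < \<epsilon>" "\<epsilon> \<le> R" and T': "T' \<subseteq> T"
        and sep: "\<And>s t. s \<in> T' \<Longrightarrow> t \<in> T' \<Longrightarrow> s \<noteq> t \<Longrightarrow> \<epsilon> < L2_set (\<lambda>i. f s (w i) - f t (w i)) {..<n}"
      define Z where "Z = {..<n} \<times> I"
      have Z: "finite Z" using I by (simp add: Z_def)
      have T'fin: "finite T'" using T' T(1) finite_subset by auto
      have "\<epsilon>\<^sup>2 \<le> K\<^sup>2" using e RK by (intro power_mono) auto
      have sumq: "(\<Sum>z\<in>Z. F (w (fst z))) \<le> K\<^sup>2"
      proof -
        have "(\<Sum>z\<in>Z. F (w (fst z))) = (\<Sum>i<n. \<Sum>k\<in>I. F (w i))"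
          unfolding Z_def sum.cartesian_product by (rule sum.cong) auto
        also have "\<dots> = (\<Sum>i<n. card I * F (w i))" by simp
        also have "\<dots> \<le> (\<Sum>i<n. card I * F (w i) + H (w i))" using H0 by (intro sum_mono) auto
        also have "\<dots> = K\<^sup>2" unfolding K_def using H0 F by (simp add: sum_nonneg)
        finally show ?thesis .
      qed
      have sepq: "\<epsilon>\<^sup>2 \<le> (\<Sum>z\<in>Z. F (w (fst z)) * \<bar>m (w (fst z), snd z) (\<Sum>a\<in>A. c s a * \<phi> a (w (fst z), snd z))
          - m (w (fst z), snd z) (\<Sum>a\<in>A. c t a * \<phi> a (w (fst z), snd z))\<bar>)"
        if st: "s \<in> T'" "t \<in> T'" "s \<noteq> t" for s t
      proof -
        have "\<epsilon>\<^sup>2 \<le> (L2_set (\<lambda>i. f s (w i) - f t (w i)) {..<n})\<^sup>2"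
          using sep[OF st] e by (intro power_mono) auto
        also have "\<dots> = (\<Sum>i<n. (f s (w i) - f t (w i))\<^sup>2)" by (simp add: L2_set_def sum_nonneg)
        also have "\<dots> \<le> (\<Sum>i<n. F (w i) * (\<Sum>k\<in>I. \<bar>p s (w i, k) - p t (w i, k)\<bar>))"
          using inc st T' by (intro sum_mono) auto
        also have "\<dots> = (\<Sum>z\<in>Z. F (w (fst z)) * \<bar>p s (w (fst z), snd z) - p t (w (fst z), snd z)\<bar>)"
          unfolding Z_def by (simp add: sum_distrib_left sum.cartesian_product case_prod_beta)
        finally show ?thesis by (simp add: p_def)
      qed
      have "card T' \<le> ((4 * real (card A + 1) + 2) * (K\<^sup>2 / \<epsilon>\<^sup>2)) ^ (2 * (card A + 1))"
        by (rule packing_bound_polynomial[OF A T'fin, where m="\<lambda>z. m (w (fst z), snd z)" and Z=Z and q="\<lambda>z. F (w (fst z))"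
             and \<phi>="\<lambda>a z. \<phi> a (w (fst z), snd z)" and c=c])
          (use m Z F sumq \<open>\<epsilon>\<^sup>2 \<le> K\<^sup>2\<close> e sepq in auto)
      also have "\<dots> = ((4 * real d + 2) * (K\<^sup>2 / \<epsilon>\<^sup>2)) ^ (2 * d)" by (simp only: d_def)
      also have "\<dots> \<le> (((4 * real d + 2) * (K / \<epsilon>))\<^sup>2) ^ (2 * d)"
      proof (rule power_mono)
        have "(4 * real d + 2) * (K\<^sup>2 / \<epsilon>\<^sup>2) \<le> (4 * real d + 2)\<^sup>2 * (K\<^sup>2 / \<epsilon>\<^sup>2)"
          by (intro mult_right_mono self_le_power) auto
        then show "(4 * real d + 2) * (K\<^sup>2 / \<epsilon>\<^sup>2) \<le> ((4 * real d + 2) * (K / \<epsilon>))\<^sup>2"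
          by (simp only: power_mult_distrib power_divide)
      qed simp
      also have "\<dots> = ((4 * real d + 2) * (K / \<epsilon>)) ^ (4 * d)" by (simp flip: power_mult)
      finally show "card T' \<le> ((4 * real d + 2) * (K / \<epsilon>)) ^ (4 * d)" .
    qed (use T R RK in auto)
    then show ?thesis by (simp add: max_abs_def chain_const_def R_def K_def d_def)
  qed
qed

text \<open>\<open>symmetrization\<close> reduces the expectation to averages over signs for a fixed sample, which are bounded
  by the preceding lemma. Since the right-hand side grows like \<open>sqrt n\<close> with a factor that depends on
  the class only through integrals of \<open>F\<close> and \<open>H\<close>, the bound is uniform in \<open>n\<close>.\<close>

lemma expected_max_abs_class_le:
  fixes f :: "'t \<Rightarrow> 's \<Rightarrow> real" and A :: "'a set" and I :: "'i set"
    and c :: "'t \<Rightarrow> 'a \<Rightarrow> real" and \<phi> :: "'a \<Rightarrow> 's \<times> 'i \<Rightarrow> real" and m :: "'s \<times> 'i \<Rightarrow> real \<Rightarrow> real"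
    and H F :: "'s \<Rightarrow> real" and n :: nat and P :: "'s measure"
  defines "p \<equiv> (\<lambda>t z. m z (\<Sum>a\<in>A. c t a * \<phi> a z))"
  assumes P: "prob_space P" and n: "n > 0" and \<tau>: "\<tau> > 0"
    and T: "finite T" "t0 \<in> T" and A: "finite A" and I: "finite I"
    and f: "\<And>t. t \<in> T \<Longrightarrow> integrable P (f t)"
    and m: "\<And>z. mono (m z)" "\<And>z x. 0 \<le> m z x" "\<And>z x. m z x \<le> 1"
    and F: "\<And>s. 0 \<le> F s" "integrable P F"
    and inc: "\<And>s t t'. t \<in> T \<Longrightarrow> t' \<in> T \<Longrightarrow> (f t s - f t' s)\<^sup>2 \<le> F s * (\<Sum>i\<in>I. \<bar>p t (s, i) - p t' (s, i)\<bar>)"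
    and H: "\<And>s t. t \<in> T \<Longrightarrow> (f t s - f t0 s)\<^sup>2 \<le> H s" "integrable P H"
  shows "(\<integral>\<^sup>+w. ennreal (max_abs T (\<lambda>t. \<Sum>i<n. (f t (w i) - f t0 (w i)) - (integral\<^sup>L P (f t) - integral\<^sup>L P (f t0)))) \<partial>PiM {..<n} (\<lambda>_. P))
    \<le> ennreal (2 * chain_const (card A + 1) * sqrt n *
        (\<tau> * (2 + (card I * integral\<^sup>L P F + integral\<^sup>L P H)) + integral\<^sup>L P H / \<tau> ^ 3))"
proof -
  interpret PR: prob_space P by fact
  interpret product_prob_space "\<lambda>_. P" "{..<n}" by unfold_locales
  define C where "C = chain_const (card A + 1)"
  have C: "C \<ge> 0" by (simp add: C_def chain_const_def)
  have H0: "0 \<le> H s" for s using H(1)[OF T(2), of s] by simp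
  define g where "g = (\<lambda>t s. f t s - f t0 s)"
  have g: "integrable P (g t)" if "t \<in> T" for t unfolding g_def using f that T by auto
  have g_int: "integral\<^sup>L P (g t) = integral\<^sup>L P (f t) - integral\<^sup>L P (f t0)" if "t \<in> T" for t
    unfolding g_def using f that T by auto
  have Tne: "T \<noteq> {}" using T by auto
  define B where "B = (\<lambda>w. \<tau> * (2 + (\<Sum>i<n. card I * F (w i) + H (w i)) / n) + (\<Sum>i<n. H (w i)) / n / \<tau> ^ 3)"
  have comp: "integrable (PiM {..<n} (\<lambda>_. P)) (\<lambda>w. h (w i))" "(\<integral>w. h (w i) \<partial>PiM {..<n} (\<lambda>_. P)) = integral\<^sup>L P h"
    if "integrable P h" "i < n" for h :: "'s \<Rightarrow> real" and i
  proof -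
    have d: "distr (PiM {..<n} (\<lambda>_. P)) P (\<lambda>w. w i) = P" using PiM_component[of i] that by auto
    have i: "(\<lambda>w. w i) \<in> PiM {..<n} (\<lambda>_. P) \<rightarrow>\<^sub>M P" using that by simp
    show "integrable (PiM {..<n} (\<lambda>_. P)) (\<lambda>w. h (w i))"
      using integrable_distr_eq[OF i, of h] that d by auto
    show "(\<integral>w. h (w i) \<partial>PiM {..<n} (\<lambda>_. P)) = integral\<^sup>L P h"
      using integral_distr[OF i, of h] that d by auto
  qed
  have int_B: "integrable (PiM {..<n} (\<lambda>_. P)) B"
    unfolding B_def
    by (intro Bochner_Integration.integrable_add integrable_mult_right integrable_divide Bochner_Integration.integrable_sum
        comp(1)[OF F(2)] comp(1)[OF H(2)]) auto
  have iK: "integrable (PiM {..<n} (\<lambda>_. P)) (\<lambda>w. \<Sum>i<n. card I * F (w i) + H (w i))"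
    and iHs: "integrable (PiM {..<n} (\<lambda>_. P)) (\<lambda>w. \<Sum>i<n. H (w i))"
    by (intro Bochner_Integration.integrable_add integrable_mult_right Bochner_Integration.integrable_sum
        comp(1)[OF F(2)] comp(1)[OF H(2)]; simp)+
  have pr: "measure (PiM {..<n} (\<lambda>_. P)) (space (PiM {..<n} (\<lambda>_. P))) = 1"
    by (intro prob_space.prob_space prob_space_PiM assms(2))
  have EK: "(\<integral>w. (\<Sum>i<n. card I * F (w i) + H (w i)) \<partial>PiM {..<n} (\<lambda>_. P)) = (\<Sum>i<n. card I * integral\<^sup>L P F + integral\<^sup>L P H)"
    using comp(1)[OF F(2)] comp(1)[OF H(2)] comp(2)[OF F(2)] comp(2)[OF H(2)]
    by (subst Bochner_Integration.integral_sum) auto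
  have EHs: "(\<integral>w. (\<Sum>i<n. H (w i)) \<partial>PiM {..<n} (\<lambda>_. P)) = (\<Sum>i<n. integral\<^sup>L P H)"
    using comp(1)[OF H(2)] comp(2)[OF H(2)] by (subst Bochner_Integration.integral_sum) auto
  have "integral\<^sup>L (PiM {..<n} (\<lambda>_. P)) B = \<tau> * (2 + (\<Sum>i<n. card I * integral\<^sup>L P F + integral\<^sup>L P H) / n) + (\<Sum>i<n. integral\<^sup>L P H) / n / \<tau> ^ 3"
    unfolding B_def using iK iHs
    by (subst Bochner_Integration.integral_add, simp, simp)
      (simp only: integral_mult_right_zero integral_divide_zero Bochner_Integration.integral_add integrable_const
        integrable_divide lebesgue_integral_const pr scaleR_one EK EHs)
  also have "\<dots> = \<tau> * (2 + (card I * integral\<^sup>L P F + integral\<^sup>L P H)) + integral\<^sup>L P H / \<tau> ^ 3"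
    using n by simp
  finally have EB: "integral\<^sup>L (PiM {..<n} (\<lambda>_. P)) B = \<tau> * (2 + (card I * integral\<^sup>L P F + integral\<^sup>L P H)) + integral\<^sup>L P H / \<tau> ^ 3" .
  have B0: "0 \<le> B w" for w unfolding B_def using F H0 \<tau> by (intro add_nonneg_nonneg mult_nonneg_nonneg divide_nonneg_nonneg sum_nonneg) auto
  have "(\<integral>\<^sup>+w. ennreal (max_abs T (\<lambda>t. \<Sum>i<n. (f t (w i) - f t0 (w i)) - (integral\<^sup>L P (f t) - integral\<^sup>L P (f t0)))) \<partial>PiM {..<n} (\<lambda>_. P))
    = (\<integral>\<^sup>+w. ennreal (max_abs T (\<lambda>t. 0 + (\<Sum>i<n. g t (w i) - integral\<^sup>L P (g t)))) \<partial>PiM {..<n} (\<lambda>_. P))"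
    unfolding max_abs_def
    by (intro nn_integral_cong arg_cong[where f=ennreal] arg_cong[where f=Max] image_cong refl, simp add: g_int, simp add: g_def)
  also have "\<dots> \<le> (\<integral>\<^sup>+w. ennreal (sign_avg n (\<lambda>e. max_abs T (\<lambda>t. 0 + 2 * (\<Sum>i<n. e i * g t (w i))))) \<partial>PiM {..<n} (\<lambda>_. P))"
    by (rule symmetrization[OF assms(2) T(1) Tne g])
  also have "\<dots> \<le> (\<integral>\<^sup>+w. ennreal (2 * C * sqrt n * B w) \<partial>PiM {..<n} (\<lambda>_. P))"
  proof (intro nn_integral_mono ennreal_leI)
    fix w
    define h k where "h = (\<Sum>i<n. H (w i))" and "k = (\<Sum>i<n. card I * F (w i) + H (w i))"
    have hk: "h \<ge> 0" "k \<ge> 0" unfolding h_def k_def using H0 F by (auto intro!: sum_nonneg add_nonneg_nonneg)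
    have "sign_avg n (\<lambda>e. max_abs T (\<lambda>t. 0 + 2 * (\<Sum>i<n. e i * g t (w i)))) \<le> sign_avg n (\<lambda>e. 2 * max_abs T (\<lambda>t. \<Sum>i<n. e i * g t (w i)))"
    proof (intro sign_avg_mono max_abs_le[OF T(1) Tne])
      fix e t assume "t \<in> T"
      then show "\<bar>0 + 2 * (\<Sum>i<n. e i * g t (w i))\<bar> \<le> 2 * max_abs T (\<lambda>t. \<Sum>i<n. e i * g t (w i))"
        using max_abs_ge[OF T(1), of t "\<lambda>t. \<Sum>i<n. e i * g t (w i)"] by (simp add: abs_mult)
    qed
    also have "\<dots> = 2 * sign_avg n (\<lambda>e. max_abs T (\<lambda>t. \<Sum>i<n. e i * g t (w i)))" by (rule sign_avg_cmult)
    also have "\<dots> \<le> 2 * (C * sqrt (sqrt h * sqrt k))"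
      unfolding C_def h_def k_def g_def
      by (intro mult_left_mono sign_avg_max_abs_class_le[OF T A I m, where c=c and \<phi>=\<phi>]) (use F inc H in \<open>auto simp: p_def\<close>)
    also have "sqrt (sqrt h * sqrt k) = sqrt n * sqrt (sqrt (h / n) * sqrt (k / n))"
    proof -
      have "sqrt n * sqrt (sqrt (h / n) * sqrt (k / n)) = sqrt (n * (sqrt (h / n) * sqrt (k / n)))"
        by (simp add: real_sqrt_mult)
      also have "n * (sqrt (h / n) * sqrt (k / n)) = sqrt h * sqrt k"
        using n by (simp add: real_sqrt_divide)
      finally show ?thesis by simp
    qed
    also have "2 * (C * (sqrt n * sqrt (sqrt (h / n) * sqrt (k / n)))) \<le> 2 * (C * (sqrt n * (\<tau> * (2 + k / n) + h / n / \<tau> ^ 3)))"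
      using C hk \<tau> by (intro mult_left_mono sqrt_sqrt_mult_le) auto
    also have "\<dots> = 2 * C * sqrt n * B w" by (simp add: B_def h_def k_def)
    finally show "sign_avg n (\<lambda>e. max_abs T (\<lambda>t. 0 + 2 * (\<Sum>i<n. e i * g t (w i)))) \<le> 2 * C * sqrt n * B w" .
  qed
  also have "\<dots> = ennreal (\<integral>w. 2 * C * sqrt n * B w \<partial>PiM {..<n} (\<lambda>_. P))"
    using int_B B0 C by (intro nn_integral_eq_integral) auto
  also have "(\<integral>w. 2 * C * sqrt n * B w \<partial>PiM {..<n} (\<lambda>_. P)) = 2 * C * sqrt n * integral\<^sup>L (PiM {..<n} (\<lambda>_. P)) B"
    by simp
  finally show ?thesis unfolding EB C_def .
qed

section \<open>Stochastic equicontinuity of empirical processes\<close>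

lemma markov_bad_event:
  assumes "prob_space M" and X: "X \<in> borel_measurable M" "\<And>\<omega>. 0 \<le> X \<omega>" and c: "c > 0" and b: "b \<ge> 0"
    and E: "(\<integral>\<^sup>+\<omega>. ennreal (X \<omega>) \<partial>M) \<le> ennreal (c * b)"
  shows "measure M {\<omega>\<in>space M. c < X \<omega>} \<le> b"
proof -
  interpret prob_space M by fact
  have "emeasure M {\<omega>\<in>space M. c < X \<omega>} \<le> emeasure M {\<omega>\<in>space M. 1 \<le> ennreal (1 / c) * ennreal (X \<omega>)}"
  proof (rule emeasure_mono)
    show "{\<omega>\<in>space M. c < X \<omega>} \<subseteq> {\<omega>\<in>space M. 1 \<le> ennreal (1 / c) * ennreal (X \<omega>)}"
    proof safe
      fix \<omega> assume "c < X \<omega>"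
      then have "1 \<le> (1 / c) * X \<omega>" using c by (simp add: field_simps)
      then have "ennreal 1 \<le> ennreal ((1 / c) * X \<omega>)" by (rule ennreal_leI)
      then show "1 \<le> ennreal (1 / c) * ennreal (X \<omega>)" using c by (simp add: ennreal_mult[symmetric] X)
    qed
  qed (use X in measurable)
  also have "\<dots> \<le> ennreal (1 / c) * (\<integral>\<^sup>+\<omega>. ennreal (X \<omega>) * indicator (space M) \<omega> \<partial>M)"
    using X by (intro nn_integral_Markov_inequality) auto
  also have "(\<integral>\<^sup>+\<omega>. ennreal (X \<omega>) * indicator (space M) \<omega> \<partial>M) = (\<integral>\<^sup>+\<omega>. ennreal (X \<omega>) \<partial>M)"
    by (rule nn_integral_cong) simp
  also have "ennreal (1 / c) * \<dots> \<le> ennreal (1 / c) * ennreal (c * b)" using E by (intro mult_left_mono) auto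
  also have "\<dots> = ennreal b" using c b by (simp add: ennreal_mult[symmetric])
  finally show ?thesis using b by (simp add: emeasure_eq_measure)
qed

lemma distr_iid_sample:
  assumes M: "prob_space M" and P: "sets P = sets borel" and S: "iid_sample M P S" and n: "n > 0"
  shows "(\<lambda>\<omega>. \<lambda>i\<in>{..<n}. S i \<omega>) \<in> M \<rightarrow>\<^sub>M PiM {..<n} (\<lambda>_. P)"
    and "distr M (PiM {..<n} (\<lambda>_. P)) (\<lambda>\<omega>. \<lambda>i\<in>{..<n}. S i \<omega>) = PiM {..<n} (\<lambda>_. P)"
proof -
  interpret prob_space M by fact
  have ind: "indep_vars (\<lambda>_. borel) S UNIV" and d: "\<And>i. distr M borel (S i) = P"
    using S by (auto simp: iid_sample_def)
  have rv: "random_variable borel (S i)" for i using ind by (auto simp: indep_vars_def2)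
  show "(\<lambda>\<omega>. \<lambda>i\<in>{..<n}. S i \<omega>) \<in> M \<rightarrow>\<^sub>M PiM {..<n} (\<lambda>_. P)"
    using rv P by (intro measurable_restrict) (simp cong: measurable_cong_sets)
  have sets_eq: "sets (PiM {..<n} (\<lambda>_. P)) = sets (PiM {..<n} (\<lambda>_. borel))"
    using P by (intro sets_PiM_cong) auto
  show "distr M (PiM {..<n} (\<lambda>_. P)) (\<lambda>\<omega>. \<lambda>i\<in>{..<n}. S i \<omega>) = PiM {..<n} (\<lambda>_. P)"
  proof -
    have "indep_vars (\<lambda>_. borel) S {..<n}" using ind by (rule indep_vars_subset) auto
    then have "distr M (PiM {..<n} (\<lambda>_. borel)) (\<lambda>\<omega>. \<lambda>i\<in>{..<n}. S i \<omega>) = PiM {..<n} (\<lambda>_. P)"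
      using n rv d by (subst (asm) indep_vars_iff_distr_eq_PiM') (auto simp: lessThan_empty_iff)
    then show ?thesis using sets_eq by (simp cong: distr_cong)
  qed
qed

text \<open>By continuity in the parameter the squared increments \<open>H j\<close>, maximized over a ball of radius \<open>r j\<close>,
  tend to zero pointwise, and by dominated convergence in mean. The maximal inequality and Markov's
  inequality then bound, for a suitable \<open>j\<close>, the probability that the process exceeds
  \<open>\<epsilon> * sqrt n\<close> on a finite subset of the ball. A countable dense subset is exhausted by finite ones,
  and continuity extends the bound to the whole ball. The exceptional event is a countable union and
  therefore measurable, although it serves uncountably many parameters at once; this permits
  estimates to be inserted for the parameter.\<close>

lemma equicontinuity_of_empirical_process:
  fixes f :: "'e::{metric_space, second_countable_topology} \<Rightarrow> 's::topological_space \<Rightarrow> real" and A :: "'a set" and I :: "'i set"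
    and c :: "'e \<Rightarrow> 'a \<Rightarrow> real" and \<phi> :: "'a \<Rightarrow> 's \<times> 'i \<Rightarrow> real" and m :: "'s \<times> 'i \<Rightarrow> real \<Rightarrow> real"
    and F G :: "'s \<Rightarrow> real" and P :: "'s measure" and M :: "'w measure" and S :: "nat \<Rightarrow> 'w \<Rightarrow> 's"
  defines "p \<equiv> (\<lambda>t z. m z (\<Sum>a\<in>A. c t a * \<phi> a z))"
  assumes M: "prob_space M" and P: "prob_space P" "sets P = sets borel" and S: "iid_sample M P S"
    and t0: "t0 \<in> T" and A: "finite A" and I: "finite I"
    and fm: "\<And>t. t \<in> T \<Longrightarrow> f t \<in> borel_measurable borel"
    and cont: "\<And>s. continuous_on T (\<lambda>t. f t s)"
    and G: "\<And>t s. t \<in> T \<Longrightarrow> \<bar>f t s\<bar> \<le> G s" "integrable P G" "integrable P (\<lambda>s. (G s)\<^sup>2)"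
    and m: "\<And>z. mono (m z)" "\<And>z x. 0 \<le> m z x" "\<And>z x. m z x \<le> 1"
    and F: "\<And>s. 0 \<le> F s" "integrable P F"
    and inc: "\<And>s t t'. t \<in> T \<Longrightarrow> t' \<in> T \<Longrightarrow> (f t s - f t' s)\<^sup>2 \<le> F s * (\<Sum>i\<in>I. \<bar>p t (s, i) - p t' (s, i)\<bar>)"
    and e: "\<epsilon> > 0" and k: "\<kappa> > 0"
  shows "\<exists>\<delta>>0. \<forall>n>0. \<exists>B\<in>sets M. measure M B \<le> \<kappa> \<and> (\<forall>\<omega>\<in>space M - B. \<forall>t\<in>T. dist t t0 < \<delta> \<longrightarrow>
    \<bar>\<Sum>i<n. (f t (S i \<omega>) - f t0 (S i \<omega>)) - (integral\<^sup>L P (f t) - integral\<^sup>L P (f t0))\<bar> \<le> \<epsilon> * sqrt n)"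
proof -
  interpret M: prob_space M by fact
  interpret PR: prob_space P by fact
  have fP: "f t \<in> borel_measurable P" if "t \<in> T" for t
    using fm[OF that] P(2) by (simp cong: measurable_cong_sets)
  have fint: "integrable P (f t)" if "t \<in> T" for t
    by (rule Bochner_Integration.integrable_bound[OF G(2) fP[OF that]])
      (use G(1)[OF that] in \<open>auto intro!: AE_I2 intro: order_trans[OF _ abs_ge_self]\<close>)
  have Gm: "G \<in> borel_measurable P" using G(2) by auto
  have Sm: "S i \<in> borel_measurable M" for i using S by (auto simp: iid_sample_def M.indep_vars_def2)
  have mean_cont: "continuous_on T (\<lambda>t. integral\<^sup>L P (f t))"
    unfolding continuous_on_sequentially comp_def
  proof (intro allI ballI impI)
    fix x a assume a: "a \<in> T" and x: "(\<forall>n. x n \<in> T) \<and> x \<longlonglongrightarrow> a"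
    show "(\<lambda>n. integral\<^sup>L P (f (x n))) \<longlonglongrightarrow> integral\<^sup>L P (f a)"
    proof (rule integral_dominated_convergence[OF fP[OF a] fP G(2)])
      show "AE s in P. (\<lambda>n. f (x n) s) \<longlonglongrightarrow> f a s"
        using cont a x unfolding continuous_on_sequentially comp_def by auto
    qed (use x G in auto)
  qed
  define r where "r = (\<lambda>j::nat. 1 / real (Suc j))"
  have r: "r j > 0" for j by (simp add: r_def)
  have "\<exists>D. countable D \<and> D \<subseteq> T \<inter> ball t0 (r j) \<and> T \<inter> ball t0 (r j) \<subseteq> closure D" for j
    using separable[of "T \<inter> ball t0 (r j)"] by metis
  then obtain D0 where D0: "\<And>j. countable (D0 j)" "\<And>j. D0 j \<subseteq> T \<inter> ball t0 (r j)" "\<And>j. T \<inter> ball t0 (r j) \<subseteq> closure (D0 j)"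
    by metis
  define D where "D = (\<lambda>j. insert t0 (D0 j))"
  have D: "countable (D j)" "t0 \<in> D j" "D j \<subseteq> T" "\<And>t. t \<in> D j \<Longrightarrow> dist t t0 < r j" "T \<inter> ball t0 (r j) \<subseteq> closure (D j)" for j
  proof -
    show "countable (D j)" "t0 \<in> D j" using D0(1) by (auto simp: D_def)
    show "D j \<subseteq> T" "\<And>t. t \<in> D j \<Longrightarrow> dist t t0 < r j" using D0(2)[of j] t0 r by (auto simp: D_def dist_commute)
    show "T \<inter> ball t0 (r j) \<subseteq> closure (D j)"
      using D0(3)[of j] closure_mono[of "D0 j" "D j"] by (auto simp: D_def)
  qed
  have DT: "t \<in> T" if "t \<in> D j" for t j using D(3) that by blast
  have Dne: "D j \<noteq> {}" for j using D(2) by blast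
  define H where "H = (\<lambda>j s. SUP t\<in>D j. (f t s - f t0 s)\<^sup>2)"
  have sq: "(f t s - f t0 s)\<^sup>2 \<le> 4 * (G s)\<^sup>2" if "t \<in> T" for t s
  proof -
    have "\<bar>f t s - f t0 s\<bar> \<le> 2 * G s" using G(1)[OF that, of s] G(1)[OF t0, of s] by linarith
    then have "\<bar>f t s - f t0 s\<bar>\<^sup>2 \<le> (2 * G s)\<^sup>2" by (intro power_mono) auto
    then show ?thesis by (simp add: power_mult_distrib)
  qed
  have bdd: "bdd_above ((\<lambda>t. (f t s - f t0 s)\<^sup>2) ` D j)" for s j
    by (rule bdd_aboveI[of _ "4 * (G s)\<^sup>2"]) (use sq DT in auto)
  have Hge: "(f t s - f t0 s)\<^sup>2 \<le> H j s" if "t \<in> D j" for t s j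
    unfolding H_def by (rule cSUP_upper[OF that bdd])
  have Hle: "H j s \<le> 4 * (G s)\<^sup>2" for j s
    unfolding H_def by (rule cSUP_least[OF Dne]) (use sq DT in auto)
  have H0: "0 \<le> H j s" for j s using Hge[OF D(2), of s j] by simp
  have Hm: "H j \<in> borel_measurable P" for j
    unfolding H_def by (intro borel_measurable_cSUP bdd D(1) borel_measurable_power borel_measurable_diff fP DT t0)
  have Hint: "integrable P (H j)" for j
    by (rule Bochner_Integration.integrable_bound[of P "\<lambda>s. 4 * (G s)\<^sup>2"]) (use G Hm Hle H0 in auto)
  have "(\<lambda>j. integral\<^sup>L P (H j)) \<longlonglongrightarrow> integral\<^sup>L P (\<lambda>_. 0)"
  proof (rule integral_dominated_convergence[of "\<lambda>_. 0" P H "\<lambda>s. 4 * (G s)\<^sup>2"])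
    show "AE s in P. (\<lambda>j. H j s) \<longlonglongrightarrow> 0"
    proof (rule AE_I2, rule LIMSEQ_I)
      fix s and \<epsilon>' :: real assume e': "0 < \<epsilon>'"
      obtain d where d: "d > 0" "\<And>t. t \<in> T \<Longrightarrow> dist t t0 < d \<Longrightarrow> dist (f t s) (f t0 s) < sqrt (\<epsilon>' / 2)"
      proof -
        have "0 < sqrt (\<epsilon>' / 2)" using e' by simp
        then have "\<exists>d>0. \<forall>t\<in>T. dist t t0 < d \<longrightarrow> dist (f t s) (f t0 s) < sqrt (\<epsilon>' / 2)"
          using cont[of s] t0 unfolding continuous_on_iff by blast
        then show ?thesis using that by blast
      qed
      obtain N where N: "r N < d" unfolding r_def using reals_Archimedean[OF d(1)] by (auto simp: inverse_eq_divide)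
      have "norm (H j s - 0) < \<epsilon>'" if "j \<ge> N" for j
      proof -
        have "r j \<le> r N" using that by (simp add: r_def frac_le)
        have "H j s \<le> \<epsilon>' / 2" unfolding H_def
        proof (rule cSUP_least[OF Dne])
          fix t assume t: "t \<in> D j"
          have "\<bar>f t s - f t0 s\<bar> < sqrt (\<epsilon>' / 2)"
            using d(2)[of t] DT[OF t] D(4)[OF t] \<open>r j \<le> r N\<close> N by (simp add: dist_real_def)
          then have "\<bar>f t s - f t0 s\<bar>\<^sup>2 \<le> (sqrt (\<epsilon>' / 2))\<^sup>2" by (intro power_mono) auto
          then show "(f t s - f t0 s)\<^sup>2 \<le> \<epsilon>' / 2" using e' by simp
        qed
        then show ?thesis using H0[of j s] e' by simp
      qed
      then show "\<exists>N. \<forall>j\<ge>N. norm (H j s - 0) < \<epsilon>'" by blast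
    qed
  qed (use Hm G Hle H0 in auto)
  then have EH: "(\<lambda>j. integral\<^sup>L P (H j)) \<longlonglongrightarrow> 0" by simp
  define C where "C = 2 * chain_const (card A + 1)"
  have C: "C > 0" by (simp add: C_def chain_const_def add_pos_nonneg)
  define K where "K = card I * integral\<^sup>L P F + 4 * integral\<^sup>L P (\<lambda>s. (G s)\<^sup>2)"
  have K: "K \<ge> 0" using F by (auto simp: K_def intro!: add_nonneg_nonneg mult_nonneg_nonneg integral_nonneg_AE)
  \<comment> \<open>Each of the two terms of the maximal inequality is made at most \<open>\<epsilon> \<kappa> / (2 C)\<close>: the first by the choice of \<open>\<tau>\<close>, the second by the choice of \<open>j\<close>.\<close>
  define \<tau> where "\<tau> = \<epsilon> * \<kappa> / (2 * C * (2 + K))"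
  have \<tau>: "\<tau> > 0" using e k C K by (simp add: \<tau>_def)
  have "0 < \<epsilon> * \<kappa> * \<tau> ^ 3 / (2 * C)" using e k C \<tau> by simp
  then obtain j where j: "integral\<^sup>L P (H j) < \<epsilon> * \<kappa> * \<tau> ^ 3 / (2 * C)"
    using order_tendstoD(2)[OF EH] unfolding eventually_sequentially by blast
  define Z where "Z = (\<lambda>n t \<omega>. \<Sum>i<n. (f t (S i \<omega>) - f t0 (S i \<omega>)) - (integral\<^sup>L P (f t) - integral\<^sup>L P (f t0)))"
  have Zm: "Z n t \<in> borel_measurable M" if "t \<in> T" for n t
    unfolding Z_def using measurable_compose[OF Sm fm[OF that]] measurable_compose[OF Sm fm[OF t0]] by measurable
  have fin: "measure M {\<omega>\<in>space M. \<epsilon> * sqrt n < max_abs T' (\<lambda>t. Z n t \<omega>)} \<le> \<kappa>"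
    if T': "finite T'" "t0 \<in> T'" "T' \<subseteq> D j" and n: "n > 0" for T' n
  proof (rule markov_bad_event[OF M])
    have T'T: "t \<in> T' \<Longrightarrow> t \<in> T" for t using T'(3) DT by blast
    show "(\<lambda>\<omega>. max_abs T' (\<lambda>t. Z n t \<omega>)) \<in> borel_measurable M"
      by (intro max_abs_measurable T'(1) Zm T'T)
    show "0 \<le> max_abs T' (\<lambda>t. Z n t \<omega>)" for \<omega> using T' by (intro max_abs_nonneg) auto
    let ?X = "\<lambda>w. max_abs T' (\<lambda>t. \<Sum>i<n. (f t (w i) - f t0 (w i)) - (integral\<^sup>L P (f t) - integral\<^sup>L P (f t0)))"
    have Xm: "?X \<in> borel_measurable (PiM {..<n} (\<lambda>_. P))"
    proof (rule max_abs_measurable[OF T'(1)])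
      fix t assume "t \<in> T'"
      then have [measurable]: "f t \<in> borel_measurable P" "f t0 \<in> borel_measurable P" using fP T'T t0 by auto
      show "(\<lambda>w. \<Sum>i<n. (f t (w i) - f t0 (w i)) - (integral\<^sup>L P (f t) - integral\<^sup>L P (f t0))) \<in> borel_measurable (PiM {..<n} (\<lambda>_. P))"
        by measurable
    qed
    have "(\<integral>\<^sup>+\<omega>. ennreal (max_abs T' (\<lambda>t. Z n t \<omega>)) \<partial>M) = (\<integral>\<^sup>+\<omega>. ennreal (?X (\<lambda>i\<in>{..<n}. S i \<omega>)) \<partial>M)"
      unfolding Z_def by (intro nn_integral_cong arg_cong[where f=ennreal] arg_cong2[where f=max_abs] refl ext sum.cong) auto
    also have "\<dots> = (\<integral>\<^sup>+w. ennreal (?X w) \<partial>distr M (PiM {..<n} (\<lambda>_. P)) (\<lambda>\<omega>. \<lambda>i\<in>{..<n}. S i \<omega>))"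
      using Xm by (intro nn_integral_distr[symmetric] distr_iid_sample[OF M P(2) S n]) auto
    also have "\<dots> = (\<integral>\<^sup>+w. ennreal (?X w) \<partial>PiM {..<n} (\<lambda>_. P))"
      by (simp only: distr_iid_sample(2)[OF M P(2) S n])
    also have "\<dots> \<le> ennreal (2 * chain_const (card A + 1) * sqrt n *
        (\<tau> * (2 + (card I * integral\<^sup>L P F + integral\<^sup>L P (H j))) + integral\<^sup>L P (H j) / \<tau> ^ 3))"
      by (rule expected_max_abs_class_le[OF P(1) n \<tau> T'(1,2) A I, where m=m and c=c and \<phi>=\<phi>])
        (use fint T'T m F inc Hge T'(3) Hint in \<open>auto simp: p_def\<close>)
    also have "\<dots> \<le> ennreal (\<epsilon> * sqrt n * \<kappa>)"
    proof (rule ennreal_leI)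
      have "integral\<^sup>L P (H j) \<le> integral\<^sup>L P (\<lambda>s. 4 * (G s)\<^sup>2)"
        using Hint G Hle by (intro integral_mono) auto
      then have "\<tau> * (2 + (card I * integral\<^sup>L P F + integral\<^sup>L P (H j))) \<le> \<tau> * (2 + K)"
        using \<tau> by (intro mult_left_mono) (auto simp: K_def)
      also have "\<dots> = \<epsilon> * \<kappa> / (2 * C)" using C K by (simp add: \<tau>_def)
      finally have 1: "\<tau> * (2 + (card I * integral\<^sup>L P F + integral\<^sup>L P (H j))) \<le> \<epsilon> * \<kappa> / (2 * C)" .
      have 2: "integral\<^sup>L P (H j) / \<tau> ^ 3 \<le> \<epsilon> * \<kappa> / (2 * C)"
        using j \<tau> by (simp add: field_simps)
      have "C * sqrt n * (\<tau> * (2 + (card I * integral\<^sup>L P F + integral\<^sup>L P (H j))) + integral\<^sup>L P (H j) / \<tau> ^ 3)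
        \<le> C * sqrt n * (\<epsilon> * \<kappa> / (2 * C) + \<epsilon> * \<kappa> / (2 * C))"
        using 1 2 C by (intro mult_left_mono add_mono) auto
      also have "\<dots> = \<epsilon> * sqrt n * \<kappa>" using C by (simp add: field_simps)
      finally show "2 * chain_const (card A + 1) * sqrt n * (\<tau> * (2 + (card I * integral\<^sup>L P F + integral\<^sup>L P (H j))) + integral\<^sup>L P (H j) / \<tau> ^ 3) \<le> \<epsilon> * sqrt n * \<kappa>"
        by (simp add: C_def)
    qed
    finally show "(\<integral>\<^sup>+\<omega>. ennreal (max_abs T' (\<lambda>t. Z n t \<omega>)) \<partial>M) \<le> ennreal (\<epsilon> * sqrt n * \<kappa>)" .
  qed (use e k n in auto)
  show ?thesis
  proof (intro exI[of _ "r j"] conjI allI impI r)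
    fix n :: nat assume n: "n > 0"
    define E where "E = (\<lambda>t. {\<omega>\<in>space M. \<epsilon> * sqrt n < \<bar>Z n t \<omega>\<bar>})"
    have E: "E t \<in> sets M" if "t \<in> T" for t unfolding E_def using Zm[OF that] by measurable
    define B where "B = (\<Union>t\<in>D j. E t)"
    have B: "B \<in> sets M" unfolding B_def using E DT by (intro sets.countable_UN'[OF D(1)]) auto
    define T' where "T' = (\<lambda>l::nat. insert t0 (from_nat_into (D j) ` {..l}))"
    have T': "finite (T' l)" "t0 \<in> T' l" "T' l \<subseteq> D j" for l
      using D(2) from_nat_into[of "D j"] by (auto simp: T'_def)
    define Bl where "Bl = (\<lambda>l. \<Union>t\<in>T' l. E t)"
    have Bl: "range Bl \<subseteq> sets M" "incseq Bl"
    proof -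
      have "Bl l \<in> sets M" for l unfolding Bl_def using T'[of l] DT E by (intro sets.finite_UN) auto
      then show "range Bl \<subseteq> sets M" by auto
      show "incseq Bl" unfolding Bl_def T'_def by (rule incseq_SucI) force
    qed
    have "(\<Union>l. Bl l) = B"
    proof
      show "(\<Union>l. Bl l) \<subseteq> B" unfolding Bl_def B_def using T'(3) by blast
      show "B \<subseteq> (\<Union>l. Bl l)"
      proof
        fix \<omega> assume "\<omega> \<in> B"
        then obtain t where t: "t \<in> D j" "\<omega> \<in> E t" by (auto simp: B_def)
        obtain l where "from_nat_into (D j) l = t" using from_nat_into_surj[OF D(1) t(1)] by auto
        then have "t \<in> T' l" by (auto simp: T'_def)
        then show "\<omega> \<in> (\<Union>l. Bl l)" using t by (auto simp: Bl_def)
      qed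
    qed
    then have "(\<lambda>l. measure M (Bl l)) \<longlonglongrightarrow> measure M B" using M.finite_Lim_measure_incseq[OF Bl] by simp
    moreover have "measure M (Bl l) \<le> \<kappa>" for l
    proof -
      have "Bl l = {\<omega>\<in>space M. \<epsilon> * sqrt n < max_abs (T' l) (\<lambda>t. Z n t \<omega>)}"
      proof -
        have "T' l \<noteq> {}" using T'(2) by blast
        then show ?thesis unfolding Bl_def E_def max_abs_def using T'(1)[of l] by (auto simp: Max_gr_iff)
      qed
      then show ?thesis using fin[OF T' n] by simp
    qed
    ultimately have BK: "measure M B \<le> \<kappa>" by (intro LIMSEQ_le_const2) auto
    have "\<bar>Z n t \<omega>\<bar> \<le> \<epsilon> * sqrt n" if \<omega>: "\<omega> \<in> space M - B" and t: "t \<in> T" "dist t t0 < r j" for \<omega> t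
    proof -
      have "t \<in> closure (D j)" using D(5)[of j] t by (auto simp: dist_commute)
      then obtain x where x: "\<And>l. x l \<in> D j" "x \<longlonglongrightarrow> t" unfolding closure_sequential by blast
      have xT: "x l \<in> T" for l using x(1) DT by blast
      have lim: "(\<lambda>l. f (x l) s) \<longlonglongrightarrow> f t s" "(\<lambda>l. integral\<^sup>L P (f (x l))) \<longlonglongrightarrow> integral\<^sup>L P (f t)" for s
        using cont[of s] mean_cont xT x(2) t(1) unfolding continuous_on_sequentially comp_def by blast+
      have "(\<lambda>l. \<bar>Z n (x l) \<omega>\<bar>) \<longlonglongrightarrow> \<bar>Z n t \<omega>\<bar>" unfolding Z_def by (intro tendsto_intros lim)
      moreover have "\<bar>Z n (x l) \<omega>\<bar> \<le> \<epsilon> * sqrt n" for l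
        using \<omega> x(1)[of l] by (auto simp: B_def E_def not_less)
      ultimately show ?thesis by (intro LIMSEQ_le_const2) auto
    qed
    then show "\<exists>B\<in>sets M. measure M B \<le> \<kappa> \<and> (\<forall>\<omega>\<in>space M - B. \<forall>t\<in>T. dist t t0 < r j \<longrightarrow>
      \<bar>\<Sum>i<n. (f t (S i \<omega>) - f t0 (S i \<omega>)) - (integral\<^sup>L P (f t) - integral\<^sup>L P (f t0))\<bar> \<le> \<epsilon> * sqrt n)"
      using B BK unfolding Z_def by blast
  qed
qed

section \<open>Positive definite matrices and symmetry of second derivatives\<close>

lemma matrix_inv_cancel:
  fixes A :: "real^'n^'n"
  assumes "invertible A"
  shows "A ** matrix_inv A = mat 1" "matrix_inv A ** A = mat 1"
proof -
  have "A ** matrix_inv A = mat 1 \<and> matrix_inv A ** A = mat 1"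
    unfolding matrix_inv_def using assms[unfolded invertible_def] by (rule someI_ex)
  then show "A ** matrix_inv A = mat 1" "matrix_inv A ** A = mat 1" by auto
qed

lemma matrix_inv_vector_cancel:
  fixes A :: "real^'n^'n"
  assumes "invertible A"
  shows "A *v (matrix_inv A *v x) = x" "matrix_inv A *v (A *v x) = x"
  by (simp_all add: matrix_vector_mul_assoc matrix_inv_cancel[OF assms])

lemma inner_matrix_symmetric:
  fixes C :: "real^'n^'n"
  assumes "transpose C = C"
  shows "x \<bullet> (C *v y) = y \<bullet> (C *v x)"
proof -
  have "x \<bullet> (C *v y) = (x v* C) \<bullet> y" by (simp add: dot_lmul_matrix)
  also have "x v* C = C *v x" using assms by (metis transpose_matrix_vector)
  finally show ?thesis by (simp add: inner_commute)
qed

lemma PDS_invertible: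
  fixes A :: "real^'n^'n" assumes "A \<in> PDS" shows "invertible A"
proof -
  have "x = 0" if "A *v x = 0" for x
  proof (rule ccontr)
    assume "x \<noteq> 0"
    then have "0 < x \<bullet> (A *v x)" using assms by (auto simp: PDS_def)
    then show False using that by simp
  qed
  then show ?thesis
    unfolding invertible_left_inverse matrix_left_invertible_ker by blast
qed

lemma symmetric_matrix_inv:
  fixes A :: "real^'n^'n" assumes A: "invertible A" and s: "transpose A = A"
  shows "transpose (matrix_inv A) = matrix_inv A"
proof -
  have "transpose (matrix_inv A) ** A = mat 1"
    using matrix_inv_cancel(1)[OF A] s by (metis matrix_transpose_mul transpose_mat)
  then have "transpose (matrix_inv A) ** (A ** matrix_inv A) = matrix_inv A"
    by (simp add: matrix_mul_assoc)
  then show ?thesis by (simp add: matrix_inv_cancel(1)[OF A])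
qed

lemma PDS_matrix_inv:
  fixes A :: "real^'n^'n" assumes A: "A \<in> PDS" shows "matrix_inv A \<in> PDS"
proof -
  note inv = PDS_invertible[OF A]
  have s: "transpose A = A" using A by (auto simp: PDS_def)
  have "0 < x \<bullet> (matrix_inv A *v x)" if "x \<noteq> 0" for x
  proof -
    define y where "y = matrix_inv A *v x"
    have x: "A *v y = x" unfolding y_def by (rule matrix_inv_vector_cancel(1)[OF inv])
    then have "y \<noteq> 0" using that by auto
    then have "0 < y \<bullet> (A *v y)" using A by (auto simp: PDS_def)
    then have "0 < y \<bullet> x" by (simp only: x)
    then show ?thesis by (simp add: y_def inner_commute)
  qed
  then show ?thesis using symmetric_matrix_inv[OF inv s] by (auto simp: PDS_def)
qed

lemma psd_cauchy_schwarz: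
  fixes C :: "real^'n^'n"
  assumes s: "transpose C = C" and psd: "\<And>x. 0 \<le> x \<bullet> (C *v x)" and y: "0 < y \<bullet> (C *v y)"
  shows "(x \<bullet> (C *v y))\<^sup>2 \<le> (x \<bullet> (C *v x)) * (y \<bullet> (C *v y))"
proof -
  define a b c where "a = x \<bullet> (C *v x)" and "b = x \<bullet> (C *v y)" and "c = y \<bullet> (C *v y)"
  have b': "y \<bullet> (C *v x) = b" unfolding b_def by (rule inner_matrix_symmetric[OF s])
  define z where "z = x + (- b / c) *\<^sub>R y"
  have "C *v z = C *v x + (- b / c) *\<^sub>R (C *v y)"
    unfolding z_def by (simp add: matrix_vector_right_distrib matrix_vector_mult_scaleR matrix_vector_mult_diff_distrib)
  then have "z \<bullet> (C *v z) = a + 2 * (- b / c) * b + (- b / c)\<^sup>2 * c"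
    unfolding z_def by (simp add: inner_add_left inner_add_right b' a_def[symmetric] b_def[symmetric] c_def[symmetric] inner_diff_left inner_diff_right power2_eq_square)
  also have "\<dots> = a - b\<^sup>2 / c" using y by (simp add: c_def power2_eq_square field_simps)
  finally have "0 \<le> a - b\<^sup>2 / c" using psd[of z] by simp
  then have "b\<^sup>2 / c \<le> a" by simp
  then show ?thesis using y by (simp add: a_def b_def c_def divide_le_eq)
qed

text \<open>The Cauchy-Schwarz inequality of the form \<open>C\<close>, applied to \<open>C *v x\<close> and \<open>x\<close>.\<close>

lemma norm_PDS_mult_le:
  fixes C :: "real^'n^'n"
  assumes C: "C \<in> PDS" and N: "\<And>x. norm (C *v x) \<le> N * norm x"
  shows "(norm (C *v x))\<^sup>2 \<le> N * (x \<bullet> (C *v x))"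
proof (cases "x = 0")
  case False
  have s: "transpose C = C" and pd: "\<And>x. x \<noteq> 0 \<Longrightarrow> 0 < x \<bullet> (C *v x)" using C by (auto simp: PDS_def)
  have psd: "0 \<le> x \<bullet> (C *v x)" for x using pd[of x] by (cases "x = 0") auto
  define y where "y = C *v x"
  have "((norm y)\<^sup>2)\<^sup>2 = (y \<bullet> (C *v x))\<^sup>2" by (simp add: y_def power2_norm_eq_inner)
  also have "\<dots> \<le> (y \<bullet> (C *v y)) * (x \<bullet> (C *v x))"
    by (rule psd_cauchy_schwarz[OF s psd pd[OF False]])
  also have "\<dots> \<le> (norm y * (N * norm y)) * (x \<bullet> (C *v x))"
  proof (rule mult_right_mono[OF _ psd])
    have "y \<bullet> (C *v y) \<le> norm y * norm (C *v y)" by (rule norm_cauchy_schwarz)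
    also have "\<dots> \<le> norm y * (N * norm y)" using N by (intro mult_left_mono) auto
    finally show "y \<bullet> (C *v y) \<le> norm y * (N * norm y)" .
  qed
  finally have "(norm y)\<^sup>2 * (norm y)\<^sup>2 \<le> (norm y)\<^sup>2 * (N * (x \<bullet> (C *v x)))"
    by (simp add: power2_eq_square mult_ac)
  moreover have "y \<noteq> 0" using pd[OF False] by (auto simp: y_def)
  ultimately have "(norm y)\<^sup>2 \<le> N * (x \<bullet> (C *v x))" by (subst (asm) mult_le_cancel_left_pos) auto
  then show ?thesis by (simp add: y_def)
qed simp

text \<open>By Cramer's rule the entries of the inverse are rational functions of the entries.\<close>

lemma continuous_on_matrix_inv:
  fixes V :: "'a::topological_space \<Rightarrow> real^'n^'n"
  assumes V: "continuous_on S V" and inv: "\<And>x. x \<in> S \<Longrightarrow> invertible (V x)"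
  shows "continuous_on S (\<lambda>x. matrix_inv (V x))"
proof -
  have ent: "continuous_on S (\<lambda>x. V x $ i $ j)" for i j using V by (intro continuous_intros)
  have entry: "matrix_inv A $ k $ j = det (\<chi> i l. if l = k then (axis j 1 :: real^'n) $ i else A $ i $ l) / det A"
    if "invertible A" for A :: "real^'n^'n" and k j
  proof -
    have "A *v (matrix_inv A *v axis j 1) = axis j 1" by (rule matrix_inv_vector_cancel(1)[OF that])
    then have "matrix_inv A *v axis j 1 = (\<chi> k. det (\<chi> i l. if l = k then (axis j 1 :: real^'n) $ i else A $ i $ l) / det A)"
      using that by (subst (asm) cramer) (auto simp: invertible_det_nz)
    moreover have "(matrix_inv A *v axis j 1) $ k = matrix_inv A $ k $ j"
      by (simp add: matrix_vector_mult_basis column_def)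
    ultimately show ?thesis by simp
  qed
  have num: "continuous_on S (\<lambda>x. det (\<chi> i l. if l = k then (axis j 1 :: real^'n) $ i else V x $ i $ l))" for k j
  proof -
    have c: "continuous_on S (\<lambda>x. (\<chi> i l. if l = k then (axis j 1 :: real^'n) $ i else V x $ i $ l) $ a $ b)" for a b
      using ent by (cases "b = k") auto
    show ?thesis unfolding det_def by (intro continuous_intros c)
  qed
  have den: "continuous_on S (\<lambda>x. det (V x))" unfolding det_def by (intro continuous_intros ent)
  have "continuous_on S (\<lambda>x. \<chi> k j. det (\<chi> i l. if l = k then (axis j 1 :: real^'n) $ i else V x $ i $ l) / det (V x))"
    using inv by (intro continuous_on_vec_lambda continuous_on_divide num den) (auto simp: invertible_det_nz)
  then show ?thesis
    by (rule continuous_on_eq) (use entry inv in \<open>auto simp: vec_eq_iff\<close>)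
qed

text \<open>Cholesky decomposition: subtract the rank-one matrix of a scaled column \<open>w\<close> with positive diagonal
  entry. The remainder is positive semidefinite by the Cauchy-Schwarz inequality and has fewer nonzero
  diagonal entries. That \<open>v i = 0\<close> for vanishing diagonal entries leaves the index \<open>i\<close> free for \<open>w\<close>.\<close>

lemma psd_sum_of_rank_ones:
  fixes C :: "real^'n^'n"
  assumes "transpose C = C" "\<And>x. 0 \<le> x \<bullet> (C *v x)"
  shows "\<exists>v :: 'n \<Rightarrow> real^'n. (\<forall>i. C $ i $ i = 0 \<longrightarrow> v i = 0) \<and> (\<forall>a b. C $ a $ b = (\<Sum>i\<in>UNIV. v i $ a * v i $ b))"
  using assms
proof (induction "card {i. C $ i $ i \<noteq> 0}" arbitrary: C rule: less_induct)
  case less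
  have B: "axis a 1 \<bullet> (C *v axis b 1) = C $ a $ b" for a b
    by (simp add: matrix_vector_mult_basis column_def inner_axis')
  have sym: "C $ a $ b = C $ b $ a" for a b using less.prems(1) by (metis transpose_def vec_lambda_beta)
  have diag: "0 \<le> C $ a $ a" for a using less.prems(2)[of "axis a 1"] by (simp add: B)
  have zero: "C $ a $ b = 0" if a: "C $ a $ a = 0" for a b
  proof (rule ccontr)
    assume nz: "C $ a $ b \<noteq> 0"
    \<comment> \<open>A direction in which the form would be negative if this entry in a row with zero diagonal were not zero; the summand \<open>1\<close> keeps the denominator positive.\<close>
    define t where "t = - C $ a $ b / (C $ b $ b + 1)"
    have "C *v (axis a 1 + t *\<^sub>R axis b 1) = C *v axis a 1 + t *\<^sub>R (C *v axis b 1)"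
      by (simp add: matrix_vector_right_distrib matrix_vector_mult_scaleR)
    then have "0 \<le> 2 * t * C $ a $ b + t\<^sup>2 * C $ b $ b"
      using less.prems(2)[of "axis a 1 + t *\<^sub>R axis b 1"]
      by (simp add: inner_add_left inner_add_right B a sym[of b a] power2_eq_square algebra_simps)
    also have "\<dots> = - (C $ a $ b)\<^sup>2 * (C $ b $ b + 2) / (C $ b $ b + 1)\<^sup>2"
      using diag[of b] unfolding t_def by (simp add: divide_simps) (simp add: power2_eq_square algebra_simps)
    also have "\<dots> < 0" using nz diag[of b] by (simp add: divide_less_0_iff zero_less_mult_iff)
    finally show False by simp
  qed
  show ?case
  proof (cases "\<exists>i. C $ i $ i \<noteq> 0")
    case False
    then show ?thesis using zero by (intro exI[of _ "\<lambda>_. 0"]) auto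
  next
    case True
    then obtain i where "C $ i $ i \<noteq> 0" by blast
    then have i: "C $ i $ i > 0" using diag[of i] by simp
    define w :: "real^'n" where "w = (\<chi> a. C $ a $ i / sqrt (C $ i $ i))"
    define C' where "C' = (\<chi> a b. C $ a $ b - w $ a * w $ b)"
    have C'v: "C' *v x = C *v x - (w \<bullet> x) *\<^sub>R w" for x
      by (simp add: vec_eq_iff C'_def matrix_vector_mult_def inner_vec_def left_diff_distrib right_diff_distrib sum_subtractf sum_distrib_left sum_distrib_right mult_ac)
    have wx: "w \<bullet> x = (x \<bullet> (C *v axis i 1)) / sqrt (C $ i $ i)" for x
      by (simp add: w_def inner_vec_def matrix_vector_mult_basis column_def sum_divide_distrib mult.commute)
    have s': "transpose C' = C'" by (simp add: C'_def transpose_def vec_eq_iff sym mult.commute)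
    have psd': "0 \<le> x \<bullet> (C' *v x)" for x
    proof -
      have "(x \<bullet> (C *v axis i 1))\<^sup>2 \<le> (x \<bullet> (C *v x)) * (axis i 1 \<bullet> (C *v axis i 1))"
        using i by (intro psd_cauchy_schwarz less.prems) (simp add: B)
      then have "(w \<bullet> x)\<^sup>2 \<le> x \<bullet> (C *v x)" using i unfolding wx B by (simp add: power_divide divide_le_eq)
      then show ?thesis unfolding C'v by (simp add: inner_diff_right inner_commute power2_eq_square)
    qed
    have z': "C' $ j $ j = 0" if "C $ j $ j = 0 \<or> j = i" for j
      using that zero[of j i] i by (auto simp: C'_def w_def)
    have "i \<in> {j. C $ j $ j \<noteq> 0}" "i \<notin> {j. C' $ j $ j \<noteq> 0}" "{j. C' $ j $ j \<noteq> 0} \<subseteq> {j. C $ j $ j \<noteq> 0}"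
      using z' i by auto
    then have "{j. C' $ j $ j \<noteq> 0} \<subset> {j. C $ j $ j \<noteq> 0}" by blast
    then have "card {j. C' $ j $ j \<noteq> 0} < card {j. C $ j $ j \<noteq> 0}" by (intro psubset_card_mono) auto
    then obtain v where v: "\<And>j. C' $ j $ j = 0 \<Longrightarrow> v j = 0" "\<And>a b. C' $ a $ b = (\<Sum>i\<in>UNIV. v i $ a * v i $ b)"
      using less.hyps[OF _ s' psd'] by blast
    have vi: "v i = 0" using v(1) z' by blast
    have "C $ a $ b = (\<Sum>j\<in>UNIV. (v(i := w)) j $ a * (v(i := w)) j $ b)" for a b
    proof -
      have "C $ a $ b = w $ a * w $ b + (\<Sum>j\<in>UNIV. v j $ a * v j $ b)" using v(2)[of a b] by (simp add: C'_def)
      also have "(\<Sum>j\<in>UNIV. v j $ a * v j $ b) = (\<Sum>j\<in>UNIV - {i}. (v(i := w)) j $ a * (v(i := w)) j $ b)"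
        using vi by (subst sum.remove[of UNIV i]) auto
      finally show ?thesis by (subst sum.remove[of UNIV i]) auto
    qed
    moreover have "(v(i := w)) j = 0" if "C $ j $ j = 0" for j using that i v(1) z' by auto
    ultimately show ?thesis by blast
  qed
qed

lemma psd_matrix_square_root:
  fixes C :: "real^'n^'n"
  assumes "transpose C = C" "\<And>x. 0 \<le> x \<bullet> (C *v x)"
  obtains A :: "real^'n^'n" where "A ** transpose A = C"
proof -
  obtain v :: "'n \<Rightarrow> real^'n" where v: "\<And>a b. C $ a $ b = (\<Sum>i\<in>UNIV. v i $ a * v i $ b)"
    using psd_sum_of_rank_ones[OF assms] by blast
  show ?thesis
    by (rule that[of "\<chi> a i. v i $ a"]) (simp add: vec_eq_iff matrix_matrix_mult_def transpose_def v)
qed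

text \<open>The mean value theorem in the direction \<open>u\<close> expresses the second difference by a difference of
  gradients at two points near \<open>x\<close>, each of which is compared with its linear approximation at \<open>x\<close>.\<close>

lemma second_difference_of_gradient:
  fixes R :: "'e::real_inner \<Rightarrow> real"
  assumes R: "\<And>y. dist x y < r \<Longrightarrow> (R has_derivative (\<lambda>h. g y \<bullet> h)) (at y)"
    and D: "bounded_linear D" "\<And>y. dist x y < r \<Longrightarrow> norm (g y - g x - D (y - x)) \<le> e * norm (y - x)"
    and h: "0 < h" "h * (norm u + norm v) < r" and e: "e \<ge> 0"
  shows "\<bar>R (x + h *\<^sub>R u + h *\<^sub>R v) - R (x + h *\<^sub>R u) - R (x + h *\<^sub>R v) + R x - h\<^sup>2 * (u \<bullet> D v)\<bar>
    \<le> h\<^sup>2 * (2 * e * (norm u + norm v)\<^sup>2)"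
proof -
  interpret D: bounded_linear D by fact
  define \<phi> where "\<phi> = (\<lambda>t. R (x + (t * h) *\<^sub>R u + h *\<^sub>R v) - R (x + (t * h) *\<^sub>R u))"
  have near: "dist x (x + (t * h) *\<^sub>R u + s *\<^sub>R v) < r" "norm ((t * h) *\<^sub>R u + s *\<^sub>R v) \<le> h * (norm u + norm v)"
    if "0 \<le> t" "t \<le> 1" "s = 0 \<or> s = h" for t s
  proof -
    have "norm ((t * h) *\<^sub>R u + s *\<^sub>R v) \<le> norm ((t * h) *\<^sub>R u) + norm (s *\<^sub>R v)" by (rule norm_triangle_ineq)
    also have "\<dots> \<le> h * norm u + h * norm v"
      using that h by (intro add_mono) (auto intro!: mult_right_mono mult_left_le_one_le)
    finally show 1: "norm ((t * h) *\<^sub>R u + s *\<^sub>R v) \<le> h * (norm u + norm v)" by (simp add: algebra_simps)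
    have "dist x (x + (t * h) *\<^sub>R u + s *\<^sub>R v) = norm ((t * h) *\<^sub>R u + s *\<^sub>R v)"
    proof -
      have "dist x (x + z) = norm z" for z :: 'e by (simp add: dist_norm)
      then show ?thesis by (simp only: add.assoc)
    qed
    then show "dist x (x + (t * h) *\<^sub>R u + s *\<^sub>R v) < r" using 1 h by simp
  qed
  define \<phi>' where "\<phi>' = (\<lambda>t. h * ((g (x + (t * h) *\<^sub>R u + h *\<^sub>R v) - g (x + (t * h) *\<^sub>R u)) \<bullet> u))"
  have der: "(\<phi> has_real_derivative \<phi>' t) (at t)" if t: "0 \<le> t" "t \<le> 1" for t
  proof -
    have lin: "((\<lambda>t. x + (t * h) *\<^sub>R u + s *\<^sub>R v) has_derivative (\<lambda>d. (d * h) *\<^sub>R u)) (at t)" for s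
      by (auto intro!: derivative_eq_intros)
    have 1: "((\<lambda>t. R (x + (t * h) *\<^sub>R u + s *\<^sub>R v)) has_derivative (\<lambda>d. g (x + (t * h) *\<^sub>R u + s *\<^sub>R v) \<bullet> ((d * h) *\<^sub>R u))) (at t)"
      if "s = 0 \<or> s = h" for s
      by (rule has_derivative_compose[OF lin R]) (use near(1)[OF t that] in simp)
    have "(\<phi> has_derivative (\<lambda>d. \<phi>' t * d)) (at t)"
      unfolding \<phi>_def
      by (rule has_derivative_eq_rhs[OF has_derivative_diff[OF 1[of h] 1[of 0, simplified]]])
        (auto simp: \<phi>'_def inner_diff_left algebra_simps)
    then show ?thesis by (simp add: has_field_derivative_def)
  qed
  obtain t where t: "0 < t" "t < 1" "\<phi> 1 - \<phi> 0 = (1 - 0) * \<phi>' t"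
    using MVT2[of 0 1 \<phi> \<phi>'] der by auto
  define y1 y0 where "y1 = x + (t * h) *\<^sub>R u + h *\<^sub>R v" and "y0 = x + (t * h) *\<^sub>R u"
  have n1: "norm (g y1 - g x - D (y1 - x)) \<le> e * (h * (norm u + norm v))"
  proof -
    have "norm (g y1 - g x - D (y1 - x)) \<le> e * norm (y1 - x)"
      unfolding y1_def using near(1)[of t h] t by (intro D(2)) auto
    also have "norm (y1 - x) \<le> h * (norm u + norm v)" using near(2)[of t h] t by (simp add: y1_def add.assoc)
    finally show ?thesis using e by (simp add: mult_left_mono)
  qed
  have n0: "norm (g y0 - g x - D (y0 - x)) \<le> e * (h * (norm u + norm v))"
  proof -
    have "norm (g y0 - g x - D (y0 - x)) \<le> e * norm (y0 - x)"
      unfolding y0_def using near(1)[of t 0] t by (intro D(2)) auto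
    also have "norm (y0 - x) \<le> h * (norm u + norm v)" using near(2)[of t 0] t by (simp add: y0_def)
    finally show ?thesis using e by (simp add: mult_left_mono)
  qed
  have "D (y1 - x) - D (y0 - x) = h *\<^sub>R D v"
    by (simp add: y1_def y0_def D.scaleR D.add)
  then have eq: "g y1 - g y0 - h *\<^sub>R D v = (g y1 - g x - D (y1 - x)) - (g y0 - g x - D (y0 - x))" by (simp add: algebra_simps)
  have n: "norm (g y1 - g y0 - h *\<^sub>R D v) \<le> 2 * (e * (h * (norm u + norm v)))"
    using norm_triangle_ineq4[of "g y1 - g x - D (y1 - x)" "g y0 - g x - D (y0 - x)"] n0 n1
    unfolding eq by linarith
  have "R (x + h *\<^sub>R u + h *\<^sub>R v) - R (x + h *\<^sub>R u) - R (x + h *\<^sub>R v) + R x - h\<^sup>2 * (u \<bullet> D v) = h * ((g y1 - g y0 - h *\<^sub>R D v) \<bullet> u)"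
  proof -
    have "\<phi>' t = h * ((g y1 - g y0) \<bullet> u)" by (simp only: \<phi>'_def y1_def y0_def)
    with t(3) show ?thesis
      by (simp add: \<phi>_def inner_diff_left algebra_simps power2_eq_square inner_commute)
  qed
  also have "\<bar>\<dots>\<bar> \<le> h * (norm (g y1 - g y0 - h *\<^sub>R D v) * norm u)"
    using h by (simp add: abs_mult mult_left_mono Cauchy_Schwarz_ineq2)
  also have "\<dots> \<le> h * (2 * (e * (h * (norm u + norm v))) * (norm u + norm v))"
    using n h e by (intro mult_left_mono mult_mono) auto
  finally show ?thesis by (simp add: power2_eq_square mult_ac)
qed

text \<open>The second difference of \<open>R\<close> with steps \<open>h u\<close> and \<open>h v\<close> is symmetric in \<open>u\<close> and \<open>v\<close>, and divided by
  \<open>h\<^sup>2\<close> it approximates \<open>u \<bullet> D v\<close> as well as \<open>v \<bullet> D u\<close>. Differentiability of the gradient at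
  the single point \<open>x\<close> suffices.\<close>

lemma gradient_derivative_symmetric:
  fixes R :: "'e::real_inner \<Rightarrow> real"
  assumes r: "r > 0" and R: "\<And>y. dist x y < r \<Longrightarrow> (R has_derivative (\<lambda>h. g y \<bullet> h)) (at y)"
    and D: "(g has_derivative D) (at x)"
  shows "u \<bullet> D v = v \<bullet> D u"
proof -
  have bl: "bounded_linear D" using D by (rule has_derivative_bounded_linear)
  define s where "s = norm u + norm v"
  have s0: "s \<ge> 0" by (simp add: s_def)
  have "\<bar>u \<bullet> D v - v \<bullet> D u\<bar> \<le> 0 + e" if e0: "e > 0" for e
  proof -
    define q where "q = s\<^sup>2 + 1"
    have q: "q > 0" by (simp add: q_def add_nonneg_pos)
    define e' where "e' = e / (4 * q)"
    have e': "e' > 0" using e0 q by (simp add: e'_def)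
    obtain d where d: "d > 0" "\<And>y. norm (y - x) < d \<Longrightarrow> norm (g y - g x - D (y - x)) \<le> e' * norm (y - x)"
      using D e' unfolding has_derivative_at_alt by blast
    define r' where "r' = min r d"
    define h where "h = r' / (s + 1) / 2"
    have r': "r' > 0" using r d by (simp add: r'_def)
    have h: "h > 0" "h * s < r'"
    proof -
      show "h > 0" using r' s0 by (simp add: h_def)
      have "h * s = r' * (s / (2 * (s + 1)))" by (simp add: h_def)
      also have "\<dots> < r' * 1" using r' s0 by (intro mult_strict_left_mono) (auto simp: divide_less_eq)
      finally show "h * s < r'" by simp
    qed
    have R': "\<And>y. dist x y < r' \<Longrightarrow> (R has_derivative (\<lambda>h. g y \<bullet> h)) (at y)" using R by (simp add: r'_def)
    have D': "\<And>y. dist x y < r' \<Longrightarrow> norm (g y - g x - D (y - x)) \<le> e' * norm (y - x)"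
      using d(2) by (simp add: r'_def dist_norm norm_minus_commute)
    define \<Delta> where "\<Delta> = R (x + h *\<^sub>R u + h *\<^sub>R v) - R (x + h *\<^sub>R u) - R (x + h *\<^sub>R v) + R x"
    have 1: "\<bar>\<Delta> - h\<^sup>2 * (u \<bullet> D v)\<bar> \<le> h\<^sup>2 * (2 * e' * s\<^sup>2)"
      using second_difference_of_gradient[of x r' R g D e' h u v] R' bl D' h e' unfolding \<Delta>_def s_def by simp
    have 2: "\<bar>\<Delta> - h\<^sup>2 * (v \<bullet> D u)\<bar> \<le> h\<^sup>2 * (2 * e' * s\<^sup>2)"
      using second_difference_of_gradient[of x r' R g D e' h v u] R' bl D' h e' unfolding \<Delta>_def s_def
      by (simp add: add.commute add.left_commute add.assoc diff_right_commute)
    have "h\<^sup>2 * \<bar>u \<bullet> D v - v \<bullet> D u\<bar> = \<bar>h\<^sup>2 * (u \<bullet> D v) - h\<^sup>2 * (v \<bullet> D u)\<bar>"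
      by (simp add: right_diff_distrib[symmetric] abs_mult)
    also have "\<dots> \<le> h\<^sup>2 * (4 * e' * s\<^sup>2)" using 1 2 by (simp add: algebra_simps)
    finally have "\<bar>u \<bullet> D v - v \<bullet> D u\<bar> \<le> 4 * e' * s\<^sup>2" using h by simp
    also have "\<dots> = e * (s\<^sup>2 / q)" using q by (simp add: e'_def field_simps)
    also have "\<dots> \<le> e * 1" using e0 q by (intro mult_left_mono) (auto simp: divide_le_eq q_def)
    finally show ?thesis by simp
  qed
  then have "\<bar>u \<bullet> D v - v \<bullet> D u\<bar> \<le> 0" by (rule field_le_epsilon)
  then show ?thesis by simp
qed

section \<open>Weak convergence tested on trigonometric polynomials\<close>

text \<open>Real trigonometric polynomials of several variables with arbitrary frequencies. Their integrals
  are linear combinations of real and imaginary parts of values of the characteristic function.\<close>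

inductive trig_poly :: "('a::real_inner \<Rightarrow> real) \<Rightarrow> bool" where
  cosine: "trig_poly (\<lambda>x. cos (t \<bullet> x))"
| sine: "trig_poly (\<lambda>x. sin (t \<bullet> x))"
| add: "trig_poly f \<Longrightarrow> trig_poly g \<Longrightarrow> trig_poly (\<lambda>x. f x + g x)"
| scale: "trig_poly f \<Longrightarrow> trig_poly (\<lambda>x. c * f x)"

lemma trig_poly_const: "trig_poly (\<lambda>x. c)"
  using trig_poly.scale[OF trig_poly.cosine[of 0], of c] by simp

text \<open>Products of sines and cosines are sums of sines and cosines.\<close>

lemma trig_poly_mult:
  assumes "trig_poly f" "trig_poly g"
  shows "trig_poly (\<lambda>x. f x * g x)"
proof -
  have half: "trig_poly (\<lambda>x. (f x + g x) / 2)" if "trig_poly f" "trig_poly g" for f g :: "'a \<Rightarrow> real"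
    using trig_poly.scale[OF trig_poly.add[OF that], of "1/2"] by (simp add: field_simps)
  have neg: "trig_poly (\<lambda>x. - f x)" if "trig_poly f" for f :: "'a \<Rightarrow> real"
    using trig_poly.scale[OF that, of "-1"] by simp
  have atom: "trig_poly (\<lambda>x. a (s \<bullet> x) * b (t \<bullet> x))" if "a = cos \<or> a = sin" "b = cos \<or> b = sin" for a b and s t :: 'a
  proof -
    have cc: "trig_poly (\<lambda>x. cos (s \<bullet> x) * cos (t \<bullet> x))" for s t :: 'a
      using half[OF trig_poly.cosine[of "s - t"] trig_poly.cosine[of "s + t"]]
      by (simp add: cos_times_cos inner_diff_left inner_add_left)
    have ss: "trig_poly (\<lambda>x. sin (s \<bullet> x) * sin (t \<bullet> x))" for s t :: 'a
      using half[OF trig_poly.cosine[of "s - t"] neg[OF trig_poly.cosine[of "s + t"]]]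
      by (simp add: sin_times_sin inner_diff_left inner_add_left)
    have sc: "trig_poly (\<lambda>x. sin (s \<bullet> x) * cos (t \<bullet> x))" for s t :: 'a
      using half[OF trig_poly.sine[of "s + t"] trig_poly.sine[of "s - t"]]
      by (simp add: sin_times_cos inner_diff_left inner_add_left)
    show ?thesis using that cc ss sc[of s t] sc[of t s] by (auto simp: mult.commute)
  qed
  have left: "trig_poly (\<lambda>x. a (s \<bullet> x) * g x)" if "a = cos \<or> a = sin" "trig_poly g" for a and s :: 'a and g
    using that(2)
  proof induction
    case (add f g)
    then show ?case using trig_poly.add[OF add.IH] by (simp add: distrib_left)
  next
    case (scale f c)
    then show ?case using trig_poly.scale[OF scale.IH, of c] by (simp add: mult_ac)
  qed (use atom that(1) in auto)
  show ?thesis using assms(1)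
  proof induction
    case (add f1 f2)
    then show ?case using trig_poly.add[OF add.IH] by (simp add: distrib_right)
  next
    case (scale f c)
    then show ?case using trig_poly.scale[OF scale.IH, of c] by (simp add: mult_ac)
  qed (use left assms(2) in auto)
qed

lemma trig_poly_integrable:
  fixes f :: "'a::euclidean_space \<Rightarrow> real"
  assumes "trig_poly f" and M: "prob_space M" "sets M = sets borel"
  shows "integrable M f"
proof -
  interpret prob_space M by fact
  have m: "g \<in> borel_measurable M" if "continuous_on UNIV g" for g :: "'a \<Rightarrow> real"
    using borel_measurable_continuous_onI[OF that] M(2) by (simp cong: measurable_cong_sets)
  show ?thesis using assms(1)
  proof induction
    case (cosine t)
    show ?case by (rule integrable_const_bound[of _ 1]) (auto intro!: m continuous_intros)
  next
    case (sine t)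
    show ?case by (rule integrable_const_bound[of _ 1]) (auto intro!: m continuous_intros)
  qed auto
qed

lemma trig_poly_integral_tendsto:
  fixes \<mu> :: "nat \<Rightarrow> 'a::euclidean_space measure"
  assumes f: "trig_poly f"
    and \<mu>: "\<And>n. prob_space (\<mu> n)" "\<And>n. sets (\<mu> n) = sets borel" and \<nu>: "prob_space \<nu>" "sets \<nu> = sets borel"
    and c: "\<And>t. (\<lambda>n. \<integral>x. cos (t \<bullet> x) \<partial>\<mu> n) \<longlonglongrightarrow> (\<integral>x. cos (t \<bullet> x) \<partial>\<nu>)"
    and s: "\<And>t. (\<lambda>n. \<integral>x. sin (t \<bullet> x) \<partial>\<mu> n) \<longlonglongrightarrow> (\<integral>x. sin (t \<bullet> x) \<partial>\<nu>)"
  shows "(\<lambda>n. \<integral>x. f x \<partial>\<mu> n) \<longlonglongrightarrow> (\<integral>x. f x \<partial>\<nu>)"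
  using f
proof induction
  case (add f g)
  have "(\<integral>x. f x + g x \<partial>N) = (\<integral>x. f x \<partial>N) + (\<integral>x. g x \<partial>N)" if "prob_space N" "sets N = sets borel" for N
    using trig_poly_integrable[OF add.hyps(1) that] trig_poly_integrable[OF add.hyps(2) that] by simp
  then show ?case using add.IH \<mu> \<nu> by (auto intro!: tendsto_add)
next
  case (scale f c)
  then show ?case by (auto intro!: tendsto_mult)
qed (use c s in auto)

text \<open>The map to the circle glues only the end points of the interval.\<close>

lemma eq_or_boundary_of_same_angle:
  fixes a b L :: real
  assumes "L > 0" "\<bar>a\<bar> \<le> L" "\<bar>b\<bar> \<le> L" and "cos (pi * a / L) = cos (pi * b / L)" "sin (pi * a / L) = sin (pi * b / L)"
  shows "a = b \<or> (\<bar>a\<bar> = L \<and> \<bar>b\<bar> = L)"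
proof -
  obtain n :: int where "pi * a / L = pi * b / L + 2 * pi * n"
    using assms(4,5) sin_cos_eq_iff by metis
  then have "pi * (a / L) = pi * (b / L + 2 * n)" by (simp add: algebra_simps)
  then have "a / L = b / L + 2 * n" by (simp only: mult_left_cancel[OF pi_neq_zero])
  then have "L * (a / L) = L * (b / L) + 2 * L * n" by (simp add: distrib_left)
  then have ab: "a - b = 2 * L * n" using assms(1) by simp
  have "\<bar>a - b\<bar> \<le> 2 * L" using assms by linarith
  then have "2 * L * \<bar>real_of_int n\<bar> \<le> 2 * L * 1" using ab assms(1) by (simp add: abs_mult)
  then have "\<bar>real_of_int n\<bar> \<le> 1" using assms(1) by (subst (asm) mult_le_cancel_left_pos) auto
  then have "n = 0 \<or> n = 1 \<or> n = -1" by linarith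
  then show ?thesis using ab assms by auto
qed

text \<open>A function that vanishes outside a cube factors through the torus obtained by gluing opposite faces,
  which \<open>E\<close> embeds into a product of planes. On the torus the functions that pull back to
  trigonometric polynomials form a separating algebra, so the Stone-Weierstrass theorem applies. As
  every point has the same image as some point of the cube, the approximation is bounded by
  \<open>B + \<epsilon>\<close> everywhere and not only on the cube.\<close>

lemma periodic_trig_approximation:
  fixes f :: "real^'n \<Rightarrow> real"
  assumes f: "continuous_on UNIV f" and L: "L > 0" and zero: "\<And>x i. L \<le> \<bar>x $ i\<bar> \<Longrightarrow> f x = 0"
    and B: "\<And>x. \<bar>f x\<bar> \<le> B" and \<epsilon>: "\<epsilon> > 0"
  obtains p where "trig_poly p" "\<And>x. (\<And>i. \<bar>x $ i\<bar> \<le> L) \<Longrightarrow> \<bar>f x - p x\<bar> \<le> \<epsilon>" "\<And>x. \<bar>p x\<bar> \<le> B + \<epsilon>"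
proof -
  define E :: "real^'n \<Rightarrow> (real \<times> real)^'n" where "E = (\<lambda>x. \<chi> i. (cos (pi * x $ i / L), sin (pi * x $ i / L)))"
  have contE: "continuous_on A E" for A unfolding E_def by (intro continuous_intros) (use L in auto)
  define K where "K = (cbox (\<chi> i. - L) (\<chi> i. L) :: (real^'n) set)"
  have K: "x \<in> K \<longleftrightarrow> (\<forall>i. \<bar>x $ i\<bar> \<le> L)" for x
    by (auto simp: K_def mem_box_cart abs_le_iff) (metis minus_le_iff)+
  have compK: "compact K" unfolding K_def by (rule compact_cbox)
  define T where "T = E ` K"
  have compT: "compact T" unfolding T_def by (rule compact_continuous_image[OF contE compK])
  have fiber: "f x = f y" if "x \<in> K" "y \<in> K" "E x = E y" for x y
  proof -
    have c: "x $ i = y $ i \<or> (\<bar>x $ i\<bar> = L \<and> \<bar>y $ i\<bar> = L)" for i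
    proof (rule eq_or_boundary_of_same_angle[OF L])
      have "E x $ i = E y $ i" using that by simp
      then show "cos (pi * x $ i / L) = cos (pi * y $ i / L)" "sin (pi * x $ i / L) = sin (pi * y $ i / L)"
        by (auto simp: E_def)
    qed (use that K in auto)
    show ?thesis
    proof (cases "\<exists>i. \<bar>x $ i\<bar> = L \<and> \<bar>y $ i\<bar> = L")
      case True
      then show ?thesis using zero by (metis order_refl)
    next
      case False
      then have "x = y" using c by (auto simp: vec_eq_iff)
      then show ?thesis by simp
    qed
  qed
  have range: "\<exists>y\<in>K. E y = E x" for x
  proof -
    define k where "k = (\<lambda>i. \<lfloor>(x $ i + L) / (2 * L)\<rfloor>)"
    define y :: "real^'n" where "y = (\<chi> i. x $ i - 2 * L * of_int (k i))"
    have yi: "y $ i = x $ i - 2 * L * of_int (k i)" for i by (simp add: y_def)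
    have "\<bar>y $ i\<bar> \<le> L" for i
    proof -
      have "real_of_int (k i) \<le> (x $ i + L) / (2 * L)" "(x $ i + L) / (2 * L) < real_of_int (k i) + 1"
        unfolding k_def by linarith+
      then have "real_of_int (k i) * (2 * L) \<le> x $ i + L" "x $ i + L < (real_of_int (k i) + 1) * (2 * L)"
        using L by (auto simp: pos_le_divide_eq pos_divide_less_eq)
      then show ?thesis unfolding yi by (simp add: abs_le_iff algebra_simps)
    qed
    moreover have "E y = E x"
    proof -
      have "pi * y $ i / L = pi * x $ i / L + 2 * pi * of_int (- k i)" for i
        unfolding yi using L by (simp add: right_diff_distrib diff_divide_distrib)
      then have "sin (pi * y $ i / L) = sin (pi * x $ i / L) \<and> cos (pi * y $ i / L) = cos (pi * x $ i / L)" for i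
        unfolding sin_cos_eq_iff by blast
      then show ?thesis by (simp add: E_def)
    qed
    ultimately show ?thesis using K by blast
  qed
  \<comment> \<open>The function on the torus; by \<open>fiber\<close> it does not depend on the point chosen over \<open>w\<close>.\<close>
  define F where "F = (\<lambda>w. f (SOME x. x \<in> K \<and> E x = w))"
  have FE: "F (E x) = f x" if "x \<in> K" for x
  proof -
    have "(SOME y. y \<in> K \<and> E y = E x) \<in> K \<and> E (SOME y. y \<in> K \<and> E y = E x) = E x"
      by (rule someI[of "\<lambda>y. y \<in> K \<and> E y = E x" x]) (use that in auto)
    then show ?thesis unfolding F_def using fiber that by blast
  qed
  \<comment> \<open>Preimages of closed sets are images of compact sets, hence closed.\<close>
  have contF: "continuous_on T F"
  proof (subst continuous_on_closed_vimage[OF compact_imp_closed[OF compT]], intro allI impI)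
    fix C :: "real set" assume C: "closed C"
    have "F -` C \<inter> T = E ` (f -` C \<inter> K)" unfolding T_def using FE by auto
    moreover have "compact (f -` C \<inter> K)"
      using closed_vimage_Int[OF C f] compK by (intro closed_Int_compact closed_vimage C f) auto
    ultimately show "closed (F -` C \<inter> T)"
      by (simp add: compact_imp_closed compact_continuous_image[OF contE])
  qed
  define R where "R = {G. continuous_on T G \<and> trig_poly (\<lambda>x. G (E x))}"
  interpret function_ring_on R T
  proof
    fix w w' assume w: "w \<in> T" "w' \<in> T" "w \<noteq> w'"
    then obtain i where i: "w $ i \<noteq> w' $ i" by (auto simp: vec_eq_iff)
    have tc: "trig_poly (\<lambda>x. fst (E x $ i))" "trig_poly (\<lambda>x. snd (E x $ i))"
      using trig_poly.cosine[of "axis i (pi / L)"] trig_poly.sine[of "axis i (pi / L)"]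
      by (simp_all add: E_def inner_axis' mult.commute)
    have "(\<lambda>w. fst (w $ i)) \<in> R" "(\<lambda>w. snd (w $ i)) \<in> R"
      using tc unfolding R_def by (auto intro!: continuous_intros)
    then show "\<exists>f\<in>R. f w \<noteq> f w'" using i by (metis prod_eqI)
  qed (auto simp: R_def compT trig_poly_const intro!: continuous_intros trig_poly.add trig_poly_mult)
  obtain G where G: "G \<in> R" "\<And>w. w \<in> T \<Longrightarrow> \<bar>F w - G w\<bar> < \<epsilon>"
    using Stone_Weierstrass_basic[OF contF \<epsilon>] by blast
  show ?thesis
  proof (rule that[of "\<lambda>x. G (E x)"])
    show "trig_poly (\<lambda>x. G (E x))" using G(1) by (simp add: R_def)
    show "\<bar>f x - G (E x)\<bar> \<le> \<epsilon>" if "\<And>i. \<bar>x $ i\<bar> \<le> L" for x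
      using G(2)[of "E x"] FE[of x] K that by (force simp: T_def)
    show "\<bar>G (E x)\<bar> \<le> B + \<epsilon>" for x
    proof -
      obtain y where y: "y \<in> K" "E y = E x" using range by blast
      then have "E x \<in> T" unfolding T_def by (metis imageI)
      then have "\<bar>f y - G (E x)\<bar> < \<epsilon>" using G(2)[of "E x"] FE[OF y(1)] y(2) by simp
      then show ?thesis using B[of y] by linarith
    qed
  qed
qed

text \<open>By tightness a bounded continuous function may be cut off outside a large ball. The cut-off function
  is approximated by a trigonometric polynomial, for which the integrals converge; outside the ball
  the approximation is bounded and the measures have little mass.\<close>

lemma weakly_converges_of_trig:
  fixes \<mu> :: "nat \<Rightarrow> (real^'n) measure"
  assumes \<mu>: "\<And>n. prob_space (\<mu> n)" "\<And>n. sets (\<mu> n) = sets borel" and \<nu>: "prob_space \<nu>" "sets \<nu> = sets borel"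
    and c: "\<And>t. (\<lambda>n. \<integral>x. cos (t \<bullet> x) \<partial>\<mu> n) \<longlonglongrightarrow> (\<integral>x. cos (t \<bullet> x) \<partial>\<nu>)"
    and s: "\<And>t. (\<lambda>n. \<integral>x. sin (t \<bullet> x) \<partial>\<mu> n) \<longlonglongrightarrow> (\<integral>x. sin (t \<bullet> x) \<partial>\<nu>)"
    and tight: "\<And>\<epsilon>. \<epsilon> > 0 \<Longrightarrow> \<exists>r. \<forall>\<^sub>F n in sequentially. measure (\<mu> n) {x. r < norm x} \<le> \<epsilon>"
  shows "weakly_converges \<mu> \<nu>"
  unfolding weakly_converges_def
proof (intro allI impI, elim conjE)
  fix f :: "real^'n \<Rightarrow> real"
  assume f: "continuous_on UNIV f" and "bounded (range f)"
  then obtain B where B: "\<And>x. \<bar>f x\<bar> \<le> B" by (auto simp: bounded_iff)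
  have B0: "B \<ge> 0" using B[of 0] by linarith
  interpret NU: prob_space \<nu> by fact
  show "(\<lambda>n. \<integral>x. f x \<partial>\<mu> n) \<longlonglongrightarrow> (\<integral>x. f x \<partial>\<nu>)"
  proof (rule LIMSEQ_I)
    fix e :: real assume e: "e > 0"
    \<comment> \<open>Bounds both the error of approximation and the mass outside the ball; \<open>small\<close> collects the total.\<close>
    define \<epsilon> where "\<epsilon> = min 1 (e / (8 * (2 * B + 2)))"
    have \<epsilon>: "\<epsilon> > 0" "\<epsilon> \<le> 1" using e B0 by (auto simp: \<epsilon>_def)
    have small: "\<epsilon> + (2 * B + \<epsilon>) * \<epsilon> \<le> e / 4"
    proof -
      have "\<epsilon> + (2 * B + \<epsilon>) * \<epsilon> \<le> \<epsilon> * (2 * B + 2)" using \<epsilon> by (simp add: algebra_simps mult_left_le)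
      also have "\<dots> \<le> e / (8 * (2 * B + 2)) * (2 * B + 2)" using B0 by (intro mult_right_mono) (auto simp: \<epsilon>_def)
      also have "\<dots> \<le> e / 4" using B0 e by (simp add: field_simps)
      finally show ?thesis .
    qed
    obtain r1 where r1: "\<forall>\<^sub>F n in sequentially. measure (\<mu> n) {x. r1 < norm x} \<le> \<epsilon>" using tight[OF \<epsilon>(1)] by blast
    have "(\<lambda>k::nat. measure \<nu> {x. real k < norm x}) \<longlonglongrightarrow> measure \<nu> (\<Inter>k. {x. real k < norm x})"
    proof (rule NU.finite_Lim_measure_decseq)
      show "range (\<lambda>k::nat. {x. real k < norm x}) \<subseteq> sets \<nu>" unfolding \<nu>(2) by (intro image_subsetI) measurable
      show "decseq (\<lambda>k::nat. {x::real^'n. real k < norm x})"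
        by (rule decseq_SucI) (simp add: Collect_mono)
    qed
    moreover have "(\<Inter>k. {x::real^'n. real k < norm x}) = {}"
    proof -
      have "\<exists>k. \<not> real k < norm x" for x :: "real^'n" using reals_Archimedean2[of "norm x"] by (auto intro: less_imp_le simp: not_less)
      then show ?thesis by blast
    qed
    ultimately have "(\<lambda>k::nat. measure \<nu> {x. real k < norm x}) \<longlonglongrightarrow> 0" by simp
    then have "\<forall>\<^sub>F k in sequentially. measure \<nu> {x. real k < norm x} < \<epsilon>" using \<epsilon>(1) by (rule order_tendstoD)
    then obtain r2 :: nat where r2: "measure \<nu> {x. real r2 < norm x} < \<epsilon>" unfolding eventually_sequentially by blast
    define r where "r = max (max r1 (real r2)) 0"
    define L where "L = r + 1"
    have L: "L > 0" by (simp add: L_def r_def add_nonneg_pos)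
    define cut where "cut = (\<lambda>x::real^'n. max 0 (min 1 (L - norm x)))"
    define h where "h = (\<lambda>x. f x * cut x)"
    have cut: "0 \<le> cut x" "cut x \<le> 1" for x by (auto simp: cut_def)
    have h: "continuous_on UNIV h" unfolding h_def cut_def by (intro continuous_intros f)
    have hB: "\<bar>h x\<bar> \<le> B" for x
    proof -
      have "\<bar>h x\<bar> = \<bar>f x\<bar> * cut x" using cut by (simp add: h_def abs_mult)
      also have "\<dots> \<le> B * 1" using B cut B0 by (intro mult_mono) auto
      finally show ?thesis by simp
    qed
    have h0: "h x = 0" if "L \<le> \<bar>x $ i\<bar>" for x i
      using that component_le_norm_cart[of x i] by (auto simp: h_def cut_def)
    obtain p where p: "trig_poly p" "\<And>x. (\<And>i. \<bar>x $ i\<bar> \<le> L) \<Longrightarrow> \<bar>h x - p x\<bar> \<le> \<epsilon>" "\<And>x. \<bar>p x\<bar> \<le> B + \<epsilon>"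
      by (rule periodic_trig_approximation[OF h L, of B \<epsilon>]) (use h0 hB \<epsilon>(1) in blast)+
    have fp: "\<bar>f x - p x\<bar> \<le> \<epsilon> + (2 * B + \<epsilon>) * indicator {x. r < norm x} x" for x
    proof (cases "r < norm x")
      case True
      then show ?thesis using B[of x] p(3)[of x] \<epsilon> by (simp; linarith)
    next
      case False
      then have "h x = f x" by (simp add: h_def cut_def L_def)
      moreover have "\<bar>x $ i\<bar> \<le> L" for i using component_le_norm_cart[of x i] False by (simp add: L_def)
      ultimately show ?thesis using p(2)[of x] False by simp
    qed
    have close: "\<bar>(\<integral>x. f x \<partial>N) - (\<integral>x. p x \<partial>N)\<bar> \<le> \<epsilon> + (2 * B + \<epsilon>) * measure N {x. r < norm x}"
      if N: "prob_space N" "sets N = sets borel" for N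
    proof -
      interpret N: prob_space N by fact
      have fN: "f \<in> borel_measurable N" using borel_measurable_continuous_onI[OF f] N(2) by (simp cong: measurable_cong_sets)
      have fi: "integrable N f" by (rule N.integrable_const_bound[of _ B]) (use B fN in auto)
      have pi: "integrable N p" by (rule trig_poly_integrable[OF p(1) N])
      have set: "{x. r < norm x} \<in> sets N" using N(2) by simp
      have "\<bar>(\<integral>x. f x \<partial>N) - (\<integral>x. p x \<partial>N)\<bar> = \<bar>\<integral>x. f x - p x \<partial>N\<bar>" using fi pi by simp
      also have "\<dots> \<le> (\<integral>x. \<bar>f x - p x\<bar> \<partial>N)" using integral_norm_bound[of N "\<lambda>x. f x - p x"] by simp
      also have "\<dots> \<le> (\<integral>x. \<epsilon> + (2 * B + \<epsilon>) * indicator {x. r < norm x} x \<partial>N)"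
        using fi pi set fp by (intro integral_mono) (auto simp: N.emeasure_finite less_top[symmetric])
      also have "\<dots> = \<epsilon> + (2 * B + \<epsilon>) * measure N {x. r < norm x}"
        using set by (subst Bochner_Integration.integral_add) (auto simp: N.prob_space N.emeasure_finite less_top[symmetric])
      finally show ?thesis .
    qed
    have mono_N: "measure N {x. r < norm x} \<le> measure N {x. r' < norm x}" if "r' \<le> r" "prob_space N" "sets N = sets borel" for N :: "(real^'n) measure" and r'
    proof -
      interpret N: prob_space N by fact
      show ?thesis using that by (intro N.finite_measure_mono) auto
    qed
    have close': "\<bar>(\<integral>x. f x \<partial>N) - (\<integral>x. p x \<partial>N)\<bar> \<le> e / 4"
      if N: "prob_space N" "sets N = sets borel" "measure N {x. r < norm x} \<le> \<epsilon>" for N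
    proof -
      have "(2 * B + \<epsilon>) * measure N {x. r < norm x} \<le> (2 * B + \<epsilon>) * \<epsilon>"
        using N(3) B0 \<epsilon> by (intro mult_left_mono) auto
      then show ?thesis using close[OF N(1,2)] small by linarith
    qed
    have lim: "\<bar>(\<integral>x. f x \<partial>\<nu>) - (\<integral>x. p x \<partial>\<nu>)\<bar> \<le> e / 4"
      using mono_N[of "real r2" \<nu>] \<nu> r2 by (intro close') (auto simp: r_def)
    have "\<forall>\<^sub>F n in sequentially. \<bar>(\<integral>x. f x \<partial>\<mu> n) - (\<integral>x. p x \<partial>\<mu> n)\<bar> \<le> e / 4"
      using r1
    proof eventually_elim
      case (elim n)
      then show ?case using mono_N[of r1 "\<mu> n"] \<mu> by (intro close') (auto simp: r_def)
    qed
    moreover have "\<forall>\<^sub>F n in sequentially. dist (\<integral>x. p x \<partial>\<mu> n) (\<integral>x. p x \<partial>\<nu>) < e / 4"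
      using trig_poly_integral_tendsto[OF p(1) \<mu> \<nu> c s] e by (intro tendstoD) auto
    ultimately have "\<forall>\<^sub>F n in sequentially. norm ((\<integral>x. f x \<partial>\<mu> n) - (\<integral>x. f x \<partial>\<nu>)) < e"
    proof eventually_elim
      case (elim n)
      then show ?case using lim e unfolding dist_real_def real_norm_def by linarith
    qed
    then show "\<exists>N. \<forall>n\<ge>N. norm ((\<integral>x. f x \<partial>\<mu> n) - (\<integral>x. f x \<partial>\<nu>)) < e" by (simp add: eventually_sequentially)
  qed
qed

section \<open>Characteristic functions of normal vectors and of normalized sums\<close>

lemma Basis_real_vec: "(Basis :: (real^'n) set) = (\<lambda>i. axis i 1) ` UNIV"
  by (auto simp: Basis_vec_def)

lemma prod_Basis_real_vec: "(\<Prod>b\<in>Basis. F ((x :: real^'n) \<bullet> b)) = (\<Prod>i\<in>UNIV. F (x $ i))"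
  unfolding Basis_real_vec by (subst prod.reindex) (auto simp: inj_on_def axis_eq_axis inner_axis)

lemma std_normal_vec_eq: "std_normal_vec = density lborel (\<lambda>x :: real^'n. ennreal (\<Prod>b\<in>Basis. std_normal_density (x \<bullet> b)))"
  unfolding std_normal_vec_def prod_Basis_real_vec by (simp add: prod_ennreal)

lemma sets_std_normal_vec [simp]: "sets std_normal_vec = sets borel"
  by (simp add: std_normal_vec_def)

lemma prob_space_std_normal_vec: "prob_space (std_normal_vec :: (real^'n) measure)"
proof
  have one: "(\<integral>\<^sup>+x. ennreal (std_normal_density x) \<partial>lborel) = 1"
    using prob_space.emeasure_space_1[OF prob_space_normal_density[of 1 0]] by (simp add: emeasure_density)
  have "emeasure (std_normal_vec :: (real^'n) measure) (space std_normal_vec)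
    = (\<integral>\<^sup>+x. ennreal (\<Prod>b\<in>Basis. std_normal_density (x \<bullet> b)) \<partial>(lborel :: (real^'n) measure))"
    unfolding std_normal_vec_eq by (subst emeasure_density) auto
  also have "\<dots> = (\<integral>\<^sup>+x. (\<Prod>b\<in>Basis. ennreal (std_normal_density (x \<bullet> b))) \<partial>(lborel :: (real^'n) measure))"
    by (simp add: prod_ennreal)
  also have "\<dots> = (\<Prod>b\<in>(Basis :: (real^'n) set). \<integral>\<^sup>+x. ennreal (std_normal_density x) \<partial>lborel)"
    by (rule nn_integral_lborel_prod) auto
  also have "\<dots> = 1" by (simp add: one)
  finally show "emeasure (std_normal_vec :: (real^'n) measure) (space std_normal_vec) = 1" .
qed

text \<open>The density and the exponential factorize over the coordinates, so the integral is a product of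
  one-dimensional characteristic functions.\<close>

lemma char_std_normal_vec:
  fixes t :: "real^'n"
  shows "(\<integral>x. iexp (t \<bullet> x) \<partial>std_normal_vec) = complex_of_real (exp (- (t \<bullet> t) / 2))"
proof -
  let ?h = "\<lambda>f :: real^'n \<Rightarrow> real. \<Sum>b\<in>Basis. f b *\<^sub>R b"
  interpret product_sigma_finite "\<lambda>_ :: real^'n. lborel :: real measure" by unfold_locales
  have int: "integrable lborel (\<lambda>y. std_normal_density y *\<^sub>R iexp (s * y))" for s
  proof -
    have "integrable std_normal_distribution (\<lambda>y. iexp (s * y))"
      by (rule prob_space.integrable_iexp[OF prob_space_normal_density]) auto
    then show ?thesis by (subst (asm) integrable_density) auto
  qed
  have char: "(\<integral>y. std_normal_density y *\<^sub>R iexp (s * y) \<partial>lborel) = complex_of_real (exp (- s\<^sup>2 / 2))" for s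
  proof -
    have "(\<integral>y. std_normal_density y *\<^sub>R iexp (s * y) \<partial>lborel) = char std_normal_distribution s"
      unfolding char_def by (subst integral_density) auto
    then show ?thesis by (simp add: char_std_normal_distribution)
  qed
  have hm: "?h \<in> (\<Pi>\<^sub>M b\<in>Basis. lborel) \<rightarrow>\<^sub>M (borel :: (real^'n) measure)" by measurable
  have hb: "?h f \<bullet> b = f b" if "b \<in> Basis" for f and b :: "real^'n"
    using that by simp
  have "(\<integral>x. iexp (t \<bullet> x) \<partial>std_normal_vec) = (\<integral>x. (\<Prod>b\<in>Basis. std_normal_density (x \<bullet> b)) *\<^sub>R iexp (t \<bullet> x) \<partial>(lborel :: (real^'n) measure))"
    unfolding std_normal_vec_eq by (subst integral_density) (auto intro!: prod_nonneg)
  also have "\<dots> = (\<integral>f. (\<Prod>b\<in>Basis. std_normal_density (?h f \<bullet> b)) *\<^sub>R iexp (t \<bullet> ?h f) \<partial>(\<Pi>\<^sub>M b\<in>Basis. lborel))"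
    by (subst lborel_eq, subst integral_distr[OF hm]) auto
  also have "\<dots> = (\<integral>f. (\<Prod>b\<in>Basis. std_normal_density (f b) *\<^sub>R iexp ((t \<bullet> b) * f b)) \<partial>(\<Pi>\<^sub>M b\<in>(Basis :: (real^'n) set). lborel))"
  proof (intro Bochner_Integration.integral_cong refl)
    fix f :: "real^'n \<Rightarrow> real"
    have "iexp (t \<bullet> ?h f) = (\<Prod>b\<in>Basis. iexp ((t \<bullet> b) * f b))"
      by (simp add: inner_sum_right exp_sum[symmetric] sum_distrib_left mult_ac)
    moreover have "(\<Prod>b\<in>Basis. std_normal_density (?h f \<bullet> b)) = (\<Prod>b\<in>Basis. std_normal_density (f b))"
      by (intro prod.cong refl arg_cong[where f=std_normal_density] hb)
    ultimately show "(\<Prod>b\<in>Basis. std_normal_density (?h f \<bullet> b)) *\<^sub>R iexp (t \<bullet> ?h f) = (\<Prod>b\<in>Basis. std_normal_density (f b) *\<^sub>R iexp ((t \<bullet> b) * f b))"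
      by (simp add: scaleR_conv_of_real prod.distrib)
  qed
  also have "\<dots> = (\<Prod>b\<in>(Basis :: (real^'n) set). \<integral>y. std_normal_density y *\<^sub>R iexp ((t \<bullet> b) * y) \<partial>lborel)"
    by (rule product_integral_prod) (use int in auto)
  also have "\<dots> = (\<Prod>b\<in>(Basis :: (real^'n) set). complex_of_real (exp (- (t \<bullet> b)\<^sup>2 / 2)))" by (simp only: char)
  also have "\<dots> = complex_of_real (exp (- (t \<bullet> t) / 2))"
    by (subst euclidean_inner[of t t]) (simp add: exp_sum[symmetric] sum_negf[symmetric] sum_divide_distrib power2_eq_square del: of_real_exp flip: of_real_prod)
  finally show ?thesis .
qed

lemma integral_cos_sin_char:
  fixes N :: "'a::euclidean_space measure"
  assumes "prob_space N" "sets N = sets borel"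
  shows "(\<integral>x. cos (t \<bullet> x) \<partial>N) = Re (\<integral>x. iexp (t \<bullet> x) \<partial>N)" "(\<integral>x. sin (t \<bullet> x) \<partial>N) = Im (\<integral>x. iexp (t \<bullet> x) \<partial>N)"
proof -
  interpret prob_space N by fact
  have "(\<lambda>x. complex_of_real (t \<bullet> x)) \<in> borel_measurable N"
    using assms(2) by (simp cong: measurable_cong_sets)
  then have i: "integrable N (\<lambda>x. iexp (t \<bullet> x))" by (intro integrable_iexp) auto
  show "(\<integral>x. cos (t \<bullet> x) \<partial>N) = Re (\<integral>x. iexp (t \<bullet> x) \<partial>N)" "(\<integral>x. sin (t \<bullet> x) \<partial>N) = Im (\<integral>x. iexp (t \<bullet> x) \<partial>N)"
    using integral_Re[OF i] integral_Im[OF i] by (simp_all add: Re_exp Im_exp)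
qed

lemma inner_second_moment:
  fixes w :: "'s \<Rightarrow> real^'n"
  assumes "\<And>i j. integrable P (\<lambda>s. w s $ i * w s $ j)"
  shows "x \<bullet> (second_moment P w *v x) = (\<integral>s. (x \<bullet> w s)\<^sup>2 \<partial>P)"
proof -
  have "(x \<bullet> w s)\<^sup>2 = (\<Sum>i\<in>UNIV. \<Sum>j\<in>UNIV. (x $ i * x $ j) * (w s $ i * w s $ j))" for s
    by (simp add: inner_vec_def power2_eq_square sum_product mult_ac)
  then have "(\<integral>s. (x \<bullet> w s)\<^sup>2 \<partial>P) = (\<Sum>i\<in>UNIV. \<Sum>j\<in>UNIV. (x $ i * x $ j) * (\<integral>s. w s $ i * w s $ j \<partial>P))"
    using assms by simp
  then show ?thesis
    by (simp add: second_moment_def inner_vec_def matrix_vector_mult_def sum_distrib_left mult_ac)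
qed

lemma iid_projection:
  fixes w :: "'s::topological_space \<Rightarrow> real"
  assumes M: "prob_space M" and P: "sets P = sets borel" and S: "iid_sample M P S"
    and w: "w \<in> borel_measurable borel"
  shows "prob_space.indep_vars M (\<lambda>_. borel) (\<lambda>i \<omega>. w (S i \<omega>)) UNIV"
    and "\<And>i. (\<lambda>\<omega>. w (S i \<omega>)) \<in> borel_measurable M"
    and "\<And>i. integrable P w \<Longrightarrow> integrable M (\<lambda>\<omega>. w (S i \<omega>))"
    and "\<And>i. (\<integral>\<omega>. w (S i \<omega>) \<partial>M) = (\<integral>s. w s \<partial>P)"
    and "\<And>i. distr M borel (\<lambda>\<omega>. w (S i \<omega>)) = distr P borel w"
proof -
  interpret prob_space M by fact
  have ind: "indep_vars (\<lambda>_. borel) S UNIV" and d: "\<And>i. distr M borel (S i) = P"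
    using S by (auto simp: iid_sample_def)
  have rv [measurable]: "S i \<in> borel_measurable M" for i using ind by (auto simp: indep_vars_def2)
  show "indep_vars (\<lambda>_. borel) (\<lambda>i \<omega>. w (S i \<omega>)) UNIV"
    using indep_vars_compose2[OF ind, of "\<lambda>_. w" "\<lambda>_. borel"] w by simp
  show m: "(\<lambda>\<omega>. w (S i \<omega>)) \<in> borel_measurable M" for i
    using measurable_compose[OF rv w] .
  show "integrable M (\<lambda>\<omega>. w (S i \<omega>))" if "integrable P w" for i
    using integrable_distr_eq[OF rv[of i] w] that by (simp add: d)
  show "(\<integral>\<omega>. w (S i \<omega>) \<partial>M) = (\<integral>s. w s \<partial>P)" for i
    using integral_distr[OF rv[of i] w] by (simp add: d)
  show "distr M borel (\<lambda>\<omega>. w (S i \<omega>)) = distr P borel w" for i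
    using distr_distr[OF w rv[of i]] by (simp add: d comp_def)
qed

lemma iid_sum_second_moment:
  fixes w :: "'s::topological_space \<Rightarrow> real"
  assumes M: "prob_space M" and P: "sets P = sets borel" and S: "iid_sample M P S"
    and w: "w \<in> borel_measurable borel" "integrable P w" "integrable P (\<lambda>s. (w s)\<^sup>2)" "(\<integral>s. w s \<partial>P) = 0"
  shows "integrable M (\<lambda>\<omega>. (\<Sum>i<n. w (S i \<omega>))\<^sup>2)" "(\<integral>\<omega>. (\<Sum>i<n. w (S i \<omega>))\<^sup>2 \<partial>M) = n * (\<integral>s. (w s)\<^sup>2 \<partial>P)"
proof -
  interpret prob_space M by fact
  note pr = iid_projection[OF M P S w(1)]
  have w2: "(\<lambda>s. (w s)\<^sup>2) \<in> borel_measurable borel" using w(1) by measurable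
  note pr2 = iid_projection[OF M P S w2]
  have off: "integrable M (\<lambda>\<omega>. w (S i \<omega>) * w (S j \<omega>)) \<and> (\<integral>\<omega>. w (S i \<omega>) * w (S j \<omega>) \<partial>M) = 0" if "i \<noteq> j" for i j
  proof -
    have ind: "indep_vars (\<lambda>_. borel) (\<lambda>i \<omega>. w (S i \<omega>)) {i, j}" using pr(1) by (rule indep_vars_subset) auto
    have "(\<integral>\<omega>. (\<Prod>k\<in>{i, j}. w (S k \<omega>)) \<partial>M) = (\<Prod>k\<in>{i, j}. \<integral>\<omega>. w (S k \<omega>) \<partial>M)"
      by (rule indep_vars_lebesgue_integral[OF _ ind]) (use pr(3) w in auto)
    moreover have "integrable M (\<lambda>\<omega>. \<Prod>k\<in>{i, j}. w (S k \<omega>))"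
      by (rule indep_vars_integrable[OF _ ind]) (use pr(3) w in auto)
    ultimately show ?thesis using that pr(4) w(4) by simp
  qed
  have i: "integrable M (\<lambda>\<omega>. w (S i \<omega>) * w (S j \<omega>))" for i j
    using off[of i j] pr2(3)[of i] w(3) by (cases "i = j") (auto simp: power2_eq_square)
  have v: "(\<integral>\<omega>. w (S i \<omega>) * w (S j \<omega>) \<partial>M) = (if i = j then (\<integral>s. (w s)\<^sup>2 \<partial>P) else 0)" for i j
    using off[of i j] pr2(4)[of i] by (auto simp: power2_eq_square)
  have eq: "(\<Sum>i<n. w (S i \<omega>))\<^sup>2 = (\<Sum>i<n. \<Sum>j<n. w (S i \<omega>) * w (S j \<omega>))" for \<omega>
    by (simp add: power2_eq_square sum_product)
  show "integrable M (\<lambda>\<omega>. (\<Sum>i<n. w (S i \<omega>))\<^sup>2)" unfolding eq using i by auto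
  show "(\<integral>\<omega>. (\<Sum>i<n. w (S i \<omega>))\<^sup>2 \<partial>M) = n * (\<integral>s. (w s)\<^sup>2 \<partial>P)"
    unfolding eq using i by (simp add: v)
qed

text \<open>The central limit theorem on the line and Levy's continuity theorem, at the frequency \<open>sqrt v\<close> with
  \<open>v\<close> the variance. For \<open>v = 0\<close>, which the central limit theorem excludes, all summands vanish almost
  surely.\<close>

lemma char_normalized_iid_sum:
  fixes w :: "'s::topological_space \<Rightarrow> real"
  assumes M: "prob_space M" and P: "sets P = sets borel" and S: "iid_sample M P S"
    and w: "w \<in> borel_measurable borel" "integrable P w" "integrable P (\<lambda>s. (w s)\<^sup>2)" "(\<integral>s. w s \<partial>P) = 0"
  shows "(\<lambda>n. \<integral>\<omega>. iexp ((\<Sum>i<n. w (S i \<omega>)) / sqrt n) \<partial>M) \<longlonglongrightarrow> complex_of_real (exp (- (\<integral>s. (w s)\<^sup>2 \<partial>P) / 2))"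
proof -
  interpret prob_space M by fact
  define v where "v = (\<integral>s. (w s)\<^sup>2 \<partial>P)"
  have v0: "v \<ge> 0" by (simp add: v_def)
  note pr = iid_projection[OF M P S w(1)]
  have w2: "(\<lambda>s. (w s)\<^sup>2) \<in> borel_measurable borel" using w(1) by measurable
  note pr2 = iid_projection[OF M P S w2]
  show ?thesis
  proof (cases "v = 0")
    case True
    have "AE \<omega> in M. w (S i \<omega>) = 0" for i
    proof -
      have "(\<integral>\<omega>. (w (S i \<omega>))\<^sup>2 \<partial>M) = 0" using pr2(4)[of i] True by (simp add: v_def)
      then have "AE \<omega> in M. (w (S i \<omega>))\<^sup>2 = 0" using integral_nonneg_eq_0_iff_AE[OF pr2(3)[OF w(3), of i]] by simp
      then show ?thesis by simp
    qed
    then have ae: "AE \<omega> in M. \<forall>i. w (S i \<omega>) = 0" by (simp add: AE_all_countable)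
    have "(\<integral>\<omega>. iexp ((\<Sum>i<n. w (S i \<omega>)) / sqrt n) \<partial>M) = 1" for n
    proof -
      have "(\<integral>\<omega>. iexp ((\<Sum>i<n. w (S i \<omega>)) / sqrt n) \<partial>M) = (\<integral>\<omega>. 1 \<partial>M)"
        using ae pr(2) by (intro integral_cong_AE) (auto elim!: eventually_mono)
      then show ?thesis by (simp add: prob_space)
    qed
    then show ?thesis using True by (simp add: v_def)
  next
    case False
    then have v: "v > 0" using v0 by simp
    have clt: "weak_conv_m (\<lambda>n. distr M borel (\<lambda>\<omega>. (\<Sum>i<n. w (S i \<omega>)) / sqrt (n * (sqrt v)\<^sup>2))) std_normal_distribution"
    proof (rule central_limit_theorem_zero_mean[OF pr(1)])
      show "variance (\<lambda>\<omega>. w (S n \<omega>)) = (sqrt v)\<^sup>2" for n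
        using pr(4)[of n] pr2(4)[of n] w(4) v by (simp add: v_def)
    qed (use pr pr2 w v in auto)
    have rd: "real_distribution (distr M borel (\<lambda>\<omega>. (\<Sum>i<n. w (S i \<omega>)) / sqrt (n * (sqrt v)\<^sup>2)))" for n
      using pr(2) by (intro real_distribution_distr borel_measurable_divide borel_measurable_sum borel_measurable_const)
    have "(\<lambda>n. char (distr M borel (\<lambda>\<omega>. (\<Sum>i<n. w (S i \<omega>)) / sqrt (n * (sqrt v)\<^sup>2))) (sqrt v)) \<longlonglongrightarrow> char std_normal_distribution (sqrt v)"
      by (rule levy_continuity1[OF rd real_dist_normal_dist clt])
    moreover have "char (distr M borel (\<lambda>\<omega>. (\<Sum>i<n. w (S i \<omega>)) / sqrt (n * (sqrt v)\<^sup>2))) (sqrt v) = (\<integral>\<omega>. iexp ((\<Sum>i<n. w (S i \<omega>)) / sqrt n) \<partial>M)" for n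
      unfolding char_def using pr(2) v by (subst integral_distr) (auto simp: real_sqrt_mult)
    ultimately show ?thesis using v by (simp add: char_std_normal_distribution v_def)
  qed
qed

section \<open>Events with probability tending to one\<close>

lemma tending_to_one_mono:
  assumes "with_prob_tending_to_one M E" "\<And>n \<omega>. \<omega> \<in> space M \<Longrightarrow> E n \<omega> \<Longrightarrow> E' n \<omega>"
  shows "with_prob_tending_to_one M E'"
proof -
  obtain A where A: "\<forall>n. A n \<in> sets M \<and> (\<forall>\<omega>\<in>A n. E n \<omega>)" "(\<lambda>n. measure M (A n)) \<longlonglongrightarrow> 1"
    using assms(1) unfolding with_prob_tending_to_one_def by blast
  have "\<omega> \<in> space M" if "\<omega> \<in> A n" for \<omega> n using A(1) that sets.sets_into_space by blast
  then show ?thesis unfolding with_prob_tending_to_one_def using A assms(2) by (intro exI[of _ A]) blast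
qed

lemma tending_to_one_conj:
  assumes M: "prob_space M" and "with_prob_tending_to_one M E" "with_prob_tending_to_one M E'"
  shows "with_prob_tending_to_one M (\<lambda>n \<omega>. E n \<omega> \<and> E' n \<omega>)"
proof -
  interpret prob_space M by fact
  obtain A where A: "\<And>n. A n \<in> sets M" "\<And>n \<omega>. \<omega> \<in> A n \<Longrightarrow> E n \<omega>" "(\<lambda>n. prob (A n)) \<longlonglongrightarrow> 1"
    using assms(2) unfolding with_prob_tending_to_one_def by blast
  obtain B where B: "\<And>n. B n \<in> sets M" "\<And>n \<omega>. \<omega> \<in> B n \<Longrightarrow> E' n \<omega>" "(\<lambda>n. prob (B n)) \<longlonglongrightarrow> 1"
    using assms(3) unfolding with_prob_tending_to_one_def by blast
  have lower: "prob (A n) + prob (B n) - 1 \<le> prob (A n \<inter> B n)" for n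
  proof -
    have "prob (A n - B n) = prob (A n) - prob (A n \<inter> B n)" by (rule finite_measure_Diff'[OF A(1) B(1)])
    moreover have "prob (A n - B n) \<le> prob (space M - B n)"
      using A(1)[of n] B(1)[of n] sets.sets_into_space by (intro finite_measure_mono) auto
    ultimately show ?thesis using B(1)[of n] by (simp add: prob_compl)
  qed
  have sum_lim: "(\<lambda>n. prob (A n) + prob (B n) - 1) \<longlonglongrightarrow> 1 + 1 - 1" by (intro tendsto_intros A B)
  have lim: "(\<lambda>n. prob (A n \<inter> B n)) \<longlonglongrightarrow> 1"
    by (rule tendsto_sandwich[of "\<lambda>n. prob (A n) + prob (B n) - 1" _ _ "\<lambda>_. 1"]) (use sum_lim in \<open>auto simp: lower\<close>)
  show ?thesis unfolding with_prob_tending_to_one_def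
    by (intro exI[of _ "\<lambda>n. A n \<inter> B n"]) (use A B lim in auto)
qed

text \<open>The sets \<open>A n\<close> that witness the property are chosen almost optimal among the events on which
  \<open>E n\<close> holds; this is needed since the set where \<open>E n\<close> holds may fail to be measurable.\<close>

lemma tending_to_oneI:
  assumes M: "prob_space M"
    and E: "\<And>\<kappa>. \<kappa> > 0 \<Longrightarrow> \<forall>\<^sub>F n in sequentially. \<exists>A\<in>sets M. 1 - \<kappa> \<le> measure M A \<and> (\<forall>\<omega>\<in>A. E n \<omega>)"
  shows "with_prob_tending_to_one M E"
proof -
  interpret prob_space M by fact
  define G where "G = (\<lambda>n. {A\<in>sets M. \<forall>\<omega>\<in>A. E n \<omega>})"
  define p where "p = (\<lambda>n. SUP A\<in>G n. prob A)"
  have G: "{} \<in> G n" for n by (simp add: G_def)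
  have bdd: "bdd_above (prob ` G n)" for n by (rule bdd_aboveI[of _ 1]) auto
  have "\<exists>A\<in>G n. p n - 1 / real (Suc n) < prob A" for n
  proof -
    have "p n - 1 / real (Suc n) < p n" by simp
    then show ?thesis unfolding p_def using less_cSUP_iff[OF _ bdd, of n] G[of n] by blast
  qed
  then obtain A where A: "\<And>n. A n \<in> G n" "\<And>n. p n - 1 / real (Suc n) < prob (A n)" by metis
  have "p \<longlonglongrightarrow> 1"
  proof (rule order_tendstoI)
    fix a :: real assume a: "a < 1"
    have "\<forall>\<^sub>F n in sequentially. \<exists>A\<in>sets M. 1 - (1 - a) / 2 \<le> prob A \<and> (\<forall>\<omega>\<in>A. E n \<omega>)"
      using a by (intro E) auto
    then show "\<forall>\<^sub>F n in sequentially. a < p n"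
    proof eventually_elim
      case (elim n)
      then obtain B where B: "B \<in> G n" "1 - (1 - a) / 2 \<le> prob B" by (auto simp: G_def)
      then have "prob B \<le> p n" unfolding p_def by (intro cSUP_upper bdd)
      then show ?case using B a by (simp add: field_simps)
    qed
  next
    fix a :: real assume "1 < a"
    moreover have "p n \<le> 1" for n unfolding p_def using G by (intro cSUP_least) auto
    ultimately have "p n < a" for n by (meson le_less_trans)
    then show "\<forall>\<^sub>F n in sequentially. p n < a" by simp
  qed
  moreover have "(\<lambda>n. 1 / real (Suc n)) \<longlonglongrightarrow> 0" using LIMSEQ_inverse_real_of_nat by (simp add: inverse_eq_divide)
  ultimately have diff_lim: "(\<lambda>n. p n - 1 / real (Suc n)) \<longlonglongrightarrow> 1 - 0" by (rule tendsto_diff)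
  have "(\<lambda>n. prob (A n)) \<longlonglongrightarrow> 1"
  proof (rule tendsto_sandwich[of "\<lambda>n. p n - 1 / real (Suc n)" _ _ "\<lambda>_. 1"])
    show "\<forall>\<^sub>F n in sequentially. p n - 1 / real (Suc n) \<le> prob (A n)"
      by (intro always_eventually allI less_imp_le A(2))
    show "(\<lambda>n. p n - 1 / real (Suc n)) \<longlonglongrightarrow> 1" using diff_lim by simp
  qed simp_all
  then show ?thesis unfolding with_prob_tending_to_one_def using A(1) by (intro exI[of _ A]) (auto simp: G_def)
qed

lemma tending_to_one_events:
  assumes M: "prob_space M" and E: "with_prob_tending_to_one M E" and k: "\<kappa> > 0"
  shows "\<forall>\<^sub>F n in sequentially. \<exists>A\<in>sets M. 1 - \<kappa> \<le> measure M A \<and> (\<forall>\<omega>\<in>A. E n \<omega>)"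
proof -
  obtain A where A: "\<And>n. A n \<in> sets M" "\<And>n \<omega>. \<omega> \<in> A n \<Longrightarrow> E n \<omega>" "(\<lambda>n. measure M (A n)) \<longlonglongrightarrow> 1"
    using E unfolding with_prob_tending_to_one_def by blast
  have "\<forall>\<^sub>F n in sequentially. 1 - \<kappa> < measure M (A n)" using A(3) k by (intro order_tendstoD(1)) auto
  then show ?thesis
  proof eventually_elim
    case (elim n)
    then show ?case using A(1)[of n] A(2)[where n=n] by (intro bexI[of _ "A n"]) auto
  qed
qed

lemma tending_to_one_ball_finite:
  assumes M: "prob_space M" and I: "finite I" and E: "\<And>j. j \<in> I \<Longrightarrow> with_prob_tending_to_one M (E j)"
  shows "with_prob_tending_to_one M (\<lambda>n \<omega>. \<forall>j\<in>I. E j n \<omega>)"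
  using I E
proof (induction I rule: finite_induct)
  case empty
  have "with_prob_tending_to_one M (\<lambda>n \<omega>. True)"
    unfolding with_prob_tending_to_one_def using prob_space.prob_space[OF M] by (intro exI[of _ "\<lambda>_. space M"]) auto
  then show ?case by simp
next
  case (insert j I)
  have "with_prob_tending_to_one M (\<lambda>n \<omega>. E j n \<omega> \<and> (\<forall>j\<in>I. E j n \<omega>))"
    using insert by (intro tending_to_one_conj[OF M]) auto
  then show ?case by simp
qed

lemma tending_to_one_close:
  fixes Z :: "nat \<Rightarrow> 'w \<Rightarrow> 'e::{metric_space, second_countable_topology}"
  assumes M: "prob_space M" and Z: "\<And>n. Z n \<in> borel_measurable M" and lim: "converges_in_prob M Z z" and d: "d > 0"
  shows "with_prob_tending_to_one M (\<lambda>n \<omega>. dist (Z n \<omega>) z < d)"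
proof -
  interpret prob_space M by fact
  have m: "{\<omega>\<in>space M. dist (Z n \<omega>) z > d / 2} \<in> sets M" for n using Z[of n] by measurable
  have "(\<lambda>n. prob {\<omega>\<in>space M. dist (Z n \<omega>) z > d / 2}) \<longlonglongrightarrow> 0"
    using lim half_gt_zero[OF d] unfolding converges_in_prob_def by blast
  then have "(\<lambda>n. 1 - prob {\<omega>\<in>space M. dist (Z n \<omega>) z > d / 2}) \<longlonglongrightarrow> 1 - 0" by (intro tendsto_intros)
  then have "(\<lambda>n. prob (space M - {\<omega>\<in>space M. dist (Z n \<omega>) z > d / 2})) \<longlonglongrightarrow> 1" unfolding prob_compl[OF m] by simp
  then show ?thesis
    unfolding with_prob_tending_to_one_def using m d
    by (intro exI[of _ "\<lambda>n. space M - {\<omega>\<in>space M. dist (Z n \<omega>) z > d / 2}"]) auto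
qed

section \<open>Asymptotic normality from a linear expansion\<close>

lemma abs_cos_diff_le: "\<bar>cos a - cos b\<bar> \<le> \<bar>a - b :: real\<bar>" and abs_sin_diff_le: "\<bar>sin a - sin b\<bar> \<le> \<bar>a - b :: real\<bar>"
proof -
  have s: "\<bar>sin ((b - a) / 2)\<bar> \<le> \<bar>a - b\<bar> / 2" using abs_sin_x_le_abs_x[of "(b - a) / 2"] by (simp add: abs_minus_commute)
  have s': "\<bar>sin ((a - b) / 2)\<bar> \<le> \<bar>a - b\<bar> / 2" using abs_sin_x_le_abs_x[of "(a - b) / 2"] by simp
  have "\<bar>cos a - cos b\<bar> = 2 * (\<bar>sin ((a + b) / 2)\<bar> * \<bar>sin ((b - a) / 2)\<bar>)" by (simp add: cos_diff_cos abs_mult)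
  also have "\<dots> \<le> 2 * (1 * (\<bar>a - b\<bar> / 2))" using s by (intro mult_left_mono mult_mono) auto
  finally show "\<bar>cos a - cos b\<bar> \<le> \<bar>a - b :: real\<bar>" by simp
  have "\<bar>sin a - sin b\<bar> = 2 * (\<bar>sin ((a - b) / 2)\<bar> * \<bar>cos ((a + b) / 2)\<bar>)" by (simp add: sin_diff_sin abs_mult)
  also have "\<dots> \<le> 2 * ((\<bar>a - b\<bar> / 2) * 1)" using s' by (intro mult_left_mono mult_mono) auto
  finally show "\<bar>sin a - sin b\<bar> \<le> \<bar>a - b :: real\<bar>" by simp
qed

text \<open>Slutsky's argument for a bounded Lipschitz test function.\<close>

lemma integral_tendsto_of_small_difference:
  fixes Z W :: "nat \<Rightarrow> 'w \<Rightarrow> 'e::euclidean_space" and h :: "real \<Rightarrow> real"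
  assumes M: "prob_space M" and Zm: "\<And>n. Z n \<in> borel_measurable M" and Wm: "\<And>n. W n \<in> borel_measurable M"
    and small: "\<And>e. e > 0 \<Longrightarrow> with_prob_tending_to_one M (\<lambda>n \<omega>. norm (Z n \<omega> - W n \<omega>) \<le> e)"
    and h: "\<And>a b. \<bar>h a - h b\<bar> \<le> \<bar>a - b\<bar>" "\<And>a. \<bar>h a\<bar> \<le> 1" "h \<in> borel_measurable borel"
    and lim: "(\<lambda>n. \<integral>\<omega>. h (t \<bullet> W n \<omega>) \<partial>M) \<longlonglongrightarrow> c"
  shows "(\<lambda>n. \<integral>\<omega>. h (t \<bullet> Z n \<omega>) \<partial>M) \<longlonglongrightarrow> c"
proof -
  interpret prob_space M by fact
  have int: "integrable M (\<lambda>\<omega>. h (t \<bullet> X \<omega>))" if "X \<in> borel_measurable M" for X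
    by (rule integrable_const_bound[of _ 1]) (use h that in auto)
  have "(\<lambda>n. (\<integral>\<omega>. h (t \<bullet> Z n \<omega>) \<partial>M) - (\<integral>\<omega>. h (t \<bullet> W n \<omega>) \<partial>M)) \<longlonglongrightarrow> 0"
  proof (rule LIMSEQ_I)
    fix e :: real assume e: "e > 0"
    define q where "q = norm t + 1"
    have q: "q > 0" "norm t \<le> q" by (auto simp: q_def add_nonneg_pos)
    \<comment> \<open>Then the Lipschitz error \<open>norm t * d\<close> is at most \<open>e / 2\<close>.\<close>
    define d where "d = e / (2 * q)"
    have d: "d > 0" using e q by (simp add: d_def)
    have td: "norm t * d \<le> e / 2"
    proof -
      have "norm t * d \<le> q * d" using d q by (intro mult_right_mono) auto
      also have "\<dots> = e / 2" using q by (simp add: d_def)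
      finally show ?thesis .
    qed
    have "\<forall>\<^sub>F n in sequentially. \<exists>A\<in>sets M. 1 - e / 8 \<le> prob A \<and> (\<forall>\<omega>\<in>A. norm (Z n \<omega> - W n \<omega>) \<le> d)"
      by (rule tending_to_one_events[OF M small[OF d]]) (use e in auto)
    then have "\<forall>\<^sub>F n in sequentially. norm ((\<integral>\<omega>. h (t \<bullet> Z n \<omega>) \<partial>M) - (\<integral>\<omega>. h (t \<bullet> W n \<omega>) \<partial>M) - 0) < e"
    proof eventually_elim
      case (elim n)
      then obtain A where A: "A \<in> sets M" "1 - e / 8 \<le> prob A" "\<And>\<omega>. \<omega> \<in> A \<Longrightarrow> norm (Z n \<omega> - W n \<omega>) \<le> d" by blast
      have pt: "\<bar>h (t \<bullet> Z n \<omega>) - h (t \<bullet> W n \<omega>)\<bar> \<le> e / 2 + 2 * indicator (space M - A) \<omega>" if "\<omega> \<in> space M" for \<omega>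
      proof (cases "\<omega> \<in> A")
        case True
        have "\<bar>h (t \<bullet> Z n \<omega>) - h (t \<bullet> W n \<omega>)\<bar> \<le> \<bar>t \<bullet> (Z n \<omega> - W n \<omega>)\<bar>" using h(1) by (simp add: inner_diff_right)
        also have "\<dots> \<le> norm t * norm (Z n \<omega> - W n \<omega>)" by (rule Cauchy_Schwarz_ineq2)
        also have "\<dots> \<le> norm t * d" using A(3)[OF True] by (intro mult_left_mono) auto
        finally show ?thesis using td True by simp
      next
        case False
        then show ?thesis using h(2)[of "t \<bullet> Z n \<omega>"] h(2)[of "t \<bullet> W n \<omega>"] that e by (simp add: abs_le_iff)
      qed
      have "\<bar>(\<integral>\<omega>. h (t \<bullet> Z n \<omega>) \<partial>M) - (\<integral>\<omega>. h (t \<bullet> W n \<omega>) \<partial>M)\<bar> = \<bar>\<integral>\<omega>. h (t \<bullet> Z n \<omega>) - h (t \<bullet> W n \<omega>) \<partial>M\<bar>"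
        using int[OF Zm] int[OF Wm] by simp
      also have "\<dots> \<le> (\<integral>\<omega>. \<bar>h (t \<bullet> Z n \<omega>) - h (t \<bullet> W n \<omega>)\<bar> \<partial>M)"
        using integral_norm_bound[of M "\<lambda>\<omega>. h (t \<bullet> Z n \<omega>) - h (t \<bullet> W n \<omega>)"] by simp
      also have "\<dots> \<le> (\<integral>\<omega>. e / 2 + 2 * indicator (space M - A) \<omega> \<partial>M)"
        using int[OF Zm] int[OF Wm] A(1) pt by (intro integral_mono) (auto simp: emeasure_eq_measure)
      also have "\<dots> = e / 2 + 2 * prob (space M - A)"
        using A(1) by (subst Bochner_Integration.integral_add) (auto simp: prob_space emeasure_eq_measure)
      also have "\<dots> < e" using A e by (simp add: prob_compl)
      finally show ?case by simp
    qed
    then show "\<exists>N. \<forall>n\<ge>N. norm ((\<integral>\<omega>. h (t \<bullet> Z n \<omega>) \<partial>M) - (\<integral>\<omega>. h (t \<bullet> W n \<omega>) \<partial>M) - 0) < e"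
      by (simp add: eventually_sequentially)
  qed
  from tendsto_add[OF this lim] show ?thesis by simp
qed

text \<open>Chebyshev's inequality: the second moment of the norm of the normalized sum does not depend on \<open>n\<close>.\<close>

lemma iid_sum_tight:
  fixes w :: "'s::topological_space \<Rightarrow> real^'n"
  assumes M: "prob_space M" and P: "sets P = sets borel" and S: "iid_sample M P S"
    and w: "w \<in> borel_measurable borel" "\<And>i. integrable P (\<lambda>s. w s $ i)" "\<And>i. integrable P (\<lambda>s. (w s $ i)\<^sup>2)" "\<And>i. (\<integral>s. w s $ i \<partial>P) = 0"
    and k: "\<kappa> > 0"
  shows "\<exists>r. \<forall>n>0. measure M {\<omega>\<in>space M. r < norm ((1 / sqrt n) *\<^sub>R (\<Sum>i<n. w (S i \<omega>)))} \<le> \<kappa>"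
proof -
  interpret prob_space M by fact
  define K where "K = (\<Sum>i\<in>UNIV. \<integral>s. (w s $ i)\<^sup>2 \<partial>P)"
  have K: "K \<ge> 0" unfolding K_def by (intro sum_nonneg integral_nonneg_AE) auto
  define r where "r = sqrt (K / \<kappa> + 1)"
  have r: "r > 0" "K \<le> r\<^sup>2 * \<kappa>" using K k by (auto simp: r_def field_simps add_nonneg_pos)
  have wi: "(\<lambda>s. w s $ i) \<in> borel_measurable borel" for i
    by (rule measurable_compose[OF w(1)]) (intro borel_measurable_continuous_onI continuous_intros)
  have Sm: "S i \<in> borel_measurable M" for i using S by (auto simp: iid_sample_def indep_vars_def2)
  have Wm: "(\<lambda>\<omega>. (1 / sqrt n) *\<^sub>R (\<Sum>i<n. w (S i \<omega>))) \<in> borel_measurable M" for n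
    using measurable_compose[OF Sm w(1)] by measurable
  have "measure M {\<omega>\<in>space M. r < norm ((1 / sqrt n) *\<^sub>R (\<Sum>i<n. w (S i \<omega>)))} \<le> \<kappa>" if n: "n > 0" for n :: nat
  proof -
    define X where "X = (\<lambda>\<omega>. (norm ((1 / sqrt n) *\<^sub>R (\<Sum>i<n. w (S i \<omega>))))\<^sup>2)"
    have X: "X \<omega> = (\<Sum>a\<in>UNIV. (1 / n) * (\<Sum>i<n. w (S i \<omega>) $ a)\<^sup>2)" for \<omega>
    proof -
      have "X \<omega> = (1 / sqrt n)\<^sup>2 * (norm (\<Sum>i<n. w (S i \<omega>)))\<^sup>2" by (simp add: X_def power_mult_distrib power_divide)
      also have "(norm (\<Sum>i<n. w (S i \<omega>)))\<^sup>2 = (\<Sum>a\<in>UNIV. (\<Sum>i<n. w (S i \<omega>) $ a)\<^sup>2)"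
        by (simp only: power2_norm_eq_inner) (simp add: inner_vec_def power2_eq_square)
      finally show ?thesis using n by (simp add: power_divide sum_distrib_left)
    qed
    note sm = iid_sum_second_moment[OF M P S wi w(2) w(3) w(4)]
    have intX: "integrable M X" unfolding X using sm(1) by auto
    have EX: "(\<integral>\<omega>. X \<omega> \<partial>M) = K" unfolding X using sm n by (simp add: K_def)
    have "measure M {\<omega>\<in>space M. r\<^sup>2 < X \<omega>} \<le> \<kappa>"
    proof (rule markov_bad_event[OF M])
      show "(\<integral>\<^sup>+\<omega>. ennreal (X \<omega>) \<partial>M) \<le> ennreal (r\<^sup>2 * \<kappa>)"
        using intX EX r by (subst nn_integral_eq_integral) (auto simp: X_def intro: ennreal_leI)
    qed (use intX r k in \<open>auto simp: X_def\<close>)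
    moreover have "{\<omega>\<in>space M. r < norm ((1 / sqrt n) *\<^sub>R (\<Sum>i<n. w (S i \<omega>)))} = {\<omega>\<in>space M. r\<^sup>2 < X \<omega>}"
      unfolding X_def using r by (auto simp: power2_less_imp_less intro: power_strict_mono)
    ultimately show ?thesis by simp
  qed
  then show ?thesis by blast
qed

text \<open>Linear functionals of the normalized sums satisfy the one-dimensional central limit theorem, which
  gives convergence of the characteristic functions to the one of a normal vector with covariance
  \<open>second_moment P w\<close>. The small difference changes neither these limits nor the tightness, so
  \<open>weakly_converges_of_trig\<close> applies. A square root of the covariance produces the normal vector
  also when the covariance is singular.\<close>

lemma asymptotically_normal_of_linear_expansion:
  fixes w :: "'s::topological_space \<Rightarrow> real^'n" and Z :: "nat \<Rightarrow> 'w \<Rightarrow> real^'n"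
  assumes M: "prob_space M" and P: "prob_space P" "sets P = sets borel" and S: "iid_sample M P S"
    and w: "w \<in> borel_measurable borel" "\<And>i j. integrable P (\<lambda>s. w s $ i * w s $ j)" "\<And>i. integrable P (\<lambda>s. w s $ i)" "\<And>i. (\<integral>s. w s $ i \<partial>P) = 0"
    and Z: "\<And>n. Z n \<in> borel_measurable M"
    and small: "\<And>e. e > 0 \<Longrightarrow> with_prob_tending_to_one M (\<lambda>n \<omega>. norm (Z n \<omega> - (1 / sqrt n) *\<^sub>R (\<Sum>i<n. w (S i \<omega>))) \<le> e)"
  shows "asymptotically_normal M Z 0 (second_moment P w)"
proof -
  interpret prob_space M by fact
  define C where "C = second_moment P w"
  have quad: "x \<bullet> (C *v x) = (\<integral>s. (x \<bullet> w s)\<^sup>2 \<partial>P)" for x unfolding C_def by (rule inner_second_moment[OF w(2)])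
  have "transpose C = C" by (simp add: C_def second_moment_def transpose_def vec_eq_iff mult.commute)
  moreover have "0 \<le> x \<bullet> (C *v x)" for x unfolding quad by (intro integral_nonneg_AE) auto
  ultimately obtain A :: "real^'n^'n" where A: "A ** transpose A = C" using psd_matrix_square_root by blast
  define \<nu> where "\<nu> = distr (std_normal_vec :: (real^'n) measure) borel (\<lambda>z. 0 + A *v z)"
  have Am: "(\<lambda>z. 0 + A *v z) \<in> std_normal_vec \<rightarrow>\<^sub>M borel"
  proof -
    have "continuous_on UNIV (\<lambda>z. 0 + A *v z)" by (intro continuous_intros matrix_vector_mult_linear_continuous_on)
    then show ?thesis using borel_measurable_continuous_onI by (simp cong: measurable_cong_sets)
  qed
  have \<nu>: "prob_space \<nu>" "sets \<nu> = sets borel"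
    unfolding \<nu>_def by (rule prob_space.prob_space_distr[OF prob_space_std_normal_vec Am]) simp
  have char\<nu>: "(\<integral>x. iexp (t \<bullet> x) \<partial>\<nu>) = complex_of_real (exp (- (t \<bullet> (C *v t)) / 2))" for t
  proof -
    have "(\<integral>x. iexp (t \<bullet> x) \<partial>\<nu>) = (\<integral>z. iexp (t \<bullet> (0 + A *v z)) \<partial>std_normal_vec)"
      unfolding \<nu>_def by (rule integral_distr[OF Am]) measurable
    also have "\<dots> = (\<integral>z. iexp ((transpose A *v t) \<bullet> z) \<partial>std_normal_vec)"
      by (simp add: dot_lmul_matrix[symmetric])
    also have "\<dots> = complex_of_real (exp (- ((transpose A *v t) \<bullet> (transpose A *v t)) / 2))"
      by (rule char_std_normal_vec)
    also have "(transpose A *v t) \<bullet> (transpose A *v t) = t \<bullet> (C *v t)"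
      by (simp add: A[symmetric] matrix_vector_mul_assoc[symmetric] dot_lmul_matrix[symmetric])
    finally show ?thesis .
  qed
  define W where "W = (\<lambda>n::nat. \<lambda>\<omega>. (1 / sqrt n) *\<^sub>R (\<Sum>i<n. w (S i \<omega>)))"
  have Sm: "S i \<in> borel_measurable M" for i using S by (auto simp: iid_sample_def indep_vars_def2)
  have Wm: "W n \<in> borel_measurable M" for n
    unfolding W_def using measurable_compose[OF Sm w(1)] by measurable
  have tW: "t \<bullet> W n \<omega> = (\<Sum>i<n. t \<bullet> w (S i \<omega>)) / sqrt n" for t n \<omega>
    by (simp add: W_def inner_sum_right)
  have limW: "(\<lambda>n. \<integral>\<omega>. iexp (t \<bullet> W n \<omega>) \<partial>M) \<longlonglongrightarrow> complex_of_real (exp (- (t \<bullet> (C *v t)) / 2))" for t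
    unfolding tW quad
  proof (rule char_normalized_iid_sum[OF M P(2) S])
    show "(\<lambda>s. t \<bullet> w s) \<in> borel_measurable borel" using w(1) by measurable
    have sq: "(t \<bullet> w s)\<^sup>2 = (\<Sum>i\<in>UNIV. \<Sum>j\<in>UNIV. (t $ i * t $ j) * (w s $ i * w s $ j))" for s
      by (simp add: inner_vec_def power2_eq_square sum_product mult_ac)
    show "integrable P (\<lambda>s. (t \<bullet> w s)\<^sup>2)" unfolding sq using w(2) by auto
    show "integrable P (\<lambda>s. t \<bullet> w s)" "(\<integral>s. t \<bullet> w s \<partial>P) = 0" unfolding inner_vec_def using w(3,4) by auto
  qed
  have Wd: "(\<integral>\<omega>. g (t \<bullet> X \<omega>) \<partial>M) = (\<integral>x. g (t \<bullet> x) \<partial>distr M borel X)"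
    if "X \<in> borel_measurable M" "g \<in> borel_measurable borel" for X and g :: "real \<Rightarrow> 'z::{banach, second_countable_topology}" and t
    by (rule integral_distr[symmetric, OF that(1)], rule measurable_compose[OF _ that(2)])
      (intro borel_measurable_continuous_onI continuous_intros)
  have pd: "prob_space (distr M borel X)" if "X \<in> borel_measurable M" for X :: "'w \<Rightarrow> real^'n"
    using that by (rule prob_space_distr)
  have iexp_m: "iexp \<in> borel_measurable borel" by measurable
  have cosW: "(\<lambda>n. \<integral>\<omega>. cos (t \<bullet> W n \<omega>) \<partial>M) \<longlonglongrightarrow> (\<integral>x. cos (t \<bullet> x) \<partial>\<nu>)"
    and sinW: "(\<lambda>n. \<integral>\<omega>. sin (t \<bullet> W n \<omega>) \<partial>M) \<longlonglongrightarrow> (\<integral>x. sin (t \<bullet> x) \<partial>\<nu>)" for t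
  proof -
    have "(\<integral>\<omega>. cos (t \<bullet> W n \<omega>) \<partial>M) = Re (\<integral>\<omega>. iexp (t \<bullet> W n \<omega>) \<partial>M)" for n
      using integral_cos_sin_char(1)[OF pd[OF Wm[of n]], of t] Wd[OF Wm[of n], of cos t] Wd[OF Wm[of n] iexp_m, of t] by simp
    then show "(\<lambda>n. \<integral>\<omega>. cos (t \<bullet> W n \<omega>) \<partial>M) \<longlonglongrightarrow> (\<integral>x. cos (t \<bullet> x) \<partial>\<nu>)"
      using tendsto_Re[OF limW[of t]] by (simp only: integral_cos_sin_char(1)[OF \<nu>] char\<nu>)
    have "(\<integral>\<omega>. sin (t \<bullet> W n \<omega>) \<partial>M) = Im (\<integral>\<omega>. iexp (t \<bullet> W n \<omega>) \<partial>M)" for n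
      using integral_cos_sin_char(2)[OF pd[OF Wm[of n]], of t] Wd[OF Wm[of n], of sin t] Wd[OF Wm[of n] iexp_m, of t] by simp
    then show "(\<lambda>n. \<integral>\<omega>. sin (t \<bullet> W n \<omega>) \<partial>M) \<longlonglongrightarrow> (\<integral>x. sin (t \<bullet> x) \<partial>\<nu>)"
      using tendsto_Im[OF limW[of t]] by (simp only: integral_cos_sin_char(2)[OF \<nu>] char\<nu>)
  qed
  have small': "with_prob_tending_to_one M (\<lambda>n \<omega>. norm (Z n \<omega> - W n \<omega>) \<le> e)" if "e > 0" for e
    using small[OF that] by (simp add: W_def)
  have "weakly_converges (\<lambda>n. distr M borel (Z n)) \<nu>"
  proof (rule weakly_converges_of_trig[OF pd[OF Z] _ \<nu>])
    show "(\<lambda>n. \<integral>x. cos (t \<bullet> x) \<partial>distr M borel (Z n)) \<longlonglongrightarrow> (\<integral>x. cos (t \<bullet> x) \<partial>\<nu>)" for t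
      using integral_tendsto_of_small_difference[OF M Z Wm small' abs_cos_diff_le _ _ cosW]
      by (simp add: Wd[OF Z])
    show "(\<lambda>n. \<integral>x. sin (t \<bullet> x) \<partial>distr M borel (Z n)) \<longlonglongrightarrow> (\<integral>x. sin (t \<bullet> x) \<partial>\<nu>)" for t
      using integral_tendsto_of_small_difference[OF M Z Wm small' abs_sin_diff_le _ _ sinW]
      by (simp add: Wd[OF Z])
    fix \<epsilon> :: real assume e: "\<epsilon> > 0"
    then have e2: "\<epsilon> / 2 > 0" by simp
    have w2: "integrable P (\<lambda>s. (w s $ i)\<^sup>2)" for i using w(2)[of i i] by (simp add: power2_eq_square)
    obtain r where r: "\<And>n. n > 0 \<Longrightarrow> prob {\<omega>\<in>space M. r < norm (W n \<omega>)} \<le> \<epsilon> / 2"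
      using iid_sum_tight[OF M P(2) S w(1,3) w2 w(4) e2] unfolding W_def by blast
    have "\<forall>\<^sub>F n in sequentially. \<exists>A\<in>sets M. 1 - \<epsilon> / 2 \<le> prob A \<and> (\<forall>\<omega>\<in>A. norm (Z n \<omega> - W n \<omega>) \<le> 1)"
      by (rule tending_to_one_events[OF M small' e2]) simp
    then have "\<forall>\<^sub>F n in sequentially. measure (distr M borel (Z n)) {x. r + 1 < norm x} \<le> \<epsilon>"
      using eventually_gt_at_top[of 0]
    proof eventually_elim
      case (elim n)
      then obtain B where B: "B \<in> sets M" "1 - \<epsilon> / 2 \<le> prob B" "\<And>\<omega>. \<omega> \<in> B \<Longrightarrow> norm (Z n \<omega> - W n \<omega>) \<le> 1" by blast
      have sets: "{\<omega>\<in>space M. r < norm (W n \<omega>)} \<in> sets M" using Wm by measurable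
      have "measure (distr M borel (Z n)) {x. r + 1 < norm x} = prob (Z n -` {x. r + 1 < norm x} \<inter> space M)"
        by (rule measure_distr[OF Z]) auto
      also have "\<dots> \<le> prob ({\<omega>\<in>space M. r < norm (W n \<omega>)} \<union> (space M - B))"
      proof (rule finite_measure_mono)
        show "Z n -` {x. r + 1 < norm x} \<inter> space M \<subseteq> {\<omega>\<in>space M. r < norm (W n \<omega>)} \<union> (space M - B)"
        proof
          fix \<omega> assume o: "\<omega> \<in> Z n -` {x. r + 1 < norm x} \<inter> space M"
          show "\<omega> \<in> {\<omega>\<in>space M. r < norm (W n \<omega>)} \<union> (space M - B)"
          proof (cases "\<omega> \<in> B")
            case True
            have "norm (Z n \<omega>) \<le> norm (Z n \<omega> - W n \<omega>) + norm (W n \<omega>)" by (metis diff_add_cancel norm_triangle_ineq)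
            then show ?thesis using B(3)[OF True] o by auto
          qed (use o in auto)
        qed
      qed (use sets B in auto)
      also have "\<dots> \<le> prob {\<omega>\<in>space M. r < norm (W n \<omega>)} + prob (space M - B)"
        using sets B by (intro measure_Un_le) auto
      also have "\<dots> \<le> \<epsilon>" using r[of n] elim B by (simp add: prob_compl)
      finally show ?case .
    qed
    then show "\<exists>r. \<forall>\<^sub>F n in sequentially. measure (distr M borel (Z n)) {x. r < norm x} \<le> \<epsilon>" by blast
  qed simp
  moreover have "multivariate_normal \<nu> 0 C" unfolding multivariate_normal_def \<nu>_def using A by blast
  ultimately show ?thesis unfolding asymptotically_normal_def C_def by blast
qed

section \<open>The weight function and the estimating equation\<close>

text \<open>\<open>v\<close> is the total variation of \<open>u\<close> up to a point, as a supremum over increasing finite chains.\<close>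

lemma bounded_variation_dominated_by_mono:
  fixes u :: "real \<Rightarrow> real"
  assumes "bounded_variation u"
  obtains v :: "real \<Rightarrow> real" and B :: real where "mono v" "\<And>x. 0 \<le> v x" "\<And>x. v x \<le> B" "\<And>a b. \<bar>u a - u b\<bar> \<le> \<bar>v a - v b\<bar>"
proof -
  obtain B where B: "\<And>t n. mono t \<Longrightarrow> (\<Sum>i<n. \<bar>u (t (Suc i)) - u (t i)\<bar>) \<le> B"
    using assms unfolding bounded_variation_def by blast
  define G :: "real \<Rightarrow> ((nat \<Rightarrow> real) \<times> nat) set" where "G = (\<lambda>x. {(t, n). mono t \<and> t n \<le> x})"
  define S where "S = (\<lambda>(t, n). \<Sum>i<n. \<bar>u (t (Suc i)) - u (t i)\<bar>)"
  define v where "v = (\<lambda>x. SUP p\<in>G x. S p)"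
  have ne: "((\<lambda>_. x), 0) \<in> G x" for x by (simp add: G_def mono_def)
  have SB: "S p \<le> B" if "p \<in> G x" for p x using that B by (auto simp: S_def G_def)
  have bdd: "bdd_above (S ` G x)" for x by (rule bdd_aboveI[of _ B]) (use SB in auto)
  have v0: "0 \<le> v x" for x
    using cSUP_upper[OF ne bdd, of x] by (simp add: v_def S_def)
  have vB: "v x \<le> B" for x unfolding v_def
  proof (rule cSUP_least)
    show "G x \<noteq> {}" using ne[of x] by blast
  qed (use SB in blast)
  have incr: "v a + \<bar>u b - u a\<bar> \<le> v b" if ab: "a \<le> b" for a b
  proof -
    have "S p \<le> v b - \<bar>u b - u a\<bar>" if p: "p \<in> G a" for p
    proof -
      obtain t n where tn: "p = (t, n)" "mono t" "t n \<le> a" using p by (auto simp: G_def)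
      \<comment> \<open>A chain that ends below \<open>a\<close> is prolonged by the points \<open>a\<close> and \<open>b\<close>.\<close>
      define t' where "t' = (\<lambda>i. if i \<le> n then t i else if i = Suc n then a else b)"
      have "mono t'" unfolding mono_iff_le_Suc
      proof
        fix i
        have "t i \<le> a" if "i \<le> n" using monoD[OF tn(2) that] tn(3) by simp
        then have le: "i = n \<Longrightarrow> t n \<le> a" by simp
        have inc: "t i \<le> t (Suc i)" by (rule monoD[OF tn(2)]) simp
        consider "i < n" | "i = n" | "i = Suc n" | "Suc n < i" by linarith
        then show "t' i \<le> t' (Suc i)"
          by cases (use inc le ab in \<open>simp_all add: t'_def\<close>)
      qed
      then have "(t', Suc (Suc n)) \<in> G b" by (simp add: G_def t'_def)
      then have "S (t', Suc (Suc n)) \<le> v b" unfolding v_def by (rule cSUP_upper[OF _ bdd])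
      moreover have "S (t', Suc (Suc n)) = S p + \<bar>u a - u (t n)\<bar> + \<bar>u b - u a\<bar>"
      proof -
        have "(\<Sum>i<n. \<bar>u (t' (Suc i)) - u (t' i)\<bar>) = S p"
          unfolding S_def tn(1) prod.case by (rule sum.cong) (auto simp: t'_def)
        then show ?thesis by (simp add: S_def t'_def)
      qed
      ultimately show ?thesis by linarith
    qed
    then have "Sup (S ` G a) \<le> v b - \<bar>u b - u a\<bar>" using ne[of a] by (intro cSUP_least) blast+
    then have "v a \<le> v b - \<bar>u b - u a\<bar>" by (simp add: v_def)
    then show ?thesis by simp
  qed
  show ?thesis
  proof (rule that[of v B])
    show "mono v"
    proof (rule monoI)
      fix a b :: real assume "a \<le> b"
      then show "v a \<le> v b" using incr[of a b] abs_ge_zero[of "u b - u a"] by linarith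
    qed
    show "\<bar>u a - u b\<bar> \<le> \<bar>v a - v b\<bar>" for a b
      using incr[of a b] incr[of b a] by (cases "a \<le> b") (auto simp: abs_minus_commute)
  qed (use v0 vB in auto)
qed

lemma C1_deriv:
  fixes \<rho> :: "real \<Rightarrow> real"
  assumes "\<rho> C1_differentiable_on UNIV"
  shows "(\<rho> has_real_derivative deriv \<rho> x) (at x)" "continuous_on UNIV (deriv \<rho>)"
proof -
  obtain D where D: "\<And>x. (\<rho> has_real_derivative D x) (at x)" "continuous_on UNIV D"
    using assms unfolding C1_differentiable_on_def by (auto simp: has_real_derivative_iff_has_vector_derivative)
  have "deriv \<rho> = D" using D(1) DERIV_imp_deriv by blast
  then show "(\<rho> has_real_derivative deriv \<rho> x) (at x)" "continuous_on UNIV (deriv \<rho>)" using D by auto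
qed

text \<open>At the origin both sides vanish: the weight has a finite limit there, so the derivative tends to zero.\<close>

lemma deriv_eq_weight:
  fixes \<rho> :: "real \<Rightarrow> real"
  assumes C1: "\<rho> C1_differentiable_on UNIV" and u: "continuous_on UNIV (weight_fun \<rho>)"
  shows "deriv \<rho> t = t * weight_fun \<rho> t"
proof (cases "t = 0")
  case True
  have c: "isCont (deriv \<rho>) 0" using C1_deriv(2)[OF C1] by (simp add: continuous_on_eq_continuous_at)
  have "isCont (weight_fun \<rho>) 0" using u by (simp add: continuous_on_eq_continuous_at)
  then have "((\<lambda>t. t * weight_fun \<rho> t) \<longlongrightarrow> 0 * weight_fun \<rho> 0) (at 0)"
    unfolding isCont_def by (intro tendsto_mult tendsto_ident_at)
  moreover have "\<forall>\<^sub>F t in at 0. t * weight_fun \<rho> t = deriv \<rho> t"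
    by (auto simp: weight_fun_def eventually_at_filter)
  ultimately have "(deriv \<rho> \<longlongrightarrow> 0 * weight_fun \<rho> 0) (at 0)" by (rule Lim_transform_eventually)
  then have "(deriv \<rho> \<longlongrightarrow> 0) (at 0)" by simp
  then have "deriv \<rho> 0 = 0" using c unfolding isCont_def by (meson LIM_unique)
  then show ?thesis using True by simp
qed (simp add: weight_fun_def)

text \<open>Beyond \<open>c1\<close> the loss is constant; at \<open>c1\<close> itself the weight vanishes by continuity.\<close>

lemma weight_fun_vanishes:
  fixes \<rho> :: "real \<Rightarrow> real"
  assumes C1: "\<rho> C1_differentiable_on UNIV" and u: "continuous_on UNIV (weight_fun \<rho>)"
    and c1: "c1 > 0" "\<rho> constant_on {c1..}" and t: "t \<ge> c1"
  shows "weight_fun \<rho> t = 0"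
proof -
  have gt: "weight_fun \<rho> t = 0" if "t > c1" for t
  proof -
    obtain k where k: "\<And>x. x \<ge> c1 \<Longrightarrow> \<rho> x = k" using c1(2) by (auto simp: constant_on_def)
    have "\<forall>\<^sub>F x in nhds t. \<rho> x = k"
      using that k by (intro eventually_mono[OF eventually_nhds_in_open[of "{c1<..}"]]) auto
    then have "(\<rho> has_real_derivative 0) (at t)" by (subst DERIV_cong_ev[OF refl _ refl]) auto
    then have "deriv \<rho> t = 0" by (rule DERIV_imp_deriv)
    then show ?thesis using that c1 by (simp add: weight_fun_def)
  qed
  have "(\<lambda>n. weight_fun \<rho> (t + 1 / real (Suc n))) \<longlonglongrightarrow> weight_fun \<rho> t"
  proof -
    have "(\<lambda>n. t + 1 / real (Suc n)) \<longlonglongrightarrow> t + 0"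
      using LIMSEQ_inverse_real_of_nat by (intro tendsto_intros) (simp add: inverse_eq_divide)
    then have lim: "(\<lambda>n. t + 1 / real (Suc n)) \<longlonglongrightarrow> t" by (simp only: add_0_right)
    have "isCont (weight_fun \<rho>) t" using u by (simp add: continuous_on_eq_continuous_at)
    then show ?thesis by (rule isCont_tendsto_compose[OF _ lim])
  qed
  moreover have "weight_fun \<rho> (t + 1 / real (Suc n)) = 0" for n
  proof (rule gt)
    have "0 < 1 / real (Suc n)" by simp
    then show "c1 < t + 1 / real (Suc n)" using t by linarith
  qed
  ultimately show ?thesis by (simp add: LIMSEQ_const_iff)
qed

text \<open>The score as a function of the matrix \<open>J\<close>, which takes the place of the inverse of \<open>V \<gamma>\<close>.\<close>

definition psi :: "(real \<Rightarrow> real) \<Rightarrow> real^'k^'k \<Rightarrow> (real^'k) \<times> (real^'q^'k) \<Rightarrow> real^'q \<Rightarrow> real \<Rightarrow> real^'q"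
  where "psi u J s \<beta> \<sigma> = u (sqrt (residual s \<beta> \<bullet> (J *v residual s \<beta>)) / \<sigma>) *\<^sub>R (transpose (snd s) *v (J *v residual s \<beta>))"

lemma Psi_beta_eq_psi: "Psi_beta \<rho> V s (\<beta>, \<gamma>) \<sigma> = psi (weight_fun \<rho>) (matrix_inv (V \<gamma>)) s \<beta> \<sigma>"
  by (simp add: Psi_beta_def psi_def mahal_def)

lemma inner_transpose_vector: "(transpose A *v x) \<bullet> y = x \<bullet> ((A :: real^'n^'m) *v y)"
  by (metis dot_lmul_matrix transpose_matrix_vector transpose_transpose)

lemma norm_mat_vec_le: "norm ((A :: real^'n^'m) *v x) \<le> norm A * norm x"
proof -
  have "norm (A *v x) \<le> L2_set (\<lambda>i. norm (A $ i) * norm x) UNIV"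
    unfolding norm_vec_def[of "A *v x"]
  proof (rule L2_set_mono)
    show "norm ((A *v x) $ i) \<le> norm (A $ i) * norm x" for i
      by (simp add: matrix_vector_mul_component Cauchy_Schwarz_ineq2)
  qed auto
  also have "\<dots> = norm A * norm x" unfolding norm_vec_def[of A] by (rule L2_set_left_distrib[symmetric]) simp
  finally show ?thesis .
qed

lemma norm_transpose_mat_vec_le: "norm (transpose (A :: real^'n^'m) *v x) \<le> norm A * norm x"
proof -
  let ?y = "transpose A *v x"
  have "norm ?y * norm ?y = x \<bullet> (A *v ?y)" by (simp add: inner_transpose_vector[symmetric] power2_norm_eq_inner[symmetric] power2_eq_square[symmetric])
  also have "\<dots> \<le> norm x * (norm A * norm ?y)"
    using norm_cauchy_schwarz[of x "A *v ?y"] mult_left_mono[OF norm_mat_vec_le[of A ?y] norm_ge_zero[of x]] by linarith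
  finally have le: "norm ?y * norm ?y \<le> (norm A * norm x) * norm ?y" by (simp add: mult_ac)
  show ?thesis by (cases "?y = 0") (use le in auto)
qed

lemma residual_add: "residual s (\<beta> + h) = residual s \<beta> - snd s *v h"
  by (simp add: residual_def matrix_vector_right_distrib)

lemma norm_snd_le_norm: "norm (snd s) \<le> norm s" by (metis norm_snd_le prod.collapse)

text \<open>Where the residual vanishes the square root is not differentiable, but it grows at most linearly and
  the derivative of \<open>\<rho>\<close> at the origin is zero, so the composition has derivative zero there, in
  accordance with the formula.\<close>

lemma loss_has_derivative:
  fixes J :: "real^'k^'k" and s :: "(real^'k) \<times> (real^'q^'k)"
  assumes C1: "\<rho> C1_differentiable_on UNIV" and u: "continuous_on UNIV (weight_fun \<rho>)"
    and J: "J \<in> PDS" and \<sigma>: "\<sigma> > 0"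
  shows "((\<lambda>\<beta>. \<rho> (sqrt (residual s \<beta> \<bullet> (J *v residual s \<beta>)) / \<sigma>)) has_derivative
    (\<lambda>h. - (1 / \<sigma>\<^sup>2) * (psi (weight_fun \<rho>) J s \<beta> \<sigma> \<bullet> h))) (at \<beta>)"
proof -
  define r where "r = residual s \<beta>"
  have symJ: "x \<bullet> (J *v y) = y \<bullet> (J *v x)" for x y
    using J by (intro inner_matrix_symmetric) (auto simp: PDS_def)
  have res: "(residual s has_derivative (\<lambda>h. - (snd s *v h))) (at \<beta>)"
    unfolding residual_def by (auto intro!: derivative_eq_intros bounded_linear.has_derivative[OF matrix_vector_mul_bounded_linear])
  have Jres: "((\<lambda>\<beta>. J *v residual s \<beta>) has_derivative (\<lambda>h. J *v (- (snd s *v h)))) (at \<beta>)"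
    by (rule bounded_linear.has_derivative[OF matrix_vector_mul_bounded_linear res])
  have q: "((\<lambda>\<beta>. residual s \<beta> \<bullet> (J *v residual s \<beta>)) has_derivative (\<lambda>h. - 2 * ((snd s *v h) \<bullet> (J *v r)))) (at \<beta>)"
    by (rule has_derivative_eq_rhs[OF has_derivative_inner[OF res Jres]])
      (auto simp: r_def[symmetric] symJ[of r] fun_eq_iff)
  show ?thesis
  proof (cases "r = 0")
    case False
    define Q where "Q = r \<bullet> (J *v r)"
    have Q: "Q > 0" using J False by (auto simp: Q_def PDS_def)
    have sq: "((\<lambda>\<beta>. sqrt (residual s \<beta> \<bullet> (J *v residual s \<beta>)) / \<sigma>) has_derivative (\<lambda>h. (- ((snd s *v h) \<bullet> (J *v r)) / sqrt Q) / \<sigma>)) (at \<beta>)"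
    proof -
      have "((\<lambda>\<beta>. sqrt (residual s \<beta> \<bullet> (J *v residual s \<beta>))) has_derivative (\<lambda>h. (- 2 * ((snd s *v h) \<bullet> (J *v r))) * (inverse (sqrt Q) / 2))) (at \<beta>)"
        using DERIV_real_sqrt[OF Q] q unfolding Q_def r_def has_field_derivative_def
        by (intro has_derivative_eq_rhs[OF has_derivative_compose[OF q]]) (auto simp: r_def mult.commute)
      then have "((\<lambda>\<beta>. sqrt (residual s \<beta> \<bullet> (J *v residual s \<beta>)) / \<sigma>) has_derivative (\<lambda>h. (- 2 * ((snd s *v h) \<bullet> (J *v r))) * (inverse (sqrt Q) / 2) / \<sigma>)) (at \<beta>)"
        by (rule bounded_linear.has_derivative[OF bounded_linear_divide])
      then show ?thesis by (rule has_derivative_eq_rhs) (simp add: fun_eq_iff field_simps)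
    qed
    have \<rho>': "(\<rho> has_derivative (*) (sqrt Q / \<sigma> * weight_fun \<rho> (sqrt Q / \<sigma>))) (at (sqrt (residual s \<beta> \<bullet> (J *v residual s \<beta>)) / \<sigma>))"
      using C1_deriv(1)[OF C1, of "sqrt Q / \<sigma>"] unfolding has_field_derivative_def deriv_eq_weight[OF C1 u] by (simp only: Q_def r_def)
    have "psi (weight_fun \<rho>) J s \<beta> \<sigma> \<bullet> h = weight_fun \<rho> (sqrt Q / \<sigma>) * ((snd s *v h) \<bullet> (J *v r))" for h
      unfolding psi_def r_def[symmetric] Q_def[symmetric] by (simp only: inner_scaleR_left inner_transpose_vector inner_commute[of "J *v r"])
    then have "(sqrt Q / \<sigma> * weight_fun \<rho> (sqrt Q / \<sigma>)) * ((- ((snd s *v h) \<bullet> (J *v r)) / sqrt Q) / \<sigma>)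
        = - (1 / \<sigma>\<^sup>2) * (psi (weight_fun \<rho>) J s \<beta> \<sigma> \<bullet> h)" for h
      using Q \<sigma> by (simp add: field_simps power2_eq_square)
    then show ?thesis
      by (intro has_derivative_eq_rhs[OF has_derivative_compose[OF sq \<rho>']] ext)
  next
    case True
    have psi0: "psi (weight_fun \<rho>) J s \<beta> \<sigma> = 0" using True by (simp add: psi_def r_def)
    define K where "K = norm (snd s) * sqrt (norm J) / \<sigma>"
    have K: "K \<ge> 0" using \<sigma> by (simp add: K_def)
    have bound: "\<bar>sqrt (residual s y \<bullet> (J *v residual s y)) / \<sigma>\<bar> \<le> K * norm (y - \<beta>)" for y
    proof -
      have ry: "residual s y = - (snd s *v (y - \<beta>))"
        using residual_add[of s \<beta> "y - \<beta>"] True by (simp add: r_def)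
      have "residual s y \<bullet> (J *v residual s y) \<le> norm (residual s y) * (norm J * norm (residual s y))"
        using norm_cauchy_schwarz[of "residual s y" "J *v residual s y"] mult_left_mono[OF norm_mat_vec_le[of J "residual s y"] norm_ge_zero[of "residual s y"]] by linarith
      also have "\<dots> = norm J * (norm (residual s y))\<^sup>2" by (simp add: power2_eq_square)
      also have "\<dots> \<le> norm J * (norm (snd s) * norm (y - \<beta>))\<^sup>2"
        unfolding ry norm_minus_cancel by (intro mult_left_mono power_mono norm_mat_vec_le) auto
      finally have "sqrt (residual s y \<bullet> (J *v residual s y)) \<le> sqrt (norm J * (norm (snd s) * norm (y - \<beta>))\<^sup>2)" by simp
      also have "\<dots> = sqrt (norm J) * (norm (snd s) * norm (y - \<beta>))" by (simp add: real_sqrt_mult)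
      finally have "sqrt (residual s y \<bullet> (J *v residual s y)) / \<sigma> \<le> sqrt (norm J) * (norm (snd s) * norm (y - \<beta>)) / \<sigma>"
        using \<sigma> by (intro divide_right_mono) auto
      moreover have "0 \<le> residual s y \<bullet> (J *v residual s y)" using J by (cases "residual s y = 0") (auto simp: PDS_def less_imp_le)
      ultimately show ?thesis using \<sigma> by (simp add: K_def field_simps)
    qed
    have "(\<rho> has_derivative (*) 0) (at 0)"
      using C1_deriv(1)[OF C1, of 0] unfolding has_field_derivative_def deriv_eq_weight[OF C1 u] by (simp only: mult_zero_left)
    then have small: "\<exists>d>0. \<forall>y. norm (y - 0) < d \<longrightarrow> norm (\<rho> y - \<rho> 0 - 0 * (y - 0)) \<le> e * norm (y - 0)" if "e > 0" for e
      using that unfolding has_derivative_at_alt by blast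
    show ?thesis unfolding has_derivative_at_alt
    proof (intro conjI allI impI)
      show "bounded_linear (\<lambda>h. - (1 / \<sigma>\<^sup>2) * (psi (weight_fun \<rho>) J s \<beta> \<sigma> \<bullet> h))"
        by (intro bounded_linear_intros)
      fix e :: real assume e: "e > 0"
      have "e / (K + 1) > 0" using e K by simp
      then obtain d where d: "d > 0" "\<And>y. \<bar>y\<bar> < d \<Longrightarrow> \<bar>\<rho> y - \<rho> 0\<bar> \<le> e / (K + 1) * \<bar>y\<bar>"
        using small by force
      have "\<bar>\<rho> (sqrt (residual s y \<bullet> (J *v residual s y)) / \<sigma>) - \<rho> 0\<bar> \<le> e * norm (y - \<beta>)" if y: "norm (y - \<beta>) < d / (K + 1)" for y
      proof -
        let ?x = "sqrt (residual s y \<bullet> (J *v residual s y)) / \<sigma>"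
        have x: "\<bar>?x\<bar> \<le> (K + 1) * norm (y - \<beta>)" using bound[of y] by (simp add: distrib_right) (use norm_ge_zero[of "y - \<beta>"] in linarith)
        also have "\<dots> < d" using y K by (simp add: field_simps)
        finally have "\<bar>\<rho> ?x - \<rho> 0\<bar> \<le> e / (K + 1) * \<bar>?x\<bar>" by (rule d(2))
        also have "\<dots> \<le> e / (K + 1) * ((K + 1) * norm (y - \<beta>))" using x e K by (intro mult_left_mono) auto
        also have "\<dots> = e * norm (y - \<beta>)" using K by (simp add: add_nonneg_eq_0_iff)
        finally show ?thesis .
      qed
      then show "\<exists>d>0. \<forall>y. norm (y - \<beta>) < d \<longrightarrow> norm (\<rho> (sqrt (residual s y \<bullet> (J *v residual s y)) / \<sigma>) - \<rho> (sqrt (residual s \<beta> \<bullet> (J *v residual s \<beta>)) / \<sigma>) -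
           - (1 / \<sigma>\<^sup>2) * (psi (weight_fun \<rho>) J s \<beta> \<sigma> \<bullet> (y - \<beta>))) \<le> e * norm (y - \<beta>)"
        using d K True by (intro exI[of _ "d / (K + 1)"]) (auto simp: psi0 r_def)
    qed
  qed
qed

lemma integral_empirical_measure:
  fixes f :: "'a::topological_space \<Rightarrow> real"
  assumes "f \<in> borel_measurable borel" "n > 0"
  shows "(\<integral>s. f s \<partial>empirical_measure S n \<omega>) = (\<Sum>i<n. f (S i \<omega>)) / n"
proof -
  have "(\<lambda>i. S i \<omega>) \<in> uniform_count_measure {..<n} \<rightarrow>\<^sub>M borel"
    by (auto simp: measurable_def uniform_count_measure_def sets_point_measure space_point_measure)
  then show ?thesis
    unfolding empirical_measure_def using assms by (subst integral_distr) (auto simp: integral_uniform_count_measure)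
qed

lemma continuous_residual [continuous_intros]: "continuous_on A (\<lambda>s. residual s \<beta>)"
  unfolding residual_def matrix_vector_mult_def by (intro continuous_intros)

lemma continuous_quadratic [continuous_intros]: "continuous_on A (\<lambda>s. residual s \<beta> \<bullet> (J *v residual s \<beta>))"
  by (intro continuous_intros continuous_on_compose2[OF matrix_vector_mult_linear_continuous_on[of UNIV J]]) auto

lemma loss_measurable:
  fixes \<rho> :: "real \<Rightarrow> real"
  assumes "\<rho> C1_differentiable_on UNIV" "\<sigma> > 0"
  shows "(\<lambda>s. \<rho> (sqrt (residual s \<beta> \<bullet> (J *v residual s \<beta>)) / \<sigma>)) \<in> borel_measurable borel"
proof (rule borel_measurable_continuous_onI)
  have "continuous_on UNIV \<rho>" using C1_deriv(1)[OF assms(1)] by (meson DERIV_isCont continuous_at_imp_continuous_on)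
  then show "continuous_on UNIV (\<lambda>s. \<rho> (sqrt (residual s \<beta> \<bullet> (J *v residual s \<beta>)) / \<sigma>))"
    by (rule continuous_on_compose2) (use assms(2) in \<open>auto intro!: continuous_intros\<close>)
qed

text \<open>The admissible \<open>\<beta>\<close> for a given \<open>\<gamma>\<close> are all vectors, so a local minimum in both variables is an
  unconstrained local minimum in \<open>\<beta>\<close>, at which the derivative of the empirical risk vanishes.\<close>

lemma estimating_equation:
  fixes V :: "real^'l \<Rightarrow> real^'k^'k" and S :: "nat \<Rightarrow> 'w \<Rightarrow> (real^'k) \<times> (real^'q^'k)"
  assumes C1: "\<rho> C1_differentiable_on UNIV" and u: "continuous_on UNIV (weight_fun \<rho>)"
    and n: "n > 0" and \<sigma>: "\<sigma> > 0"
    and min: "local_min_on (\<lambda>(\<beta>, \<gamma>). risk \<rho> (empirical_measure S n \<omega>) \<sigma> \<beta> (V \<gamma>)) (param_set \<Theta> V) (\<beta>, \<gamma>)"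
  shows "(\<Sum>i<n. Psi_beta \<rho> V (S i \<omega>) (\<beta>, \<gamma>) \<sigma>) = 0"
proof -
  define J where "J = matrix_inv (V \<gamma>)"
  have in_set: "(\<beta>, \<gamma>) \<in> param_set \<Theta> V" using min by (simp add: local_min_on_def)
  then have J: "J \<in> PDS" unfolding J_def by (intro PDS_matrix_inv) (auto simp: param_set_def)
  have R: "risk \<rho> (empirical_measure S n \<omega>) \<sigma> b (V \<gamma>) = (\<Sum>i<n. \<rho> (sqrt (residual (S i \<omega>) b \<bullet> (J *v residual (S i \<omega>) b)) / \<sigma>)) / n" for b
    unfolding risk_def mahal_def J_def by (rule integral_empirical_measure[OF loss_measurable[OF C1 \<sigma>] n])
  let ?D = "\<lambda>h. (\<Sum>i<n. - (1 / \<sigma>\<^sup>2) * (psi (weight_fun \<rho>) J (S i \<omega>) \<beta> \<sigma> \<bullet> h)) / n"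
  have der: "((\<lambda>b. risk \<rho> (empirical_measure S n \<omega>) \<sigma> b (V \<gamma>)) has_derivative ?D) (at \<beta>)"
    unfolding R by (intro bounded_linear.has_derivative[OF bounded_linear_divide] has_derivative_sum loss_has_derivative[OF C1 u J \<sigma>])
  have "\<forall>\<^sub>F z in at (\<beta>, \<gamma>) within param_set \<Theta> V. (case (\<beta>, \<gamma>) of (\<beta>, \<gamma>) \<Rightarrow> risk \<rho> (empirical_measure S n \<omega>) \<sigma> \<beta> (V \<gamma>)) \<le> (case z of (\<beta>, \<gamma>) \<Rightarrow> risk \<rho> (empirical_measure S n \<omega>) \<sigma> \<beta> (V \<gamma>))"
    using min unfolding local_min_on_def by blast
  then have "\<forall>\<^sub>F z in at (\<beta>, \<gamma>) within param_set \<Theta> V. risk \<rho> (empirical_measure S n \<omega>) \<sigma> \<beta> (V \<gamma>) \<le> risk \<rho> (empirical_measure S n \<omega>) \<sigma> (fst z) (V (snd z))"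
    by (simp add: case_prod_beta)
  moreover have "filterlim (\<lambda>b. (b, \<gamma>)) (at (\<beta>, \<gamma>) within param_set \<Theta> V) (at \<beta>)"
  proof -
    have "((\<lambda>b. (b, \<gamma>)) \<longlongrightarrow> (\<beta>, \<gamma>)) (at \<beta>)" by (intro tendsto_intros)
    moreover have "\<forall>\<^sub>F b in at \<beta>. (b, \<gamma>) \<in> param_set \<Theta> V - {(\<beta>, \<gamma>)}"
      using in_set by (auto simp: eventually_at_filter param_set_def)
    ultimately show ?thesis by (auto simp: filterlim_at eventually_conj_iff)
  qed
  ultimately have "\<forall>\<^sub>F b in at \<beta>. risk \<rho> (empirical_measure S n \<omega>) \<sigma> \<beta> (V \<gamma>) \<le> risk \<rho> (empirical_measure S n \<omega>) \<sigma> (fst (b, \<gamma>)) (V (snd (b, \<gamma>)))"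
    by (rule eventually_compose_filterlim)
  then have "\<forall>\<^sub>F b in at \<beta>. risk \<rho> (empirical_measure S n \<omega>) \<sigma> \<beta> (V \<gamma>) \<le> risk \<rho> (empirical_measure S n \<omega>) \<sigma> b (V \<gamma>)"
    by simp
  then have "?D = (\<lambda>h. 0)" by (rule has_derivative_local_min[OF der])
  then have "?D h = 0" for h by (rule fun_cong)
  then have "(\<Sum>i<n. psi (weight_fun \<rho>) J (S i \<omega>) \<beta> \<sigma>) \<bullet> h = 0" for h
    using n \<sigma> by (simp add: sum_distrib_left[symmetric] sum_divide_distrib[symmetric] sum_negf inner_sum_left)
  then have "(\<Sum>i<n. psi (weight_fun \<rho>) J (S i \<omega>) \<beta> \<sigma>) = 0" by (metis inner_eq_zero_iff)
  then show ?thesis by (simp add: Psi_beta_eq_psi J_def)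
qed

section \<open>The mean of the score\<close>

lemma psd_quadratic: "J \<in> PDS \<Longrightarrow> 0 \<le> x \<bullet> (J *v (x :: real^'n))"
  by (cases "x = 0") (auto simp: PDS_def less_imp_le)

text \<open>\<open>norm (J r)\<close> is at most \<open>sqrt (norm J)\<close> times the Mahalanobis norm of the residual \<open>r\<close>, so the
  score without its weight, although quadratic in \<open>s\<close>, is of the order of \<open>norm s\<close> where that norm is
  bounded.\<close>

lemma norm_score_le:
  fixes J :: "real^'k^'k" and s :: "(real^'k) \<times> (real^'q^'k)"
  assumes J: "J \<in> PDS" and \<sigma>: "\<sigma> > 0" and c: "c \<ge> 0"
    and d: "sqrt (residual s \<beta> \<bullet> (J *v residual s \<beta>)) / \<sigma> \<le> c"
  shows "norm (transpose (snd s) *v (J *v residual s \<beta>)) \<le> norm s * (sqrt (norm J) * c * \<sigma>)"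
proof -
  let ?r = "residual s \<beta>"
  have "(norm (J *v ?r))\<^sup>2 \<le> norm J * (?r \<bullet> (J *v ?r))" by (rule norm_PDS_mult_le[OF J norm_mat_vec_le])
  then have "norm (J *v ?r) \<le> sqrt (norm J * (?r \<bullet> (J *v ?r)))" by (rule real_le_rsqrt)
  also have "\<dots> = sqrt (norm J) * sqrt (?r \<bullet> (J *v ?r))" by (rule real_sqrt_mult)
  also have "\<dots> \<le> sqrt (norm J) * (c * \<sigma>)" using d \<sigma> by (intro mult_left_mono) (auto simp: field_simps)
  finally have Jr: "norm (J *v ?r) \<le> sqrt (norm J) * (c * \<sigma>)" .
  have "norm (transpose (snd s) *v (J *v ?r)) \<le> norm (snd s) * norm (J *v ?r)" by (rule norm_transpose_mat_vec_le)
  also have "\<dots> \<le> norm s * (sqrt (norm J) * (c * \<sigma>))" using Jr norm_snd_le_norm[of s] by (intro mult_mono) auto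
  finally show ?thesis by (simp add: mult.assoc)
qed

text \<open>The weight vanishes where the Mahalanobis distance exceeds \<open>c\<close>, and elsewhere \<open>norm_score_le\<close>
  applies. This is what makes second moments of the data sufficient.\<close>

lemma norm_psi_le:
  fixes J :: "real^'k^'k" and s :: "(real^'k) \<times> (real^'q^'k)"
  assumes J: "J \<in> PDS" and \<sigma>: "\<sigma> > 0" and c: "c \<ge> 0"
    and u: "\<And>t. t \<ge> c \<Longrightarrow> u t = 0" "\<And>t. t \<ge> 0 \<Longrightarrow> \<bar>u t\<bar> \<le> U"
  shows "norm (psi u J s \<beta> \<sigma>) \<le> U * (sqrt (norm J) * c * \<sigma>) * norm s"
proof -
  let ?d = "sqrt (residual s \<beta> \<bullet> (J *v residual s \<beta>)) / \<sigma>"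
  have U: "U \<ge> 0" using u(2)[of 0] by linarith
  have d0: "?d \<ge> 0" using psd_quadratic[OF J] \<sigma> by simp
  show ?thesis
  proof (cases "?d \<le> c")
    case True
    have "norm (psi u J s \<beta> \<sigma>) = \<bar>u ?d\<bar> * norm (transpose (snd s) *v (J *v residual s \<beta>))" by (simp add: psi_def)
    also have "\<dots> \<le> U * (norm s * (sqrt (norm J) * c * \<sigma>))"
      using u(2)[OF d0] norm_score_le[OF J \<sigma> c True] U by (intro mult_mono) auto
    finally show ?thesis by (simp add: mult_ac)
  next
    case False
    then show ?thesis using u(1)[of ?d] U c \<sigma> by (simp add: psi_def)
  qed
qed

lemma continuous_psi:
  assumes "continuous_on UNIV u" "\<sigma> > 0"
  shows "continuous_on A (\<lambda>s :: (real^'k) \<times> (real^'q^'k). psi u J s \<beta> \<sigma>)"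
proof -
  have 1: "continuous_on A (\<lambda>s :: (real^'k) \<times> (real^'q^'k). u (sqrt (residual s \<beta> \<bullet> (J *v residual s \<beta>)) / \<sigma>))"
    by (rule continuous_on_compose2[OF assms(1)]) (use assms(2) in \<open>auto intro!: continuous_intros\<close>)
  have 2: "continuous_on A (\<lambda>s :: (real^'k) \<times> (real^'q^'k). transpose (snd s) *v (J *v residual s \<beta>))"
    by (simp only: matrix_vector_mult_def transpose_def vec_lambda_beta) (intro continuous_intros)
  show ?thesis unfolding psi_def by (intro continuous_intros 1 2)
qed

lemma integral_vec_component:
  fixes f :: "'a \<Rightarrow> real^'n"
  assumes "integrable M f"
  shows "(\<integral>x. f x \<partial>M) $ i = (\<integral>x. f x $ i \<partial>M)" "integrable M (\<lambda>x. f x $ i)"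
proof -
  have "(\<integral>x. f x \<bullet> axis i 1 \<partial>M) = (\<integral>x. f x \<partial>M) \<bullet> axis i 1" by (intro integral_inner_left assms)
  then show "(\<integral>x. f x \<partial>M) $ i = (\<integral>x. f x $ i \<partial>M)" by (simp add: inner_axis)
  have "integrable M (\<lambda>x. f x \<bullet> axis i 1)" by (intro integrable_inner_left assms)
  then show "integrable M (\<lambda>x. f x $ i)" by (simp add: inner_axis)
qed

context
  fixes \<rho> :: "real \<Rightarrow> real" and c1 :: real and P :: "((real^'k) \<times> (real^'q^'k)) measure"
  assumes C1: "\<rho> C1_differentiable_on UNIV" and ucont: "continuous_on UNIV (weight_fun \<rho>)"
    and c1: "c1 > 0" "mono_on {0..c1} \<rho>" "\<rho> constant_on {c1..}" and \<rho>0: "\<forall>x. 0 \<le> \<rho> x"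
    and bv: "bounded_variation (weight_fun \<rho>)"
    and P: "prob_space P" "sets P = sets borel" "integrable P (\<lambda>s. (norm s)\<^sup>2)"
begin

lemma weight_zero: "t \<ge> c1 \<Longrightarrow> weight_fun \<rho> t = 0"
  using weight_fun_vanishes[OF C1 ucont c1(1,3)] .

lemma weight_bound: obtains U where "U \<ge> 0" "\<And>t. \<bar>weight_fun \<rho> t\<bar> \<le> U"
proof -
  obtain v :: "real \<Rightarrow> real" and B where v: "\<And>x. 0 \<le> v x" "\<And>x. v x \<le> B" "\<And>a b. \<bar>weight_fun \<rho> a - weight_fun \<rho> b\<bar> \<le> \<bar>v a - v b\<bar>"
    by (rule bounded_variation_dominated_by_mono[OF bv]) blast
  have "\<bar>weight_fun \<rho> t\<bar> \<le> B" for t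
    using v(3)[of t c1] weight_zero[of c1] v(1)[of t] v(1)[of c1] v(2)[of t] v(2)[of c1] by simp
  then show ?thesis using v(1)[of 0] v(2)[of 0] by (intro that[of B]) auto
qed

lemma loss_bound: "0 \<le> x \<Longrightarrow> \<bar>\<rho> x\<bar> \<le> \<rho> c1"
proof -
  assume x: "0 \<le> x"
  obtain k where k: "\<And>x. x \<ge> c1 \<Longrightarrow> \<rho> x = k" using c1(3) by (auto simp: constant_on_def)
  have "\<rho> x \<le> \<rho> c1"
  proof (cases "x \<le> c1")
    case True
    then show ?thesis using c1(1,2) x by (auto simp: mono_on_def)
  next
    case False
    then show ?thesis using k[of x] k[of c1] by simp
  qed
  then show ?thesis using \<rho>0 by simp
qed

lemma norm_integrable: "integrable P norm"
proof -
  interpret prob_space P by fact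
  show ?thesis by (rule square_integrable_imp_integrable) (use P in \<open>auto cong: measurable_cong_sets\<close>)
qed

lemma psi_borel: "\<sigma> > 0 \<Longrightarrow> (\<lambda>s. psi (weight_fun \<rho>) J s \<beta> \<sigma>) \<in> borel_measurable borel"
  by (intro borel_measurable_continuous_onI continuous_psi ucont)

lemma psi_integrable:
  assumes "J \<in> PDS" "\<sigma> > 0"
  shows "integrable P (\<lambda>s. psi (weight_fun \<rho>) J s \<beta> \<sigma>)"
proof -
  obtain U where U: "U \<ge> 0" "\<And>t. \<bar>weight_fun \<rho> t\<bar> \<le> U" by (rule weight_bound) blast
  let ?L = "U * (sqrt (norm J) * c1 * \<sigma>)"
  have L: "?L \<ge> 0" using U c1 assms by simp
  show ?thesis
  proof (rule Bochner_Integration.integrable_bound[of P "\<lambda>s. ?L * norm s"])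
    show "integrable P (\<lambda>s. ?L * norm s)" using norm_integrable by simp
    show "(\<lambda>s. psi (weight_fun \<rho>) J s \<beta> \<sigma>) \<in> borel_measurable P"
      using psi_borel[OF assms(2)] P(2) by (simp cong: measurable_cong_sets)
    show "AE s in P. norm (psi (weight_fun \<rho>) J s \<beta> \<sigma>) \<le> norm (?L * norm s)"
    proof (rule AE_I2)
      fix s
      have "norm (psi (weight_fun \<rho>) J s \<beta> \<sigma>) \<le> ?L * norm s"
        using U c1 weight_zero by (intro norm_psi_le assms) auto
      also have "\<dots> \<le> norm (?L * norm s)" by simp
      finally show "norm (psi (weight_fun \<rho>) J s \<beta> \<sigma>) \<le> norm (?L * norm s)" .
    qed
  qed
qed

text \<open>Differentiation under the integral: by the bound for the score the loss is Lipschitz in \<open>\<beta>\<close> with a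
  constant proportional to \<open>norm s\<close>, so the difference quotients are dominated.\<close>

lemma risk_has_derivative:
  assumes J: "J \<in> PDS" and \<sigma>: "\<sigma> > 0"
  shows "((\<lambda>\<beta>. \<integral>s. \<rho> (sqrt (residual s \<beta> \<bullet> (J *v residual s \<beta>)) / \<sigma>) \<partial>P) has_derivative
    (\<lambda>h. - (1 / \<sigma>\<^sup>2) * ((\<integral>s. psi (weight_fun \<rho>) J s \<beta> \<sigma> \<partial>P) \<bullet> h))) (at \<beta>)"
proof -
  interpret prob_space P by fact
  obtain U where U: "U \<ge> 0" "\<And>t. \<bar>weight_fun \<rho> t\<bar> \<le> U" by (rule weight_bound) blast
  define L where "L = (1 / \<sigma>\<^sup>2) * (U * (sqrt (norm J) * c1 * \<sigma>))"
  have L: "L \<ge> 0" using U c1 \<sigma> by (simp add: L_def)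
  define F :: "(real^'k) \<times> (real^'q^'k) \<Rightarrow> real^'q \<Rightarrow> real" where "F = (\<lambda>s \<beta>. \<rho> (sqrt (residual s \<beta> \<bullet> (J *v residual s \<beta>)) / \<sigma>))"
  define D :: "(real^'k) \<times> (real^'q^'k) \<Rightarrow> real^'q \<Rightarrow> real^'q \<Rightarrow> real" where "D = (\<lambda>s \<beta> h. - (1 / \<sigma>\<^sup>2) * (psi (weight_fun \<rho>) J s \<beta> \<sigma> \<bullet> h))"
  have FD: "((\<lambda>\<beta>. F s \<beta>) has_derivative D s \<beta>) (at \<beta>)" for s :: "(real^'k) \<times> (real^'q^'k)" and \<beta>
    unfolding F_def D_def by (rule loss_has_derivative[OF C1 ucont J \<sigma>])
  have Fe: "\<rho> (sqrt (residual s b \<bullet> (J *v residual s b)) / \<sigma>) = F s b" for s b by (simp add: F_def)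
  have Dle: "\<bar>D s \<beta> h\<bar> \<le> L * norm s * norm h" for s \<beta> h
  proof -
    have "\<bar>D s \<beta> h\<bar> = (1 / \<sigma>\<^sup>2) * \<bar>psi (weight_fun \<rho>) J s \<beta> \<sigma> \<bullet> h\<bar>" by (simp add: D_def abs_mult)
    also have "\<dots> \<le> (1 / \<sigma>\<^sup>2) * (norm (psi (weight_fun \<rho>) J s \<beta> \<sigma>) * norm h)"
      by (intro mult_left_mono Cauchy_Schwarz_ineq2) auto
    also have "\<dots> \<le> (1 / \<sigma>\<^sup>2) * ((U * (sqrt (norm J) * c1 * \<sigma>) * norm s) * norm h)"
      using U c1 weight_zero by (intro mult_left_mono mult_right_mono norm_psi_le J \<sigma>) auto
    finally show ?thesis by (simp add: L_def mult_ac)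
  qed
  have lip: "\<bar>F s y - F s \<beta>\<bar> \<le> L * norm s * norm (y - \<beta>)" for s y
  proof -
    have "norm (F s y - F s \<beta>) \<le> (L * norm s) * norm (y - \<beta>)"
    proof (rule differentiable_bound[of UNIV "F s" "D s"])
      show "onorm (D s x) \<le> L * norm s" for x by (rule onorm_le) (use Dle[of s x] in simp)
    qed (use FD in auto)
    then show ?thesis by simp
  qed
  have Fm: "(\<lambda>s. F s \<beta>) \<in> borel_measurable P" for \<beta>
    using loss_measurable[OF C1 \<sigma>, of \<beta> J] P(2) unfolding F_def by (simp cong: measurable_cong_sets)
  have Fint: "integrable P (\<lambda>s. F s \<beta>)" for \<beta>
    by (rule integrable_const_bound[of _ "\<rho> c1"])
      (use Fm psd_quadratic[OF J] \<sigma> in \<open>auto intro!: AE_I2 loss_bound simp: F_def\<close>)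
  have Dint: "integrable P (\<lambda>s. D s \<beta> h)" for h
    unfolding D_def using psi_integrable[OF J \<sigma>] by auto
  have Dval: "(\<integral>s. D s \<beta> h \<partial>P) = - (1 / \<sigma>\<^sup>2) * ((\<integral>s. psi (weight_fun \<rho>) J s \<beta> \<sigma> \<partial>P) \<bullet> h)" for h
    unfolding D_def using psi_integrable[OF J \<sigma>] by simp
  show ?thesis
    unfolding has_derivative_iff_norm
  proof
    show "bounded_linear (\<lambda>h. - (1 / \<sigma>\<^sup>2) * ((\<integral>s. psi (weight_fun \<rho>) J s \<beta> \<sigma> \<partial>P) \<bullet> h))"
      by (intro bounded_linear_intros)
    show "((\<lambda>y. norm ((\<integral>s. \<rho> (sqrt (residual s y \<bullet> (J *v residual s y)) / \<sigma>) \<partial>P) - (\<integral>s. \<rho> (sqrt (residual s \<beta> \<bullet> (J *v residual s \<beta>)) / \<sigma>) \<partial>P) -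
        - (1 / \<sigma>\<^sup>2) * ((\<integral>s. psi (weight_fun \<rho>) J s \<beta> \<sigma> \<partial>P) \<bullet> (y - \<beta>))) / norm (y - \<beta>)) \<longlongrightarrow> 0) (at \<beta>)"
      unfolding Fe Dval[symmetric] tendsto_at_iff_sequentially comp_def
    proof (intro allI impI)
      fix Y assume Y: "\<forall>i. Y i \<in> UNIV - {\<beta>}" "Y \<longlonglongrightarrow> \<beta>"
      define q where "q = (\<lambda>i s. (F s (Y i) - F s \<beta> - D s \<beta> (Y i - \<beta>)) / norm (Y i - \<beta>))"
      have ne: "norm (Y i - \<beta>) > 0" for i using Y(1) by simp
      have "(\<lambda>i. integral\<^sup>L P (q i)) \<longlonglongrightarrow> integral\<^sup>L P (\<lambda>_. 0)"
      proof (rule integral_dominated_convergence[of _ _ _ "\<lambda>s. 2 * L * norm s"])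
        show "q i \<in> borel_measurable P" for i unfolding q_def using Fint[of "Y i"] Fint[of \<beta>] Dint[of "Y i - \<beta>"] by auto
        show "integrable P (\<lambda>s. 2 * L * norm s)" using norm_integrable by simp
        show "AE s in P. (\<lambda>i. q i s) \<longlonglongrightarrow> 0"
        proof (rule AE_I2)
          fix s
          have "((\<lambda>y. norm (F s y - F s \<beta> - D s \<beta> (y - \<beta>)) / norm (y - \<beta>)) \<longlongrightarrow> 0) (at \<beta>)"
            using FD[of s \<beta>] unfolding has_derivative_iff_norm by blast
          then have "(\<lambda>i. norm (F s (Y i) - F s \<beta> - D s \<beta> (Y i - \<beta>)) / norm (Y i - \<beta>)) \<longlonglongrightarrow> 0"
            using Y unfolding tendsto_at_iff_sequentially comp_def by blast
          then have "(\<lambda>i. norm (q i s)) \<longlonglongrightarrow> 0" by (simp add: q_def)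
          then show "(\<lambda>i. q i s) \<longlonglongrightarrow> 0" by (rule tendsto_norm_zero_cancel)
        qed
        show "AE s in P. norm (q i s) \<le> 2 * L * norm s" for i
        proof (rule AE_I2)
          fix s
          have "\<bar>F s (Y i) - F s \<beta> - D s \<beta> (Y i - \<beta>)\<bar> \<le> 2 * L * norm s * norm (Y i - \<beta>)"
            using lip[of s "Y i"] Dle[of s \<beta> "Y i - \<beta>"] by linarith
          then show "norm (q i s) \<le> 2 * L * norm s" using ne[of i] by (simp add: q_def divide_le_eq)
        qed
      qed simp
      then have "(\<lambda>i. \<bar>integral\<^sup>L P (q i)\<bar>) \<longlonglongrightarrow> 0" by (simp add: tendsto_rabs_zero)
      moreover have "norm ((\<integral>s. F s (Y i) \<partial>P) - (\<integral>s. F s \<beta> \<partial>P) - (\<integral>s. D s \<beta> (Y i - \<beta>) \<partial>P)) / norm (Y i - \<beta>) = \<bar>integral\<^sup>L P (q i)\<bar>" for i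
        unfolding q_def using Fint[of "Y i"] Fint[of \<beta>] Dint[of "Y i - \<beta>"] by simp
      ultimately show "(\<lambda>i. norm ((\<integral>s. F s (Y i) \<partial>P) - (\<integral>s. F s \<beta> \<partial>P) - (\<integral>s. D s \<beta> (Y i - \<beta>) \<partial>P)) / norm (Y i - \<beta>)) \<longlonglongrightarrow> 0"
        by simp
    qed
  qed
qed

text \<open>By the preceding lemma \<open>\<Lambda>\<close> is the gradient of \<open>- \<sigma>\<^sup>2\<close> times the risk.\<close>

lemma Lambda_beta_derivative_symmetric:
  assumes J: "J \<in> PDS" and \<sigma>: "\<sigma> > 0"
    and D: "((\<lambda>\<beta>. \<integral>s. psi (weight_fun \<rho>) J s \<beta> \<sigma> \<partial>P) has_derivative D) (at \<beta>)"
  shows "x \<bullet> D y = y \<bullet> D x"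
proof (rule gradient_derivative_symmetric[OF _ _ D])
  fix b :: "real^'q"
  have "((\<lambda>\<beta>. - \<sigma>\<^sup>2 * (\<integral>s. \<rho> (sqrt (residual s \<beta> \<bullet> (J *v residual s \<beta>)) / \<sigma>) \<partial>P)) has_derivative
    (\<lambda>h. - \<sigma>\<^sup>2 * (- (1 / \<sigma>\<^sup>2) * ((\<integral>s. psi (weight_fun \<rho>) J s b \<sigma> \<partial>P) \<bullet> h)))) (at b)"
    by (rule has_derivative_mult_right[OF risk_has_derivative[OF J \<sigma>]])
  then show "((\<lambda>\<beta>. - \<sigma>\<^sup>2 * (\<integral>s. \<rho> (sqrt (residual s \<beta> \<bullet> (J *v residual s \<beta>)) / \<sigma>) \<partial>P)) has_derivative
    (\<lambda>h. (\<integral>s. psi (weight_fun \<rho>) J s b \<sigma> \<partial>P) \<bullet> h)) (at b)"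
    using \<sigma> by (simp add: field_simps)
qed (rule zero_less_one)

text \<open>The reflection at the regression \<open>X b\<close> changes the sign of the residual and keeps the Mahalanobis
  distance and the design, so it changes the sign of the score.\<close>

lemma mean_psi_zero:
  assumes J: "J \<in> PDS" and \<sigma>: "\<sigma> > 0"
    and refl: "distr P borel (\<lambda>s. (2 *\<^sub>R (snd s *v b) - fst s, snd s)) = P"
  shows "(\<integral>s. psi (weight_fun \<rho>) J s b \<sigma> \<partial>P) = 0"
proof -
  define \<tau> where "\<tau> = (\<lambda>s :: (real^'k) \<times> (real^'q^'k). (2 *\<^sub>R (snd s *v b) - fst s, snd s))"
  have "continuous_on UNIV \<tau>" unfolding \<tau>_def matrix_vector_mult_def by (intro continuous_intros)
  then have \<tau>m: "\<tau> \<in> P \<rightarrow>\<^sub>M borel" using borel_measurable_continuous_onI P(2) by (simp cong: measurable_cong_sets)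
  have odd: "psi (weight_fun \<rho>) J (\<tau> s) b \<sigma> = - psi (weight_fun \<rho>) J s b \<sigma>" for s
  proof -
    have res: "residual (\<tau> s) b = - residual s b" by (simp add: residual_def \<tau>_def scaleR_2)
    have snd: "snd (\<tau> s) = snd s" by (simp add: \<tau>_def)
    have neg: "A *v (- x) = - (A *v x)" for A :: "real^'m^'n" and x
      by (simp add: matrix_vector_mult_def vec_eq_iff sum_negf)
    show ?thesis
      unfolding psi_def res snd by (simp only: neg inner_minus_left inner_minus_right minus_minus scaleR_minus_right)
  qed
  have "(\<integral>s. psi (weight_fun \<rho>) J s b \<sigma> \<partial>P) = (\<integral>s. psi (weight_fun \<rho>) J s b \<sigma> \<partial>distr P borel \<tau>)"
    using refl by (simp add: \<tau>_def)
  also have "\<dots> = (\<integral>s. psi (weight_fun \<rho>) J (\<tau> s) b \<sigma> \<partial>P)"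
    by (rule integral_distr[OF \<tau>m psi_borel[OF \<sigma>]])
  also have "\<dots> = - (\<integral>s. psi (weight_fun \<rho>) J s b \<sigma> \<partial>P)" by (simp add: odd)
  finally have "(2 :: real) *\<^sub>R (\<integral>s. psi (weight_fun \<rho>) J s b \<sigma> \<partial>P) = 0" by (simp add: scaleR_2)
  then show ?thesis by simp
qed

end

text \<open>As functions of \<open>E\<close> both sides are measures that agree on measurable rectangles, and \<open>P\<close> is finite.\<close>

lemma disintegration:
  fixes P :: "('a::{second_countable_topology} \<times> 'b::{second_countable_topology}) measure"
  assumes P: "prob_space P" "sets P = sets borel" and K: "regular_cond_distr P K" and E: "E \<in> sets borel"
  shows "emeasure P E = (\<integral>\<^sup>+X. emeasure (K X) {y. (y, X) \<in> E} \<partial>distr P borel snd)"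
proof -
  interpret prob_space P by fact
  have Km: "K \<in> borel \<rightarrow>\<^sub>M prob_algebra borel"
    and Ke: "\<And>A B. A \<in> sets borel \<Longrightarrow> B \<in> sets borel \<Longrightarrow> emeasure P (A \<times> B) = (\<integral>\<^sup>+X. emeasure (K X) A * indicator B X \<partial>distr P borel snd)"
    using K unfolding regular_cond_distr_def by auto
  have Ks: "K \<in> borel \<rightarrow>\<^sub>M subprob_algebra borel" using measurable_prob_algebraD[OF Km] .
  have setsK: "sets (K X) = sets borel" "space (K X) = UNIV" for X
    using measurable_space[OF Ks, of X] by (auto simp: space_subprob_algebra dest: sets_eq_imp_space_eq)
  have sndm: "snd \<in> P \<rightarrow>\<^sub>M borel" using P(2) by (simp add: borel_prod[symmetric] cong: measurable_cong_sets)
  define N where "N = distr P borel snd"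
  define G where "G = (\<lambda>X. distr (K X) (borel :: ('a \<times> 'b) measure) (\<lambda>y. (y, X)))"
  have pair: "(\<lambda>(X, y). (y, X)) \<in> (borel :: 'b measure) \<Otimes>\<^sub>M (borel :: 'a measure) \<rightarrow>\<^sub>M (borel :: ('a \<times> 'b) measure)"
    unfolding borel_prod[symmetric] by (rule measurable_pair_swap')
  have Gm: "G \<in> borel \<rightarrow>\<^sub>M subprob_algebra borel"
    unfolding G_def by (rule measurable_distr2[OF pair Ks])
  have sl: "(\<lambda>y :: 'a. (y, X :: 'b)) \<in> borel \<rightarrow>\<^sub>M borel" for X by (simp add: borel_prod[symmetric])
  have slK: "(\<lambda>y :: 'a. (y, X :: 'b)) \<in> K X \<rightarrow>\<^sub>M borel" for X using sl setsK by (simp cong: measurable_cong_sets)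
  have G_em: "emeasure (G X) E = emeasure (K X) {y. (y, X) \<in> E}" if "E \<in> sets borel" for E X
    unfolding G_def using that slK[of X] setsK(2)[of X] by (subst emeasure_distr) (auto simp: vimage_def)
  define Q where "Q = N \<bind> G"
  have GN: "G \<in> N \<rightarrow>\<^sub>M subprob_algebra borel" using Gm by (simp add: N_def cong: measurable_cong_sets)
  have Q_em: "emeasure Q E = (\<integral>\<^sup>+X. emeasure (K X) {y. (y, X) \<in> E} \<partial>N)" if "E \<in> sets borel" for E
    unfolding Q_def using GN that by (subst emeasure_bind) (auto simp: N_def G_em)
  have Q_sets: "sets Q = sets borel" unfolding Q_def by (rule sets_bind[OF _]) (use measurable_space[OF GN] in \<open>auto simp: N_def space_subprob_algebra\<close>)
  have "P = Q"
  proof (rule measure_eqI_generator_eq[where E="{A \<times> B | A B. A \<in> sets borel \<and> B \<in> sets borel}" and \<Omega>=UNIV and A="\<lambda>_. UNIV"])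
    show "Int_stable {A \<times> B | A B. A \<in> sets (borel :: 'a measure) \<and> B \<in> sets (borel :: 'b measure)}"
      unfolding Int_stable_def by (auto simp: Times_Int_Times) (metis sets.Int)
    have gen: "sets (borel :: ('a \<times> 'b) measure) = sigma_sets UNIV {A \<times> B | A B. A \<in> sets borel \<and> B \<in> sets borel}"
      unfolding borel_prod[symmetric] sets_pair_measure by simp
    show "sets P = sigma_sets UNIV {A \<times> B | A B. A \<in> sets borel \<and> B \<in> sets borel}" using P(2) gen by simp
    show "sets Q = sigma_sets UNIV {A \<times> B | A B. A \<in> sets borel \<and> B \<in> sets borel}" using Q_sets gen by simp
    show "range (\<lambda>_. UNIV) \<subseteq> {A \<times> B | A B. A \<in> sets (borel :: 'a measure) \<and> B \<in> sets (borel :: 'b measure)}"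
      by (auto intro!: exI[of _ UNIV])
    fix R assume "R \<in> {A \<times> B | A B. A \<in> sets (borel :: 'a measure) \<and> B \<in> sets (borel :: 'b measure)}"
    then obtain A B where R: "R = A \<times> B" "A \<in> sets borel" "B \<in> sets borel" by blast
    have Rs: "R \<in> sets borel" unfolding R(1) borel_prod[symmetric] using R by simp
    have "emeasure (K X) {y. (y, X) \<in> R} = emeasure (K X) A * indicator B X" for X
      unfolding R(1) by (auto simp: indicator_def)
    then have "emeasure Q R = (\<integral>\<^sup>+X. emeasure (K X) A * indicator B X \<partial>N)" by (simp only: Q_em[OF Rs])
    then show "emeasure P R = emeasure Q R" by (simp only: R(1) Ke[OF R(2,3)] N_def)
  qed (auto simp: emeasure_eq_measure)
  then show ?thesis using Q_em[OF E] by (simp add: N_def)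
qed

text \<open>For almost every \<open>X\<close> the symmetry says that the conditional distribution gives the same mass to a
  section of an event and to its mirror image at \<open>X b\<close>; integrating over \<open>X\<close> gives the invariance.\<close>

lemma reflection_invariance:
  fixes P :: "((real^'k) \<times> (real^'q^'k)) measure"
  assumes P: "prob_space P" "sets P = sets borel" and sym: "point_of_symmetry P b"
  shows "distr P borel (\<lambda>s. (2 *\<^sub>R (snd s *v b) - fst s, snd s)) = P"
proof -
  define \<tau> where "\<tau> = (\<lambda>s :: (real^'k) \<times> (real^'q^'k). (2 *\<^sub>R (snd s *v b) - fst s, snd s))"
  have \<tau>b: "\<tau> \<in> borel \<rightarrow>\<^sub>M borel"
    unfolding \<tau>_def matrix_vector_mult_def by (intro borel_measurable_continuous_onI continuous_intros)
  then have \<tau>m: "\<tau> \<in> P \<rightarrow>\<^sub>M borel" using P(2) by (simp cong: measurable_cong_sets)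
  obtain K where K: "regular_cond_distr P K" and
    inv: "AE X in distr P borel snd. \<forall>A \<in> sets borel.
        measure (K X) ((\<lambda>y. X *v b + y) ` A) = measure (K X) ((\<lambda>y. X *v b - y) ` A)"
    using sym unfolding point_of_symmetry_def by blast
  have Ks: "K \<in> borel \<rightarrow>\<^sub>M prob_algebra borel" using K by (simp add: regular_cond_distr_def)
  have Kp: "prob_space (K X)" for X using measurable_space[OF Ks, of X] by (auto simp: space_prob_algebra)
  have "distr P borel \<tau> = P"
  proof (rule measure_eqI)
    fix E assume "E \<in> sets (distr P borel \<tau>)"
    then have E: "E \<in> sets borel" by simp
    have pre: "\<tau> -` E \<in> sets borel" using measurable_sets[OF \<tau>b E] by simp
    have sp: "space P = UNIV" using sets_eq_imp_space_eq[OF P(2)] by simp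
    have "emeasure (distr P borel \<tau>) E = emeasure P (\<tau> -` E)" using \<tau>m E sp by (simp add: emeasure_distr)
    also have "\<dots> = (\<integral>\<^sup>+X. emeasure (K X) {y. (y, X) \<in> \<tau> -` E} \<partial>distr P borel snd)"
      by (rule disintegration[OF P K pre])
    also have "\<dots> = (\<integral>\<^sup>+X. emeasure (K X) {y. (y, X) \<in> E} \<partial>distr P borel snd)"
    proof (rule nn_integral_cong_AE, use inv in eventually_elim)
      case (elim X)
      define A where "A = {z. (X *v b + z, X) \<in> E}"
      have sec: "(\<lambda>z. (X *v b + z, X)) \<in> borel \<rightarrow>\<^sub>M (borel :: ((real^'k) \<times> (real^'q^'k)) measure)"
        by (intro borel_measurable_continuous_onI continuous_intros)
      have "A \<in> sets borel" using measurable_sets[OF sec E] by (simp add: A_def vimage_def)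
      then have m: "measure (K X) ((\<lambda>y. X *v b + y) ` A) = measure (K X) ((\<lambda>y. X *v b - y) ` A)" using elim by blast
      have 1: "(\<lambda>y. X *v b + y) ` A = {y. (y, X) \<in> E}"
      proof (intro set_eqI iffI)
        fix y assume "y \<in> {y. (y, X) \<in> E}"
        then show "y \<in> (\<lambda>y. X *v b + y) ` A" by (intro image_eqI[of _ _ "y - X *v b"]) (auto simp: A_def)
      qed (auto simp: A_def)
      have 2: "(\<lambda>y. X *v b - y) ` A = {y. (y, X) \<in> \<tau> -` E}"
      proof (intro set_eqI iffI)
        fix y assume "y \<in> {y. (y, X) \<in> \<tau> -` E}"
        then show "y \<in> (\<lambda>y. X *v b - y) ` A" by (intro image_eqI[of _ _ "X *v b - y"]) (auto simp: A_def \<tau>_def scaleR_2 algebra_simps)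
      qed (auto simp: A_def \<tau>_def scaleR_2)
      interpret KX: prob_space "K X" by (rule Kp)
      show ?case using m unfolding 1 2 by (simp add: KX.emeasure_eq_measure)
    qed
    also have "\<dots> = emeasure P E" by (rule disintegration[OF P K E, symmetric])
    finally show "emeasure (distr P borel \<tau>) E = emeasure P E" .
  qed (use P in simp)
  then show ?thesis by (simp add: \<tau>_def)
qed

section \<open>Equicontinuity of the score\<close>

text \<open>The values \<open>B s s\<close> depend linearly on finitely many features of \<open>s\<close>, the products of coordinates,
  with coefficients that carry the parameter.\<close>

lemma quadratic_form_expansion:
  fixes B :: "'e::euclidean_space \<Rightarrow> 'e \<Rightarrow> real"
  assumes "bilinear B"
  shows "B s s = (\<Sum>e\<in>Basis. \<Sum>e'\<in>Basis. B e e' * ((s \<bullet> e) * (s \<bullet> e')))"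
proof -
  have l: "linear (\<lambda>x. B x y)" and r: "linear (B x)" for x y using assms by (auto simp: bilinear_def)
  have "B s s = B (\<Sum>e\<in>Basis. (s \<bullet> e) *\<^sub>R e) (\<Sum>e'\<in>Basis. (s \<bullet> e') *\<^sub>R e')" by (simp add: euclidean_representation)
  also have "\<dots> = (\<Sum>e\<in>Basis. (s \<bullet> e) * B e (\<Sum>e'\<in>Basis. (s \<bullet> e') *\<^sub>R e'))"
    by (subst linear_sum[OF l]) (simp add: linear_scale[OF l])
  also have "\<dots> = (\<Sum>e\<in>Basis. (s \<bullet> e) * (\<Sum>e'\<in>Basis. (s \<bullet> e') * B e e'))"
    by (intro sum.cong refl, subst linear_sum[OF r]) (simp add: linear_scale[OF r])
  finally show ?thesis by (simp add: sum_distrib_left mult_ac)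
qed

lemma residual_linear: "linear (\<lambda>s. residual s \<beta>)"
  by (rule linearI)
    (simp_all add: residual_def matrix_vector_mult_add_rdistrib scaleR_matrix_vector_assoc algebra_simps)

lemma bilinear_score:
  fixes J :: "real^'k^'k" and \<beta> :: "real^'q" and j :: 'q
  shows "bilinear (\<lambda>(s :: (real^'k) \<times> (real^'q^'k)) (s' :: (real^'k) \<times> (real^'q^'k)). (transpose (snd s) *v (J *v residual s' \<beta>)) $ j)"
    and "bilinear (\<lambda>(s :: (real^'k) \<times> (real^'q^'k)) (s' :: (real^'k) \<times> (real^'q^'k)). residual s \<beta> \<bullet> (J *v residual s' \<beta>))"
proof -
  have lin: "linear (\<lambda>s :: (real^'k) \<times> (real^'q^'k). J *v residual s \<beta>)"
    using linear_compose[OF residual_linear matrix_vector_mul_linear[of J]] by (simp add: comp_def)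
  have comp: "(transpose (snd s) *v z) $ j = (\<Sum>i\<in>UNIV. snd s $ i $ j * z $ i)" for s :: "(real^'k) \<times> (real^'q^'k)" and z
    by (simp only: matrix_vector_mult_def transpose_def vec_lambda_beta)
  show "bilinear (\<lambda>(s :: (real^'k) \<times> (real^'q^'k)) (s' :: (real^'k) \<times> (real^'q^'k)). (transpose (snd s) *v (J *v residual s' \<beta>)) $ j)"
  proof -
    have l1: "linear (\<lambda>s :: (real^'k) \<times> (real^'q^'k). (transpose (snd s) *v z) $ j)" for z
      unfolding comp by (rule linearI) (simp_all add: algebra_simps sum.distrib sum_distrib_left)
    have l2: "linear (\<lambda>s' :: (real^'k) \<times> (real^'q^'k). (B *v (J *v residual s' \<beta>)) $ j)" for B :: "real^'k^'q"
      by (rule linearI) (simp_all only: linear_add[OF lin] linear_scale[OF lin] matrix_vector_right_distrib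
        matrix_vector_mult_scaleR vector_add_component vector_scaleR_component real_scaleR_def)
    show ?thesis unfolding bilinear_def
    proof (intro conjI allI)
      fix y :: "(real^'k) \<times> (real^'q^'k)"
      show "linear (\<lambda>s :: (real^'k) \<times> (real^'q^'k). (transpose (snd s) *v (J *v residual y \<beta>)) $ j)" by (rule l1)
      show "linear (\<lambda>s'. (transpose (snd y) *v (J *v residual s' \<beta>)) $ j)" by (rule l2)
    qed
  qed
  show "bilinear (\<lambda>(s :: (real^'k) \<times> (real^'q^'k)) (s' :: (real^'k) \<times> (real^'q^'k)). residual s \<beta> \<bullet> (J *v residual s' \<beta>))"
  proof -
    have l1: "linear (\<lambda>s :: (real^'k) \<times> (real^'q^'k). residual s \<beta> \<bullet> w)" for w
      by (rule linearI) (simp_all only: linear_add[OF residual_linear] linear_scale[OF residual_linear] inner_add_left inner_scaleR_left real_scaleR_def)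
    have l2: "linear (\<lambda>s' :: (real^'k) \<times> (real^'q^'k). w \<bullet> (J *v residual s' \<beta>))" for w
      by (rule linearI) (simp_all only: linear_add[OF lin] linear_scale[OF lin] inner_add_right inner_scaleR_right real_scaleR_def)
    show ?thesis unfolding bilinear_def by (intro conjI allI l1 l2)
  qed
qed

text \<open>The square on the left is bounded by a first power on the right because \<open>\<bar>a - a'\<bar> + \<bar>b - b'\<bar>\<close> is at
  most \<open>2\<close>.\<close>

lemma sum_mixed_products_le:
  fixes x x' g g' a a' b b' K C :: real
  assumes x: "x = g * (K * (2 * a - 1))" "x' = g' * (K * (2 * a' - 1))" and K: "K \<ge> 0"
    and a: "0 \<le> a" "a \<le> 1" "0 \<le> a'" "a' \<le> 1" and b: "0 \<le> b" "b \<le> 1" "0 \<le> b'" "b' \<le> 1"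
    and g: "\<bar>g\<bar> \<le> U" "\<bar>g - g'\<bar> \<le> W * \<bar>b - b'\<bar>" and W: "W \<ge> 0"
  shows "(x - x')\<^sup>2 \<le> 2 * (K * (2 * U + W))\<^sup>2 * (\<bar>a - a'\<bar> + \<bar>b - b'\<bar>)"
proof -
  define p where "p = \<bar>a - a'\<bar> + \<bar>b - b'\<bar>"
  have p: "0 \<le> p" "p \<le> 2" using a b by (auto simp: p_def)
  have U: "U \<ge> 0" using g(1) by linarith
  have "x - x' = K * (g * (2 * (a - a')) + (g - g') * (2 * a' - 1))" unfolding x by (simp add: algebra_simps)
  then have "\<bar>x - x'\<bar> = K * \<bar>g * (2 * (a - a')) + (g - g') * (2 * a' - 1)\<bar>" using K by (simp add: abs_mult)
  also have "\<dots> \<le> K * ((2 * U + W) * p)"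
  proof (rule mult_left_mono[OF _ K])
    have 1: "\<bar>g * (2 * (a - a'))\<bar> \<le> U * (2 * \<bar>a - a'\<bar>)" unfolding abs_mult using g(1) by (intro mult_mono) auto
    have 2: "\<bar>(g - g') * (2 * a' - 1)\<bar> \<le> (W * \<bar>b - b'\<bar>) * 1" unfolding abs_mult using g(2) a W by (intro mult_mono) (auto simp: abs_le_iff)
    have "0 \<le> 2 * U * \<bar>b - b'\<bar> + W * \<bar>a - a'\<bar>" using U W by simp
    moreover have "(2 * U + W) * p = U * (2 * \<bar>a - a'\<bar>) + W * \<bar>b - b'\<bar> + (2 * U * \<bar>b - b'\<bar> + W * \<bar>a - a'\<bar>)"
      by (simp add: p_def algebra_simps)
    ultimately show "\<bar>g * (2 * (a - a')) + (g - g') * (2 * a' - 1)\<bar> \<le> (2 * U + W) * p"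
      using 1 2 abs_triangle_ineq[of "g * (2 * (a - a'))" "(g - g') * (2 * a' - 1)"] by linarith
  qed
  finally have "\<bar>x - x'\<bar>\<^sup>2 \<le> (K * ((2 * U + W) * p))\<^sup>2" by (intro power_mono) auto
  also have "\<dots> = (K * (2 * U + W))\<^sup>2 * (p * p)" by (simp add: power2_eq_square)
  also have "\<dots> \<le> (K * (2 * U + W))\<^sup>2 * (2 * p)" using p by (intro mult_left_mono mult_right_mono) auto
  also have "\<dots> = 2 * (K * (2 * U + W))\<^sup>2 * p" by simp
  finally show ?thesis by (simp only: p_def power2_abs)
qed

text \<open>Near \<open>\<eta>0\<close> the matrices \<open>J \<eta>\<close> and the scales are bounded (the set \<open>T\<close>), and there a component of the
  score is \<open>u (sqrt (qd \<eta> s)) * sc \<eta> s\<close> with two quadratic forms in \<open>s\<close>. Both factors are expressed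
  by monotone functions with values in the unit interval: the increments of \<open>u\<close> are dominated by
  those of a monotone \<open>v\<close>, and \<open>sc \<eta> s\<close> may be clipped at \<open>K * norm s\<close>, since it stays below this
  bound wherever the weight does not vanish. A boolean index tells the two forms apart. The squared
  increments are then bounded as \<open>equicontinuity_of_empirical_process\<close> requires, with a factor
  \<open>F s\<close> proportional to \<open>(norm s)\<^sup>2\<close>.\<close>

lemma score_equicontinuity:
  fixes \<rho> :: "real \<Rightarrow> real" and c1 :: real and P :: "((real^'k) \<times> (real^'q^'k)) measure"
    and V :: "real^'l \<Rightarrow> real^'k^'k" and M :: "'w measure" and S :: "nat \<Rightarrow> 'w \<Rightarrow> (real^'k) \<times> (real^'q^'k)"
    and j :: 'q
  defines "f \<equiv> (\<lambda>\<eta> s. Psi_beta \<rho> V s (fst \<eta>) (snd \<eta>) $ j)"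
  assumes C1: "\<rho> C1_differentiable_on UNIV" and ucont: "continuous_on UNIV (weight_fun \<rho>)"
    and c1: "c1 > 0" "mono_on {0..c1} \<rho>" "\<rho> constant_on {c1..}" and \<rho>0: "\<forall>x. 0 \<le> \<rho> x"
    and bv: "bounded_variation (weight_fun \<rho>)"
    and P: "prob_space P" "sets P = sets borel" "integrable P (\<lambda>s. (norm s)\<^sup>2)"
    and M: "prob_space M" and S: "iid_sample M P S"
    and V: "continuous_on \<Theta> V" and \<eta>0: "\<eta>0 \<in> param_set \<Theta> V \<times> {0<..}"
    and e: "\<epsilon> > 0" and k: "\<kappa> > 0"
  shows "\<exists>\<delta>>0. \<forall>n>0. \<exists>B\<in>sets M. measure M B \<le> \<kappa> \<and> (\<forall>\<omega>\<in>space M - B. \<forall>\<eta>\<in>param_set \<Theta> V \<times> {0<..}. dist \<eta> \<eta>0 < \<delta> \<longrightarrow>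
    \<bar>\<Sum>i<n. (f \<eta> (S i \<omega>) - f \<eta>0 (S i \<omega>)) - (integral\<^sup>L P (f \<eta>) - integral\<^sup>L P (f \<eta>0))\<bar> \<le> \<epsilon> * sqrt n)"
proof -
  define J where "J = (\<lambda>\<eta> :: ((real^'q) \<times> (real^'l)) \<times> real. matrix_inv (V (snd (fst \<eta>))))"
  define \<beta> where "\<beta> = (\<lambda>\<eta> :: ((real^'q) \<times> (real^'l)) \<times> real. fst (fst \<eta>))"
  define D where "D = (param_set \<Theta> V :: ((real^'q) \<times> (real^'l)) set) \<times> {0::real<..}"
  define u where "u = weight_fun \<rho>"
  have VP: "V (snd (fst \<eta>)) \<in> PDS" "snd (fst \<eta>) \<in> \<Theta>" if "\<eta> \<in> D" for \<eta> using that by (auto simp: D_def param_set_def)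
  have Jcont: "continuous_on D J"
    unfolding J_def
    by (intro continuous_on_matrix_inv continuous_on_compose2[OF V] continuous_intros PDS_invertible VP) (use VP(2) in auto)
  have JP: "J \<eta> \<in> PDS" if "\<eta> \<in> D" for \<eta> unfolding J_def by (rule PDS_matrix_inv[OF VP(1)[OF that]])
  have \<sigma>: "snd \<eta> > 0" if "\<eta> \<in> D" for \<eta> using that by (auto simp: D_def)
  have f_eq: "f \<eta> s = psi u (J \<eta>) s (\<beta> \<eta>) (snd \<eta>) $ j" for \<eta> s
    unfolding f_def J_def \<beta>_def u_def by (cases \<eta>, cases "fst \<eta>") (simp add: Psi_beta_eq_psi)
  have \<eta>0D: "\<eta>0 \<in> D" using \<eta>0 by (simp add: D_def)
  obtain U where U: "U \<ge> 0" "\<And>t. \<bar>u t\<bar> \<le> U" unfolding u_def by (rule weight_bound[OF C1 ucont c1 \<rho>0 bv P]) blast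
  have u0: "u t = 0" if "t \<ge> c1" for t unfolding u_def by (rule weight_fun_vanishes[OF C1 ucont c1(1,3) that])
  obtain v :: "real \<Rightarrow> real" and B where v: "mono v" "\<And>x. 0 \<le> v x" "\<And>x. v x \<le> B" "\<And>a b. \<bar>u a - u b\<bar> \<le> \<bar>v a - v b\<bar>"
    unfolding u_def by (rule bounded_variation_dominated_by_mono[OF bv]) blast
  \<comment> \<open>The summand \<open>1\<close> keeps \<open>W\<close> positive, so that \<open>v / W\<close> takes values in the unit interval.\<close>
  define W where "W = B + 1"
  have W: "W > 0" "v x \<le> W" for x using v(2)[of 0] v(3)[of 0] v(3)[of x] by (auto simp: W_def)
  \<comment> \<open>The slack \<open>1\<close> makes \<open>T\<close> contain all admissible parameters near \<open>\<eta>0\<close>.\<close>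
  define N where "N = norm (J \<eta>0) + 1"
  define T where "T = {\<eta> \<in> D. norm (J \<eta>) \<le> N \<and> snd \<eta> \<le> snd \<eta>0 + 1}"
  have N0: "N \<ge> 0" by (simp add: N_def)
  have \<eta>0T: "\<eta>0 \<in> T" using \<eta>0D by (simp add: T_def N_def)
  have TD: "\<eta> \<in> D" if "\<eta> \<in> T" for \<eta> using that by (simp add: T_def)
  define K where "K = sqrt N * c1 * (snd \<eta>0 + 1)"
  have K: "K \<ge> 0" using N0 c1(1) \<sigma>[OF \<eta>0D] by (simp add: K_def)
  have Kle: "sqrt (norm (J \<eta>)) * c1 * snd \<eta> \<le> K" if "\<eta> \<in> T" for \<eta>
    unfolding K_def using that \<sigma>[OF TD[OF that]] c1(1) N0 by (intro mult_mono) (auto simp: T_def)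
  define sc where "sc = (\<lambda>\<eta> s. (transpose (snd s) *v (J \<eta> *v residual s (\<beta> \<eta>))) $ j)"
  define qd where "qd = (\<lambda>\<eta> s. (residual s (\<beta> \<eta>) \<bullet> (J \<eta> *v residual s (\<beta> \<eta>))) / (snd \<eta>)\<^sup>2)"
  have f_sc: "f \<eta> s = u (sqrt (qd \<eta> s)) * sc \<eta> s" if "\<eta> \<in> T" for \<eta> s
    unfolding f_eq psi_def qd_def sc_def using \<sigma>[OF TD[OF that]] by (simp add: real_sqrt_divide)
  have sc_le: "\<bar>sc \<eta> s\<bar> \<le> K * norm s" if "\<eta> \<in> T" "u (sqrt (qd \<eta> s)) \<noteq> 0" for \<eta> s
  proof -
    have "sqrt (qd \<eta> s) \<le> c1" using u0[of "sqrt (qd \<eta> s)"] that(2) by (meson linear)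
    then have d: "sqrt (residual s (\<beta> \<eta>) \<bullet> (J \<eta> *v residual s (\<beta> \<eta>))) / snd \<eta> \<le> c1"
      using \<sigma>[OF TD[OF that(1)]] by (simp add: qd_def real_sqrt_divide)
    have "\<bar>sc \<eta> s\<bar> \<le> norm (transpose (snd s) *v (J \<eta> *v residual s (\<beta> \<eta>)))"
      unfolding sc_def by (rule component_le_norm_cart)
    also have "\<dots> \<le> norm s * (sqrt (norm (J \<eta>)) * c1 * snd \<eta>)"
      by (rule norm_score_le[OF JP \<sigma> _ d]) (use TD[OF that(1)] c1 in auto)
    also have "\<dots> \<le> norm s * K" using Kle[OF that(1)] by (intro mult_left_mono) auto
    finally show ?thesis by (simp add: mult.commute)
  qed
  \<comment> \<open>The features are the products of two coordinates of \<open>s\<close>, once for each of the two forms; \<open>c\<close> holds the coefficients and \<open>m\<close> the monotone functions.\<close>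
  define A :: "(((real^'k) \<times> (real^'q^'k)) \<times> ((real^'k) \<times> (real^'q^'k)) \<times> bool) set" where "A = Basis \<times> Basis \<times> UNIV"
  define c where "c = (\<lambda>\<eta> (x :: (real^'k) \<times> (real^'q^'k), y :: (real^'k) \<times> (real^'q^'k), b).
     if b then (transpose (snd x) *v (J \<eta> *v residual y (\<beta> \<eta>))) $ j else (residual x (\<beta> \<eta>) \<bullet> (J \<eta> *v residual y (\<beta> \<eta>))) / (snd \<eta>)\<^sup>2)"
  define \<phi> where "\<phi> = (\<lambda>(x :: (real^'k) \<times> (real^'q^'k), y :: (real^'k) \<times> (real^'q^'k), b :: bool) (s :: (real^'k) \<times> (real^'q^'k), b'). if b = b' then (s \<bullet> x) * (s \<bullet> y) else 0)"
  define clip where "clip = (\<lambda>x::real. max 0 (min 1 x))"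
  define m where "m = (\<lambda>(s :: (real^'k) \<times> (real^'q^'k), b) z. if b then clip ((z / (K * norm s) + 1) / 2) else v (sqrt z) / W)"
  have lin_comb: "(\<Sum>a\<in>A. c \<eta> a * \<phi> a (s, b)) = (if b then sc \<eta> s else qd \<eta> s)" for \<eta> s b
  proof -
    have "(\<Sum>a\<in>A. c \<eta> a * \<phi> a (s, b)) = (\<Sum>x\<in>Basis. \<Sum>y\<in>Basis. \<Sum>b'\<in>UNIV. c \<eta> (x, y, b') * \<phi> (x, y, b') (s, b))"
      unfolding A_def by (simp only: sum.cartesian_product')
    also have "\<dots> = (\<Sum>x\<in>Basis. \<Sum>y\<in>Basis. c \<eta> (x, y, b) * ((s \<bullet> x) * (s \<bullet> y)))"
      by (intro sum.cong refl) (auto simp: UNIV_bool \<phi>_def)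
    also have "\<dots> = (if b then sc \<eta> s else qd \<eta> s)"
    proof (cases b)
      case True
      then show ?thesis
        unfolding sc_def c_def using quadratic_form_expansion[OF bilinear_score(1)[of "J \<eta>" "\<beta> \<eta>" j], of s] by simp
    next
      case False
      have "(\<Sum>x\<in>Basis. \<Sum>y\<in>Basis. c \<eta> (x, y, b) * ((s \<bullet> x) * (s \<bullet> y)))
        = (\<Sum>x\<in>Basis. \<Sum>y\<in>Basis. (residual x (\<beta> \<eta>) \<bullet> (J \<eta> *v residual y (\<beta> \<eta>))) * ((s \<bullet> x) * (s \<bullet> y))) / (snd \<eta>)\<^sup>2"
        using False by (simp add: c_def sum_divide_distrib)
      also have "\<dots> = qd \<eta> s" unfolding qd_def quadratic_form_expansion[OF bilinear_score(2)[of "\<beta> \<eta>" "J \<eta>"], of s] ..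
      finally show ?thesis using False by simp
    qed
    finally show ?thesis .
  qed
  have clip_mono: "clip ((a + 1) / 2) \<le> clip ((b + 1) / 2)" if "a \<le> b" for a b
    unfolding clip_def using that by (intro max.mono min.mono order_refl) simp
  have clip_id: "clip ((a + 1) / 2) = (a + 1) / 2" if "\<bar>a\<bar> \<le> 1" for a
    using that by (auto simp: clip_def abs_le_iff)
  have m01: "mono (m z)" "0 \<le> m z x" "m z x \<le> 1" for z x
  proof -
    obtain s b where z: "z = (s, b)" by (cases z)
    show "mono (m z)"
    proof (rule monoI)
      fix x y :: real assume xy: "x \<le> y"
      have "x / (K * norm s) \<le> y / (K * norm s)" using xy K by (intro divide_right_mono) auto
      then have "clip ((x / (K * norm s) + 1) / 2) \<le> clip ((y / (K * norm s) + 1) / 2)"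
        by (rule clip_mono)
      moreover have "v (sqrt x) / W \<le> v (sqrt y) / W" using xy W(1) by (intro divide_right_mono monoD[OF v(1)]) auto
      ultimately show "m z x \<le> m z y" unfolding z m_def by simp
    qed
    show "0 \<le> m z x" "m z x \<le> 1" unfolding z m_def clip_def using v(2) W by (auto simp: divide_le_eq)
  qed
  define F where "F = (\<lambda>s :: (real^'k) \<times> (real^'q^'k). 2 * ((K * norm s) * (2 * U + W))\<^sup>2)"
  have sq_int: "integrable P (\<lambda>s. c * (norm s)\<^sup>2)" for c using P(3) by simp
  \<comment> \<open>Where the weight vanishes both sides are zero, so the clipped form may replace the form itself; for \<open>norm s = 0\<close> the division by zero inside \<open>m\<close> is multiplied by zero.\<close>
  have f_rep: "f \<eta> s = u (sqrt (qd \<eta> s)) * ((K * norm s) * (2 * m (s, True) (sc \<eta> s) - 1))" if t: "\<eta> \<in> T" for \<eta> s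
  proof (cases "u (sqrt (qd \<eta> s)) = 0")
    case True
    then show ?thesis using f_sc[OF t] by simp
  next
    case False
    note le = sc_le[OF t False]
    show ?thesis
    proof (cases "K * norm s = 0")
      case True
      have "sc \<eta> s = 0" using le unfolding True by simp
      then show ?thesis unfolding f_sc[OF t] True by simp
    next
      case False
      then have pos: "K * norm s > 0" using K by (simp add: less_le)
      have "\<bar>sc \<eta> s / (K * norm s)\<bar> \<le> 1" using le pos by simp
      then have "clip ((sc \<eta> s / (K * norm s) + 1) / 2) = (sc \<eta> s / (K * norm s) + 1) / 2"
        by (rule clip_id)
      then have "2 * m (s, True) (sc \<eta> s) - 1 = sc \<eta> s / (K * norm s)" by (simp add: m_def)
      then have "(K * norm s) * (2 * m (s, True) (sc \<eta> s) - 1) = sc \<eta> s"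
        using False by (simp only: times_divide_eq_right nonzero_mult_div_cancel_left not_False_eq_True)
      then show ?thesis using f_sc[OF t] by simp
    qed
  qed
  have inc: "(f \<eta> s - f \<eta>' s)\<^sup>2 \<le> F s * (\<Sum>b\<in>UNIV. \<bar>m (s, b) (\<Sum>a\<in>A. c \<eta> a * \<phi> a (s, b)) - m (s, b) (\<Sum>a\<in>A. c \<eta>' a * \<phi> a (s, b))\<bar>)"
    if "\<eta> \<in> T" "\<eta>' \<in> T" for \<eta> \<eta>' s
  proof -
    have Wv: "\<bar>u x - u y\<bar> \<le> W * \<bar>v x / W - v y / W\<bar>" for x y
    proof -
      have "W * \<bar>v x / W - v y / W\<bar> = \<bar>v x - v y\<bar>" using W(1) by (simp add: diff_divide_distrib[symmetric])
      then show ?thesis using v(4)[of x y] by simp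
    qed
    have "(f \<eta> s - f \<eta>' s)\<^sup>2 \<le> 2 * ((K * norm s) * (2 * U + W))\<^sup>2 * (\<bar>m (s, True) (sc \<eta> s) - m (s, True) (sc \<eta>' s)\<bar> + \<bar>m (s, False) (qd \<eta> s) - m (s, False) (qd \<eta>' s)\<bar>)"
    proof (rule sum_mixed_products_le[OF f_rep[OF that(1)] f_rep[OF that(2)]])
      show "\<bar>u (sqrt (qd \<eta> s)) - u (sqrt (qd \<eta>' s))\<bar> \<le> W * \<bar>m (s, False) (qd \<eta> s) - m (s, False) (qd \<eta>' s)\<bar>"
        unfolding m_def using Wv by simp
    qed (use m01 U W(1) K in auto)
    then show ?thesis unfolding lin_comb by (simp add: F_def UNIV_bool add.commute)
  qed
  define G where "G = (\<lambda>s :: (real^'k) \<times> (real^'q^'k). U * K * norm s)"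
  have "\<exists>\<delta>>0. \<forall>n>0. \<exists>B\<in>sets M. measure M B \<le> \<kappa> \<and> (\<forall>\<omega>\<in>space M - B. \<forall>\<eta>\<in>T. dist \<eta> \<eta>0 < \<delta> \<longrightarrow>
    \<bar>\<Sum>i<n. (f \<eta> (S i \<omega>) - f \<eta>0 (S i \<omega>)) - (integral\<^sup>L P (f \<eta>) - integral\<^sup>L P (f \<eta>0))\<bar> \<le> \<epsilon> * sqrt n)"
  proof (rule equicontinuity_of_empirical_process[OF M P(1,2) S \<eta>0T, where A=A and I="UNIV :: bool set" and c=c and \<phi>=\<phi> and m=m and F=F and G=G])
    show "finite A" by (simp add: A_def)
    show "f \<eta> \<in> borel_measurable borel" if "\<eta> \<in> T" for \<eta>
      unfolding f_eq u_def
      by (rule measurable_compose[OF psi_borel[OF C1 ucont c1 \<rho>0 bv P \<sigma>[OF TD[OF that]]]])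
        (intro borel_measurable_continuous_onI continuous_intros)
    show "continuous_on T (\<lambda>\<eta>. f \<eta> s)" for s
    proof -
      have Jc: "continuous_on T (\<lambda>\<eta>. J \<eta> $ a $ b)" for a b
        by (intro continuous_intros continuous_on_subset[OF Jcont]) (use TD in blast)
      have rc: "continuous_on T (\<lambda>\<eta>. residual s (\<beta> \<eta>))"
        unfolding residual_def \<beta>_def matrix_vector_mult_def by (intro continuous_intros)
      have Jr: "continuous_on T (\<lambda>\<eta>. J \<eta> *v residual s (\<beta> \<eta>))"
        unfolding matrix_vector_mult_def[of "J _"] by (intro continuous_intros Jc rc)
      have 1: "continuous_on T (\<lambda>\<eta>. u (sqrt (residual s (\<beta> \<eta>) \<bullet> (J \<eta> *v residual s (\<beta> \<eta>))) / snd \<eta>))"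
        unfolding u_def by (rule continuous_on_compose2[OF ucont]) (use \<sigma>[OF TD] in \<open>force intro!: continuous_intros rc Jr\<close>)+
      have 2: "continuous_on T (\<lambda>\<eta>. (transpose (snd s) *v (J \<eta> *v residual s (\<beta> \<eta>))) $ j)"
        by (intro continuous_intros continuous_on_compose2[OF matrix_vector_mult_linear_continuous_on[of UNIV "transpose (snd s)"] Jr]) auto
      show ?thesis unfolding f_eq psi_def vector_scaleR_component real_scaleR_def by (intro continuous_intros 1 2)
    qed
    show "\<bar>f \<eta> s\<bar> \<le> G s" if "\<eta> \<in> T" for \<eta> s
    proof -
      have "\<bar>f \<eta> s\<bar> \<le> norm (psi u (J \<eta>) s (\<beta> \<eta>) (snd \<eta>))" unfolding f_eq by (rule component_le_norm_cart)
      also have "\<dots> \<le> U * (sqrt (norm (J \<eta>)) * c1 * snd \<eta>) * norm s"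
        using TD[OF that] u0 U c1(1) by (intro norm_psi_le JP \<sigma>) auto
      also have "\<dots> \<le> U * K * norm s" using Kle[OF that] U by (intro mult_right_mono mult_left_mono) auto
      finally show ?thesis by (simp add: G_def)
    qed
    show "integrable P G" unfolding G_def using norm_integrable[OF C1 ucont c1 \<rho>0 bv P] by simp
    show "integrable P (\<lambda>s. (G s)\<^sup>2)" unfolding G_def power_mult_distrib[of _ "norm _"] by (rule sq_int)
    show "integrable P F"
    proof -
      have "F = (\<lambda>s. (2 * (K * (2 * U + W))\<^sup>2) * (norm s)\<^sup>2)" by (simp add: F_def power_mult_distrib mult_ac)
      then show ?thesis using sq_int by simp
    qed
    show "0 \<le> F s" for s by (simp add: F_def)
  qed (use m01 inc e k in auto)
  then obtain \<delta> where d: "\<delta> > 0" and bad: "\<And>n. n > 0 \<Longrightarrow> \<exists>B\<in>sets M. measure M B \<le> \<kappa> \<and> (\<forall>\<omega>\<in>space M - B. \<forall>\<eta>\<in>T. dist \<eta> \<eta>0 < \<delta> \<longrightarrow>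
    \<bar>\<Sum>i<n. (f \<eta> (S i \<omega>) - f \<eta>0 (S i \<omega>)) - (integral\<^sup>L P (f \<eta>) - integral\<^sup>L P (f \<eta>0))\<bar> \<le> \<epsilon> * sqrt n)" by blast
  obtain d1 where d1: "d1 > 0" "\<And>\<eta>. \<eta> \<in> D \<Longrightarrow> dist \<eta> \<eta>0 < d1 \<Longrightarrow> dist (J \<eta>) (J \<eta>0) < 1"
    using Jcont \<eta>0D unfolding continuous_on_iff by (metis zero_less_one)
  define d2 where "d2 = min \<delta> (min d1 1)"
  have inT: "\<eta> \<in> T \<and> dist \<eta> \<eta>0 < \<delta>" if "\<eta> \<in> D" "dist \<eta> \<eta>0 < d2" for \<eta>
  proof -
    have "norm (J \<eta>) \<le> norm (J \<eta>0) + norm (J \<eta> - J \<eta>0)" by (metis add.commute diff_add_cancel norm_triangle_ineq)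
    moreover have "norm (J \<eta> - J \<eta>0) < 1" using d1(2)[OF that(1)] that(2) by (simp add: d2_def dist_norm)
    moreover have "dist (snd \<eta>) (snd \<eta>0) < 1" using dist_snd_le[of \<eta> \<eta>0] that(2) by (simp add: d2_def)
    ultimately show ?thesis using that by (simp add: T_def N_def d2_def dist_real_def)
  qed
  show ?thesis
  proof (intro exI[of _ d2] conjI allI impI)
    show "d2 > 0" using d d1 by (simp add: d2_def)
    fix n :: nat assume "n > 0"
    then show "\<exists>B\<in>sets M. measure M B \<le> \<kappa> \<and> (\<forall>\<omega>\<in>space M - B. \<forall>\<eta>\<in>param_set \<Theta> V \<times> {0<..}. dist \<eta> \<eta>0 < d2 \<longrightarrow>
      \<bar>\<Sum>i<n. (f \<eta> (S i \<omega>) - f \<eta>0 (S i \<omega>)) - (integral\<^sup>L P (f \<eta>) - integral\<^sup>L P (f \<eta>0))\<bar> \<le> \<epsilon> * sqrt n)"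
      using bad[of n] inT unfolding D_def by meson
  qed
qed

section \<open>Linearization at the point of symmetry\<close>

lemma has_derivative_partial_beta:
  fixes L :: "(real^'q) \<times> 'c \<Rightarrow> real \<Rightarrow> real^'q"
  assumes "(\<lambda>\<beta>. L (\<beta>, c) \<tau>) differentiable (at b)"
  shows "((\<lambda>\<beta>. L (\<beta>, c) \<tau>) has_derivative (\<lambda>h. partial_beta L (b, c) \<tau> *v h)) (at b)"
proof -
  have d: "((\<lambda>\<beta>. L (\<beta>, c) \<tau>) has_derivative frechet_derivative (\<lambda>\<beta>. L (\<beta>, c) \<tau>) (at b)) (at b)"
    using assms by (simp add: frechet_derivative_works)
  have "frechet_derivative (\<lambda>\<beta>. L (\<beta>, c) \<tau>) (at b) = (\<lambda>h. partial_beta L (b, c) \<tau> *v h)"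
    unfolding partial_beta_def fst_conv snd_conv
    by (rule ext, rule matrix_works[symmetric])
       (use has_derivative_linear[OF d] in \<open>simp add: linear_matrix_vector_mul_eq\<close>)
  then show ?thesis using d by simp
qed

text \<open>The mean value inequality on the segment from \<open>b0\<close> to \<open>b\<close>, with \<open>c\<close> and \<open>\<tau>\<close> fixed. The points of
  the segment are not farther from the base point than its end, so that by the joint continuity of
  the derivative one \<open>\<delta>\<close> works for all \<open>c\<close> and \<open>\<tau>\<close>.\<close>

lemma uniform_linearization:
  fixes L :: "(real^'q) \<times> 'c::metric_space \<Rightarrow> real \<Rightarrow> real^'q" and D :: "((real^'q) \<times> 'c) set"
  assumes cd: "cont_diff_beta_at D L (b0, c0) \<sigma>0" and in_D: "(b0, c0) \<in> D" "\<sigma>0 > 0"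
    and fiber: "\<And>b b' c. (b, c) \<in> D \<Longrightarrow> (b', c) \<in> D" and e: "e > 0"
  shows "\<exists>\<delta>>0. \<forall>b c \<tau>. (b, c) \<in> D \<longrightarrow> \<tau> > 0 \<longrightarrow> dist ((b, c), \<tau>) ((b0, c0), \<sigma>0) < \<delta> \<longrightarrow>
    norm (L (b, c) \<tau> - L (b0, c) \<tau> - partial_beta L (b0, c0) \<sigma>0 *v (b - b0)) \<le> e * norm (b - b0)"
proof -
  define P0 where "P0 = partial_beta L (b0, c0) \<sigma>0"
  obtain N where N: "open N" "((b0, c0), \<sigma>0) \<in> N"
    and diff: "\<forall>(\<eta>, \<tau>) \<in> N \<inter> (D \<times> {0<..}). (\<lambda>\<beta>. L (\<beta>, snd \<eta>) \<tau>) differentiable (at (fst \<eta>))"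
    and cont: "continuous_on (N \<inter> (D \<times> {0<..})) (\<lambda>(\<eta>, \<tau>). partial_beta L \<eta> \<tau>)"
    using cd unfolding cont_diff_beta_at_def by blast
  obtain r where r: "r > 0" "ball ((b0, c0), \<sigma>0) r \<subseteq> N" using N open_contains_ball by blast
  have in_N: "((b0, c0), \<sigma>0) \<in> N \<inter> (D \<times> {0<..})" using N in_D by auto
  have "\<exists>d>0. \<forall>x\<in>N \<inter> (D \<times> {0<..}). dist x ((b0, c0), \<sigma>0) < d \<longrightarrow>
      dist (case x of (\<eta>, \<tau>) \<Rightarrow> partial_beta L \<eta> \<tau>) (case ((b0, c0), \<sigma>0) of (\<eta>, \<tau>) \<Rightarrow> partial_beta L \<eta> \<tau>) < e"
    using cont[unfolded continuous_on_iff] in_N e by blast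
  then obtain d where "d > 0" and near: "\<forall>x\<in>N \<inter> (D \<times> {0<..}). dist x ((b0, c0), \<sigma>0) < d \<longrightarrow>
      dist (case x of (\<eta>, \<tau>) \<Rightarrow> partial_beta L \<eta> \<tau>) (case ((b0, c0), \<sigma>0) of (\<eta>, \<tau>) \<Rightarrow> partial_beta L \<eta> \<tau>) < e"
    by blast
  have d: "d > 0" "dist (partial_beta L \<eta> \<tau>) P0 < e" if "(\<eta>, \<tau>) \<in> N \<inter> (D \<times> {0<..})" "dist (\<eta>, \<tau>) ((b0, c0), \<sigma>0) < d" for \<eta> \<tau>
    using near[rule_format, OF that] by (simp_all add: P0_def \<open>d > 0\<close>)
  show ?thesis
  proof (intro exI[of _ "min r d"] conjI allI impI)
    fix b c and \<tau> :: real assume bc: "(b, c) \<in> D" and \<tau>: "\<tau> > 0" and near: "dist ((b, c), \<tau>) ((b0, c0), \<sigma>0) < min r d"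
    define S where "S = closed_segment b0 b"
    have on_S: "((x, c), \<tau>) \<in> N \<inter> (D \<times> {0<..})" "dist ((x, c), \<tau>) ((b0, c0), \<sigma>0) < d" if x: "x \<in> S" for x
    proof -
      have "dist x b0 \<le> dist b b0" using dist_in_closed_segment[of x b0 b] x by (simp add: S_def dist_commute)
      then have "dist ((x, c), \<tau>) ((b0, c0), \<sigma>0) \<le> dist ((b, c), \<tau>) ((b0, c0), \<sigma>0)"
        unfolding dist_prod_def fst_conv snd_conv
        by (intro real_sqrt_le_mono add_mono power_mono) auto
      then have lt: "dist ((x, c), \<tau>) ((b0, c0), \<sigma>0) < min r d" using near by linarith
      then have "((x, c), \<tau>) \<in> ball ((b0, c0), \<sigma>0) r" by (simp add: dist_commute)
      then show "((x, c), \<tau>) \<in> N \<inter> (D \<times> {0<..})" using r(2) fiber[OF bc, of x] \<tau> by auto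
      show "dist ((x, c), \<tau>) ((b0, c0), \<sigma>0) < d" using lt by simp
    qed
    define g where "g = (\<lambda>x. L (x, c) \<tau> - P0 *v x)"
    have "norm (g b - g b0) \<le> e * norm (b - b0)"
    proof (rule differentiable_bound[of S g "\<lambda>x h. partial_beta L (x, c) \<tau> *v h - P0 *v h"])
      show "convex S" "b \<in> S" "b0 \<in> S" by (auto simp: S_def)
      fix x assume x: "x \<in> S"
      have "(\<lambda>\<beta>. L (\<beta>, c) \<tau>) differentiable (at x)" using bspec[OF diff on_S(1)[OF x]] by simp
      then show "(g has_derivative (\<lambda>h. partial_beta L (x, c) \<tau> *v h - P0 *v h)) (at x within S)"
        unfolding g_def
        by (rule has_derivative_at_withinI[OF has_derivative_diff[OF has_derivative_partial_beta
              bounded_linear_imp_has_derivative[OF matrix_vector_mul_bounded_linear]]])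
      show "onorm (\<lambda>h. partial_beta L (x, c) \<tau> *v h - P0 *v h) \<le> e"
      proof (rule onorm_le)
        fix h
        have "norm (partial_beta L (x, c) \<tau> *v h - P0 *v h) = norm ((partial_beta L (x, c) \<tau> - P0) *v h)"
          by (simp add: matrix_vector_mult_diff_rdistrib)
        also have "\<dots> \<le> norm (partial_beta L (x, c) \<tau> - P0) * norm h" by (rule norm_mat_vec_le)
        also have "\<dots> \<le> e * norm h" using d(2)[OF on_S[OF x]] by (intro mult_right_mono) (auto simp: dist_norm)
        finally show "norm (partial_beta L (x, c) \<tau> *v h - P0 *v h) \<le> e * norm h" .
      qed
    qed
    then show "norm (L (b, c) \<tau> - L (b0, c) \<tau> - partial_beta L (b0, c0) \<sigma>0 *v (b - b0)) \<le> e * norm (b - b0)"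
      by (simp add: g_def P0_def matrix_vector_mult_diff_distrib algebra_simps)
  qed (use r \<open>d > 0\<close> in auto)
qed

text \<open>Since \<open>norm D\<^sup>-\<^sup>1 * e \<le> 1/2\<close>, the error term \<open>e * norm Z\<close> can be absorbed on the left.\<close>

lemma solve_linearized_equation:
  fixes D :: "real^'q^'q"
  assumes D: "invertible D" and a: "norm (D *v Z + G) \<le> \<epsilon> + e * norm Z" and e: "norm (matrix_inv D) * e \<le> 1/2"
    and \<epsilon>: "\<epsilon> \<ge> 0" and e0: "e \<ge> 0"
  shows "norm (Z + matrix_inv D *v G) \<le> 2 * (norm (matrix_inv D) * \<epsilon>) + 2 * (norm (matrix_inv D) * e) * norm (matrix_inv D *v G)"
proof -
  define I where "I = matrix_inv D"
  define k where "k = norm I"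
  define x where "x = norm (Z + I *v G)"
  have "Z + I *v G = I *v (D *v Z + G)"
    by (simp add: I_def matrix_vector_right_distrib matrix_inv_vector_cancel[OF D])
  then have "x \<le> k * norm (D *v Z + G)" unfolding x_def k_def by (metis norm_mat_vec_le)
  also have "\<dots> \<le> k * (\<epsilon> + e * norm Z)" using a by (intro mult_left_mono) (auto simp: k_def)
  finally have x: "x \<le> k * \<epsilon> + (k * e) * norm Z" by (simp add: algebra_simps)
  have "norm Z \<le> x + norm (I *v G)" unfolding x_def by (metis add_diff_cancel norm_triangle_ineq4)
  then have "(k * e) * norm Z \<le> (k * e) * (x + norm (I *v G))" using e0 by (intro mult_left_mono) (auto simp: k_def)
  moreover have "(k * e) * x \<le> 1/2 * x" using e by (intro mult_right_mono) (auto simp: k_def I_def x_def)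
  ultimately have "x \<le> 2 * (k * \<epsilon>) + 2 * (k * e) * norm (I *v G)" using x by (simp add: algebra_simps)
  then show ?thesis by (simp add: x_def k_def I_def)
qed

lemma second_moment_linear_image:
  fixes D :: "real^'q^'q" and \<psi> :: "'s \<Rightarrow> real^'q"
  assumes sym: "transpose D = D" and int: "\<And>i j. integrable P (\<lambda>s. \<psi> s $ i * \<psi> s $ j)"
  shows "second_moment P (\<lambda>s. - (D *v \<psi> s)) = D ** second_moment P \<psi> ** D"
    and "integrable P (\<lambda>s. (- (D *v \<psi> s)) $ i * (- (D *v \<psi> s)) $ j)"
proof -
  have D: "D $ i $ j = D $ j $ i" for i j using sym by (simp add: transpose_def vec_eq_iff)
  have prod: "(- (D *v \<psi> s)) $ i * (- (D *v \<psi> s)) $ j = (\<Sum>a\<in>UNIV. \<Sum>b\<in>UNIV. (D $ i $ b * D $ a $ j) * (\<psi> s $ b * \<psi> s $ a))" for s i j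
  proof -
    have "(- (D *v \<psi> s)) $ i * (- (D *v \<psi> s)) $ j = (\<Sum>b\<in>UNIV. D $ i $ b * \<psi> s $ b) * (\<Sum>a\<in>UNIV. D $ a $ j * \<psi> s $ a)"
      unfolding D[of _ j] by (simp add: matrix_vector_mult_def)
    also have "\<dots> = (\<Sum>a\<in>UNIV. \<Sum>b\<in>UNIV. (D $ i $ b * D $ a $ j) * (\<psi> s $ b * \<psi> s $ a))"
      unfolding sum_product by (subst sum.swap) (simp add: mult_ac)
    finally show ?thesis .
  qed
  show "integrable P (\<lambda>s. (- (D *v \<psi> s)) $ i * (- (D *v \<psi> s)) $ j)" unfolding prod using int by auto
  show "second_moment P (\<lambda>s. - (D *v \<psi> s)) = D ** second_moment P \<psi> ** D"
  proof -
    have "(\<integral>s. (\<Sum>a\<in>UNIV. \<Sum>b\<in>UNIV. (D $ i $ b * D $ a $ j) * (\<psi> s $ b * \<psi> s $ a)) \<partial>P)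
        = (\<Sum>a\<in>UNIV. \<Sum>b\<in>UNIV. (D $ i $ b * D $ a $ j) * (\<integral>s. \<psi> s $ b * \<psi> s $ a \<partial>P))" for i j
      using int by simp
    then show ?thesis
      unfolding second_moment_def prod
      by (simp add: vec_eq_iff matrix_matrix_mult_def sum_distrib_left sum_distrib_right mult_ac)
  qed
qed

section \<open>Asymptotic normality of the regression estimate\<close>

theorem theorem7:
  fixes M :: "'w measure"
    and P :: "((real^'k) \<times> (real^'q^'k)) measure"
    and S :: "nat \<Rightarrow> 'w \<Rightarrow> (real^'k) \<times> (real^'q^'k)"
    and \<Theta> :: "(real^'l) set"
    and V :: "real^'l \<Rightarrow> real^'k^'k"
    and \<rho>0 \<rho>1 :: "real \<Rightarrow> real"
    and b0 c1 :: real
    and \<beta>0 :: "((real^'k) \<times> (real^'q^'k)) measure \<Rightarrow> real^'q"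
    and \<theta>0 :: "((real^'k) \<times> (real^'q^'k)) measure \<Rightarrow> real^'l"
    and \<sigma>n :: "nat \<Rightarrow> 'w \<Rightarrow> real"
    and \<sigma>P :: real
    and \<xi>n :: "nat \<Rightarrow> 'w \<Rightarrow> (real^'q) \<times> (real^'l)"
    and \<xi>P :: "(real^'q) \<times> (real^'l)"
  defines "\<Psi> \<equiv> Psi_beta \<rho>1 V"
    and "\<Lambda> \<equiv> Lambda_beta \<rho>1 V P"
  defines "D\<beta> \<equiv> partial_beta \<Lambda> \<xi>P \<sigma>P"
  assumes "prob_space M"
    and "prob_space P" and "sets P = sets borel"
    and "iid_sample M P S"
    and "V ` \<Theta> \<subseteq> PDS" and "inj_on V \<Theta>"
    and "\<forall>x. 0 \<le> \<rho>0 x" and "\<forall>x. 0 \<le> \<rho>1 x"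
    and "0 < b0" and "ereal b0 < (SUP x. ereal (\<rho>0 x))"
    and "\<forall>Q. prob_space Q \<and> sets Q = sets borel \<longrightarrow> \<theta>0 Q \<in> \<Theta>"
    and "0 < c1" and "mono_on {0..c1} \<rho>1" and "\<rho>1 constant_on {c1..}"
    and "\<rho>1 C1_differentiable_on UNIV"
    and "continuous_on UNIV (weight_fun \<rho>1)" and "bounded_variation (weight_fun \<rho>1)"
    and "continuous_on \<Theta> V"
    and "integrable P (\<lambda>s. (norm s)\<^sup>2)"
    and "\<forall>n. \<sigma>n n \<in> borel_measurable M" and "\<forall>n. \<xi>n n \<in> borel_measurable M"
    and "scale_solution \<rho>0 b0 V \<beta>0 \<theta>0 P \<sigma>P"
    and "local_min_on (\<lambda>(\<beta>, \<gamma>). risk \<rho>1 P \<sigma>P \<beta> (V \<gamma>)) (param_set \<Theta> V) \<xi>P"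
    and "with_prob_tending_to_one M (\<lambda>n \<omega>.
          scale_solution \<rho>0 b0 V \<beta>0 \<theta>0 (empirical_measure S n \<omega>) (\<sigma>n n \<omega>) \<and>
          local_min_on (\<lambda>(\<beta>, \<gamma>). risk \<rho>1 (empirical_measure S n \<omega>) (\<sigma>n n \<omega>) \<beta> (V \<gamma>))
            (param_set \<Theta> V) (\<xi>n n \<omega>))"
    and "converges_in_prob M (\<lambda>n \<omega>. (\<xi>n n \<omega>, \<sigma>n n \<omega>)) (\<xi>P, \<sigma>P)"
    and "point_of_symmetry P (fst \<xi>P)"
    and "cont_diff_beta_at (param_set \<Theta> V) \<Lambda> \<xi>P \<sigma>P"
    and "invertible D\<beta>"
  shows "asymptotically_normal M (\<lambda>n \<omega>. sqrt n *\<^sub>R (fst (\<xi>n n \<omega>) - fst \<xi>P)) 0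
           (matrix_inv D\<beta> ** second_moment P (\<lambda>s. \<Psi> s \<xi>P \<sigma>P) ** matrix_inv D\<beta>)"
proof -
  note M = assms(4) and P = assms(5,6) and S = assms(7) and \<rho>1 = assms(11) and c1 = assms(15-17)
    and C1 = assms(18) and ucont = assms(19) and bv = assms(20) and V = assms(21) and sq = assms(22)
    and \<sigma>n_meas = assms(23) and \<xi>n_meas = assms(24) and minP = assms(26) and est = assms(27)
    and conv = assms(28) and symm = assms(29) and cd = assms(30) and inv = assms(31)
  interpret prob_space M by (rule M)
  note loss = C1 ucont c1 \<rho>1 bv
  define D :: "((real^'q) \<times> (real^'l)) set" where "D = param_set \<Theta> V"
  obtain bP \<gamma>P where \<xi>P: "\<xi>P = (bP, \<gamma>P)" by (cases \<xi>P)
  have \<xi>PD: "(bP, \<gamma>P) \<in> D" using minP by (simp add: local_min_on_def \<xi>P D_def)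
  have \<sigma>P: "\<sigma>P > 0" using assms(25) by (simp add: scale_solution_def)
  have fiber: "(b', c) \<in> D" if "(b, c) \<in> D" for b b' c using that by (simp add: D_def param_set_def)
  have JP: "matrix_inv (V c) \<in> PDS" if "(b, c) \<in> D" for b c
    by (rule PDS_matrix_inv) (use that in \<open>simp add: D_def param_set_def\<close>)
  have \<Psi>_psi: "\<Psi> s (b, c) \<tau> = psi (weight_fun \<rho>1) (matrix_inv (V c)) s b \<tau>" for s b c \<tau>
    by (simp add: \<Psi>_def Psi_beta_eq_psi)
  have \<Psi>_int: "integrable P (\<lambda>s. \<Psi> s (b, c) \<tau>)" if "(b, c) \<in> D" "\<tau> > 0" for b c \<tau>
    unfolding \<Psi>_psi by (rule psi_integrable[OF loss P sq JP[OF that(1)] that(2)])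
  have \<Lambda>_eq: "\<Lambda> (b, c) \<tau> = (\<integral>s. \<Psi> s (b, c) \<tau> \<partial>P)" for b c \<tau> by (simp add: \<Lambda>_def \<Psi>_def Lambda_beta_def)
  have \<Lambda>_zero: "\<Lambda> (bP, c) \<tau> = 0" if "(b, c) \<in> D" "\<tau> > 0" for b c \<tau>
    unfolding \<Lambda>_eq \<Psi>_psi
    by (rule mean_psi_zero[OF loss P sq JP[OF that(1)] that(2)]) (use reflection_invariance[OF P symm] in \<open>simp add: \<xi>P\<close>)
  have D_eq: "D\<beta> = partial_beta \<Lambda> (bP, \<gamma>P) \<sigma>P" by (simp add: D\<beta>_def \<xi>P)
  have D_sym: "transpose D\<beta> = D\<beta>"
  proof -
    have "(\<lambda>\<beta>. \<Lambda> (\<beta>, \<gamma>P) \<sigma>P) differentiable (at bP)"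
      using cd \<xi>PD \<sigma>P unfolding cont_diff_beta_at_def by (force simp: \<xi>P D_def)
    then have "((\<lambda>\<beta>. \<Lambda> (\<beta>, \<gamma>P) \<sigma>P) has_derivative (\<lambda>h. D\<beta> *v h)) (at bP)" unfolding D_eq by (rule has_derivative_partial_beta)
    then have bil: "x \<bullet> (D\<beta> *v y) = y \<bullet> (D\<beta> *v x)" for x y
      unfolding \<Lambda>_eq \<Psi>_psi by (rule Lambda_beta_derivative_symmetric[OF loss P sq JP[OF \<xi>PD] \<sigma>P])
    have "D\<beta> $ i $ j = D\<beta> $ j $ i" for i j
      using bil[of "axis i 1" "axis j 1"] by (simp add: matrix_vector_mult_basis column_def inner_axis')
    then show ?thesis by (simp add: transpose_def vec_eq_iff)
  qed
  define I where "I = matrix_inv D\<beta>"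
  have I_sym: "transpose I = I" unfolding I_def by (rule symmetric_matrix_inv[OF inv D_sym])
  define \<psi> where "\<psi> = (\<lambda>s. \<Psi> s \<xi>P \<sigma>P)"
  have \<psi>_psi: "\<psi> s = psi (weight_fun \<rho>1) (matrix_inv (V \<gamma>P)) s bP \<sigma>P" for s by (simp add: \<psi>_def \<xi>P \<Psi>_psi)
  have \<psi>_borel: "\<psi> \<in> borel_measurable borel" unfolding \<psi>_psi[abs_def] by (rule psi_borel[OF loss P sq \<sigma>P])
  have \<psi>_int: "integrable P \<psi>" unfolding \<psi>_def \<xi>P by (rule \<Psi>_int[OF \<xi>PD \<sigma>P])
  have \<psi>_mean: "(\<integral>s. \<psi> s \<partial>P) = 0" using \<Lambda>_zero[OF \<xi>PD \<sigma>P] by (simp add: \<Lambda>_eq \<psi>_def \<xi>P)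
  obtain L where L: "L \<ge> 0" "\<And>s. norm (\<psi> s) \<le> L * norm s"
  proof -
    obtain U where U: "U \<ge> 0" "\<And>t. \<bar>weight_fun \<rho>1 t\<bar> \<le> U" by (rule weight_bound[OF loss P sq]) blast
    have "norm (\<psi> s) \<le> U * (sqrt (norm (matrix_inv (V \<gamma>P))) * c1 * \<sigma>P) * norm s" for s
      unfolding \<psi>_psi using U c1(1) by (intro norm_psi_le JP[OF \<xi>PD] \<sigma>P weight_zero[OF loss P sq]) auto
    then show ?thesis using U c1(1) \<sigma>P by (intro that[of "U * (sqrt (norm (matrix_inv (V \<gamma>P))) * c1 * \<sigma>P)"]) auto
  qed
  have \<psi>2_int: "integrable P (\<lambda>s. \<psi> s $ i * \<psi> s $ j)" for i j
  proof (rule Bochner_Integration.integrable_bound[of P "\<lambda>s. L\<^sup>2 * (norm s)\<^sup>2"])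
    show "integrable P (\<lambda>s. L\<^sup>2 * (norm s)\<^sup>2)" using sq by simp
    show "(\<lambda>s. \<psi> s $ i * \<psi> s $ j) \<in> borel_measurable P"
      using integral_vec_component(2)[OF \<psi>_int] by (intro borel_measurable_times) auto
    show "AE s in P. norm (\<psi> s $ i * \<psi> s $ j) \<le> norm (L\<^sup>2 * (norm s)\<^sup>2)"
    proof (rule AE_I2)
      fix s
      have "\<bar>\<psi> s $ i\<bar> * \<bar>\<psi> s $ j\<bar> \<le> (L * norm s) * (L * norm s)"
        by (intro mult_mono order_trans[OF component_le_norm_cart L(2)]) (use L in auto)
      then show "norm (\<psi> s $ i * \<psi> s $ j) \<le> norm (L\<^sup>2 * (norm s)\<^sup>2)"
        by (simp add: abs_mult power2_eq_square mult_ac)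
    qed
  qed
  \<comment> \<open>The influence function: its normalized sum is the linear part of \<open>Z\<close>.\<close>
  define w where "w = (\<lambda>s. - (I *v \<psi> s))"
  define Z where "Z = (\<lambda>n \<omega>. sqrt (real n) *\<^sub>R (fst (\<xi>n n \<omega>) - bP))"
  define G where "G = (\<lambda>n \<omega>. (1 / sqrt (real n)) *\<^sub>R (\<Sum>i<n. \<psi> (S i \<omega>)))"
  have IG: "(1 / sqrt (real n)) *\<^sub>R (\<Sum>i<n. w (S i \<omega>)) = - (I *v G n \<omega>)" for n \<omega>
    by (simp add: w_def G_def sum_negf matrix_vector_mult_scaleR linear_sum[OF matrix_vector_mul_linear])
  have lin_cont: "continuous_on UNIV (\<lambda>x. - (I *v x))"
    by (intro continuous_intros matrix_vector_mult_linear_continuous_on)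
  have w_borel: "w \<in> borel_measurable borel"
    unfolding w_def by (rule measurable_compose[OF \<psi>_borel borel_measurable_continuous_onI[OF lin_cont]])
  have w2: "integrable P (\<lambda>s. w s $ i * w s $ j)" for i j
    unfolding w_def by (rule second_moment_linear_image(2)[OF I_sym \<psi>2_int])
  have bl: "bounded_linear (\<lambda>x. - (I *v x))" by (intro bounded_linear_minus matrix_vector_mul_bounded_linear)
  have w_int: "integrable P w" unfolding w_def by (rule integrable_bounded_linear[OF bl \<psi>_int])
  have w_mean: "(\<integral>s. w s \<partial>P) = 0"
    unfolding w_def using integral_bounded_linear[OF bl \<psi>_int] by (simp add: \<psi>_mean)
  have wi_int: "integrable P (\<lambda>s. w s $ i)" and wi_mean: "(\<integral>s. w s $ i \<partial>P) = 0" for i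
    using integral_vec_component[OF w_int, of i] w_mean by simp_all
  have Z_meas: "Z n \<in> borel_measurable M" for n
  proof -
    have "continuous_on UNIV (\<lambda>x :: (real^'q) \<times> (real^'l). sqrt (real n) *\<^sub>R (fst x - bP))" by (intro continuous_intros)
    from measurable_compose[OF \<xi>n_meas[rule_format] borel_measurable_continuous_onI[OF this]]
    show ?thesis by (simp add: Z_def)
  qed
  define \<eta> where "\<eta> = (\<lambda>n \<omega>. (\<xi>n n \<omega>, \<sigma>n n \<omega>))"
  have \<eta>_meas: "\<eta> n \<in> borel_measurable M" for n
    unfolding \<eta>_def using \<xi>n_meas \<sigma>n_meas by (intro borel_measurable_Pair) auto
  have \<eta>0: "(\<xi>P, \<sigma>P) \<in> param_set \<Theta> V \<times> {0<..}" using \<xi>PD \<sigma>P by (simp add: \<xi>P D_def)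
  have close: "with_prob_tending_to_one M (\<lambda>n \<omega>. dist (\<eta> n \<omega>) (\<xi>P, \<sigma>P) < d)" if "d > 0" for d
    using tending_to_one_close[OF M \<eta>_meas _ that] conv by (simp add: \<eta>_def)
  have good: "with_prob_tending_to_one M (\<lambda>n \<omega>. \<eta> n \<omega> \<in> param_set \<Theta> V \<times> {0<..} \<and> (n > 0 \<longrightarrow> (\<Sum>i<n. \<Psi> (S i \<omega>) (\<xi>n n \<omega>) (\<sigma>n n \<omega>)) = 0))"
  proof (rule tending_to_one_mono[OF est], elim conjE)
    fix n \<omega>
    assume sc: "scale_solution \<rho>0 b0 V \<beta>0 \<theta>0 (empirical_measure S n \<omega>) (\<sigma>n n \<omega>)"
      and lm: "local_min_on (\<lambda>(\<beta>, \<gamma>). risk \<rho>1 (empirical_measure S n \<omega>) (\<sigma>n n \<omega>) \<beta> (V \<gamma>)) (param_set \<Theta> V) (\<xi>n n \<omega>)"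
    have pos: "\<sigma>n n \<omega> > 0" using sc by (simp add: scale_solution_def)
    moreover have "\<xi>n n \<omega> \<in> param_set \<Theta> V" using lm by (simp add: local_min_on_def)
    moreover have "(\<Sum>i<n. \<Psi> (S i \<omega>) (\<xi>n n \<omega>) (\<sigma>n n \<omega>)) = 0" if "n > 0"
      unfolding \<Psi>_def using estimating_equation[OF C1 ucont that pos, of S \<omega> V \<Theta> "fst (\<xi>n n \<omega>)" "snd (\<xi>n n \<omega>)"] lm by simp
    ultimately show "\<eta> n \<omega> \<in> param_set \<Theta> V \<times> {0<..} \<and> (n > 0 \<longrightarrow> (\<Sum>i<n. \<Psi> (S i \<omega>) (\<xi>n n \<omega>) (\<sigma>n n \<omega>)) = 0)"
      by (simp add: \<eta>_def)
  qed
  define f where "f = (\<lambda>(j :: 'q) (\<eta> :: ((real^'q) \<times> (real^'l)) \<times> real) s. Psi_beta \<rho>1 V s (fst \<eta>) (snd \<eta>) $ j)"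
  \<comment> \<open>The equicontinuity with the estimates inserted for the parameter.\<close>
  have equi: "with_prob_tending_to_one M (\<lambda>n \<omega>. n > 0 \<longrightarrow> \<bar>\<Sum>i<n. (f j (\<eta> n \<omega>) (S i \<omega>) - f j (\<xi>P, \<sigma>P) (S i \<omega>)) - (integral\<^sup>L P (f j (\<eta> n \<omega>)) - integral\<^sup>L P (f j (\<xi>P, \<sigma>P)))\<bar> \<le> \<epsilon> * sqrt n)"
    if e: "\<epsilon> > 0" for \<epsilon> j
  proof (rule tending_to_oneI[OF M])
    fix \<kappa> :: real assume k: "\<kappa> > 0"
    then have k2: "\<kappa> / 2 > 0" by simp
    obtain \<delta> where \<delta>: "\<delta> > 0" and bad: "\<And>n. n > 0 \<Longrightarrow> \<exists>B\<in>sets M. prob B \<le> \<kappa> / 2 \<and> (\<forall>\<omega>\<in>space M - B. \<forall>\<eta>\<in>param_set \<Theta> V \<times> {0<..}. dist \<eta> (\<xi>P, \<sigma>P) < \<delta> \<longrightarrow>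
      \<bar>\<Sum>i<n. (f j \<eta> (S i \<omega>) - f j (\<xi>P, \<sigma>P) (S i \<omega>)) - (integral\<^sup>L P (f j \<eta>) - integral\<^sup>L P (f j (\<xi>P, \<sigma>P)))\<bar> \<le> \<epsilon> * sqrt n)"
      using score_equicontinuity[OF loss P sq M S V \<eta>0 e k2, of j] unfolding f_def by blast
    have "\<forall>\<^sub>F n in sequentially. \<exists>A\<in>sets M. 1 - \<kappa> / 2 \<le> prob A \<and> (\<forall>\<omega>\<in>A. dist (\<eta> n \<omega>) (\<xi>P, \<sigma>P) < \<delta> \<and>
        (\<eta> n \<omega> \<in> param_set \<Theta> V \<times> {0<..} \<and> (n > 0 \<longrightarrow> (\<Sum>i<n. \<Psi> (S i \<omega>) (\<xi>n n \<omega>) (\<sigma>n n \<omega>)) = 0)))"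
      by (rule tending_to_one_events[OF M tending_to_one_conj[OF M close[OF \<delta>] good] k2])
    then show "\<forall>\<^sub>F n in sequentially. \<exists>A\<in>sets M. 1 - \<kappa> \<le> prob A \<and> (\<forall>\<omega>\<in>A. n > 0 \<longrightarrow> \<bar>\<Sum>i<n. (f j (\<eta> n \<omega>) (S i \<omega>) - f j (\<xi>P, \<sigma>P) (S i \<omega>)) - (integral\<^sup>L P (f j (\<eta> n \<omega>)) - integral\<^sup>L P (f j (\<xi>P, \<sigma>P)))\<bar> \<le> \<epsilon> * sqrt n)"
      using eventually_gt_at_top[of 0]
    proof eventually_elim
      case (elim n)
      then obtain A where A: "A \<in> sets M" "1 - \<kappa> / 2 \<le> prob A"
        "\<And>\<omega>. \<omega> \<in> A \<Longrightarrow> dist (\<eta> n \<omega>) (\<xi>P, \<sigma>P) < \<delta> \<and> \<eta> n \<omega> \<in> param_set \<Theta> V \<times> {0<..}" by blast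
      obtain B where B: "B \<in> sets M" "prob B \<le> \<kappa> / 2" "\<And>\<omega> \<eta>. \<omega> \<in> space M - B \<Longrightarrow> \<eta> \<in> param_set \<Theta> V \<times> {0<..} \<Longrightarrow> dist \<eta> (\<xi>P, \<sigma>P) < \<delta> \<Longrightarrow>
        \<bar>\<Sum>i<n. (f j \<eta> (S i \<omega>) - f j (\<xi>P, \<sigma>P) (S i \<omega>)) - (integral\<^sup>L P (f j \<eta>) - integral\<^sup>L P (f j (\<xi>P, \<sigma>P)))\<bar> \<le> \<epsilon> * sqrt n"
        using bad[OF elim(2)] by blast
      have "prob A - prob B \<le> prob (A - B)"
        using finite_measure_Diff'[OF A(1) B(1)] finite_measure_mono[of "A \<inter> B" B] B(1) by auto
      then have "1 - \<kappa> \<le> prob (A - B)" using A(2) B(2) by linarith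
      moreover have "\<omega> \<in> space M" if "\<omega> \<in> A" for \<omega> using A(1) that sets.sets_into_space by blast
      ultimately show ?case using A B by (intro bexI[of _ "A - B"]) auto
    qed
  qed
  have small: "with_prob_tending_to_one M (\<lambda>n \<omega>. norm (Z n \<omega> - (1 / sqrt (real n)) *\<^sub>R (\<Sum>i<n. w (S i \<omega>))) \<le> t)" if t: "t > 0" for t
  proof (rule tending_to_oneI[OF M])
    fix \<kappa> :: real assume k: "\<kappa> > 0"
    then have k2: "\<kappa> / 2 > 0" by simp
    have wsq: "integrable P (\<lambda>s. (w s $ i)\<^sup>2)" for i using w2[of i i] by (simp add: power2_eq_square)
    obtain r0 where r0: "\<And>n. n > 0 \<Longrightarrow> prob {\<omega>\<in>space M. r0 < norm ((1 / sqrt (real n)) *\<^sub>R (\<Sum>i<n. w (S i \<omega>)))} \<le> \<kappa> / 2"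
      using iid_sum_tight[OF M P(2) S w_borel wi_int wsq wi_mean k2] by blast
    define r where "r = max r0 0"
    define q where "q = real CARD('q)"
    define K where "K = norm I + 1"
    have K: "K > 0" "norm I \<le> K" by (auto simp: K_def add_nonneg_pos)
    \<comment> \<open>The error of \<open>Z\<close> has the two parts of \<open>solve_linearized_equation\<close>; \<open>\<epsilon>\<close> makes the first at most \<open>t / 2\<close>, and \<open>e\<close> the second where the linear part is at most \<open>r\<close>.\<close>
    define \<epsilon> where "\<epsilon> = t / (4 * K * (q + 1))"
    have q0: "q \<ge> 0" by (simp add: q_def)
    have \<epsilon>: "\<epsilon> > 0" using t K q0 by (simp add: \<epsilon>_def)
    define e where "e = min (1/2) (t / (4 * (r + 1))) / K"
    have r1: "r \<ge> 0" by (simp add: r_def)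
    have e: "e > 0" using t K r1 by (simp add: e_def)
    have Ke: "norm I * e \<le> min (1/2) (t / (4 * (r + 1)))"
    proof -
      have "norm I * e \<le> K * e" using K e by (intro mult_right_mono) auto
      also have "\<dots> = min (1/2) (t / (4 * (r + 1)))" using K by (simp add: e_def)
      finally show ?thesis .
    qed
    have K\<epsilon>: "norm I * (q * \<epsilon>) \<le> t / 4"
    proof -
      have "norm I * (q * \<epsilon>) \<le> K * ((q + 1) * \<epsilon>)" using K \<epsilon> q0 by (intro mult_mono) auto
      also have "\<dots> = t / 4" using K q0 by (simp add: \<epsilon>_def)
      finally show ?thesis .
    qed
    have re: "2 * (norm I * e) * r \<le> t / 2"
    proof -
      have "norm I * e * r \<le> t / (4 * (r + 1)) * r" using Ke r1 by (intro mult_right_mono) auto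
      also have "\<dots> = t / 4 * (r / (r + 1))" using r1 by simp
      also have "\<dots> \<le> t / 4 * 1" using t r1 by (intro mult_left_mono) (auto simp: divide_le_eq)
      finally show ?thesis by simp
    qed
    obtain \<delta> where \<delta>: "\<delta> > 0" "\<And>b c \<tau>. (b, c) \<in> D \<Longrightarrow> \<tau> > 0 \<Longrightarrow> dist ((b, c), \<tau>) ((bP, \<gamma>P), \<sigma>P) < \<delta> \<Longrightarrow>
        norm (\<Lambda> (b, c) \<tau> - \<Lambda> (bP, c) \<tau> - D\<beta> *v (b - bP)) \<le> e * norm (b - bP)"
    proof -
      have "\<exists>\<delta>>0. \<forall>b c \<tau>. (b, c) \<in> D \<longrightarrow> \<tau> > 0 \<longrightarrow> dist ((b, c), \<tau>) ((bP, \<gamma>P), \<sigma>P) < \<delta> \<longrightarrow>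
          norm (\<Lambda> (b, c) \<tau> - \<Lambda> (bP, c) \<tau> - D\<beta> *v (b - bP)) \<le> e * norm (b - bP)"
        unfolding D_eq by (rule uniform_linearization[OF cd[unfolded \<xi>P, folded D_def] \<xi>PD \<sigma>P _ e]) (rule fiber)
      then show ?thesis using that by blast
    qed
    have all: "with_prob_tending_to_one M (\<lambda>n \<omega>. \<forall>j\<in>UNIV. n > 0 \<longrightarrow> \<bar>\<Sum>i<n. (f j (\<eta> n \<omega>) (S i \<omega>) - f j (\<xi>P, \<sigma>P) (S i \<omega>)) - (integral\<^sup>L P (f j (\<eta> n \<omega>)) - integral\<^sup>L P (f j (\<xi>P, \<sigma>P)))\<bar> \<le> \<epsilon> * sqrt n)"
      by (intro tending_to_one_ball_finite[OF M] equi[OF \<epsilon>]) simp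
    have "\<forall>\<^sub>F n in sequentially. \<exists>A\<in>sets M. 1 - \<kappa> / 2 \<le> prob A \<and> (\<forall>\<omega>\<in>A. (\<forall>j\<in>UNIV. n > 0 \<longrightarrow> \<bar>\<Sum>i<n. (f j (\<eta> n \<omega>) (S i \<omega>) - f j (\<xi>P, \<sigma>P) (S i \<omega>)) - (integral\<^sup>L P (f j (\<eta> n \<omega>)) - integral\<^sup>L P (f j (\<xi>P, \<sigma>P)))\<bar> \<le> \<epsilon> * sqrt n) \<and>
       (dist (\<eta> n \<omega>) (\<xi>P, \<sigma>P) < \<delta> \<and> (\<eta> n \<omega> \<in> param_set \<Theta> V \<times> {0<..} \<and> (n > 0 \<longrightarrow> (\<Sum>i<n. \<Psi> (S i \<omega>) (\<xi>n n \<omega>) (\<sigma>n n \<omega>)) = 0))))"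
      by (rule tending_to_one_events[OF M tending_to_one_conj[OF M all tending_to_one_conj[OF M close[OF \<delta>(1)] good]] k2])
    then show "\<forall>\<^sub>F n in sequentially. \<exists>A\<in>sets M. 1 - \<kappa> \<le> prob A \<and> (\<forall>\<omega>\<in>A. norm (Z n \<omega> - (1 / sqrt (real n)) *\<^sub>R (\<Sum>i<n. w (S i \<omega>))) \<le> t)"
      using eventually_gt_at_top[of 0]
    proof eventually_elim
      case (elim n)
      note n = elim(2)
      obtain A where A: "A \<in> sets M" "1 - \<kappa> / 2 \<le> prob A"
        "\<And>\<omega> j. \<omega> \<in> A \<Longrightarrow> \<bar>\<Sum>i<n. (f j (\<eta> n \<omega>) (S i \<omega>) - f j (\<xi>P, \<sigma>P) (S i \<omega>)) - (integral\<^sup>L P (f j (\<eta> n \<omega>)) - integral\<^sup>L P (f j (\<xi>P, \<sigma>P)))\<bar> \<le> \<epsilon> * sqrt n"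
        "\<And>\<omega>. \<omega> \<in> A \<Longrightarrow> dist (\<eta> n \<omega>) (\<xi>P, \<sigma>P) < \<delta>"
        "\<And>\<omega>. \<omega> \<in> A \<Longrightarrow> \<eta> n \<omega> \<in> param_set \<Theta> V \<times> {0<..}"
        "\<And>\<omega>. \<omega> \<in> A \<Longrightarrow> (\<Sum>i<n. \<Psi> (S i \<omega>) (\<xi>n n \<omega>) (\<sigma>n n \<omega>)) = 0"
        using elim by blast
      define B where "B = {\<omega>\<in>space M. r0 < norm ((1 / sqrt (real n)) *\<^sub>R (\<Sum>i<n. w (S i \<omega>)))}"
      have Sm: "S i \<in> borel_measurable M" for i using S by (auto simp: iid_sample_def indep_vars_def2)
      have B: "B \<in> sets M" unfolding B_def using measurable_compose[OF Sm w_borel] by measurable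
      have Bp: "prob B \<le> \<kappa> / 2" unfolding B_def by (rule r0[OF n])
      have "prob A - prob B \<le> prob (A - B)"
        using finite_measure_Diff'[OF A(1) B] finite_measure_mono[of "A \<inter> B" B] B by auto
      then have AB: "1 - \<kappa> \<le> prob (A - B)" using A(2) Bp by linarith
      have "norm (Z n \<omega> - (1 / sqrt (real n)) *\<^sub>R (\<Sum>i<n. w (S i \<omega>))) \<le> t" if \<omega>: "\<omega> \<in> A - B" for \<omega>
      proof -
        obtain b c where bc: "\<xi>n n \<omega> = (b, c)" by (cases "\<xi>n n \<omega>")
        define \<tau> where "\<tau> = \<sigma>n n \<omega>"
        have par: "(b, c) \<in> D" "\<tau> > 0" using A(5)[of \<omega>] \<omega> by (auto simp: \<eta>_def bc D_def \<tau>_def)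
        have sn: "sqrt (real n) > 0" "sqrt (real n) * sqrt (real n) = n" using n by auto
        \<comment> \<open>The estimating equation removes the sum of the scores at the estimates, and the mean of the score at the limit is zero.\<close>
        have comp: "\<bar>(G n \<omega> + sqrt n *\<^sub>R \<Lambda> (b, c) \<tau>) $ j\<bar> \<le> \<epsilon>" for j
        proof -
          have fj: "f j (\<eta> n \<omega>) s = \<Psi> s (b, c) \<tau> $ j" "f j (\<xi>P, \<sigma>P) s = \<psi> s $ j" for s
            by (simp_all add: f_def \<eta>_def \<Psi>_def \<psi>_def bc \<tau>_def)
          have i1: "integral\<^sup>L P (f j (\<eta> n \<omega>)) = \<Lambda> (b, c) \<tau> $ j"
            unfolding fj[abs_def] \<Lambda>_eq by (rule integral_vec_component(1)[OF \<Psi>_int[OF par], symmetric])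
          have i0: "integral\<^sup>L P (f j (\<xi>P, \<sigma>P)) = 0"
            unfolding fj[abs_def] using integral_vec_component(1)[OF \<psi>_int, of j] \<psi>_mean by simp
          have "(\<Sum>i<n. \<Psi> (S i \<omega>) (b, c) \<tau> $ j) = 0"
            using A(6)[of \<omega>] \<omega> by (simp add: bc \<tau>_def sum_component[symmetric])
          then have "(\<Sum>i<n. (f j (\<eta> n \<omega>) (S i \<omega>) - f j (\<xi>P, \<sigma>P) (S i \<omega>)) - (integral\<^sup>L P (f j (\<eta> n \<omega>)) - integral\<^sup>L P (f j (\<xi>P, \<sigma>P))))
            = - ((\<Sum>i<n. \<psi> (S i \<omega>) $ j) + n * \<Lambda> (b, c) \<tau> $ j)"
            unfolding i1 i0 fj by (simp add: sum_subtractf)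
          also have "(\<Sum>i<n. \<psi> (S i \<omega>) $ j) + n * \<Lambda> (b, c) \<tau> $ j = sqrt n * ((G n \<omega> + sqrt n *\<^sub>R \<Lambda> (b, c) \<tau>) $ j)"
            using sn by (simp add: G_def distrib_left mult.assoc[symmetric])
          finally have "\<bar>sqrt n * ((G n \<omega> + sqrt n *\<^sub>R \<Lambda> (b, c) \<tau>) $ j)\<bar> \<le> \<epsilon> * sqrt n"
            using A(3)[of \<omega> j] \<omega> by simp
          then have "sqrt n * \<bar>(G n \<omega> + sqrt n *\<^sub>R \<Lambda> (b, c) \<tau>) $ j\<bar> \<le> sqrt n * \<epsilon>" using sn by (simp only: abs_mult mult.commute)
          then show ?thesis using sn(1) by (simp only: mult_le_cancel_left_pos)
        qed
        have sum_le: "norm (G n \<omega> + sqrt n *\<^sub>R \<Lambda> (b, c) \<tau>) \<le> q * \<epsilon>"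
        proof -
          have "norm (G n \<omega> + sqrt n *\<^sub>R \<Lambda> (b, c) \<tau>) \<le> (\<Sum>j\<in>UNIV. \<bar>(G n \<omega> + sqrt n *\<^sub>R \<Lambda> (b, c) \<tau>) $ j\<bar>)" by (rule norm_le_l1_cart)
          also have "\<dots> \<le> (\<Sum>j\<in>(UNIV :: 'q set). \<epsilon>)" by (intro sum_mono comp)
          finally show ?thesis by (simp add: q_def)
        qed
        have "dist ((b, c), \<tau>) ((bP, \<gamma>P), \<sigma>P) < \<delta>" using A(4)[of \<omega>] \<omega> by (simp add: \<eta>_def bc \<tau>_def \<xi>P)
        \<comment> \<open>Here the symmetry enters: \<open>\<Lambda> (bP, c) \<tau> = 0\<close> at the estimated \<open>c\<close> and \<open>\<tau>\<close>.\<close>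
        then have "norm (\<Lambda> (b, c) \<tau> - D\<beta> *v (b - bP)) \<le> e * norm (b - bP)"
          using \<delta>(2)[OF par] \<Lambda>_zero[OF par] by simp
        then have near: "sqrt n * norm (\<Lambda> (b, c) \<tau> - D\<beta> *v (b - bP)) \<le> sqrt n * (e * norm (b - bP))" using sn by (intro mult_left_mono) auto
        have lin: "norm (sqrt n *\<^sub>R \<Lambda> (b, c) \<tau> - D\<beta> *v Z n \<omega>) \<le> e * norm (Z n \<omega>)"
        proof -
          have "sqrt n *\<^sub>R \<Lambda> (b, c) \<tau> - D\<beta> *v Z n \<omega> = sqrt n *\<^sub>R (\<Lambda> (b, c) \<tau> - D\<beta> *v (b - bP))"
            unfolding Z_def bc fst_conv matrix_vector_mult_scaleR by (rule scaleR_diff_right[symmetric])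
          moreover have "norm (Z n \<omega>) = sqrt n * norm (b - bP)" using sn by (simp add: Z_def bc)
          ultimately show ?thesis using near sn by (simp add: mult.left_commute)
        qed
        have "D\<beta> *v Z n \<omega> + G n \<omega> = (G n \<omega> + sqrt n *\<^sub>R \<Lambda> (b, c) \<tau>) - (sqrt n *\<^sub>R \<Lambda> (b, c) \<tau> - D\<beta> *v Z n \<omega>)" by simp
        then have "norm (D\<beta> *v Z n \<omega> + G n \<omega>) \<le> norm (G n \<omega> + sqrt n *\<^sub>R \<Lambda> (b, c) \<tau>) + norm (sqrt n *\<^sub>R \<Lambda> (b, c) \<tau> - D\<beta> *v Z n \<omega>)"
          by (metis norm_triangle_ineq4)
        also have "\<dots> \<le> q * \<epsilon> + e * norm (Z n \<omega>)" using sum_le lin by (rule add_mono)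
        finally have main: "norm (Z n \<omega> + I *v G n \<omega>) \<le> 2 * (norm I * (q * \<epsilon>)) + 2 * (norm I * e) * norm (I *v G n \<omega>)"
          unfolding I_def by (rule solve_linearized_equation[OF inv]) (use Ke e \<epsilon> q0 in \<open>auto simp: I_def\<close>)
        have "\<omega> \<in> space M" using \<omega> A(1) sets.sets_into_space by blast
        then have "norm (I *v G n \<omega>) \<le> r" using \<omega> unfolding B_def IG r_def by auto
        then have "2 * (norm I * e) * norm (I *v G n \<omega>) \<le> 2 * (norm I * e) * r" using e by (intro mult_left_mono) auto
        then have "norm (Z n \<omega> + I *v G n \<omega>) \<le> t" using main K\<epsilon> re by linarith
        then show ?thesis unfolding IG by simp
      qed
      then show ?case using A(1) B AB by (intro bexI[of _ "A - B"]) auto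
    qed
  qed
  have "asymptotically_normal M Z 0 (second_moment P w)"
    by (rule asymptotically_normal_of_linear_expansion[OF M P S w_borel w2 wi_int wi_mean Z_meas small])
  moreover have "second_moment P w = I ** second_moment P \<psi> ** I"
    unfolding w_def by (rule second_moment_linear_image(1)[OF I_sym \<psi>2_int])
  ultimately show ?thesis by (simp only: Z_def \<xi>P I_def \<psi>_def fst_conv)
qed

end
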